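(* Let $\varphi:\mathbf S^n\to\mathbb R$ be $\mathcal C^2$-smooth, let $g=\theta\circ\lambda:\mathbf S^n\to[-\infty,+\infty]$ with $\theta:\mathbb R^n\to[-\infty,+\infty]$ a (proper) symmetric polyhedral function, and let $f=\varphi+g$. Assume that $\overline X\in\mathbf S^n$ satisfies $0\in\partial f(\overline X)$, put $\overline Y=-\nabla\varphi(\overline X)$, and suppose $K(\overline X,\overline Y)\neq\varnothing$. Then the following properties are equivalent. (a) $\overline X$ is a tilt-stable local minimizer of $f$. (b) The strong second-order sufficient condition holds: $$\langle\nabla^2\varphi(\overline X)H,H\rangle+\Upsilon_{\overline X,\overline Y}(H)>0\quad\text{for all } H\in\mathrm{aff}\,\mathcal C_g(\overline X,\overline Y)\setminus\{0\}.$$ Moreover, both conditions yield the kernel condition $$\ker\nabla^2\varphi(\overline X)\cap\ker q=\{0\},\qquad\text{where}\quad \ker q=\{H\in\mathrm{aff}\,\mathcal C_g(\overline X,\overline Y): \Upsilon_{\overline X,\overline Y}(H)=0\}.$$ If, in addition, $\varphi$ is convex, then the kernel condition and the conditions in (a) and (b) are equivalent. Furthermore, for $P\in\mathbf O^n(\overline X)\cap\mathbf O^n(\overline Y)$, $\ker q$ is equivalently described as the set of all $H\in\mathbf S^n$ satisfying: (i) $(P^\top HP)_{ij}=0$ for all $i,j$ such that $\lambda_i(\overline X)\ne\lambda_j(\overline X)$ and $\lambda_i(\overline Y)\ne\lambda_j(\overline Y)$; (ii) for each $l\in\{1,\dots,r\}$, $(P^\top HP)_{\alpha^l\alpha^l}$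 is block diagonal: $(P^\top HP)_{\alpha^l\alpha^l}=\mathrm{Diag}\big((P^\top HP)_{\gamma_1^l\gamma_1^l},\dots,(P^\top HP)_{\gamma^l_{u^l}\gamma^l_{u^l}}\big)$; (iii) $\langle\mathrm{diag}(P^\top HP),a^\nu\rangle=\langle\mathrm{diag}(P^\top HP),a^{\nu'}\rangle$ for all $\nu,\nu'\in\eta_1$ and $\langle\mathrm{diag}(P^\top HP),b^\mu\rangle=0$ for all $\mu\in\eta_2$; (iv) for each $l\in\{1,\dots,r\}$ and $k\in\mathcal E^l$ there exists $\rho_k^l\in\mathbb R$ such that $(P^\top HP)_{\gamma_k^l\gamma_k^l}=\rho_k^lI_{|\gamma_k^l|}$.
   Context: $\mathbf S^n$ is the space of real symmetric $n\times n$ matrices with the Frobenius inner product; $\lambda(X)$ is the vector of eigenvalues of $X$ in nonincreasing order. $\mathbf O^n(X)$ is the set of orthogonal $P$ with $X=P\,\mathrm{Diag}(\lambda(X))P^\top$. $\mathrm{diag}(Z)$ is the vector of diagonal entries of $Z$; $\mathrm{aff}$ is the affine hull. "Polyhedral" means the epigraph is a polyhedral convex set; "symmetric" means invariant under coordinate permutations. Then $g$ is convex; $\partial f$ is the limiting subdifferential, and $0\in\partial f(\overline X)$ means $\overline Y\in\partial g(\overline X)$. Index sets: $\mu_1>\dots>\mu_r$ are the distinct eigenvalues of $\overline X$ and $\alpha^l=\{i:\lambda_i(\overline X)=\mu_l\}$. Each $\alpha^l$ is partitioned into $\gamma^l_1,\dots,\gamma^l_{u^l}$ according to $\lambda(\overline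 Y)$: $\lambda_i(\overline Y)=\lambda_j(\overline Y)$ if $i,j\in\gamma_s^l$, and $\lambda_i(\overline Y)>\lambda_j(\overline Y)$ if $i\in\gamma^l_s$, $j\in\gamma^l_{s'}$, $s<s'$. Representation of $\theta$: $\theta=\theta_1+\theta_2$ with $\theta_1(x)=\max_{1\le\nu\le p}\{\langle a^\nu,x\rangle-c_\nu\}$ and $\theta_2$ the indicator function of $\mathrm{dom}\,\theta=\{x:\max_{1\le\mu\le m}\{\langle b^\mu,x\rangle-d_\mu\}\le0\}$, with each $(b^\mu,d_\mu)\ne(0,0)$. (The case $\theta_1=0$ is covered by $p=1,(a^1,c_1)=(0,0)$; the case $\theta_2=0$ by $m=1,(b^1,d_1)=(0,1)$.) For $x\in\mathrm{dom}\,\theta$: $\iota_1(x)$ is the set of $\nu$ attaining the maximum in $\theta_1(x)$, and $\iota_2(x)=\{\mu:\langle b^\mu,x\rangle=d_\mu\}$. For $y\in\partial\theta(x)$, a representation of $y$ is $y=\sum_{\nu\in\iota_1(x)}u_\nu a^\nu+\sum_{\mu\in\iota_2(x)}v_\mu b^\mu$ with $u_\nu\ge0$, $\sum u_\nu=1$, $v_\mu\ge0$; $\eta_1(x,y)$ (resp. $\eta_2(x,y)$) is the set of $\nu\in\iota_1(x)$ (resp. $\mu\in\iota_2(x)$) for which some representation of $y$ has $u_\nu>0$ (resp. $v_\mu>0$). Write $\iota_i=\iota_i(\lambda(\overline X))$, $\eta_i=\eta_i(\lambda(\overline X),\lambda(\overline Y))$. $K(\overline X,\overline Y)$ is the set of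 $d\in\mathbb R^n$ with $\langle d,a^{\nu'}-a^\nu\rangle=0$ for $\nu,\nu'\in\eta_1$; $\langle d,b^\mu\rangle=0$ for $\mu\in\eta_2$; $\langle d,a^{\nu'}-a^\nu\rangle<0$ for $\nu'\in\iota_1\setminus\eta_1,\ \nu\in\eta_1$; and $\langle d,b^\mu\rangle<0$ for $\mu\in\iota_2\setminus\eta_2$. $\mathcal E^l$ is the set of $s\in\{1,\dots,u^l\}$ for which there exist $i,j\in\gamma^l_s$ with $(a^\nu)_i\ne(a^\nu)_j$ for some $\nu\in\eta_1$ or $(b^\mu)_i\ne(b^\mu)_j$ for some $\mu\in\eta_2$. Critical cone: $\mathcal C_g(X,Y)=\{H\in\mathbf S^n:\langle Y,H\rangle=\mathrm dg(X)(H)\}$, $\mathrm dg(X)(H)=\liminf_{t\searrow0,H'\to H}\frac{g(X+tH')-g(X)}{t}$. $\Upsilon_{\overline X,\overline Y}(H)=2\sum_{1\le l<l'\le r}\sum_{i\in\alpha^l}\sum_{j\in\alpha^{l'}}\frac{\lambda_i(\overline Y)-\lambda_j(\overline Y)}{\lambda_i(\overline X)-\lambda_j(\overline X)}(P^\top HP)_{ij}^2$ with $P\in\mathbf O^n(\overline X)\cap\mathbf O^n(\overline Y)$. Tilt stability: $\overline X$ is a tilt-stable local minimizer of $f$ if $f(\overline X)$ is finite and there is $\gamma>0$ such that $M_\gamma:V\mapsto\operatorname{argmin}\{f(X)-\langle V,X\rangle:\|X-\overline X\|\le\gamma\}$ is single-valued and Lipschitz continuous on a neighborhood of $0$ with $M_\gamma(0)=\{\overline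 X\}$. *)

theory Defs
  imports "HOL-Analysis.Analysis"
begin

section \<open>The Euclidean space of real symmetric matrices\<close>

typedef (overloaded) ('n::finite) symmat = "{A :: real^'n^'n. transpose A = A}"
  morphisms mat_of sym_of
  by (rule exI[of _ "0"]) (simp add: transpose_def zero_vec_def vec_eq_iff)

setup_lifting type_definition_symmat

lemma transpose_mat_of [simp]: "transpose (mat_of X) = mat_of X"
  using mat_of by auto

lemma subspace_symmetric: "subspace {A :: real^'n^'n. transpose A = A}"
  by (auto simp: subspace_def transpose_def vec_eq_iff)

instantiation symmat :: (finite) real_inner
begin

lift_definition zero_symmat :: "'a symmat" is 0
  by (simp add: transpose_def vec_eq_iff)

lift_definition plus_symmat :: "'a symmat \<Rightarrow> 'a symmat \<Rightarrow> 'a symmat" is "(+)"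
  by (simp add: transpose_def vec_eq_iff)

lift_definition minus_symmat :: "'a symmat \<Rightarrow> 'a symmat \<Rightarrow> 'a symmat" is "(-)"
  by (simp add: transpose_def vec_eq_iff)

lift_definition uminus_symmat :: "'a symmat \<Rightarrow> 'a symmat" is uminus
  by (simp add: transpose_def vec_eq_iff)

lift_definition scaleR_symmat :: "real \<Rightarrow> 'a symmat \<Rightarrow> 'a symmat" is scaleR
  by (simp add: transpose_def vec_eq_iff)

text \<open>The inner product inherited from \<^typ>\<open>real^'n^'n\<close> is the Frobenius inner product.\<close>

lift_definition inner_symmat :: "'a symmat \<Rightarrow> 'a symmat \<Rightarrow> real" is inner .

lift_definition norm_symmat :: "'a symmat \<Rightarrow> real" is norm .

definition dist_symmat :: "'a symmat \<Rightarrow> 'a symmat \<Rightarrow> real"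
  where "dist_symmat X Y = norm (X - Y)"

definition sgn_symmat :: "'a symmat \<Rightarrow> 'a symmat"
  where "sgn_symmat X = inverse (norm X) *\<^sub>R X"

definition uniformity_symmat :: "('a symmat \<times> 'a symmat) filter"
  where "uniformity_symmat = (INF e\<in>{0<..}. principal {(X, Y). dist X Y < e})"

definition open_symmat :: "'a symmat set \<Rightarrow> bool"
  where "open_symmat U \<longleftrightarrow> (\<forall>X\<in>U. eventually (\<lambda>(X', Y). X' = X \<longrightarrow> Y \<in> U) uniformity)"

instance
proof
  fix X Y Z :: "'a symmat" and r s :: real and U :: "'a symmat set"
  show "X + Y + Z = X + (Y + Z)" by transfer (simp add: add.assoc)
  show "X + Y = Y + X" by transfer (simp add: add.commute)
  show "0 + X = X" by transfer simp
  show "- X + X = 0" by transfer simp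
  show "X - Y = X + - Y" by transfer simp
  show "r *\<^sub>R (X + Y) = r *\<^sub>R X + r *\<^sub>R Y" by transfer (simp add: scaleR_add_right)
  show "(r + s) *\<^sub>R X = r *\<^sub>R X + s *\<^sub>R X" by transfer (simp add: scaleR_add_left)
  show "r *\<^sub>R s *\<^sub>R X = (r * s) *\<^sub>R X" by transfer simp
  show "1 *\<^sub>R X = X" by transfer simp
  show "dist X Y = norm (X - Y)" by (rule dist_symmat_def)
  show "sgn X = inverse (norm X) *\<^sub>R X" by (rule sgn_symmat_def)
  show "uniformity = (INF e\<in>{0<..}. principal {(X :: 'a symmat, Y). dist X Y < e})"
    by (rule uniformity_symmat_def)
  show "open U = (\<forall>X\<in>U. eventually (\<lambda>(X', Y). X' = X \<longrightarrow> Y \<in> U) uniformity)"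
    by (rule open_symmat_def)
  show "inner X Y = inner Y X" by transfer (rule inner_commute)
  show "inner (X + Y) Z = inner X Z + inner Y Z" by transfer (rule inner_add_left)
  show "inner (r *\<^sub>R X) Y = r * inner X Y" by transfer simp
  show "0 \<le> inner X X" by transfer simp
  show "inner X X = 0 \<longleftrightarrow> X = 0" by transfer simp
  show "norm X = sqrt (inner X X)" by transfer (rule norm_eq_sqrt_inner)
qed

end

text \<open>Which orthonormal basis serves as \<^term>\<open>Basis\<close> is immaterial.\<close>

definition is_symmetric_onb :: "(real^'n^'n) set \<Rightarrow> bool"
  where "is_symmetric_onb B \<longleftrightarrow> pairwise orthogonal B \<and> (\<forall>A\<in>B. norm A = 1) \<and>
    independent B \<and> span B = {A. transpose A = A}"

definition symmetric_onb :: "(real^'n^'n) set"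
  where "symmetric_onb = (SOME B. is_symmetric_onb B)"

lemma is_symmetric_onb: "is_symmetric_onb symmetric_onb"
proof -
  have "\<exists>B :: (real^'n^'n) set. is_symmetric_onb B"
    by (rule orthonormal_basis_subspace[OF subspace_symmetric])
       (use is_symmetric_onb_def in blast)
  then show ?thesis
    unfolding symmetric_onb_def by (rule someI_ex)
qed

lemma symmetric_onb:
  shows "pairwise orthogonal symmetric_onb"
    and "A \<in> symmetric_onb \<Longrightarrow> norm A = 1"
    and "independent symmetric_onb"
    and "span symmetric_onb = {A. transpose A = A}"
  using is_symmetric_onb unfolding is_symmetric_onb_def by blast+

lemma mat_of_sym_of_onb: "A \<in> symmetric_onb \<Longrightarrow> mat_of (sym_of A) = A"
  using span_base[of A symmetric_onb] by (simp add: symmetric_onb(4) sym_of_inverse)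

instantiation symmat :: (finite) euclidean_space
begin

definition Basis_symmat :: "'a symmat set"
  where "Basis_symmat = sym_of ` symmetric_onb"

instance
proof
  show "(Basis :: 'a symmat set) \<noteq> {}"
  proof
    assume "(Basis :: 'a symmat set) = {}"
    then have "(symmetric_onb :: (real^'a^'a) set) = {}"
      by (simp add: Basis_symmat_def)
    moreover have "mat 1 \<in> span (symmetric_onb :: (real^'a^'a) set)"
      by (simp add: symmetric_onb(4) transpose_mat)
    ultimately show False
      by (simp add: mat_def vec_eq_iff split: if_splits)
  qed
  show "finite (Basis :: 'a symmat set)"
    unfolding Basis_symmat_def using symmetric_onb(3) independent_imp_finite by blast
  show "inner U V = (if U = V then 1 else 0)"
    if UV: "U \<in> Basis" "V \<in> Basis" for U V :: "'a symmat"
  proof -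
    obtain A B :: "real^'a^'a" where AB: "A \<in> symmetric_onb" "B \<in> symmetric_onb"
      "U = sym_of A" "V = sym_of B"
      using UV unfolding Basis_symmat_def by blast
    have "inner U V = inner A B"
      using AB by (simp add: inner_symmat.rep_eq mat_of_sym_of_onb)
    moreover have "U = V \<longleftrightarrow> A = B"
      using AB mat_of_sym_of_onb by metis
    moreover have "inner A B = 0" if "A \<noteq> B"
      using symmetric_onb(1) AB that unfolding pairwise_def orthogonal_def by blast
    moreover have "inner A A = 1"
      using symmetric_onb(2)[OF AB(1)] by (simp add: norm_eq_1)
    ultimately show ?thesis by auto
  qed
  show "(\<forall>U\<in>Basis. inner X U = 0) \<longleftrightarrow> X = 0" for X :: "'a symmat"
  proof
    assume *: "\<forall>U\<in>Basis. inner X U = 0"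
    have "orthogonal (mat_of X) A" if "A \<in> symmetric_onb" for A
    proof -
      have "inner X (sym_of A) = 0"
        using * that unfolding Basis_symmat_def by blast
      then show ?thesis
        using mat_of_sym_of_onb[OF that] by (simp add: inner_symmat.rep_eq orthogonal_def)
    qed
    moreover have "mat_of X \<in> span symmetric_onb"
      by (simp add: symmetric_onb(4))
    ultimately have "orthogonal (mat_of X) (mat_of X)"
      by (metis orthogonal_to_span)
    then show "X = 0"
      by (simp add: orthogonal_def mat_of_inject[symmetric] zero_symmat.rep_eq)
  qed simp
qed

end


section \<open>Variational analysis\<close>

definition gradient :: "('a::euclidean_space \<Rightarrow> real) \<Rightarrow> 'a \<Rightarrow> 'a"
  where "gradient \<phi> x = (THE v. GDERIV \<phi> x :> v)"

definition hessian :: "('a::euclidean_space \<Rightarrow> real) \<Rightarrow> 'a \<Rightarrow> 'a \<Rightarrow> 'a"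
  where "hessian \<phi> x = frechet_derivative (gradient \<phi>) (at x)"

definition C2_smooth :: "('a::euclidean_space \<Rightarrow> real) \<Rightarrow> bool"
  where "C2_smooth \<phi> \<longleftrightarrow>
    (\<forall>x. \<phi> differentiable at x) \<and>
    (\<forall>x. gradient \<phi> differentiable at x) \<and>
    continuous_on UNIV (\<lambda>x. Blinfun (hessian \<phi> x))"

definition proper_fun :: "('a \<Rightarrow> ereal) \<Rightarrow> bool"
  where "proper_fun f \<longleftrightarrow> (\<forall>x. f x \<noteq> -\<infinity>) \<and> (\<exists>x. f x \<noteq> \<infinity>)"

definition polyhedral_fun :: "('a::euclidean_space \<Rightarrow> ereal) \<Rightarrow> bool"
  where "polyhedral_fun f \<longleftrightarrow> polyhedron {(x, t :: real). f x \<le> ereal t}"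

definition symmetric_fun :: "(real^'n \<Rightarrow> ereal) \<Rightarrow> bool"
  where "symmetric_fun f \<longleftrightarrow> (\<forall>\<pi> x. \<pi> permutes UNIV \<longrightarrow> f (\<chi> i. x $ \<pi> i) = f x)"

definition regular_subdifferential :: "('a::euclidean_space \<Rightarrow> ereal) \<Rightarrow> 'a \<Rightarrow> 'a set"
  where "regular_subdifferential f x =
    {v. \<bar>f x\<bar> \<noteq> \<infinity> \<and>
        0 \<le> Liminf (at x) (\<lambda>y. (f y - f x - ereal (v \<bullet> (y - x))) / ereal (norm (y - x)))}"

definition limiting_subdifferential :: "('a::euclidean_space \<Rightarrow> ereal) \<Rightarrow> 'a \<Rightarrow> 'a set"
  where "limiting_subdifferential f x =
    {v. \<bar>f x\<bar> \<noteq> \<infinity> \<and>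
        (\<exists>xs vs. xs \<longlonglongrightarrow> x \<and> (\<lambda>k. f (xs k)) \<longlonglongrightarrow> f x \<and> vs \<longlonglongrightarrow> v \<and>
                 (\<forall>k. vs k \<in> regular_subdifferential f (xs k)))}"

definition subderivative :: "('a::euclidean_space \<Rightarrow> ereal) \<Rightarrow> 'a \<Rightarrow> 'a \<Rightarrow> ereal"
  where "subderivative f x h =
    Liminf (at_right 0 \<times>\<^sub>F nhds h) (\<lambda>(t, h'). (f (x + t *\<^sub>R h') - f x) / ereal t)"

definition critical_cone :: "('a::euclidean_space \<Rightarrow> ereal) \<Rightarrow> 'a \<Rightarrow> 'a \<Rightarrow> 'a set"
  where "critical_cone f x y = {h. ereal (y \<bullet> h) = subderivative f x h}"

definition tilt_argmin :: "('a::euclidean_space \<Rightarrow> ereal) \<Rightarrow> 'a \<Rightarrow> real \<Rightarrow> 'a \<Rightarrow> 'a set"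
  where "tilt_argmin f x0 \<gamma> v =
    {x \<in> cball x0 \<gamma>. \<forall>z \<in> cball x0 \<gamma>. f x - ereal (v \<bullet> x) \<le> f z - ereal (v \<bullet> z)}"

definition tilt_stable_local_minimizer :: "('a::euclidean_space \<Rightarrow> ereal) \<Rightarrow> 'a \<Rightarrow> bool"
  where "tilt_stable_local_minimizer f x0 \<longleftrightarrow>
    \<bar>f x0\<bar> \<noteq> \<infinity> \<and>
    (\<exists>\<gamma>>0. tilt_argmin f x0 \<gamma> 0 = {x0} \<and>
       (\<exists>U s L. open U \<and> 0 \<in> U \<and> (\<forall>v\<in>U. tilt_argmin f x0 \<gamma> v = {s v}) \<and> L-lipschitz_on U s))"


section \<open>Ordered eigenvalues and index sets\<close>

type_synonym 'n rvec = "(real, 'n) vec"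
type_synonym 'n rmat = "((real, 'n) vec, 'n) vec"

text \<open>The coordinates \<open>1, \<dots>, n\<close> are the elements of a finite linearly ordered type
  \<^typ>\<open>'n\<close>; its order gives a meaning to ``nonincreasing''. Eigenvalues are repeated according
  to their multiplicity as roots of the characteristic polynomial.\<close>

definition eigvals :: "('n::{finite,linorder}) symmat \<Rightarrow> 'n rvec"
  where "eigvals X = (THE v. (\<forall>i j. i \<le> j \<longrightarrow> v $ j \<le> v $ i) \<and>
    (\<forall>t. det (mat t - mat_of X) = (\<Prod>i\<in>UNIV. t - v $ i)))"

definition Diag :: "('n::finite) rvec \<Rightarrow> 'n rmat"
  where "Diag v = (\<chi> i j. if i = j then v $ i else 0)"

definition diag :: "('n::finite) rmat \<Rightarrow> 'n rvec"
  where "diag A = (\<chi> i. A $ i $ i)"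

definition eig_orth :: "('n::{finite,linorder}) symmat \<Rightarrow> ('n rmat) set"
  where "eig_orth X =
    {P. orthogonal_matrix P \<and> mat_of X = P ** Diag (eigvals X) ** transpose P}"

definition conj_by :: "('n::finite) rmat \<Rightarrow> 'n symmat \<Rightarrow> 'n rmat"
  where "conj_by P H = transpose P ** mat_of H ** P"

text \<open>The \<open>k\<close>-th largest element of a finite set, counted from \<open>k = 1\<close>.\<close>

definition kth_largest :: "real set \<Rightarrow> nat \<Rightarrow> real"
  where "kth_largest S k = rev (sorted_list_of_set S) ! (k - 1)"

definition num_eigs :: "('n::{finite,linorder}) symmat \<Rightarrow> nat"
  where "num_eigs X = card (range (($) (eigvals X)))"

definition alpha :: "('n::{finite,linorder}) symmat \<Rightarrow> nat \<Rightarrow> 'n set"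
  where "alpha X l = {i. eigvals X $ i = kth_largest (range (($) (eigvals X))) l}"

definition num_blocks ::
    "('n::{finite,linorder}) symmat \<Rightarrow> 'n symmat \<Rightarrow> nat \<Rightarrow> nat"
  where "num_blocks X Y l = card (($) (eigvals Y) ` alpha X l)"

definition gam ::
    "('n::{finite,linorder}) symmat \<Rightarrow> 'n symmat \<Rightarrow> nat \<Rightarrow> nat \<Rightarrow> 'n set"
  where "gam X Y l s =
    {i \<in> alpha X l. eigvals Y $ i = kth_largest (($) (eigvals Y) ` alpha X l) s}"

text \<open>The value does not depend on the choice of \<open>P\<close>, because the quotient is constant on the
  blocks determined by the pair of eigenvalues \<open>(\<lambda>\<^sub>i(X), \<lambda>\<^sub>i(Y))\<close>.\<close>

definition Upsilon ::
    "('n::{finite,linorder}) symmat \<Rightarrow> 'n symmat \<Rightarrow> 'n symmat \<Rightarrow> real"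
  where "Upsilon X Y H =
    (let P = (SOME P. P \<in> eig_orth X \<inter> eig_orth Y) in
     2 * (\<Sum>l\<in>{1..num_eigs X}. \<Sum>l'\<in>{l<..num_eigs X}. \<Sum>i\<in>alpha X l. \<Sum>j\<in>alpha X l'.
            (eigvals Y $ i - eigvals Y $ j) / (eigvals X $ i - eigvals X $ j)
              * (conj_by P H $ i $ j)\<^sup>2))"


section \<open>Representations of polyhedral functions\<close>

definition max_affine :: "nat \<Rightarrow> (nat \<Rightarrow> real^'n) \<Rightarrow> (nat \<Rightarrow> real) \<Rightarrow> real^'n \<Rightarrow> real"
  where "max_affine p a c x = Max ((\<lambda>\<nu>. a \<nu> \<bullet> x - c \<nu>) ` {1..p})"

definition polyhedral_rep :: "(real^'n \<Rightarrow> ereal) \<Rightarrow>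
    nat \<Rightarrow> (nat \<Rightarrow> real^'n) \<Rightarrow> (nat \<Rightarrow> real) \<Rightarrow> nat \<Rightarrow> (nat \<Rightarrow> real^'n) \<Rightarrow> (nat \<Rightarrow> real) \<Rightarrow> bool"
  where "polyhedral_rep \<theta> p a c m b d \<longleftrightarrow>
    1 \<le> p \<and> 1 \<le> m \<and> (\<forall>\<mu>\<in>{1..m}. (b \<mu>, d \<mu>) \<noteq> (0, 0)) \<and>
    (\<forall>x. \<theta> x = ereal (max_affine p a c x) + (if max_affine m b d x \<le> 0 then 0 else \<infinity>))"

definition iota1 :: "nat \<Rightarrow> (nat \<Rightarrow> real^'n) \<Rightarrow> (nat \<Rightarrow> real) \<Rightarrow> real^'n \<Rightarrow> nat set"
  where "iota1 p a c x = {\<nu>\<in>{1..p}. a \<nu> \<bullet> x - c \<nu> = max_affine p a c x}"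

definition iota2 :: "nat \<Rightarrow> (nat \<Rightarrow> real^'n) \<Rightarrow> (nat \<Rightarrow> real) \<Rightarrow> real^'n \<Rightarrow> nat set"
  where "iota2 m b d x = {\<mu>\<in>{1..m}. b \<mu> \<bullet> x = d \<mu>}"

text \<open>\<open>J1\<close> and \<open>J2\<close> are the active index sets, \<open>u\<close> and \<open>v\<close> the multipliers representing \<open>y\<close>.\<close>

definition represents :: "nat set \<Rightarrow> nat set \<Rightarrow> (nat \<Rightarrow> real^'n) \<Rightarrow> (nat \<Rightarrow> real^'n) \<Rightarrow> real^'n \<Rightarrow>
    (nat \<Rightarrow> real) \<Rightarrow> (nat \<Rightarrow> real) \<Rightarrow> bool"
  where "represents J1 J2 a b y u v \<longleftrightarrow>
    (\<forall>\<nu>\<in>J1. 0 \<le> u \<nu>) \<and> (\<Sum>\<nu>\<in>J1. u \<nu>) = 1 \<and> (\<forall>\<mu>\<in>J2. 0 \<le> v \<mu>) \<and>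
    y = (\<Sum>\<nu>\<in>J1. u \<nu> *\<^sub>R a \<nu>) + (\<Sum>\<mu>\<in>J2. v \<mu> *\<^sub>R b \<mu>)"

definition eta1 :: "nat set \<Rightarrow> nat set \<Rightarrow> (nat \<Rightarrow> real^'n) \<Rightarrow> (nat \<Rightarrow> real^'n) \<Rightarrow> real^'n \<Rightarrow> nat set"
  where "eta1 J1 J2 a b y = {\<nu>\<in>J1. \<exists>u v. represents J1 J2 a b y u v \<and> u \<nu> > 0}"

definition eta2 :: "nat set \<Rightarrow> nat set \<Rightarrow> (nat \<Rightarrow> real^'n) \<Rightarrow> (nat \<Rightarrow> real^'n) \<Rightarrow> real^'n \<Rightarrow> nat set"
  where "eta2 J1 J2 a b y = {\<mu>\<in>J2. \<exists>u v. represents J1 J2 a b y u v \<and> v \<mu> > 0}"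

text \<open>In the next two definitions \<open>J1\<close>, \<open>J2\<close>, \<open>E1\<close>, \<open>E2\<close> stand for
  \<open>\<iota>\<^sub>1\<close>, \<open>\<iota>\<^sub>2\<close>, \<open>\<eta>\<^sub>1\<close>, \<open>\<eta>\<^sub>2\<close> at \<open>(\<lambda>(X), \<lambda>(Y))\<close>.\<close>

definition K_set :: "nat set \<Rightarrow> nat set \<Rightarrow> nat set \<Rightarrow> nat set \<Rightarrow>
    (nat \<Rightarrow> real^'n) \<Rightarrow> (nat \<Rightarrow> real^'n) \<Rightarrow> (real^'n) set"
  where "K_set J1 J2 E1 E2 a b =
    {h. (\<forall>\<nu>\<in>E1. \<forall>\<nu>'\<in>E1. h \<bullet> (a \<nu>' - a \<nu>) = 0) \<and>
        (\<forall>\<mu>\<in>E2. h \<bullet> b \<mu> = 0) \<and>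
        (\<forall>\<nu>'\<in>J1 - E1. \<forall>\<nu>\<in>E1. h \<bullet> (a \<nu>' - a \<nu>) < 0) \<and>
        (\<forall>\<mu>\<in>J2 - E2. h \<bullet> b \<mu> < 0)}"

definition E_set :: "('n::{finite,linorder}) symmat \<Rightarrow> 'n symmat \<Rightarrow> nat set \<Rightarrow> nat set \<Rightarrow>
    (nat \<Rightarrow> 'n rvec) \<Rightarrow> (nat \<Rightarrow> 'n rvec) \<Rightarrow> nat \<Rightarrow> nat set"
  where "E_set X Y E1 E2 a b l =
    {s\<in>{1..num_blocks X Y l}. \<exists>i\<in>gam X Y l s. \<exists>j\<in>gam X Y l s.
       (\<exists>\<nu>\<in>E1. a \<nu> $ i \<noteq> a \<nu> $ j) \<or> (\<exists>\<mu>\<in>E2. b \<mu> $ i \<noteq> b \<mu> $ j)}"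


section \<open>Second-order conditions\<close>

definition SSOSC :: "(('n::{finite,linorder}) symmat \<Rightarrow> real) \<Rightarrow> ('n symmat \<Rightarrow> ereal) \<Rightarrow>
    'n symmat \<Rightarrow> 'n symmat \<Rightarrow> bool"
  where "SSOSC \<phi> g X Y \<longleftrightarrow>
    (\<forall>H \<in> affine hull critical_cone g X Y - {0}. hessian \<phi> X H \<bullet> H + Upsilon X Y H > 0)"

definition ker_q :: "(('n::{finite,linorder}) symmat \<Rightarrow> ereal) \<Rightarrow>
    'n symmat \<Rightarrow> 'n symmat \<Rightarrow> 'n symmat set"
  where "ker_q g X Y = {H \<in> affine hull critical_cone g X Y. Upsilon X Y H = 0}"

definition kernel_condition :: "(('n::{finite,linorder}) symmat \<Rightarrow> real) \<Rightarrow> ('n symmat \<Rightarrow> ereal) \<Rightarrow>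
    'n symmat \<Rightarrow> 'n symmat \<Rightarrow> bool"
  where "kernel_condition \<phi> g X Y \<longleftrightarrow> {H. hessian \<phi> X H = 0} \<inter> ker_q g X Y = {0}"

end

(* Tilt stability is equivalent to strong monotonicity of the mapping grad phi + dg on the part of its
   graph near (X, 0): since g is convex, this is the growth estimate behind a Lipschitz argmin mapping.

   In an eigenbasis P common to X and Y, the affine hull of the critical cone is the subspace T of all H
   such that P^T H P is block diagonal on the eigenspaces of X, scalar on the blocks of the index sets
   E^l, and has its diagonal in the span of K. The inclusion in T comes from the trace deficits in von
   Neumann's inequality, which bound the off-block entries. Conversely, each H in T is a sum of velocities
   of curves P R(t) Diag(v + t e) R(t)^T P^T, where R(t) is a Cayley transform.

   Given two sequences of pairs in gph dg that tend to (X, Y), every limit H of the normalized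
   differences of the base points either gives an infinite limit of the normalized monotonicity product,
   or lies in T and then this limit is at least Upsilon(H); the lower bound is a rearrangement inequality.
   So positivity on T forces strong monotonicity. For the converse, one perturbs the eigenvalues of X in a
   direction of K that separates all eigenvalues that can be separated. Along spectral curves through the
   perturbed point the monotonicity product has a limit, and it tends to Upsilon(H) as the perturbation
   vanishes. *)

theory Submission
  imports Defs
begin

section \<open>Orthogonal matrices\<close>

text \<open>The obstacle is that eigenbases are neither unique nor continuous. Estimates are made in
  bases that diagonalize a matrix together with its subgradient, such bases are compared only
  through products like \<open>transpose P ** P1\<close>, and their limits come from compactness.
  The two limit bases of a sequence of pairs may differ, so the quadratic form has to be evaluated
  with different bases on its two sides. Nonemptiness of \<open>K\<close> acts as a relative
  interior condition: after a small shift along \<open>K\<close>, the vector y stays a subgradient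
  in all directions of \<open>L\<close>, the span of \<open>K\<close>. Since \<theta> is symmetric,
  exchanging two indices with equal entries in x and in y preserves \<open>L\<close>; pairing with a
  strictly active vector that distinguishes the two indices then forces the corresponding entries of
  every vector of \<open>L\<close> to agree. This is the origin of the scalar blocks. Polyhedrality
  leaves only finitely many subdifferentials, so subgradients close to y can be traded for y
  itself.\<close>

lemma transpose_sum_diff [simp]:
  fixes A B :: "real^'n^'m"
  shows "transpose (A + B) = transpose A + transpose B" "transpose (A - B) = transpose A - transpose B"
    "transpose (c *\<^sub>R A) = c *\<^sub>R transpose A"
  by (simp_all add: transpose_def vec_eq_iff)

lemma mat_of_sym_of: "transpose A = A \<Longrightarrow> mat_of (sym_of A) = A"
  by (simp add: sym_of_inverse)

lemma transpose_nth [simp]: "transpose A $ i $ j = A $ j $ i"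
  by (simp add: transpose_def)

lemma inner_matrix_sum: "A \<bullet> B = (\<Sum>i\<in>UNIV. \<Sum>j\<in>UNIV. A $ i $ j * B $ i $ j)" for A B :: "real^'n^'m"
  by (simp add: inner_vec_def)

lemma inner_matrix_mult_left: "(A ** B) \<bullet> C = B \<bullet> (transpose A ** C)"
  for A :: "real^'k^'m" and B :: "real^'n^'k" and C :: "real^'n^'m"
proof -
  have "(A ** B) \<bullet> C = (\<Sum>i\<in>UNIV. \<Sum>j\<in>UNIV. \<Sum>k\<in>UNIV. A $ i $ k * B $ k $ j * C $ i $ j)"
    by (simp add: inner_matrix_sum matrix_matrix_mult_def sum_distrib_right)
  also have "\<dots> = (\<Sum>i\<in>UNIV. \<Sum>k\<in>UNIV. \<Sum>j\<in>UNIV. A $ i $ k * B $ k $ j * C $ i $ j)"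
    by (intro sum.cong refl sum.swap)
  also have "\<dots> = (\<Sum>k\<in>UNIV. \<Sum>i\<in>UNIV. \<Sum>j\<in>UNIV. A $ i $ k * B $ k $ j * C $ i $ j)"
    by (rule sum.swap)
  also have "\<dots> = (\<Sum>k\<in>UNIV. \<Sum>j\<in>UNIV. \<Sum>i\<in>UNIV. A $ i $ k * B $ k $ j * C $ i $ j)"
    by (intro sum.cong refl sum.swap)
  also have "\<dots> = B \<bullet> (transpose A ** C)"
    by (simp add: inner_matrix_sum matrix_matrix_mult_def sum_distrib_left transpose_def mult.assoc mult.left_commute)
  finally show ?thesis .
qed

lemma inner_transpose: "transpose A \<bullet> transpose B = A \<bullet> B" for A B :: "real^'n^'m"
  unfolding inner_matrix_sum transpose_def by (simp, rule sum.swap)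

lemma inner_matrix_mult_right: "(B ** A) \<bullet> C = B \<bullet> (C ** transpose A)"
  for A :: "real^'n^'k" and B :: "real^'k^'m" and C :: "real^'n^'m"
  using inner_matrix_mult_left[of "transpose A" "transpose B" "transpose C"]
    inner_transpose[of "B ** A" C] inner_transpose[of B "C ** transpose A"]
  by (simp add: matrix_transpose_mul)

lemma orthogonal_matrix_mult [simp]:
  fixes P :: "real^'n^'n"
  assumes "orthogonal_matrix P"
  shows "transpose P ** P = mat 1" "P ** transpose P = mat 1"
    "transpose P ** (P ** A) = A" "P ** (transpose P ** A) = A"
    "B ** transpose P ** P = B" "B ** P ** transpose P = B"
proof -
  show *: "transpose P ** P = mat 1" "P ** transpose P = mat 1"
    using assms by (auto simp: orthogonal_matrix_def)
  show "transpose P ** (P ** A) = A" "P ** (transpose P ** A) = A"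
    by (simp_all add: matrix_mul_assoc *)
  show "B ** transpose P ** P = B" "B ** P ** transpose P = B"
    by (simp_all add: matrix_mul_assoc[symmetric] *)
qed

lemma inner_orthogonal_mult:
  fixes A B P :: "real^'n^'n"
  assumes "orthogonal_matrix P"
  shows "(P ** A) \<bullet> (P ** B) = A \<bullet> B" "(A ** P) \<bullet> (B ** P) = A \<bullet> B"
  using inner_matrix_mult_right[of A P "B ** P"] assms by (simp_all add: inner_matrix_mult_left)

lemma norm_orthogonal_mult:
  fixes A P :: "real^'n^'n"
  assumes "orthogonal_matrix P"
  shows "norm (P ** A) = norm A" "norm (A ** P) = norm A"
  using inner_orthogonal_mult[OF assms] by (simp_all add: norm_eq_sqrt_inner)

lemma orthogonal_matrix_transposeI: "orthogonal_matrix P \<Longrightarrow> orthogonal_matrix (transpose P)"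
  for P :: "real^'n^'n"
  by simp

lemma orthogonal_columns:
  fixes P :: "real^'n^'n"
  assumes "orthogonal_matrix P"
  shows "(\<Sum>r\<in>UNIV. P $ r $ i * P $ r $ j) = (if i = j then 1 else 0)"
proof -
  have "(transpose P ** P) $ i $ j = (if i = j then 1 else 0)"
    using assms by (simp add: orthogonal_matrix mat_def)
  then show ?thesis
    by (simp add: matrix_matrix_mult_def transpose_def)
qed

lemma orthogonal_rows:
  fixes P :: "real^'n^'n"
  assumes "orthogonal_matrix P"
  shows "(\<Sum>r\<in>UNIV. P $ i $ r * P $ j $ r) = (if i = j then 1 else 0)"
  using orthogonal_columns[OF orthogonal_matrix_transposeI[OF assms], of i j] by (simp add: transpose_def)

lemma orthogonal_entry_le_1:
  fixes P :: "real^'n^'n"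
  assumes "orthogonal_matrix P"
  shows "(P $ i $ j)\<^sup>2 \<le> 1" "\<bar>P $ i $ j\<bar> \<le> 1"
proof -
  have "(P $ i $ j)\<^sup>2 \<le> (\<Sum>r\<in>UNIV. (P $ i $ r)\<^sup>2)"
    by (intro member_le_sum) auto
  also have "\<dots> = 1"
    using orthogonal_rows[OF assms, of i i] by (simp add: power2_eq_square)
  finally show "(P $ i $ j)\<^sup>2 \<le> 1" .
  then show "\<bar>P $ i $ j\<bar> \<le> 1"
    by (simp add: abs_square_le_1)
qed

lemma continuous_matrix_mult [continuous_intros]:
  fixes A :: "'a::topological_space \<Rightarrow> real^'k^'m" and B :: "'a \<Rightarrow> real^'n^'k"
  shows "continuous_on S A \<Longrightarrow> continuous_on S B \<Longrightarrow> continuous_on S (\<lambda>x. A x ** B x)"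
  unfolding matrix_matrix_mult_def by (intro continuous_intros)

lemma tendsto_matrix_mult [tendsto_intros]:
  fixes A :: "'a \<Rightarrow> real^'k^'m" and B :: "'a \<Rightarrow> real^'n^'k"
  shows "(A \<longlongrightarrow> a) F \<Longrightarrow> (B \<longlongrightarrow> b) F \<Longrightarrow> ((\<lambda>x. A x ** B x) \<longlongrightarrow> a ** b) F"
  unfolding matrix_matrix_mult_def by (intro tendsto_intros)

lemma continuous_transpose [continuous_intros]:
  fixes A :: "'a::topological_space \<Rightarrow> real^'n^'m"
  shows "continuous_on S A \<Longrightarrow> continuous_on S (\<lambda>x. transpose (A x))"
  unfolding transpose_def by (intro continuous_intros)

lemma tendsto_transpose [tendsto_intros]:
  fixes A :: "'a \<Rightarrow> real^'n^'m"
  shows "(A \<longlongrightarrow> a) F \<Longrightarrow> ((\<lambda>x. transpose (A x)) \<longlongrightarrow> transpose a) F"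
  unfolding transpose_def by (intro tendsto_intros)

lemma closed_orthogonal_matrices: "closed {P :: real^'n^'n. orthogonal_matrix P}"
  unfolding orthogonal_matrix by (intro closed_Collect_eq continuous_intros)

lemma compact_orthogonal_matrices: "compact {P :: real^'n^'n. orthogonal_matrix P}"
proof -
  have "norm P \<le> norm (mat 1 :: real^'n^'n)" if "orthogonal_matrix P" for P :: "real^'n^'n"
    using norm_orthogonal_mult(1)[OF that, of "mat 1"] by simp
  then show ?thesis
    using closed_orthogonal_matrices by (auto simp: compact_eq_bounded_closed bounded_iff)
qed

section \<open>Symmetric, diagonal and conjugated matrices\<close>

lemma bounded_linear_mat_of: "bounded_linear mat_of"
  by (rule bounded_linear_intro[where K=1]) (simp_all add: plus_symmat.rep_eq scaleR_symmat.rep_eq norm_symmat.rep_eq)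

lemmas tendsto_mat_of [tendsto_intros] = bounded_linear.tendsto[OF bounded_linear_mat_of]
lemma tendsto_mat_of_iff: "((\<lambda>k. mat_of (A k)) \<longlongrightarrow> mat_of a) F \<longleftrightarrow> (A \<longlongrightarrow> a) F"
proof
  assume "((\<lambda>k. mat_of (A k)) \<longlongrightarrow> mat_of a) F"
  then show "(A \<longlongrightarrow> a) F"
    unfolding tendsto_iff by (simp add: dist_norm norm_symmat.rep_eq minus_symmat.rep_eq)
qed (rule tendsto_mat_of)

lemma Diag_nth [simp]: "Diag v $ i $ j = (if i = j then v $ i else 0)"
  by (simp add: Diag_def)

lemma diag_nth [simp]: "diag A $ i = A $ i $ i"
  by (simp add: diag_def)

lemma transpose_Diag [simp]: "transpose (Diag v) = Diag v"
  by (simp add: transpose_def vec_eq_iff)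

lemma inner_Diag: "A \<bullet> Diag v = diag A \<bullet> v" "Diag v \<bullet> A = v \<bullet> diag A"
  by (simp_all add: inner_matrix_sum inner_vec_def if_distrib[of "\<lambda>z. c * z" for c] if_distrib[of "\<lambda>z. z * c" for c] cong: if_cong)

lemma diag_Diag [simp]: "diag (Diag v) = v"
  by (simp add: vec_eq_iff)

lemma diag_linear:
  "diag (A + B) = diag A + diag B" "diag (A - B) = diag A - diag B" "diag (c *\<^sub>R A) = c *\<^sub>R diag A"
  by (simp_all add: vec_eq_iff)

lemma Diag_linear:
  "Diag (v + w) = Diag v + Diag w" "Diag (v - w) = Diag v - Diag w" "Diag (c *\<^sub>R v) = c *\<^sub>R Diag v"
  by (simp_all add: vec_eq_iff)

lemma tendsto_Diag [tendsto_intros]: "(v \<longlongrightarrow> w) F \<Longrightarrow> ((\<lambda>x. Diag (v x)) \<longlongrightarrow> Diag w) F"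
proof -
  assume *: "(v \<longlongrightarrow> w) F"
  have "((\<lambda>x. Diag (v x) $ i $ j) \<longlongrightarrow> Diag w $ i $ j) F" for i j
    using tendsto_vec_nth[OF *] by simp
  then show ?thesis
    by (intro vec_tendstoI)
qed

lemma mult_Diag_nth:
  fixes A :: "real^'n::finite^'m" and B :: "real^'m^'n::finite"
  shows "(A ** Diag v) $ i $ j = A $ i $ j * v $ j" "(Diag v ** B) $ k $ l = v $ k * B $ k $ l"
  by (simp_all add: matrix_matrix_mult_def if_distrib[of "\<lambda>z. c * z" for c] if_distrib[of "\<lambda>z. z * c" for c]
      cong: if_cong)

lemma conj_Diag_nth:
  fixes Q :: "real^'n::finite^'m"
  shows "(Q ** Diag v ** transpose Q) $ i $ j = (\<Sum>k\<in>UNIV. Q $ i $ k * Q $ j $ k * v $ k)"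
proof -
  have "(Q ** Diag v ** transpose Q) $ i $ j = (\<Sum>k\<in>UNIV. (Q ** Diag v) $ i $ k * transpose Q $ k $ j)"
    unfolding matrix_matrix_mult_def by simp
  also have "\<dots> = (\<Sum>k\<in>UNIV. Q $ i $ k * v $ k * Q $ j $ k)"
    by (intro sum.cong refl) (simp add: mult_Diag_nth transpose_nth)
  finally show ?thesis
    by (simp add: mult_ac)
qed

lemma transpose_conj_by [simp]: "transpose (conj_by P H) = conj_by P H"
  by (simp add: conj_by_def matrix_transpose_mul matrix_mul_assoc)

lemma conj_by_commute: "conj_by P H $ i $ j = conj_by P H $ j $ i"
  using transpose_nth[of "conj_by P H" j i] by simp

lemma matrix_mult_scaleR_right: "A ** (k *\<^sub>R B) = k *\<^sub>R (A ** B)"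
  for A :: "real^'k^'m" and B :: "real^'n^'k"
  by (simp add: matrix_matrix_mult_def vec_eq_iff sum_distrib_left mult_ac)

lemma matrix_mult_scaleR_left: "(k *\<^sub>R A) ** B = k *\<^sub>R (A ** B)"
  for A :: "real^'k^'m" and B :: "real^'n^'k"
  by (simp add: matrix_matrix_mult_def vec_eq_iff sum_distrib_left mult_ac)

lemma matrix_mult_diff:
  fixes A B :: "real^'k^'m" and C D :: "real^'n^'k"
  shows "(A - B) ** C = A ** C - B ** C" "A ** (C - D) = A ** C - A ** D"
  by (simp_all add: matrix_matrix_mult_def vec_eq_iff sum_subtractf algebra_simps)

lemma matrix_mult_add:
  fixes A B :: "real^'k^'m" and C D :: "real^'n^'k"
  shows "(A + B) ** C = A ** C + B ** C" "A ** (C + D) = A ** C + A ** D"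
  by (simp_all add: matrix_matrix_mult_def vec_eq_iff sum.distrib algebra_simps)

lemma bounded_linear_conj_by: "bounded_linear (conj_by P)"
proof -
  have "linear (\<lambda>A. transpose P ** A ** P)"
    by (rule linearI) (simp_all add: matrix_mult_add matrix_mult_scaleR_left matrix_mult_scaleR_right)
  then have "bounded_linear (\<lambda>A. transpose P ** A ** P)"
    by (simp add: linear_conv_bounded_linear)
  from bounded_linear_compose[OF this bounded_linear_mat_of] show ?thesis
    by (simp add: conj_by_def[abs_def])
qed

section \<open>Plane rotations and ordered diagonalization\<close>

text \<open>Right multiplication of \<open>P\<close> by a Givens rotation in the plane of
  \<open>i\<close> and \<open>j\<close>. A point \<open>(c, s)\<close> of the unit circle replaces
  the angle.\<close>

definition rot_cols :: "'n \<Rightarrow> 'n \<Rightarrow> real \<Rightarrow> real \<Rightarrow> 'n::finite rmat \<Rightarrow> 'n rmat"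
  where "rot_cols i j c s P = (\<chi> r k. if k = i then c * P $ r $ i + s * P $ r $ j
    else if k = j then c * P $ r $ j - s * P $ r $ i else P $ r $ k)"

lemma sum_split_pair:
  fixes f :: "'n::finite \<Rightarrow> 'b::comm_monoid_add"
  assumes "i \<noteq> j"
  shows "(\<Sum>k\<in>UNIV. f k) = f i + (f j + (\<Sum>k\<in>UNIV - {i, j}. f k))"
proof -
  have "(\<Sum>k\<in>UNIV. f k) = f i + (\<Sum>k\<in>UNIV - {i}. f k)"
    by (rule sum.remove) auto
  also have "(\<Sum>k\<in>UNIV - {i}. f k) = f j + (\<Sum>k\<in>UNIV - {i} - {j}. f k)"
    by (rule sum.remove) (use assms in auto)
  also have "UNIV - {i} - {j} = UNIV - {i, j}"
    by auto
  finally show ?thesis .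
qed

text \<open>The rotation only changes the orthonormal basis inside a space on which
  \<open>Diag w\<close> is scalar.\<close>

lemma rot_cols_conj_Diag:
  assumes "i \<noteq> j" "c\<^sup>2 + s\<^sup>2 = 1" "w $ i = w $ j"
  shows "rot_cols i j c s P ** Diag w ** transpose (rot_cols i j c s P) = P ** Diag w ** transpose P"
proof -
  have "(rot_cols i j c s P ** Diag w ** transpose (rot_cols i j c s P)) $ r $ q
      = (P ** Diag w ** transpose P) $ r $ q" for r q
  proof -
    have rest: "(\<Sum>k\<in>UNIV - {i, j}. rot_cols i j c s P $ r $ k * rot_cols i j c s P $ q $ k * w $ k)
        = (\<Sum>k\<in>UNIV - {i, j}. P $ r $ k * P $ q $ k * w $ k)"
      by (intro sum.cong) (auto simp: rot_cols_def)
    have "(c * a + s * b) * (c * a' + s * b') * t + (c * b - s * a) * (c * b' - s * a') * t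
        = (c\<^sup>2 + s\<^sup>2) * (a * a' * t + b * b' * t)" for a b a' b' t :: real
      by (simp add: algebra_simps power2_eq_square)
    from this[of "P $ r $ i" "P $ r $ j" "P $ q $ i" "P $ q $ j" "w $ j"] show ?thesis
      unfolding conj_Diag_nth sum_split_pair[OF assms(1)] rest using assms
      by (simp add: rot_cols_def)
  qed
  then show ?thesis
    by (simp add: vec_eq_iff)
qed

lemma Diag_1: "Diag 1 = mat 1"
  by (simp add: vec_eq_iff mat_def)

lemma orthogonal_rot_cols:
  assumes "i \<noteq> j" "c\<^sup>2 + s\<^sup>2 = 1" "orthogonal_matrix P"
  shows "orthogonal_matrix (rot_cols i j c s P)"
proof -
  \<comment> \<open>For the constant weight 1 all entries are equal, so the invariance applies to
    every pair of indices and says that the rows stay orthonormal.\<close>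
  have "rot_cols i j c s P ** transpose (rot_cols i j c s P) = mat 1"
    using rot_cols_conj_Diag[of i j c s 1 P] assms by (simp add: Diag_1)
  then show ?thesis
    unfolding orthogonal_matrix using matrix_left_right_inverse by blast
qed

lemma conj_by_nth: "conj_by P Z $ k $ l = column k P \<bullet> (mat_of Z *v column l P)"
proof -
  have "column l (mat_of Z ** P) = mat_of Z *v column l P"
    by (simp add: vec_eq_iff column_def matrix_matrix_mult_def matrix_vector_mult_def)
  then show ?thesis
    unfolding conj_by_def matrix_mul_assoc[symmetric]
    by (simp add: matrix_matrix_mult_def[of "transpose P"] column_def inner_vec_def vec_eq_iff)
qed

lemma column_rot_cols:
  assumes "i \<noteq> j"
  shows "column i (rot_cols i j c s P) = c *\<^sub>R column i P + s *\<^sub>R column j P"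
    "column j (rot_cols i j c s P) = c *\<^sub>R column j P - s *\<^sub>R column i P"
    "k \<noteq> i \<Longrightarrow> k \<noteq> j \<Longrightarrow> column k (rot_cols i j c s P) = column k P"
  using assms by (auto simp: vec_eq_iff column_def rot_cols_def)

text \<open>The variation formula of Jacobi's eigenvalue method. Only the diagonal entries
  \<open>i\<close> and \<open>j\<close> change and their sum is kept, hence the factor
  \<open>w $ i - w $ j\<close>.\<close>

lemma diag_conj_rot_cols:
  fixes P :: "'n::finite rmat" and Z :: "'n symmat"
  assumes "i \<noteq> j" "c\<^sup>2 + s\<^sup>2 = 1"
  defines "A \<equiv> conj_by P Z"
  shows "diag (conj_by (rot_cols i j c s P) Z) \<bullet> w = diag A \<bullet> w
    + (w $ i - w $ j) * (2 * c * s * A $ i $ j - s\<^sup>2 * (A $ i $ i - A $ j $ j))"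
proof -
  let ?B = "conj_by (rot_cols i j c s P) Z"
  have ji: "A $ j $ i = A $ i $ j"
    by (simp add: A_def conj_by_commute[of P Z j i])
  have c2: "c * c = 1 - s\<^sup>2"
    using assms(2) by (simp add: power2_eq_square)
  have ii: "?B $ i $ i = A $ i $ i + (2 * c * s * A $ i $ j - s\<^sup>2 * (A $ i $ i - A $ j $ j))"
  proof -
    have "?B $ i $ i = (c * c) * A $ i $ i + c * s * A $ i $ j + c * s * A $ j $ i + s\<^sup>2 * A $ j $ j"
      using assms(1) unfolding A_def
      by (simp add: conj_by_nth column_rot_cols inner_add_left inner_add_right
          matrix_vector_right_distrib matrix_scaleR_vector_ac algebra_simps power2_eq_square flip: scaleR_matrix_vector_assoc)
    then show ?thesis
      by (simp add: c2 ji) (simp add: algebra_simps)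
  qed
  have jj: "?B $ j $ j = A $ j $ j - (2 * c * s * A $ i $ j - s\<^sup>2 * (A $ i $ i - A $ j $ j))"
  proof -
    have "?B $ j $ j = (c * c) * A $ j $ j - c * s * A $ i $ j - c * s * A $ j $ i + s\<^sup>2 * A $ i $ i"
      using assms(1) unfolding A_def
      by (simp add: conj_by_nth column_rot_cols inner_diff_left inner_diff_right
          matrix_vector_mult_diff_distrib matrix_scaleR_vector_ac algebra_simps power2_eq_square flip: scaleR_matrix_vector_assoc)
    then show ?thesis
      by (simp add: c2 ji) (simp add: algebra_simps)
  qed
  have rest: "(\<Sum>k\<in>UNIV - {i, j}. ?B $ k $ k * w $ k) = (\<Sum>k\<in>UNIV - {i, j}. A $ k $ k * w $ k)"
    unfolding A_def by (intro sum.cong) (auto simp: conj_by_nth column_rot_cols[OF assms(1)])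
  show ?thesis
    by (simp add: inner_vec_def sum_split_pair[OF assms(1)] rest ii jj) (simp add: algebra_simps)
qed

text \<open>Optimality at the point \<open>(1, 0)\<close> of the circle: a small rotation of
  suitable sign detects \<open>x\<close>, the quarter turn detects the sign of \<delta>.\<close>

lemma stationary_on_circle:
  fixes x \<delta> k :: real
  assumes *: "\<And>c s. c\<^sup>2 + s\<^sup>2 = 1 \<Longrightarrow> k * (2 * c * s * x - s\<^sup>2 * \<delta>) \<le> 0"
  shows "k \<noteq> 0 \<Longrightarrow> x = 0" "k > 0 \<Longrightarrow> \<delta> \<ge> 0"
proof -
  show "k > 0 \<Longrightarrow> \<delta> \<ge> 0"
    using *[of 0 1] by (simp add: zero_le_mult_iff)
  assume k: "k \<noteq> 0"
  show "x = 0"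
  proof (rule ccontr)
    assume x: "x \<noteq> 0"
    have r: "k * (2 * r * x - r\<^sup>2 * \<delta>) \<le> 0" for r
    proof -
      \<comment> \<open>Parametrization by the tangent \<open>r\<close> of the angle, so that
        \<open>s = r * c\<close>; the factor \<open>c^2\<close> is divided out.\<close>
      define c where "c = 1 / sqrt (1 + r\<^sup>2)"
      have pos: "1 + r\<^sup>2 > 0"
        by (meson add_pos_nonneg zero_le_power2 zero_less_one)
      then have c2: "c\<^sup>2 = 1 / (1 + r\<^sup>2)"
        by (simp add: c_def power_divide)
      then have "c\<^sup>2 + (r * c)\<^sup>2 = 1"
        using pos by (simp add: power_mult_distrib field_simps)
      from *[OF this] have "c\<^sup>2 * (k * (2 * r * x - r\<^sup>2 * \<delta>)) \<le> 0"
        by (simp add: algebra_simps power2_eq_square)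
      moreover have "c\<^sup>2 > 0"
        using c2 pos by simp
      ultimately show ?thesis
        by (simp add: mult_le_0_iff not_le)
    qed
    \<comment> \<open>The sign of \<open>r\<close> makes the linear term \<open>2 k r x\<close>
      positive, and \<open>M\<close> exceeding the absolute value of \<delta> makes it dominate the
      quadratic term.\<close>
    define M where "M = \<bar>\<delta>\<bar> + 1"
    define r where "r = sgn k * x / M"
    have M: "M > 0" "\<bar>\<delta>\<bar> < M"
      by (auto simp: M_def)
    have "k * (2 * r * x - r\<^sup>2 * \<delta>) = (x\<^sup>2 / M\<^sup>2) * (2 * \<bar>k\<bar> * M - k * \<delta>)"
      using M(1) k by (simp add: r_def field_simps power2_eq_square abs_sgn sgn_mult_self_eq)
    moreover have "k * \<delta> < 2 * \<bar>k\<bar> * M"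
    proof -
      have "k * \<delta> \<le> \<bar>k\<bar> * \<bar>\<delta>\<bar>"
        by (metis abs_ge_self abs_mult)
      also have "\<dots> < \<bar>k\<bar> * M"
        using M k by simp
      also have "\<dots> \<le> 2 * \<bar>k\<bar> * M"
        using M(1) by simp
      finally show ?thesis .
    qed
    ultimately have "k * (2 * r * x - r\<^sup>2 * \<delta>) > 0"
      using M(1) x by simp
    with r[of r] show False by simp
  qed
qed

text \<open>A strictly decreasing vector, used as tie-breaking weight here and as a source of
  distinct entries in \<open>obtain_separating_direction\<close>.\<close>

definition rank_vec :: "'n::{finite,linorder} rvec"
  where "rank_vec = (\<chi> i. - real (card {j. j < i}))"

lemma rank_vec_less: "i < j \<Longrightarrow> rank_vec $ j < rank_vec $ i"
proof -
  assume "i < j"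
  then have "{k. k < i} \<subset> {k. k < j}"
    by (auto intro: less_trans)
  then have "card {k. k < i} < card {k. k < j}"
    by (intro psubset_card_mono) auto
  then show ?thesis
    by (simp add: rank_vec_def)
qed

text \<open>Maximizing a second linear functional with distinct weights among the maximizers of the
  first one forces the conjugated matrix to be diagonal.\<close>

lemma rotation_closed_maximizers:
  fixes Z :: "'n::{finite,linorder} symmat" and w :: "'n rvec"
  assumes M: "compact M" "M \<noteq> {}" "\<And>P. P \<in> M \<Longrightarrow> orthogonal_matrix P"
    and max: "\<And>P R. P \<in> M \<Longrightarrow> orthogonal_matrix R \<Longrightarrow> diag (conj_by R Z) \<bullet> w \<le> diag (conj_by P Z) \<bullet> w"
    and rot: "\<And>P i j c s. P \<in> M \<Longrightarrow> i \<noteq> j \<Longrightarrow> w $ i = w $ j \<Longrightarrow> c\<^sup>2 + s\<^sup>2 = 1 \<Longrightarrow> rot_cols i j c s P \<in> M"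
  obtains P where "P \<in> M" "\<And>i j. i \<noteq> j \<Longrightarrow> conj_by P Z $ i $ j = 0"
    "\<And>i j. w $ j < w $ i \<Longrightarrow> conj_by P Z $ j $ j \<le> conj_by P Z $ i $ i"
    "\<And>i j. i < j \<Longrightarrow> w $ i = w $ j \<Longrightarrow> conj_by P Z $ j $ j \<le> conj_by P Z $ i $ i"
proof -
  have "continuous_on M (\<lambda>P. diag (conj_by P Z) \<bullet> rank_vec)"
    unfolding diag_def conj_by_def by (intro continuous_intros)
  from continuous_attains_sup[OF M(1,2) this] obtain P where P: "P \<in> M"
    and Pmax: "\<And>R. R \<in> M \<Longrightarrow> diag (conj_by R Z) \<bullet> rank_vec \<le> diag (conj_by P Z) \<bullet> rank_vec"
    by blast
  let ?A = "conj_by P Z"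
  have w: "(w $ i - w $ j) * (2 * c * s * ?A $ i $ j - s\<^sup>2 * (?A $ i $ i - ?A $ j $ j)) \<le> 0"
    if "i \<noteq> j" "c\<^sup>2 + s\<^sup>2 = 1" for i j c s
    using max[OF P orthogonal_rot_cols[OF that M(3)[OF P]]] unfolding diag_conj_rot_cols[OF that] by linarith
  have d: "(rank_vec $ i - rank_vec $ j) * (2 * c * s * ?A $ i $ j - s\<^sup>2 * (?A $ i $ i - ?A $ j $ j)) \<le> 0"
    if "i \<noteq> j" "c\<^sup>2 + s\<^sup>2 = 1" "w $ i = w $ j" for i j c s
    using Pmax[OF rot[OF P that(1,3,2)]] unfolding diag_conj_rot_cols[OF that(1,2)] by linarith
  have dne: "rank_vec $ i - rank_vec $ j \<noteq> 0" if "i \<noteq> j" for i j :: 'n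
  proof (cases "i < j")
    case True
    then show ?thesis
      using rank_vec_less[OF True] by simp
  next
    case False
    then have "j < i" using that by simp
    then show ?thesis
      using rank_vec_less[of j i] by simp
  qed
  show ?thesis
  proof (rule that[OF P])
    show "?A $ i $ j = 0" if "i \<noteq> j" for i j
    proof (cases "w $ i = w $ j")
      case True
      show ?thesis
        by (rule stationary_on_circle(1)[OF d[OF that _ True] dne[OF that]])
    next
      case False
      show ?thesis
        by (rule stationary_on_circle(1)[OF w[OF that]]) (use False in auto)
    qed
    show "?A $ j $ j \<le> ?A $ i $ i" if "w $ j < w $ i" for i j
    proof -
      have "i \<noteq> j" using that by auto
      from stationary_on_circle(2)[OF w[OF this]] that show ?thesis
        by simp
    qed
    show "?A $ j $ j \<le> ?A $ i $ i" if "i < j" "w $ i = w $ j" for i j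
    proof -
      have "i \<noteq> j" using that by auto
      from stationary_on_circle(2)[OF d[OF this _ that(2)]] rank_vec_less[OF that(1)] show ?thesis
        by simp
    qed
  qed
qed

section \<open>Ordered eigenvalues\<close>

lemma linear_factors_eq_imp_permutes:
  fixes v w :: "'n::finite rvec"
  assumes "\<And>t. (\<Prod>i\<in>UNIV. t - v $ i) = (\<Prod>i\<in>UNIV. t - w $ i)"
  obtains \<sigma> where "\<sigma> permutes UNIV" "\<And>i. v $ i = w $ \<sigma> i"
proof -
  have poly: "poly (\<Prod>i\<in>UNIV. [:- u $ i, 1:]) t = (\<Prod>i\<in>UNIV. t - u $ i)" for u :: "'n rvec" and t
    by (simp add: poly_prod)
  have "proots (\<Prod>i\<in>UNIV. [:- u $ i, 1:]) = image_mset (($) u) (mset_set UNIV)" for u :: "'n rvec"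
    by (subst proots_prod) (simp_all add: sum_unfold_sum_mset image_mset.compositionality comp_def)
  moreover have "(\<Prod>i\<in>UNIV. [:- v $ i, 1:]) = (\<Prod>i\<in>UNIV. [:- w $ i, 1:])"
    using assms by (intro poly_ext) (simp only: poly)
  ultimately have "image_mset (($) v) (mset_set UNIV) = image_mset (($) w) (mset_set UNIV)"
    by metis
  then obtain p where "p permutes UNIV" "\<forall>i\<in>UNIV. v $ i = w $ p i"
    using image_mset_eq_implies_permutes[OF finite_class.finite_UNIV] by blast
  then show thesis
    by (intro that[of p]) auto
qed

text \<open>Pigeonhole: if \<open>w $ k < v $ k\<close>, then \<sigma> would send the indices up to
  \<open>k\<close> injectively to indices strictly before \<open>k\<close>.\<close>

lemma antitone_permuted_le:
  fixes v w :: "'n::{finite,linorder} rvec"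
  assumes v: "\<And>i j. i \<le> j \<Longrightarrow> v $ j \<le> v $ i" and w: "\<And>i j. i \<le> j \<Longrightarrow> w $ j \<le> w $ i"
    and \<sigma>: "\<sigma> permutes UNIV" "\<And>i. v $ i = w $ \<sigma> i"
  shows "v $ k \<le> w $ k"
proof (rule ccontr)
  assume "\<not> v $ k \<le> w $ k"
  then have less: "w $ k < v $ k" by simp
  have inj: "inj \<sigma>"
    using \<sigma>(1) permutes_inj by blast
  have "\<sigma> ` {..k} \<subseteq> {..<k}"
  proof (rule image_subsetI)
    fix i assume "i \<in> {..k}"
    with v have "v $ k \<le> w $ \<sigma> i"
      using \<sigma>(2) by simp
    then show "\<sigma> i \<in> {..<k}"
      using less w[of k "\<sigma> i"] by force
  qed
  then have "card (\<sigma> ` {..k}) \<le> card {..<k}"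
    by (intro card_mono) auto
  moreover have "card (\<sigma> ` {..k}) = card {..k}"
    using inj by (simp add: card_image inj_on_subset)
  moreover have "card {..<k} < card {..k}"
    by (intro psubset_card_mono) auto
  ultimately show False
    by simp
qed

lemma antitone_factors_unique:
  fixes v w :: "'n::{finite,linorder} rvec"
  assumes v: "\<And>i j. i \<le> j \<Longrightarrow> v $ j \<le> v $ i" and w: "\<And>i j. i \<le> j \<Longrightarrow> w $ j \<le> w $ i"
    and eq: "\<And>t. (\<Prod>i\<in>UNIV. t - v $ i) = (\<Prod>i\<in>UNIV. t - w $ i)"
  shows "v = w"
proof -
  obtain \<sigma> where \<sigma>: "\<sigma> permutes UNIV" "\<And>i. v $ i = w $ \<sigma> i"
    using linear_factors_eq_imp_permutes[OF eq] by blast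
  obtain \<tau> where \<tau>: "\<tau> permutes UNIV" "\<And>i. w $ i = v $ \<tau> i"
    using linear_factors_eq_imp_permutes[OF eq[symmetric]] by blast
  show ?thesis
    using antitone_permuted_le[OF v w \<sigma>] antitone_permuted_le[OF w v \<tau>]
    by (simp add: vec_eq_iff antisym)
qed

text \<open>The vector \<open>v\<close> need not be ordered; \<open>eigvals\<close> recovers it
  exactly when it is nonincreasing.\<close>

definition spectral :: "'n::finite rmat \<Rightarrow> 'n rvec \<Rightarrow> 'n symmat"
  where "spectral P v = sym_of (P ** Diag v ** transpose P)"

lemma mat_of_spectral: "mat_of (spectral P v) = P ** Diag v ** transpose P"
  unfolding spectral_def by (rule mat_of_sym_of) (simp add: matrix_transpose_mul matrix_mul_assoc)

lemma spectral_iff: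
  assumes "orthogonal_matrix P"
  shows "Z = spectral P v \<longleftrightarrow> conj_by P Z = Diag v"
proof
  assume "Z = spectral P v"
  then show "conj_by P Z = Diag v"
    using assms by (simp add: conj_by_def mat_of_spectral flip: matrix_mul_assoc)
next
  assume *: "conj_by P Z = Diag v"
  have "P ** (transpose P ** mat_of Z ** P) ** transpose P = mat_of Z"
    using assms by (simp flip: matrix_mul_assoc)
  then have "mat_of Z = mat_of (spectral P v)"
    using * by (simp add: conj_by_def mat_of_spectral)
  then show "Z = spectral P v"
    by (simp add: mat_of_inject)
qed

lemma det_mat_minus_spectral:
  fixes P :: "'n::finite rmat"
  assumes "orthogonal_matrix P"
  shows "det (mat t - mat_of (spectral P v)) = (\<Prod>i\<in>UNIV. t - v $ i)"
proof -
  have "Diag (\<chi> i. t - v $ i) = mat t - Diag v"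
    by (simp add: vec_eq_iff mat_def)
  then have "P ** Diag (\<chi> i. t - v $ i) ** transpose P = P ** mat t ** transpose P - mat_of (spectral P v)"
    by (simp add: matrix_mult_diff mat_of_spectral)
  also have "P ** mat t = t *\<^sub>R P"
  proof -
    have "mat t = t *\<^sub>R (mat 1 :: 'n rmat)"
      by (simp add: vec_eq_iff mat_def)
    then show ?thesis
      by (simp add: matrix_mult_scaleR_right)
  qed
  also have "t *\<^sub>R P ** transpose P = mat t"
    using assms by (simp add: matrix_mult_scaleR_left) (simp add: vec_eq_iff mat_def)
  finally have "det (mat t - mat_of (spectral P v)) = det P * det (Diag (\<chi> i. t - v $ i)) * det P"
    using det_mul[of "P ** Diag (\<chi> i. t - v $ i)" "transpose P"] by (simp add: det_mul)
  also have "\<dots> = det (Diag (\<chi> i. t - v $ i))"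
    using det_orthogonal_matrix[OF assms] by auto
  also have "\<dots> = (\<Prod>i\<in>UNIV. t - v $ i)"
    by (subst det_diagonal) auto
  finally show ?thesis .
qed

lemma eigvals_spectral:
  assumes P: "orthogonal_matrix P" and v: "\<And>i j. i \<le> j \<Longrightarrow> v $ j \<le> v $ i"
  shows "eigvals (spectral P v) = v"
  unfolding eigvals_def det_mat_minus_spectral[OF P]
proof (rule the_equality)
  show "(\<forall>i j. i \<le> j \<longrightarrow> v $ j \<le> v $ i) \<and> (\<forall>t. (\<Prod>i\<in>UNIV. t - v $ i) = (\<Prod>i\<in>UNIV. t - v $ i))"
    using v by simp
  show "u = v" if "(\<forall>i j. i \<le> j \<longrightarrow> u $ j \<le> u $ i) \<and> (\<forall>t. (\<Prod>i\<in>UNIV. t - v $ i) = (\<Prod>i\<in>UNIV. t - u $ i))" for u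
    by (rule antitone_factors_unique) (use that v in simp_all)
qed

lemma diag_conj_by_rot_eq:
  assumes "i \<noteq> j" "c\<^sup>2 + s\<^sup>2 = 1" "w $ i = w $ j"
  shows "diag (conj_by (rot_cols i j c s P) Z) \<bullet> w = diag (conj_by P Z) \<bullet> w"
  by (simp add: diag_conj_rot_cols[OF assms(1,2)] assms(3))

text \<open>The spectral theorem by maximization over the compact orthogonal group: the maximizers
  are stable under rotations that mix equal weights, so \<open>rotation_closed_maximizers\<close>
  picks a diagonalizing one. Weight 0 yields the ordered decomposition, general weights yield the
  trace inequalities.\<close>

lemma maximizer_diagonal:
  fixes Z :: "'n::{finite,linorder} symmat" and w :: "'n rvec"
  obtains P where "orthogonal_matrix P"
    "\<And>R. orthogonal_matrix R \<Longrightarrow> diag (conj_by R Z) \<bullet> w \<le> diag (conj_by P Z) \<bullet> w"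
    "\<And>i j. i \<noteq> j \<Longrightarrow> conj_by P Z $ i $ j = 0"
    "\<And>i j. w $ j < w $ i \<Longrightarrow> conj_by P Z $ j $ j \<le> conj_by P Z $ i $ i"
    "\<And>i j. i < j \<Longrightarrow> w $ i = w $ j \<Longrightarrow> conj_by P Z $ j $ j \<le> conj_by P Z $ i $ i"
proof -
  let ?F = "\<lambda>P. diag (conj_by P Z) \<bullet> w" and ?O = "{P :: 'n rmat. orthogonal_matrix P}"
  have cont: "continuous_on S ?F" for S
    unfolding diag_def conj_by_def by (intro continuous_intros)
  have ne: "?O \<noteq> {}"
    using orthogonal_matrix_id by blast
  from continuous_attains_sup[OF compact_orthogonal_matrices ne cont] obtain P0
    where P0: "orthogonal_matrix P0" "\<And>R. orthogonal_matrix R \<Longrightarrow> ?F R \<le> ?F P0"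
    by blast
  define M where "M = ?O \<inter> {P. ?F P0 \<le> ?F P}"
  have M: "compact M" "M \<noteq> {}"
    unfolding M_def using P0
    by (auto intro!: compact_Int_closed compact_orthogonal_matrices closed_Collect_le cont)
  show ?thesis
  proof (rule rotation_closed_maximizers[OF M])
    show "orthogonal_matrix P" if "P \<in> M" for P
      using that by (simp add: M_def)
    show "?F R \<le> ?F P" if "P \<in> M" "orthogonal_matrix R" for P R
      using that P0(2)[of R] by (simp add: M_def)
    show "rot_cols i j c s P \<in> M" if "P \<in> M" "i \<noteq> j" "w $ i = w $ j" "c\<^sup>2 + s\<^sup>2 = 1" for P i j c s
      using that orthogonal_rot_cols[OF that(2,4)] diag_conj_by_rot_eq[OF that(2,4,3)] by (simp add: M_def)
    fix P
    assume P: "P \<in> M" and *: "\<And>i j. i \<noteq> j \<Longrightarrow> conj_by P Z $ i $ j = 0"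
      "\<And>i j. w $ j < w $ i \<Longrightarrow> conj_by P Z $ j $ j \<le> conj_by P Z $ i $ i"
      "\<And>i j. i < j \<Longrightarrow> w $ i = w $ j \<Longrightarrow> conj_by P Z $ j $ j \<le> conj_by P Z $ i $ i"
    have "orthogonal_matrix P" "\<And>R. orthogonal_matrix R \<Longrightarrow> ?F R \<le> ?F P"
      using P P0(2) by (auto simp: M_def intro: order_trans)
    from that[OF this *] show thesis .
  qed
qed

lemma spectral_of_diagonal:
  assumes "orthogonal_matrix P" "\<And>i j. i \<noteq> j \<Longrightarrow> conj_by P Z $ i $ j = 0"
  shows "Z = spectral P (diag (conj_by P Z))"
  unfolding spectral_iff[OF assms(1)] using assms(2) by (simp add: vec_eq_iff)

lemma ordered_spectral_decomposition:
  fixes Z :: "'n::{finite,linorder} symmat"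
  obtains P v where "orthogonal_matrix P" "Z = spectral P v" "\<And>i j. i \<le> j \<Longrightarrow> v $ j \<le> v $ i"
\<comment> \<open>With weight 0 every orthogonal matrix is a maximizer, so the tie-breaking weight
  alone orders the eigenvalues.\<close>
proof (rule maximizer_diagonal[of Z 0])
  fix P
  assume P: "orthogonal_matrix P" "\<And>i j. i \<noteq> j \<Longrightarrow> conj_by P Z $ i $ j = 0"
    "\<And>i j. i < j \<Longrightarrow> (0 :: 'n rvec) $ i = 0 $ j \<Longrightarrow> conj_by P Z $ j $ j \<le> conj_by P Z $ i $ i"
  have mono: "diag (conj_by P Z) $ j \<le> diag (conj_by P Z) $ i" if "i \<le> j" for i j
    using that P(3)[of i j] by (cases "i = j") auto
  show thesis
    by (rule that[OF P(1) spectral_of_diagonal[OF P(1,2)] mono])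
qed

lemma eigvals_antitone: "i \<le> j \<Longrightarrow> eigvals Z $ j \<le> eigvals Z $ i"
proof -
  assume "i \<le> j"
  obtain P v where "orthogonal_matrix P" "Z = spectral P v" "\<And>i j. i \<le> j \<Longrightarrow> v $ j \<le> v $ i"
    using ordered_spectral_decomposition[of Z] by blast
  then show ?thesis
    using eigvals_spectral[of P v] \<open>i \<le> j\<close> by simp
qed

lemma eig_orth_iff: "P \<in> eig_orth Z \<longleftrightarrow> orthogonal_matrix P \<and> Z = spectral P (eigvals Z)"
  by (simp add: eig_orth_def mat_of_inject[symmetric] mat_of_spectral)

lemma eig_orth_conj_by: "P \<in> eig_orth Z \<Longrightarrow> conj_by P Z = Diag (eigvals Z)"
  using spectral_iff eig_orth_iff by blast

lemma eig_orth_nonempty: "eig_orth Z \<noteq> {}"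
proof -
  obtain P v where "orthogonal_matrix P" "Z = spectral P v" "\<And>i j. i \<le> j \<Longrightarrow> v $ j \<le> v $ i"
    using ordered_spectral_decomposition[of Z] by blast
  then have "P \<in> eig_orth Z"
    using eigvals_spectral[of P v] by (simp add: eig_orth_iff)
  then show ?thesis by blast
qed

lemma eigvals_spectral_permutes:
  assumes "orthogonal_matrix P"
  obtains \<sigma> where "\<sigma> permutes UNIV" "\<And>i. v $ i = eigvals (spectral P v) $ \<sigma> i"
proof -
  obtain R where R: "orthogonal_matrix R" "spectral P v = spectral R (eigvals (spectral P v))"
    using eig_orth_nonempty[of "spectral P v"] by (auto simp: eig_orth_iff)
  have "(\<Prod>i\<in>UNIV. t - v $ i) = (\<Prod>i\<in>UNIV. t - eigvals (spectral P v) $ i)" for t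
    using det_mat_minus_spectral[OF assms, of t v] det_mat_minus_spectral[OF R(1), of t "eigvals (spectral P v)"] R(2)
    by simp
  from linear_factors_eq_imp_permutes[OF this] show ?thesis
    using that by blast
qed

section \<open>Trace inequalities for eigenvalues\<close>

lemma inner_conj_by:
  assumes "orthogonal_matrix P"
  shows "conj_by P W \<bullet> conj_by P Z = W \<bullet> Z"
  using assms by (simp add: conj_by_def inner_orthogonal_mult inner_symmat.rep_eq)

lemma inner_spectral: 
  assumes "orthogonal_matrix P"
  shows "Z \<bullet> spectral P w = diag (conj_by P Z) \<bullet> w"
proof -
  have "conj_by P (spectral P w) = Diag w"
    using spectral_iff[OF assms] by blast
  then show ?thesis
    using inner_conj_by[OF assms, of Z "spectral P w"] by (simp add: inner_Diag)
qed

lemma norm_eigvals: "norm (eigvals Z) = norm Z"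
proof -
  obtain P where P: "P \<in> eig_orth Z"
    using eig_orth_nonempty by blast
  then have "Z \<bullet> Z = eigvals Z \<bullet> eigvals Z"
    using inner_spectral[of P Z "eigvals Z"] eig_orth_conj_by[OF P] by (simp add: eig_orth_iff)
  then show ?thesis
    by (simp add: norm_eq_sqrt_inner)
qed

text \<open>Support function form of Schur's theorem that diagonals lie in the convex hull of the
  permuted eigenvalue vectors. The permutation depends on \<open>w\<close> but not on
  \<open>R\<close>.\<close>

lemma diag_conj_by_le_permuted:
  fixes Z :: "'n::{finite,linorder} symmat"
  obtains \<sigma> where "\<sigma> permutes UNIV"
    "\<And>R. orthogonal_matrix R \<Longrightarrow> diag (conj_by R Z) \<bullet> w \<le> (\<chi> i. eigvals Z $ \<sigma> i) \<bullet> w"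
proof (rule maximizer_diagonal[of Z w])
  fix P
  assume P: "orthogonal_matrix P"
    "\<And>R. orthogonal_matrix R \<Longrightarrow> diag (conj_by R Z) \<bullet> w \<le> diag (conj_by P Z) \<bullet> w"
    "\<And>i j. i \<noteq> j \<Longrightarrow> conj_by P Z $ i $ j = 0"
  have Z: "Z = spectral P (diag (conj_by P Z))"
    by (rule spectral_of_diagonal[OF P(1,3)])
  obtain \<sigma> where \<sigma>: "\<sigma> permutes UNIV"
    "\<And>i. diag (conj_by P Z) $ i = eigvals (spectral P (diag (conj_by P Z))) $ \<sigma> i"
    by (rule eigvals_spectral_permutes[OF P(1), of "diag (conj_by P Z)"]) blast
  have "diag (conj_by P Z) = (\<chi> i. eigvals Z $ \<sigma> i)"
    unfolding vec_eq_iff using \<sigma>(2) unfolding Z[symmetric] by simp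
  then show thesis
    using that[OF \<sigma>(1)] P(2) by simp
qed

lemma diag_conj_by_le_eigvals:
  fixes Z :: "'n::{finite,linorder} symmat"
  assumes w: "\<And>i j. i \<le> j \<Longrightarrow> w $ j \<le> w $ i" and R: "orthogonal_matrix R"
  shows "diag (conj_by R Z) \<bullet> w \<le> eigvals Z \<bullet> w"
proof (rule maximizer_diagonal[of Z w])
  fix P
  assume P: "orthogonal_matrix P"
    "\<And>R. orthogonal_matrix R \<Longrightarrow> diag (conj_by R Z) \<bullet> w \<le> diag (conj_by P Z) \<bullet> w"
    "\<And>i j. i \<noteq> j \<Longrightarrow> conj_by P Z $ i $ j = 0"
    "\<And>i j. w $ j < w $ i \<Longrightarrow> conj_by P Z $ j $ j \<le> conj_by P Z $ i $ i"
    "\<And>i j. i < j \<Longrightarrow> w $ i = w $ j \<Longrightarrow> conj_by P Z $ j $ j \<le> conj_by P Z $ i $ i"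
  have "diag (conj_by P Z) $ j \<le> diag (conj_by P Z) $ i" if "i \<le> j" for i j
    using that P(4)[of j i] P(5)[of i j] w[OF that] by (cases "i = j"; cases "w $ i = w $ j") auto
  from eigvals_spectral[OF P(1) this] have "eigvals Z = diag (conj_by P Z)"
    using spectral_of_diagonal[OF P(1,3)] by simp
  then show ?thesis
    using P(2)[OF R] by simp
qed

lemma von_Neumann_trace: "W \<bullet> Z \<le> eigvals W \<bullet> eigvals Z"
proof -
  obtain P where P: "P \<in> eig_orth W"
    using eig_orth_nonempty by blast
  then have "W \<bullet> Z = diag (conj_by P Z) \<bullet> eigvals W"
    using inner_spectral[of P Z "eigvals W"] by (simp add: eig_orth_iff inner_commute)
  then show ?thesis
    using diag_conj_by_le_eigvals[OF eigvals_antitone, of P Z W] P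
    by (simp add: eig_orth_iff inner_commute)
qed

text \<open>In the case of equality every eigenbasis of \<open>W\<close> maximizes the trace of
  \<open>Z\<close> weighted by \<open>eigvals W\<close>. These bases are closed under rotations
  inside the eigenspaces of \<open>W\<close>, and the tie-breaker selects one that also diagonalizes
  \<open>Z\<close> in the right order.\<close>

lemma von_Neumann_equality:
  assumes eq: "W \<bullet> Z = eigvals W \<bullet> eigvals Z"
  shows "eig_orth Z \<inter> eig_orth W \<noteq> {}"
proof -
  let ?w = "eigvals W" and ?M = "eig_orth W"
  have val: "diag (conj_by P Z) \<bullet> ?w = eigvals Z \<bullet> ?w" if "P \<in> ?M" for P
    using that eq inner_spectral[of P Z ?w] by (simp add: eig_orth_iff inner_commute)
  have closed: "closed {P. mat_of W = P ** Diag ?w ** transpose P}"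
    by (intro closed_Collect_eq continuous_intros)
  have M: "compact ?M"
    using compact_Int_closed[OF compact_orthogonal_matrices closed] by (simp add: eig_orth_def Int_def)
  have max: "diag (conj_by R Z) \<bullet> ?w \<le> diag (conj_by P Z) \<bullet> ?w" if "P \<in> ?M" "orthogonal_matrix R" for P R
    using diag_conj_by_le_eigvals[OF eigvals_antitone that(2)] by (simp add: val[OF that(1)])
  have rot: "rot_cols i j c s P \<in> ?M" if "P \<in> ?M" "i \<noteq> j" "?w $ i = ?w $ j" "c\<^sup>2 + s\<^sup>2 = 1" for P i j c s
    using that by (simp add: eig_orth_def orthogonal_rot_cols rot_cols_conj_Diag)
  have orth: "orthogonal_matrix P" if "P \<in> ?M" for P
    using that by (simp add: eig_orth_def)
  show ?thesis
  proof (rule rotation_closed_maximizers[of ?M Z ?w, OF M eig_orth_nonempty orth max rot])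
  fix P
  assume P: "P \<in> ?M" "\<And>i j. i \<noteq> j \<Longrightarrow> conj_by P Z $ i $ j = 0"
    "\<And>i j. ?w $ j < ?w $ i \<Longrightarrow> conj_by P Z $ j $ j \<le> conj_by P Z $ i $ i"
    "\<And>i j. i < j \<Longrightarrow> ?w $ i = ?w $ j \<Longrightarrow> conj_by P Z $ j $ j \<le> conj_by P Z $ i $ i"
  have "diag (conj_by P Z) $ j \<le> diag (conj_by P Z) $ i" if "i \<le> j" for i j
    using that P(3)[of j i] P(4)[of i j] eigvals_antitone[OF that, of W]
    by (cases "i = j"; cases "?w $ i = ?w $ j") auto
  from eigvals_spectral[OF orth[OF P(1)] this] have "eigvals Z = diag (conj_by P Z)"
    using spectral_of_diagonal[of P Z, OF orth[OF P(1)] P(2)] by simp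
  moreover have "Z = spectral P (diag (conj_by P Z))"
    by (rule spectral_of_diagonal[of P Z, OF orth[OF P(1)] P(2)])
  ultimately have "P \<in> eig_orth Z"
    unfolding eig_orth_iff using orth[OF P(1)] by argo
  with P(1) show ?thesis by blast
  qed
qed

lemma Hoffman_Wielandt: "norm (eigvals Z - eigvals W) \<le> norm (Z - W)"
proof -
  have "(norm (eigvals Z - eigvals W))\<^sup>2 \<le> (norm (Z - W))\<^sup>2"
    using von_Neumann_trace[of W Z] norm_eigvals[of Z] norm_eigvals[of W]
    by (simp add: norm_eq_sqrt_inner[symmetric] power2_norm_eq_inner inner_diff_left inner_diff_right
        inner_commute norm_eq)
  then show ?thesis
    by (simp add: norm_le_square)
qed

lemma tendsto_eigvals [tendsto_intros]:
  assumes "(Z \<longlongrightarrow> A) F"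
  shows "((\<lambda>k. eigvals (Z k)) \<longlongrightarrow> eigvals A) F"
proof -
  have "((\<lambda>k. eigvals (Z k) - eigvals A) \<longlongrightarrow> 0) F"
  proof (rule Lim_transform_bound)
    show "\<forall>\<^sub>F k in F. norm (eigvals (Z k) - eigvals A) \<le> norm (Z k - A)"
      by (simp add: Hoffman_Wielandt)
  qed (use assms in \<open>simp add: LIM_zero_iff\<close>)
  then show ?thesis
    by (simp add: LIM_zero_iff)
qed

lemma continuous_eigvals [continuous_intros]: "continuous_on S Z \<Longrightarrow> continuous_on S (\<lambda>x. eigvals (Z x))"
  unfolding continuous_on_def using tendsto_eigvals by blast

section \<open>Polyhedral functions\<close>

locale polyhedral_function =
  fixes \<theta> :: "'n::finite rvec \<Rightarrow> ereal"
    and p :: nat and a :: "nat \<Rightarrow> 'n rvec" and c :: "nat \<Rightarrow> real"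
    and m :: nat and b :: "nat \<Rightarrow> 'n rvec" and d :: "nat \<Rightarrow> real"
  assumes rep: "polyhedral_rep \<theta> p a c m b d"
begin

definition dm :: "'n rvec set"
  where "dm = {x. \<forall>\<mu>\<in>{1..m}. b \<mu> \<bullet> x \<le> d \<mu>}"

abbreviation th :: "'n rvec \<Rightarrow> real"
  where "th \<equiv> max_affine p a c"

abbreviation act1 :: "'n rvec \<Rightarrow> nat set"
  where "act1 \<equiv> iota1 p a c"

abbreviation act2 :: "'n rvec \<Rightarrow> nat set"
  where "act2 \<equiv> iota2 m b d"

text \<open>Convex subgradients of \<theta>; since \<theta> is \<open>th\<close> on
  \<open>dm\<close> and infinite elsewhere, real values suffice.\<close>

definition sub :: "'n rvec \<Rightarrow> 'n rvec set"
  where "sub x = {w. x \<in> dm \<and> (\<forall>z\<in>dm. th x + w \<bullet> (z - x) \<le> th z)}"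

lemma theta_eq: "\<theta> x = (if x \<in> dm then ereal (th x) else \<infinity>)"
proof -
  have "max_affine m b d x \<le> 0 \<longleftrightarrow> x \<in> dm"
    using rep by (simp add: max_affine_def polyhedral_rep_def dm_def)
  then show ?thesis
    using rep by (simp add: polyhedral_rep_def)
qed

lemma p_ge_1: "1 \<le> p"
  using rep by (simp add: polyhedral_rep_def)

lemma th_ge: "\<nu> \<in> {1..p} \<Longrightarrow> a \<nu> \<bullet> x - c \<nu> \<le> th x"
  unfolding max_affine_def by (intro Max_ge) auto

lemma th_le_iff: "th x \<le> r \<longleftrightarrow> (\<forall>\<nu>\<in>{1..p}. a \<nu> \<bullet> x - c \<nu> \<le> r)"
  using p_ge_1 by (simp add: max_affine_def)

lemma th_less_iff: "th x < r \<longleftrightarrow> (\<forall>\<nu>\<in>{1..p}. a \<nu> \<bullet> x - c \<nu> < r)"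
  using p_ge_1 by (simp add: max_affine_def)

lemma act1D: "\<nu> \<in> act1 x \<Longrightarrow> \<nu> \<in> {1..p}" "\<nu> \<in> act1 x \<Longrightarrow> a \<nu> \<bullet> x - c \<nu> = th x"
  by (auto simp: iota1_def)

lemma act2D: "\<mu> \<in> act2 x \<Longrightarrow> \<mu> \<in> {1..m}" "\<mu> \<in> act2 x \<Longrightarrow> b \<mu> \<bullet> x = d \<mu>"
  by (auto simp: iota2_def)

lemma finite_act: "finite (act1 x)" "finite (act2 x)"
  by (auto simp: iota1_def iota2_def)

lemma continuous_th: "continuous_on S th"
proof -
  have "continuous_on S (\<lambda>x. Max ((\<lambda>\<nu>. a \<nu> \<bullet> x - c \<nu>) ` T))" if "finite T" "T \<noteq> {}" for T :: "nat set"
    using that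
  proof (induction T rule: finite_ne_induct)
    case (singleton \<nu>)
    then show ?case by (simp, intro continuous_intros)
  next
    case (insert \<nu> T)
    then show ?case by (simp, intro continuous_intros)
  qed
  from this[of "{1..p}"] show ?thesis
    using p_ge_1 by (simp add: max_affine_def[abs_def])
qed

lemma closed_dm: "closed dm"
proof -
  have "dm = (\<Inter>\<mu>\<in>{1..m}. {x. b \<mu> \<bullet> x \<le> d \<mu>})"
    by (auto simp: dm_def)
  then show ?thesis
    by (simp add: closed_halfspace_le closed_INT)
qed

lemma subD: "w \<in> sub x \<Longrightarrow> x \<in> dm" "w \<in> sub x \<Longrightarrow> z \<in> dm \<Longrightarrow> th x + w \<bullet> (z - x) \<le> th z"
  by (auto simp: sub_def)

lemma closed_sub: "closed (sub x)"
proof -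
  have "sub x = (if x \<in> dm then (\<Inter>z\<in>dm. {w. th x + w \<bullet> (z - x) \<le> th z}) else {})"
    by (auto simp: sub_def)
  moreover have "closed {w. th x + w \<bullet> (z - x) \<le> th z}" for z
    by (intro closed_Collect_le continuous_intros)
  ultimately show ?thesis
    by auto
qed

text \<open>A short step along \<open>D\<close> stays in \<open>dm\<close> and raises
  \<open>th\<close> at the rate of the largest active slope; if \<open>w\<close> exceeded all active
  slopes, the subgradient inequality would fail there.\<close>

lemma sub_first_order:
  assumes w: "w \<in> sub x" and D: "\<And>\<mu>. \<mu> \<in> act2 x \<Longrightarrow> b \<mu> \<bullet> D \<le> 0"
  shows "\<exists>\<nu>\<in>act1 x. w \<bullet> D \<le> a \<nu> \<bullet> D"
proof (rule ccontr)
  assume "\<not> ?thesis"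
  then have less: "a \<nu> \<bullet> D < w \<bullet> D" if "\<nu> \<in> act1 x" for \<nu>
    using that by force
  have x: "x \<in> dm"
    using subD(1)[OF w] .
  have e1: "\<forall>\<^sub>F s in at_right 0. a \<nu> \<bullet> (x + s *\<^sub>R D) - c \<nu> < th x + s * (w \<bullet> D)" if \<nu>: "\<nu> \<in> {1..p}" for \<nu>
  proof (cases "\<nu> \<in> act1 x")
    case True
    show ?thesis
      unfolding eventually_at_right_field
      using act1D(2)[OF True] less[OF True]
      by (intro exI[of _ 1]) (auto simp: inner_add_right algebra_simps)
  next
    case False
    then have lt: "a \<nu> \<bullet> x - c \<nu> < th x"
      using th_ge[OF \<nu>, of x] \<nu> by (auto simp: iota1_def)
    have "((\<lambda>s. th x + s * (w \<bullet> D) - (a \<nu> \<bullet> (x + s *\<^sub>R D) - c \<nu>)) \<longlongrightarrow> th x + 0 * (w \<bullet> D) - (a \<nu> \<bullet> (x + 0 *\<^sub>R D) - c \<nu>)) (at_right 0)"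
      by (intro tendsto_intros)
    then have "\<forall>\<^sub>F s in at_right 0. 0 < th x + s * (w \<bullet> D) - (a \<nu> \<bullet> (x + s *\<^sub>R D) - c \<nu>)"
      using lt by (intro order_tendstoD(1)) auto
    then show ?thesis
      by eventually_elim simp
  qed
  have e2: "\<forall>\<^sub>F s in at_right 0. b \<mu> \<bullet> (x + s *\<^sub>R D) \<le> d \<mu>" if \<mu>: "\<mu> \<in> {1..m}" for \<mu>
  proof (cases "\<mu> \<in> act2 x")
    case True
    show ?thesis
      unfolding eventually_at_right_field
      using act2D(2)[OF True] D[OF True]
      by (intro exI[of _ 1]) (auto simp: inner_add_right mult_nonneg_nonpos)
  next
    case False
    then have lt: "b \<mu> \<bullet> x < d \<mu>"
      using x \<mu> by (auto simp: iota2_def dm_def order.strict_iff_order)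
    have "((\<lambda>s. b \<mu> \<bullet> (x + s *\<^sub>R D)) \<longlongrightarrow> b \<mu> \<bullet> (x + 0 *\<^sub>R D)) (at_right 0)"
      by (intro tendsto_intros)
    then have "\<forall>\<^sub>F s in at_right 0. b \<mu> \<bullet> (x + s *\<^sub>R D) < d \<mu>"
      using lt by (intro order_tendstoD(2)) auto
    then show ?thesis
      by eventually_elim simp
  qed
  have "\<forall>\<^sub>F s in at_right 0. (\<forall>\<nu>\<in>{1..p}. a \<nu> \<bullet> (x + s *\<^sub>R D) - c \<nu> < th x + s * (w \<bullet> D))
     \<and> (\<forall>\<mu>\<in>{1..m}. b \<mu> \<bullet> (x + s *\<^sub>R D) \<le> d \<mu>)"
    using e1 e2 by (intro eventually_conj eventually_ball_finite) auto
  then obtain s where s: "\<forall>\<nu>\<in>{1..p}. a \<nu> \<bullet> (x + s *\<^sub>R D) - c \<nu> < th x + s * (w \<bullet> D)"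
     "\<forall>\<mu>\<in>{1..m}. b \<mu> \<bullet> (x + s *\<^sub>R D) \<le> d \<mu>"
    using eventually_happens'[OF trivial_limit_at_right_real] by blast
  have "th (x + s *\<^sub>R D) < th x + s * (w \<bullet> D)"
    using s(1) by (simp add: th_less_iff)
  moreover have "x + s *\<^sub>R D \<in> dm"
    using s(2) by (simp add: dm_def)
  ultimately show False
    using subD(2)[OF w, of "x + s *\<^sub>R D"] by simp
qed

text \<open>By \<open>sub_first_order\<close> the subgradients at a point of \<open>dm\<close> are
  determined by the active index sets, so only finitely many subdifferentials exist.\<close>

lemma sub_cong_act:
  assumes w: "w \<in> sub z" and x: "x \<in> dm" and eq: "act1 x = act1 z" "act2 x = act2 z"
  shows "w \<in> sub x"
proof -
  have "th x + w \<bullet> (z' - x) \<le> th z'" if z': "z' \<in> dm" for z'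
  proof -
    have "b \<mu> \<bullet> (z' - x) \<le> 0" if "\<mu> \<in> act2 z" for \<mu>
      using z' act2D[of \<mu> x] that eq(2) by (auto simp: dm_def inner_diff_right)
    from sub_first_order[OF w this] obtain \<nu> where "\<nu> \<in> act1 x" "w \<bullet> (z' - x) \<le> a \<nu> \<bullet> (z' - x)"
      using eq(1) by auto
    then show ?thesis
      using act1D[of \<nu> x] th_ge[of \<nu> z'] by (simp add: inner_diff_right)
  qed
  then show ?thesis
    using x by (simp add: sub_def)
qed

lemma finite_cone_member:
  fixes V :: "'a::euclidean_space set"
  assumes "finite V" "y \<in> convex_cone hull V"
  shows "\<exists>k. (\<forall>v\<in>V. 0 \<le> k v) \<and> y = (\<Sum>v\<in>V. k v *\<^sub>R v)"
proof -
  let ?C = "{z. \<exists>k. (\<forall>v\<in>V. 0 \<le> k v) \<and> z = (\<Sum>v\<in>V. k v *\<^sub>R v)}"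
  have "convex_cone ?C"
    unfolding convex_cone_iff
  proof (intro conjI ballI allI impI)
    show "0 \<in> ?C"
      by (auto intro: exI[of _ "\<lambda>_. 0"])
  next
    fix y z assume "y \<in> ?C" "z \<in> ?C"
    then obtain k l where "\<forall>v\<in>V. 0 \<le> k v" "y = (\<Sum>v\<in>V. k v *\<^sub>R v)" "\<forall>v\<in>V. 0 \<le> l v" "z = (\<Sum>v\<in>V. l v *\<^sub>R v)"
      by auto
    then show "y + z \<in> ?C"
      by (auto simp: sum.distrib scaleR_add_left intro!: exI[of _ "\<lambda>v. k v + l v"])
  next
    fix y and s :: real assume "y \<in> ?C" "0 \<le> s"
    then obtain k where "\<forall>v\<in>V. 0 \<le> k v" "y = (\<Sum>v\<in>V. k v *\<^sub>R v)"
      by auto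
    then show "s *\<^sub>R y \<in> ?C"
      using \<open>0 \<le> s\<close> by (auto simp: scaleR_sum_right intro!: exI[of _ "\<lambda>v. s * k v"])
  qed
  moreover have "V \<subseteq> ?C"
  proof
    fix u assume "u \<in> V"
    have "(\<Sum>v\<in>V. (if v = u then 1 else 0) *\<^sub>R v) = (\<Sum>v\<in>V. if v = u then v else 0)"
      by (intro sum.cong) auto
    also have "\<dots> = u"
      using assms(1) \<open>u \<in> V\<close> by simp
    finally show "u \<in> ?C"
      by (intro CollectI exI[of _ "\<lambda>v. if v = u then 1 else 0"]) auto
  qed
  ultimately have "convex_cone hull V \<subseteq> ?C"
    by (intro hull_minimal) auto
  with assms(2) show ?thesis
    by blast
qed

text \<open>Farkas' lemma for the homogenized system with generators \<open>(a \<nu>, 1)\<close> and \<open>(b \<mu>, 0)\<close>.\<close>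

lemma sub_represents:
  assumes y: "y \<in> sub x"
  shows "\<exists>u v. represents (act1 x) (act2 x) a b y u v"
proof -
  let ?G = "\<lambda>s. case s of Inl \<nu> \<Rightarrow> (a \<nu>, 1 :: real) | Inr \<mu> \<Rightarrow> (b \<mu>, 0)"
  let ?J = "act1 x <+> act2 x"
  let ?V = "?G ` ?J"
  have fin: "finite ?J" "finite ?V"
    using finite_act by auto
  have "(y, 1) \<in> convex_cone hull ?V"
  proof (rule ccontr)
    assume notin: "(y, 1) \<notin> convex_cone hull ?V"
    have cl: "closed (convex_cone hull ?V)"
      using fin(2) by (rule closed_convex_cone_hull)
    have cc: "convex_cone (convex_cone hull ?V)"
      by (rule convex_cone_convex_cone_hull)
    obtain w r where wr: "w \<bullet> (y, 1) < r" "\<And>z. z \<in> convex_cone hull ?V \<Longrightarrow> r < w \<bullet> z"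
      using separating_hyperplane_closed_point[OF convex_convex_cone_hull cl notin] by blast
    have zero: "0 \<in> convex_cone hull ?V"
      using cc by (simp add: convex_cone_contains_0)
    have nonneg: "0 \<le> w \<bullet> z" if "z \<in> ?V" for z
    proof (rule ccontr)
      assume neg: "\<not> 0 \<le> w \<bullet> z"
      define s where "s = \<bar>r\<bar> / \<bar>w \<bullet> z\<bar> + 1"
      have "s *\<^sub>R z \<in> convex_cone hull ?V"
        using convex_cone_scaleR[OF cc _ hull_inc[OF that]] by (simp add: s_def)
      from wr(2)[OF this] have "r < s * (w \<bullet> z)" by simp
      moreover have "s * (w \<bullet> z) = - \<bar>r\<bar> + w \<bullet> z"
        using neg by (simp add: s_def algebra_simps)
      ultimately show False
        using neg by linarith
    qed
    \<comment> \<open>Read as a direction, the separating functional has all active slopes at most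
      \<open>- s\<close> although \<open>y \<bullet> D\<close> exceeds \<open>- s\<close>, against
      \<open>sub_first_order\<close>.\<close>
    define D s where "D = - fst w" and "s = - snd w"
    then have w: "w = (- D, - s)"
      by (simp add: prod_eq_iff)
    have bD: "b \<mu> \<bullet> D \<le> 0" if "\<mu> \<in> act2 x" for \<mu>
    proof -
      have "?G (Inr \<mu>) \<in> ?V"
        using that by (intro imageI) auto
      from nonneg[OF this] show ?thesis
        by (simp add: w inner_commute)
    qed
    have aD: "a \<nu> \<bullet> D \<le> - s" if "\<nu> \<in> act1 x" for \<nu>
    proof -
      have "?G (Inl \<nu>) \<in> ?V"
        using that by (intro imageI) auto
      from nonneg[OF this] show ?thesis
        by (simp add: w inner_commute)
    qed
    have "- s < y \<bullet> D"
      using wr(1) wr(2)[OF zero] by (simp add: w inner_commute)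
    moreover obtain \<nu> where "\<nu> \<in> act1 x" "y \<bullet> D \<le> a \<nu> \<bullet> D"
      using sub_first_order[OF y bD] by blast
    ultimately show False
      using aD[of \<nu>] by simp
  qed
  from finite_cone_member[OF fin(2) this]
  obtain k where k: "\<forall>v\<in>?V. 0 \<le> k v" "(y, 1) = (\<Sum>v\<in>?V. k v *\<^sub>R v)"
    by (elim exE conjE)
  define N where "N v = real (card {s \<in> ?J. ?G s = v})" for v
  define l where "l s = k (?G s) / N (?G s)" for s
  have Npos: "N (?G s) > 0" if "s \<in> ?J" for s
  proof -
    have "finite {s' \<in> ?J. ?G s' = ?G s}" "s \<in> {s' \<in> ?J. ?G s' = ?G s}"
      using fin(1) that by auto
    then have "0 < card {s' \<in> ?J. ?G s' = ?G s}"
      using card_gt_0_iff by blast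
    then show ?thesis
      unfolding N_def by simp
  qed
  have "(\<Sum>s\<in>?J. l s *\<^sub>R ?G s) = (\<Sum>v\<in>?V. \<Sum>s\<in>{s \<in> ?J. ?G s = v}. l s *\<^sub>R ?G s)"
    by (rule sum.image_gen[OF fin(1)])
  also have "\<dots> = (\<Sum>v\<in>?V. k v *\<^sub>R v)"
  proof (rule sum.cong[OF refl])
    fix v assume "v \<in> ?V"
    then obtain s0 where s0: "s0 \<in> ?J" "v = ?G s0" by blast
    have "(\<Sum>s\<in>{s \<in> ?J. ?G s = v}. l s *\<^sub>R ?G s) = (\<Sum>s\<in>{s \<in> ?J. ?G s = v}. (k v / N v) *\<^sub>R v)"
      by (intro sum.cong) (auto simp: l_def)
    also have "\<dots> = N v *\<^sub>R ((k v / N v) *\<^sub>R v)"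
      unfolding sum_constant_scaleR N_def ..
    also have "\<dots> = k v *\<^sub>R v"
      using Npos[OF s0(1)] s0(2) by simp
    finally show "(\<Sum>s\<in>{s \<in> ?J. ?G s = v}. l s *\<^sub>R ?G s) = k v *\<^sub>R v" .
  qed
  finally have sum: "(\<Sum>s\<in>?J. l s *\<^sub>R ?G s) = (y, 1)"
    using k(2) by simp
  have lpos: "0 \<le> l s" if "s \<in> ?J" for s
    using bspec[OF k(1) imageI[OF that]] Npos[OF that] by (simp add: l_def)
  have split: "(\<Sum>s\<in>?J. l s *\<^sub>R ?G s) = (\<Sum>\<nu>\<in>act1 x. l (Inl \<nu>) *\<^sub>R (a \<nu>, 1)) + (\<Sum>\<mu>\<in>act2 x. l (Inr \<mu>) *\<^sub>R (b \<mu>, 0))"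
    using finite_act[of x] by (simp add: sum.Plus)
  have "y = (\<Sum>\<nu>\<in>act1 x. l (Inl \<nu>) *\<^sub>R a \<nu>) + (\<Sum>\<mu>\<in>act2 x. l (Inr \<mu>) *\<^sub>R b \<mu>)"
    using arg_cong[OF sum[unfolded split], of fst] by (simp add: fst_sum)
  moreover have "(\<Sum>\<nu>\<in>act1 x. l (Inl \<nu>)) = 1"
    using arg_cong[OF sum[unfolded split], of snd] by (simp add: snd_sum)
  ultimately have "represents (act1 x) (act2 x) a b y (l \<circ> Inl) (l \<circ> Inr)"
    using lpos InlI[of _ "act1 x" "act2 x"] InrI[of _ "act2 x" "act1 x"] by (simp add: represents_def)
  then show ?thesis by blast
qed

text \<open>Each of the finitely many subdifferentials is closed, so those that miss
  \<open>y\<close> keep a positive distance from it. The radius is uniform in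
  \<open>z\<close>.\<close>

lemma sub_nearby:
  obtains \<delta> where "\<delta> > 0" "\<And>w z. w \<in> sub z \<Longrightarrow> norm (w - y) < \<delta> \<Longrightarrow> y \<in> sub z"
proof -
  define F where "F J = {w. \<exists>z. (act1 z, act2 z) = J \<and> w \<in> sub z}" for J
  have F: "F (act1 z, act2 z) = sub z" if "w \<in> sub z" for w z
    using sub_cong_act subD(1)[OF that] by (auto simp: F_def)
  have "closed (F J)" for J
  proof (cases "F J = {}")
    case False
    then obtain w z where "(act1 z, act2 z) = J" "w \<in> sub z"
      by (auto simp: F_def)
    then show ?thesis
      using F[of w z] closed_sub[of z] by simp
  qed simp
  then have "open (\<Inter>J\<in>{J \<in> Pow {1..p} \<times> Pow {1..m}. y \<notin> F J}. - F J)"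
    by (intro open_INT) auto
  moreover have "y \<in> (\<Inter>J\<in>{J \<in> Pow {1..p} \<times> Pow {1..m}. y \<notin> F J}. - F J)"
    by auto
  ultimately obtain \<delta> where \<delta>: "\<delta> > 0" "ball y \<delta> \<subseteq> (\<Inter>J\<in>{J \<in> Pow {1..p} \<times> Pow {1..m}. y \<notin> F J}. - F J)"
    by (rule openE)
  show ?thesis
  proof (rule that[OF \<delta>(1)])
    fix w z assume w: "w \<in> sub z" and "norm (w - y) < \<delta>"
    then have "w \<in> ball y \<delta>"
      by (simp add: dist_norm norm_minus_commute)
    with \<delta>(2) have w': "w \<in> (\<Inter>J\<in>{J \<in> Pow {1..p} \<times> Pow {1..m}. y \<notin> F J}. - F J)"
      by blast
    have "act1 z \<subseteq> {1..p}" "act2 z \<subseteq> {1..m}"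
      by (auto simp: iota1_def iota2_def)
    then have J: "(act1 z, act2 z) \<in> Pow {1..p} \<times> Pow {1..m}"
      by simp
    have "y \<in> F (act1 z, act2 z)"
    proof (rule ccontr)
      assume "y \<notin> F (act1 z, act2 z)"
      with J w' have "w \<notin> F (act1 z, act2 z)"
        by simp
      with F[OF w] w show False
        by simp
    qed
    then show "y \<in> sub z"
      using F[OF w] by simp
  qed
qed

end

section \<open>Permutation symmetry\<close>

definition permv :: "('n \<Rightarrow> 'n) \<Rightarrow> 'n::finite rvec \<Rightarrow> 'n rvec"
  where "permv \<pi> x = (\<chi> i. x $ \<pi> i)"

lemma sum_nonneg_zero_terms:
  fixes f :: "'b \<Rightarrow> real"
  assumes "finite A" "\<forall>i\<in>A. 0 \<le> f i" "sum f A = 0"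
  shows "\<forall>i\<in>A. f i = 0"
  using assms by (simp add: sum_nonneg_eq_0_iff)

lemma permv_nth [simp]: "permv \<pi> x $ i = x $ \<pi> i"
  by (simp add: permv_def)

lemma permv_linear:
  "permv \<pi> (x + y) = permv \<pi> x + permv \<pi> y" "permv \<pi> (x - y) = permv \<pi> x - permv \<pi> y"
  "permv \<pi> (c *\<^sub>R x) = c *\<^sub>R permv \<pi> x"
  by (simp_all add: vec_eq_iff)

lemma inner_permv:
  assumes "\<pi> permutes UNIV"
  shows "permv \<pi> x \<bullet> permv \<pi> y = x \<bullet> y"
  using sum.permute[OF assms, of "\<lambda>i. x $ i * y $ i"] by (simp add: inner_vec_def o_def)

lemma permv_inv:
  assumes "\<pi> permutes UNIV"
  shows "permv \<pi> (permv (inv \<pi>) x) = x"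
  using permutes_inverses(2)[OF assms] by (simp add: vec_eq_iff)

context polyhedral_function
begin

text \<open>Splits the deficit of the subgradient inequality at \<open>z\<close> into nonnegative
  terms, one per index. The representation may stem from another point, as long as the indices with
  positive multiplier are active at \<open>z\<close>.\<close>

lemma represents_gap:
  assumes repr: "represents J1 J2 a b y u v" and fin: "finite J1" "finite J2"
    and J1: "\<forall>\<nu>\<in>J1. 0 < u \<nu> \<longrightarrow> \<nu> \<in> act1 z"
    and J2: "\<forall>\<mu>\<in>J2. 0 < v \<mu> \<longrightarrow> \<mu> \<in> act2 z"
    and z': "z' \<in> dm"
  shows "th z' - th z - y \<bullet> (z' - z) =
      (\<Sum>\<nu>\<in>J1. u \<nu> * (th z' - th z - a \<nu> \<bullet> (z' - z))) + (\<Sum>\<mu>\<in>J2. v \<mu> * (- (b \<mu> \<bullet> (z' - z))))"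
    "\<nu> \<in> J1 \<Longrightarrow> 0 \<le> u \<nu> * (th z' - th z - a \<nu> \<bullet> (z' - z))"
    "\<mu> \<in> J2 \<Longrightarrow> 0 \<le> v \<mu> * (- (b \<mu> \<bullet> (z' - z)))"
proof -
  have y: "y = (\<Sum>\<nu>\<in>J1. u \<nu> *\<^sub>R a \<nu>) + (\<Sum>\<mu>\<in>J2. v \<mu> *\<^sub>R b \<mu>)" and u1: "(\<Sum>\<nu>\<in>J1. u \<nu>) = 1"
    and nn: "\<And>\<nu>. \<nu> \<in> J1 \<Longrightarrow> 0 \<le> u \<nu>" "\<And>\<mu>. \<mu> \<in> J2 \<Longrightarrow> 0 \<le> v \<mu>"
    using repr unfolding represents_def by blast+
  have "(\<Sum>\<nu>\<in>J1. u \<nu> * (th z' - th z - a \<nu> \<bullet> (z' - z)))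
      = (\<Sum>\<nu>\<in>J1. u \<nu> * (th z' - th z)) - (\<Sum>\<nu>\<in>J1. u \<nu> * (a \<nu> \<bullet> (z' - z)))"
    by (simp add: right_diff_distrib sum_subtractf)
  also have "(\<Sum>\<nu>\<in>J1. u \<nu> * (th z' - th z)) = th z' - th z"
    by (simp only: sum_distrib_right[symmetric] u1 mult_1)
  finally show "th z' - th z - y \<bullet> (z' - z) =
      (\<Sum>\<nu>\<in>J1. u \<nu> * (th z' - th z - a \<nu> \<bullet> (z' - z))) + (\<Sum>\<mu>\<in>J2. v \<mu> * (- (b \<mu> \<bullet> (z' - z))))"
    by (simp add: y inner_add_left inner_sum_left sum_negf)
  show "0 \<le> u \<nu> * (th z' - th z - a \<nu> \<bullet> (z' - z))" if "\<nu> \<in> J1"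
  proof (cases "u \<nu> = 0")
    case False
    then have "\<nu> \<in> act1 z"
      using nn(1)[OF that] bspec[OF J1 that] by simp
    then have "0 \<le> th z' - th z - a \<nu> \<bullet> (z' - z)"
      using act1D[of \<nu> z] th_ge[of \<nu> z'] by (simp add: inner_diff_right)
    then show ?thesis
      using nn(1)[OF that] by simp
  qed simp
  show "0 \<le> v \<mu> * (- (b \<mu> \<bullet> (z' - z)))" if "\<mu> \<in> J2"
  proof (cases "v \<mu> = 0")
    case False
    then have "\<mu> \<in> act2 z"
      using nn(2)[OF that] bspec[OF J2 that] by simp
    then have "0 \<le> - (b \<mu> \<bullet> (z' - z))"
      using act2D[of \<mu> z] z' by (simp add: inner_diff_right dm_def)
    then show ?thesis
      using nn(2)[OF that] by (rule_tac mult_nonneg_nonneg)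
  qed simp
qed

end

locale symmetric_polyhedral = polyhedral_function \<theta> p a c m b d
  for \<theta> :: "'n::finite rvec \<Rightarrow> ereal" and p a c m b d +
  assumes symm: "symmetric_fun \<theta>"
begin

lemma theta_permv: "\<pi> permutes UNIV \<Longrightarrow> \<theta> (permv \<pi> z) = \<theta> z"
  using symm by (simp add: symmetric_fun_def permv_def)

lemma dm_permv: "\<pi> permutes UNIV \<Longrightarrow> permv \<pi> z \<in> dm \<longleftrightarrow> z \<in> dm"
  using theta_permv[of \<pi> z] by (auto simp: theta_eq split: if_splits)

lemma th_permv: "\<pi> permutes UNIV \<Longrightarrow> z \<in> dm \<Longrightarrow> th (permv \<pi> z) = th z"
  using theta_permv[of \<pi> z] dm_permv[of \<pi> z] by (simp add: theta_eq)

lemma sub_permv: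
  assumes \<pi>: "\<pi> permutes UNIV" and w: "w \<in> sub z"
  shows "permv \<pi> w \<in> sub (permv \<pi> z)"
proof -
  have z: "z \<in> dm"
    using subD(1)[OF w] .
  have "th (permv \<pi> z) + permv \<pi> w \<bullet> (z' - permv \<pi> z) \<le> th z'" if z': "z' \<in> dm" for z'
  proof -
    define u where "u = permv (inv \<pi>) z'"
    have zu: "z' = permv \<pi> u"
      by (simp add: u_def permv_inv[OF \<pi>])
    have u: "u \<in> dm"
      using z' dm_permv[OF \<pi>] by (simp add: zu)
    have "permv \<pi> w \<bullet> (permv \<pi> u - permv \<pi> z) = w \<bullet> (u - z)"
      using inner_permv[OF \<pi>, of w "u - z"] by (simp add: permv_linear)
    then show ?thesis
      using subD(2)[OF w u] th_permv[OF \<pi> z] th_permv[OF \<pi> u] by (simp add: zu)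
  qed
  then show ?thesis
    using z dm_permv[OF \<pi>] by (simp add: sub_def)
qed

end

section \<open>The points with a given subgradient y, and the sets K and L\<close>

locale subgradient_pair = polyhedral_function \<theta> p a c m b d
  for \<theta> :: "'n::finite rvec \<Rightarrow> ereal" and p a c m b d +
  fixes x y :: "'n rvec"
  assumes y_sub: "y \<in> sub x"
begin

abbreviation E1 :: "nat set"
  where "E1 \<equiv> eta1 (act1 x) (act2 x) a b y"

abbreviation E2 :: "nat set"
  where "E2 \<equiv> eta2 (act1 x) (act2 x) a b y"

text \<open>The linear span of \<open>K\<close>, whenever that set is nonempty.\<close>

definition L :: "'n rvec set"
  where "L = {e. (\<forall>\<nu>\<in>E1. \<forall>\<nu>'\<in>E1. e \<bullet> (a \<nu>' - a \<nu>) = 0) \<and> (\<forall>\<mu>\<in>E2. e \<bullet> b \<mu> = 0)}"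

lemma subspace_L: "subspace L"
  by (auto simp: subspace_def L_def inner_add_left)

lemma LD:
  shows "e \<in> L \<Longrightarrow> \<nu> \<in> E1 \<Longrightarrow> \<nu>' \<in> E1 \<Longrightarrow> e \<bullet> a \<nu> = e \<bullet> a \<nu>'"
    and "e \<in> L \<Longrightarrow> \<mu> \<in> E2 \<Longrightarrow> e \<bullet> b \<mu> = 0"
proof -
  show "e \<in> L \<Longrightarrow> \<nu> \<in> E1 \<Longrightarrow> \<nu>' \<in> E1 \<Longrightarrow> e \<bullet> a \<nu> = e \<bullet> a \<nu>'"
    unfolding L_def by (drule CollectD, drule conjunct1, drule (1) bspec, drule (1) bspec)
      (simp add: inner_diff_right)
  show "e \<in> L \<Longrightarrow> \<mu> \<in> E2 \<Longrightarrow> e \<bullet> b \<mu> = 0"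
    unfolding L_def by blast
qed

lemma E1_subset: "\<nu> \<in> E1 \<Longrightarrow> \<nu> \<in> act1 x"
  by (simp add: eta1_def)

lemma E2_subset: "\<mu> \<in> E2 \<Longrightarrow> \<mu> \<in> act2 x"
  by (simp add: eta2_def)

lemma E1I:
  assumes uv: "represents (act1 x) (act2 x) a b y u v" and "\<nu> \<in> act1 x" "u \<nu> \<noteq> 0"
  shows "\<nu> \<in> E1"
proof -
  have nonneg: "\<forall>\<nu>\<in>act1 x. 0 \<le> u \<nu>"
    using uv unfolding represents_def by (elim conjE)
  have "0 < u \<nu>"
    using bspec[OF nonneg assms(2)] assms(3) by simp
  then show ?thesis
    using assms(1,2) unfolding eta1_def by blast
qed

lemma E2I:
  assumes uv: "represents (act1 x) (act2 x) a b y u v" and "\<mu> \<in> act2 x" "v \<mu> \<noteq> 0"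
  shows "\<mu> \<in> E2"
proof -
  have nonneg: "\<forall>\<mu>\<in>act2 x. 0 \<le> v \<mu>"
    using uv unfolding represents_def by (elim conjE)
  have "0 < v \<mu>"
    using bspec[OF nonneg assms(2)] assms(3) by simp
  then show ?thesis
    using assms(1,2) unfolding eta2_def by blast
qed

lemma inner_y_L:
  assumes e: "e \<in> L" and \<nu>: "\<nu> \<in> E1"
  shows "e \<bullet> y = e \<bullet> a \<nu>"
proof -
  obtain u v where uv: "represents (act1 x) (act2 x) a b y u v"
    using sub_represents[OF y_sub] by blast
  have 1: "u \<nu>' * (e \<bullet> a \<nu>') = u \<nu>' * (e \<bullet> a \<nu>)" if "\<nu>' \<in> act1 x" for \<nu>'
  proof (cases "u \<nu>' = 0")
    case False
    then have "\<nu>' \<in> E1"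
      using E1I[OF uv that] by simp
    then show ?thesis
      using LD(1)[OF e _ \<nu>] by simp
  qed simp
  have 2: "v \<mu> * (e \<bullet> b \<mu>) = 0" if "\<mu> \<in> act2 x" for \<mu>
  proof (cases "v \<mu> = 0")
    case False
    then have "\<mu> \<in> E2"
      using E2I[OF uv that] by simp
    then show ?thesis
      using LD(2)[OF e] by simp
  qed simp
  have yeq: "y = (\<Sum>\<nu>\<in>act1 x. u \<nu> *\<^sub>R a \<nu>) + (\<Sum>\<mu>\<in>act2 x. v \<mu> *\<^sub>R b \<mu>)" and usum: "(\<Sum>\<nu>\<in>act1 x. u \<nu>) = 1"
    using uv unfolding represents_def by blast+
  have 3: "e \<bullet> y = (\<Sum>\<nu>'\<in>act1 x. u \<nu>' * (e \<bullet> a \<nu>')) + (\<Sum>\<mu>\<in>act2 x. v \<mu> * (e \<bullet> b \<mu>))"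
    by (subst yeq) (simp add: inner_add_right inner_sum_right)
  have 4: "(\<Sum>\<nu>'\<in>act1 x. u \<nu>' * (e \<bullet> a \<nu>')) = (\<Sum>\<nu>'\<in>act1 x. u \<nu>' * (e \<bullet> a \<nu>))"
    by (rule sum.cong[OF refl 1])
  have 5: "(\<Sum>\<mu>\<in>act2 x. v \<mu> * (e \<bullet> b \<mu>)) = 0"
    by (intro sum.neutral ballI 2)
  have 6: "(\<Sum>\<nu>'\<in>act1 x. u \<nu>' * (e \<bullet> a \<nu>)) = e \<bullet> a \<nu>"
    by (simp only: sum_distrib_right[symmetric] usum mult_1)
  show ?thesis
    by (simp only: 3 4 5 6 add_0_right)
qed

text \<open>As \<open>y\<close> is a subgradient at both points, the deficit from \<open>x\<close>
  to \<open>z\<close> is at most 0. All its nonnegative terms vanish, and a positive multiplier then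
  forces activity at \<open>z\<close>.\<close>

lemma E_active:
  assumes "y \<in> sub z"
  shows "\<nu> \<in> E1 \<Longrightarrow> \<nu> \<in> act1 z" "\<mu> \<in> E2 \<Longrightarrow> \<mu> \<in> act2 z"
proof -
  have zdm: "z \<in> dm" and xdm: "x \<in> dm"
    using subD(1)[OF assms] subD(1)[OF y_sub] by simp_all
  have gap0: "th z - th x - y \<bullet> (z - x) \<le> 0"
    using subD(2)[OF assms xdm] by (simp add: inner_diff_right)
  have *: "(\<forall>\<nu>\<in>act1 x. u \<nu> * (th z - th x - a \<nu> \<bullet> (z - x)) = 0) \<and> (\<forall>\<mu>\<in>act2 x. v \<mu> * (- (b \<mu> \<bullet> (z - x))) = 0)"
    if uv: "represents (act1 x) (act2 x) a b y u v" for u v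
  proof -
    have J1: "\<forall>\<nu>\<in>act1 x. 0 < u \<nu> \<longrightarrow> \<nu> \<in> act1 x" and J2: "\<forall>\<mu>\<in>act2 x. 0 < v \<mu> \<longrightarrow> \<mu> \<in> act2 x"
      by simp_all
    note gap = represents_gap[OF uv finite_act J1 J2 zdm]
    have s1: "0 \<le> (\<Sum>\<nu>\<in>act1 x. u \<nu> * (th z - th x - a \<nu> \<bullet> (z - x)))"
      using gap(2) by (intro sum_nonneg) auto
    have s2: "0 \<le> (\<Sum>\<mu>\<in>act2 x. v \<mu> * (- (b \<mu> \<bullet> (z - x))))"
      using gap(3) by (intro sum_nonneg) auto
    have "(\<Sum>\<nu>\<in>act1 x. u \<nu> * (th z - th x - a \<nu> \<bullet> (z - x))) + (\<Sum>\<mu>\<in>act2 x. v \<mu> * (- (b \<mu> \<bullet> (z - x)))) \<le> 0"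
      using gap0 gap(1) by linarith
    with s1 s2 have zero: "(\<Sum>\<nu>\<in>act1 x. u \<nu> * (th z - th x - a \<nu> \<bullet> (z - x))) = 0" "(\<Sum>\<mu>\<in>act2 x. v \<mu> * (- (b \<mu> \<bullet> (z - x)))) = 0"
      by linarith+
    then show ?thesis
      by (intro conjI sum_nonneg_zero_terms[OF _ _ zero(1)] sum_nonneg_zero_terms[OF _ _ zero(2)]
          finite_act ballI gap(2,3))
  qed
  show "\<nu> \<in> act1 z" if \<nu>: "\<nu> \<in> E1"
  proof -
    obtain u v where uv: "represents (act1 x) (act2 x) a b y u v" "0 < u \<nu>"
      using \<nu> unfolding eta1_def by blast
    then have "th z - th x - a \<nu> \<bullet> (z - x) = 0"
      using bspec[OF conjunct1[OF *[OF uv(1)]] E1_subset[OF \<nu>]] by simp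
    then have "a \<nu> \<bullet> z - c \<nu> = th z"
      using act1D(2)[OF E1_subset[OF \<nu>]] by (simp add: inner_diff_right)
    then show ?thesis
      using act1D(1)[OF E1_subset[OF \<nu>]] by (simp add: iota1_def)
  qed
  show "\<mu> \<in> act2 z" if \<mu>: "\<mu> \<in> E2"
  proof -
    obtain u v where uv: "represents (act1 x) (act2 x) a b y u v" "0 < v \<mu>"
      using \<mu> unfolding eta2_def by blast
    then have "b \<mu> \<bullet> (z - x) = 0"
      using bspec[OF conjunct2[OF *[OF uv(1)]] E2_subset[OF \<mu>]] by simp
    then show ?thesis
      using act2D[OF E2_subset[OF \<mu>]] by (simp add: iota2_def inner_diff_right)
  qed
qed

text \<open>Converse of \<open>E_active\<close>: a representation at \<open>x\<close> puts positive
  weight on \<open>E1\<close> and \<open>E2\<close> only, so it certifies \<open>y\<close> at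
  \<open>z\<close> as well.\<close>

lemma sub_of_E_active:
  assumes z: "z \<in> dm" and E: "E1 \<subseteq> act1 z" "E2 \<subseteq> act2 z"
  shows "y \<in> sub z"
proof -
  obtain u v where uv: "represents (act1 x) (act2 x) a b y u v"
    using sub_represents[OF y_sub] by blast
  have J1: "\<forall>\<nu>\<in>act1 x. 0 < u \<nu> \<longrightarrow> \<nu> \<in> act1 z"
    using E1I[OF uv] E(1) by auto
  have J2: "\<forall>\<mu>\<in>act2 x. 0 < v \<mu> \<longrightarrow> \<mu> \<in> act2 z"
    using E2I[OF uv] E(2) by auto
  have "0 \<le> th z' - th z - y \<bullet> (z' - z)" if "z' \<in> dm" for z'
    unfolding represents_gap(1)[OF uv finite_act J1 J2 that]
    by (intro add_nonneg_nonneg sum_nonneg represents_gap(2,3)[OF uv finite_act J1 J2 that])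
  then show ?thesis
    using z by (simp add: sub_def algebra_simps)
qed

lemma diff_in_L:
  assumes "y \<in> sub z" "y \<in> sub z'"
  shows "z - z' \<in> L"
  unfolding L_def
proof (intro CollectI conjI ballI)
  fix \<nu> \<nu>' assume "\<nu> \<in> E1" "\<nu>' \<in> E1"
  with E_active(1)[OF assms(1)] E_active(1)[OF assms(2)]
  have "a \<nu> \<bullet> z - c \<nu> = th z" "a \<nu>' \<bullet> z - c \<nu>' = th z" "a \<nu> \<bullet> z' - c \<nu> = th z'" "a \<nu>' \<bullet> z' - c \<nu>' = th z'"
    using act1D(2) by blast+
  then show "(z - z') \<bullet> (a \<nu>' - a \<nu>) = 0"
    by (simp add: inner_diff_left inner_diff_right inner_commute[of z] inner_commute[of z'])
next
  fix \<mu> assume "\<mu> \<in> E2"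
  with E_active(2)[OF assms(1)] E_active(2)[OF assms(2)]
  have "b \<mu> \<bullet> z = d \<mu>" "b \<mu> \<bullet> z' = d \<mu>"
    using act2D(2) by blast+
  then show "(z - z') \<bullet> b \<mu> = 0"
    by (simp add: inner_diff_left inner_diff_right inner_commute[of _ "b \<mu>"])
qed

text \<open>Every term of the deficit is nonnegative and at most the whole, hence o(t). Each index
  of \<open>E1\<close> or \<open>E2\<close> has a representation with positive multiplier at it, so
  its own slope agrees in the limit with that of \<open>th\<close>, respectively vanishes.\<close>

lemma limit_in_L:
  assumes z': "\<And>k. z' k \<in> dm" and z: "\<And>k. y \<in> sub (z k)" and t: "\<And>k. 0 < (t k :: real)"
    and e: "(\<lambda>k. (1 / t k) *\<^sub>R (z' k - z k)) \<longlonglongrightarrow> e"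
    and gap: "(\<lambda>k. (th (z' k) - th (z k) - y \<bullet> (z' k - z k)) / t k) \<longlonglongrightarrow> 0"
  shows "e \<in> L"
proof -
  let ?G = "\<lambda>k. th (z' k) - th (z k) - y \<bullet> (z' k - z k)"
  have *: "\<nu> \<in> act1 x \<Longrightarrow> u \<nu> * (th (z' k) - th (z k) - a \<nu> \<bullet> (z' k - z k)) \<le> ?G k"
      "\<nu> \<in> act1 x \<Longrightarrow> 0 \<le> u \<nu> * (th (z' k) - th (z k) - a \<nu> \<bullet> (z' k - z k))"
      "\<mu> \<in> act2 x \<Longrightarrow> v \<mu> * (- (b \<mu> \<bullet> (z' k - z k))) \<le> ?G k"
      "\<mu> \<in> act2 x \<Longrightarrow> 0 \<le> v \<mu> * (- (b \<mu> \<bullet> (z' k - z k)))"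
    if uv: "represents (act1 x) (act2 x) a b y u v" for u v k \<nu> \<mu>
  proof -
    have J1: "\<forall>\<nu>\<in>act1 x. 0 < u \<nu> \<longrightarrow> \<nu> \<in> act1 (z k)"
      using E1I[OF uv] E_active(1)[OF z] by auto
    have J2: "\<forall>\<mu>\<in>act2 x. 0 < v \<mu> \<longrightarrow> \<mu> \<in> act2 (z k)"
      using E2I[OF uv] E_active(2)[OF z] by auto
    note gap = represents_gap[OF uv finite_act J1 J2 z'[of k]]
    have s: "0 \<le> (\<Sum>\<nu>\<in>act1 x. u \<nu> * (th (z' k) - th (z k) - a \<nu> \<bullet> (z' k - z k)))"
      "0 \<le> (\<Sum>\<mu>\<in>act2 x. v \<mu> * (- (b \<mu> \<bullet> (z' k - z k))))"
      by (intro sum_nonneg gap(2,3); assumption)+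
    show "0 \<le> u \<nu> * (th (z' k) - th (z k) - a \<nu> \<bullet> (z' k - z k))" if "\<nu> \<in> act1 x"
      using gap(2) that by blast
    show "0 \<le> v \<mu> * (- (b \<mu> \<bullet> (z' k - z k)))" if "\<mu> \<in> act2 x"
      using gap(3) that by blast
    show "u \<nu> * (th (z' k) - th (z k) - a \<nu> \<bullet> (z' k - z k)) \<le> ?G k" if "\<nu> \<in> act1 x"
    proof -
      have "u \<nu> * (th (z' k) - th (z k) - a \<nu> \<bullet> (z' k - z k)) \<le> (\<Sum>\<nu>\<in>act1 x. u \<nu> * (th (z' k) - th (z k) - a \<nu> \<bullet> (z' k - z k)))"
        using gap(2) that finite_act by (intro member_le_sum) auto
      then show ?thesis
        using gap(1) s(2) by linarith
    qed
    show "v \<mu> * (- (b \<mu> \<bullet> (z' k - z k))) \<le> ?G k" if "\<mu> \<in> act2 x"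
    proof -
      have "v \<mu> * (- (b \<mu> \<bullet> (z' k - z k))) \<le> (\<Sum>\<mu>\<in>act2 x. v \<mu> * (- (b \<mu> \<bullet> (z' k - z k))))"
        using gap(3) that finite_act by (intro member_le_sum) auto
      then show ?thesis
        using gap(1) s(1) by linarith
    qed
  qed
  have scaled: "(\<lambda>k. q k / t k) \<longlonglongrightarrow> 0"
    if "0 < r" "\<And>k. r * q k \<le> ?G k" "\<And>k. 0 \<le> r * q k" for r :: real and q
  proof -
    have "(\<lambda>k. r * q k / t k) \<longlonglongrightarrow> 0"
    proof (rule tendsto_sandwich[OF _ _ tendsto_const gap])
      show "\<forall>\<^sub>F k in sequentially. 0 \<le> r * q k / t k"
        by (intro always_eventually allI divide_nonneg_pos that(3) t)
      show "\<forall>\<^sub>F k in sequentially. r * q k / t k \<le> ?G k / t k"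
        by (intro always_eventually allI divide_right_mono that(2) less_imp_le[OF t])
    qed
    from tendsto_mult[OF tendsto_const[of "1 / r"] this] show ?thesis
      using that(1) by simp
  qed
  have lim: "(\<lambda>k. (w \<bullet> (z' k - z k)) / t k) \<longlonglongrightarrow> w \<bullet> e" for w
    using tendsto_inner[OF tendsto_const[of w] e] by simp
  have A: "(\<lambda>k. (th (z' k) - th (z k)) / t k) \<longlonglongrightarrow> a \<nu> \<bullet> e" if \<nu>: "\<nu> \<in> E1" for \<nu>
  proof -
    obtain u v where uv: "represents (act1 x) (act2 x) a b y u v" "0 < u \<nu>"
      using \<nu> unfolding eta1_def by blast
    have "(\<lambda>k. (th (z' k) - th (z k) - a \<nu> \<bullet> (z' k - z k)) / t k) \<longlonglongrightarrow> 0"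
      by (intro scaled[OF uv(2)] *(1,2)[OF uv(1) E1_subset[OF \<nu>]])
    from tendsto_add[OF this lim[of "a \<nu>"]] show ?thesis
      by (simp add: diff_divide_distrib)
  qed
  have B: "b \<mu> \<bullet> e = 0" if \<mu>: "\<mu> \<in> E2" for \<mu>
  proof -
    obtain u v where uv: "represents (act1 x) (act2 x) a b y u v" "0 < v \<mu>"
      using \<mu> unfolding eta2_def by blast
    have "(\<lambda>k. - (b \<mu> \<bullet> (z' k - z k)) / t k) \<longlonglongrightarrow> 0"
      by (intro scaled[OF uv(2)] *(3,4)[OF uv(1) E2_subset[OF \<mu>]])
    from tendsto_minus[OF this] have "(\<lambda>k. (b \<mu> \<bullet> (z' k - z k)) / t k) \<longlonglongrightarrow> 0"
      by simp
    with lim[of "b \<mu>"] show ?thesis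
      by (rule LIMSEQ_unique)
  qed
  have C: "a \<nu> \<bullet> e = a \<nu>' \<bullet> e" if "\<nu> \<in> E1" "\<nu>' \<in> E1" for \<nu> \<nu>'
    by (rule LIMSEQ_unique[OF A[OF that(1)] A[OF that(2)]])
  show ?thesis
    unfolding L_def
  proof (intro CollectI conjI ballI)
    show "e \<bullet> (a \<nu>' - a \<nu>) = 0" if "\<nu> \<in> E1" "\<nu>' \<in> E1" for \<nu> \<nu>'
      using C[OF that] by (simp add: inner_diff_right inner_commute[of e])
    show "e \<bullet> b \<mu> = 0" if "\<mu> \<in> E2" for \<mu>
      using B[OF that] by (simp add: inner_commute[of e])
  qed
qed

abbreviation K :: "'n rvec set"
  where "K \<equiv> K_set (act1 x) (act2 x) E1 E2 a b"

definition strict_nbhd :: "'n rvec set"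
  where "strict_nbhd = {z. (\<forall>\<nu>'\<in>{1..p} - act1 x. \<forall>\<nu>\<in>E1. a \<nu>' \<bullet> z - c \<nu>' < a \<nu> \<bullet> z - c \<nu>)
    \<and> (\<forall>\<mu>\<in>{1..m} - act2 x. b \<mu> \<bullet> z < d \<mu>)}"

text \<open>\<open>K\<close> is the intersection of \<open>L\<close> with this open set, hence
  relatively open in \<open>L\<close>.\<close>

definition strict_dirs :: "'n rvec set"
  where "strict_dirs = {h. (\<forall>\<nu>'\<in>act1 x - E1. \<forall>\<nu>\<in>E1. h \<bullet> (a \<nu>' - a \<nu>) < 0) \<and> (\<forall>\<mu>\<in>act2 x - E2. h \<bullet> b \<mu> < 0)}"

lemma finite_E: "finite E1" "finite E2"
  using finite_subset[of E1 "act1 x"] finite_subset[of E2 "act2 x"] finite_act[of x] E1_subset E2_subset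
  by (simp_all add: subset_iff)

lemma open_strict_nbhd: "open strict_nbhd"
proof -
  have "strict_nbhd = (\<Inter>\<nu>'\<in>{1..p} - act1 x. \<Inter>\<nu>\<in>E1. {z. a \<nu>' \<bullet> z - c \<nu>' < a \<nu> \<bullet> z - c \<nu>})
      \<inter> (\<Inter>\<mu>\<in>{1..m} - act2 x. {z. b \<mu> \<bullet> z < d \<mu>})"
    by (auto simp: strict_nbhd_def)
  also have "open \<dots>"
    using finite_E by (intro open_Int open_INT ballI open_Collect_less continuous_intros) auto
  finally show ?thesis .
qed

lemma open_strict_dirs: "open strict_dirs"
proof -
  have "strict_dirs = (\<Inter>\<nu>'\<in>act1 x - E1. \<Inter>\<nu>\<in>E1. {h. h \<bullet> (a \<nu>' - a \<nu>) < 0}) \<inter> (\<Inter>\<mu>\<in>act2 x - E2. {h. h \<bullet> b \<mu> < 0})"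
    by (auto simp: strict_dirs_def)
  also have "open \<dots>"
    using finite_E finite_act by (intro open_Int open_INT ballI open_Collect_less continuous_intros) auto
  finally show ?thesis .
qed

lemma x_strict_nbhd: "x \<in> strict_nbhd"
proof -
  have "a \<nu>' \<bullet> x - c \<nu>' < a \<nu> \<bullet> x - c \<nu>" if "\<nu>' \<in> {1..p} - act1 x" "\<nu> \<in> E1" for \<nu> \<nu>'
    using that th_ge[of \<nu>' x] act1D(2)[OF E1_subset[OF that(2)]] by (auto simp: iota1_def)
  moreover have "b \<mu> \<bullet> x < d \<mu>" if "\<mu> \<in> {1..m} - act2 x" for \<mu>
    using that subD(1)[OF y_sub] by (auto simp: iota2_def dm_def order.strict_iff_order)
  ultimately show ?thesis
    by (simp add: strict_nbhd_def)
qed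

text \<open>Moving along \<open>L\<close> keeps the strictly active pieces tied,
  \<open>strict_dirs\<close> pushes the other active ones below them, and \<open>strict_nbhd\<close>
  keeps the inactive ones inactive.\<close>

lemma y_sub_along:
  assumes h: "h \<in> L" "h \<in> strict_dirs" and \<epsilon>: "0 < \<epsilon>" and N: "x + \<epsilon> *\<^sub>R h \<in> strict_nbhd"
  shows "y \<in> sub (x + \<epsilon> *\<^sub>R h)"
proof (rule sub_of_E_active)
  let ?z = "x + \<epsilon> *\<^sub>R h"
  have le: "a \<nu>' \<bullet> ?z - c \<nu>' \<le> a \<nu> \<bullet> ?z - c \<nu>" if \<nu>: "\<nu> \<in> E1" and \<nu>': "\<nu>' \<in> {1..p}" for \<nu> \<nu>'
  proof (cases "\<nu>' \<in> act1 x")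
    case True
    have "h \<bullet> (a \<nu>' - a \<nu>) \<le> 0"
    proof (cases "\<nu>' \<in> E1")
      case True
      then show ?thesis
        using LD(1)[OF h(1) \<nu>] by (simp add: inner_diff_right)
    next
      case False
      then show ?thesis
        using h(2) \<nu> \<open>\<nu>' \<in> act1 x\<close> by (auto simp: strict_dirs_def intro: less_imp_le)
    qed
    then have "\<epsilon> * (a \<nu>' \<bullet> h) \<le> \<epsilon> * (a \<nu> \<bullet> h)"
      using \<epsilon> by (simp add: inner_diff_right inner_commute[of h])
    then show ?thesis
      using act1D(2)[OF E1_subset[OF \<nu>]] act1D(2)[OF True] by (simp add: inner_add_right)
  next
    case False
    then show ?thesis
      using N \<nu> \<nu>' by (auto simp: strict_nbhd_def intro: less_imp_le)
  qed
  have lb: "b \<mu> \<bullet> ?z \<le> d \<mu> \<and> (\<mu> \<in> E2 \<longrightarrow> b \<mu> \<bullet> ?z = d \<mu>)" if \<mu>: "\<mu> \<in> {1..m}" for \<mu>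
  proof (cases "\<mu> \<in> act2 x")
    case True
    have "h \<bullet> b \<mu> \<le> 0 \<and> (\<mu> \<in> E2 \<longrightarrow> h \<bullet> b \<mu> = 0)"
    proof (cases "\<mu> \<in> E2")
      case True
      then show ?thesis
        using LD(2)[OF h(1)] by simp
    next
      case False
      then show ?thesis
        using h(2) \<open>\<mu> \<in> act2 x\<close> by (auto simp: strict_dirs_def intro: less_imp_le)
    qed
    then show ?thesis
      using act2D(2)[OF True] \<epsilon> by (simp add: inner_add_right inner_commute[of h] mult_nonneg_nonpos)
  next
    case False
    then show ?thesis
      using N \<mu> E2_subset[of \<mu>] by (auto simp: strict_nbhd_def intro: less_imp_le)
  qed
  show "?z \<in> dm"
    using lb by (simp add: dm_def)
  show "E1 \<subseteq> act1 ?z"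
  proof
    fix \<nu> assume \<nu>: "\<nu> \<in> E1"
    then have "\<nu> \<in> {1..p}"
      using act1D(1)[OF E1_subset] by simp
    moreover have "a \<nu> \<bullet> ?z - c \<nu> = th ?z"
      using le[OF \<nu>] th_ge[OF \<open>\<nu> \<in> {1..p}\<close>, of ?z] th_le_iff[of ?z "a \<nu> \<bullet> ?z - c \<nu>"] by (intro antisym) auto
    ultimately show "\<nu> \<in> act1 ?z"
      by (simp add: iota1_def)
  qed
  show "E2 \<subseteq> act2 ?z"
  proof
    fix \<mu> assume \<mu>: "\<mu> \<in> E2"
    then have "\<mu> \<in> {1..m}"
      using act2D(1)[OF E2_subset] by simp
    then show "\<mu> \<in> act2 ?z"
      using lb[of \<mu>] \<mu> by (simp add: iota2_def)
  qed
qed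

text \<open>The point \<open>x\<close> may lie on the relative boundary of the set of points with
  subgradient \<open>y\<close>, where a direction of \<open>L\<close> need not be admissible. The
  shift along \<open>h\<close> enters the relative interior, and only then is the step
  \<open>t\<close> chosen.\<close>

lemma eventually_y_sub:
  assumes h: "h \<in> K" and e: "e \<in> L"
  shows "\<forall>\<^sub>F \<epsilon> in at_right 0. y \<in> sub (x + \<epsilon> *\<^sub>R h) \<and> (\<forall>\<^sub>F t in at_right 0. y \<in> sub (x + \<epsilon> *\<^sub>R h + t *\<^sub>R e))"
proof -
  have hL: "h \<in> L" and hS: "h \<in> strict_dirs"
    using h by (auto simp: K_set_def L_def strict_dirs_def)
  have "((\<lambda>\<epsilon>. x + \<epsilon> *\<^sub>R h) \<longlongrightarrow> x + 0 *\<^sub>R h) (at_right 0)"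
    by (intro tendsto_intros)
  then have ev: "\<forall>\<^sub>F \<epsilon> in at_right 0. x + \<epsilon> *\<^sub>R h \<in> strict_nbhd"
    using topological_tendstoD[OF _ open_strict_nbhd] x_strict_nbhd by simp
  have ev': "\<forall>\<^sub>F \<epsilon> in at_right 0. 0 < (\<epsilon> :: real)"
    by (rule eventually_at_right_less)
  from ev ev' show ?thesis
  proof eventually_elim
    case (elim \<epsilon>)
    have "((\<lambda>t. h + (t / \<epsilon>) *\<^sub>R e) \<longlongrightarrow> h + (0 / \<epsilon>) *\<^sub>R e) (at_right 0)"
      using elim(2) by (intro tendsto_intros) auto
    then have 1: "\<forall>\<^sub>F t in at_right 0. h + (t / \<epsilon>) *\<^sub>R e \<in> strict_dirs"
      using topological_tendstoD[OF _ open_strict_dirs] hS by simp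
    have "((\<lambda>t. x + \<epsilon> *\<^sub>R h + t *\<^sub>R e) \<longlongrightarrow> x + \<epsilon> *\<^sub>R h + 0 *\<^sub>R e) (at_right 0)"
      by (intro tendsto_intros)
    then have 2: "\<forall>\<^sub>F t in at_right 0. x + \<epsilon> *\<^sub>R h + t *\<^sub>R e \<in> strict_nbhd"
      using topological_tendstoD[OF _ open_strict_nbhd] elim(1) by simp
    have 3: "x + \<epsilon> *\<^sub>R h + t *\<^sub>R e = x + \<epsilon> *\<^sub>R (h + (t / \<epsilon>) *\<^sub>R e)" for t
      using elim(2) by (simp add: scaleR_add_right)
    have "\<forall>\<^sub>F t in at_right 0. y \<in> sub (x + \<epsilon> *\<^sub>R h + t *\<^sub>R e)"
      using 1 2
    proof eventually_elim
      case (elim t)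
      have "h + (t / \<epsilon>) *\<^sub>R e \<in> L"
        using hL e subspace_L by (intro subspace_add subspace_scale)
      then show ?case
        using elim y_sub_along[of "h + (t / \<epsilon>) *\<^sub>R e" \<epsilon>] \<open>0 < \<epsilon>\<close> unfolding 3 by simp
    qed
    then show ?case
      using y_sub_along[OF hL hS elim(2,1)] by simp
  qed
qed

lemma eventually_K:
  assumes h: "h \<in> K" and e: "e \<in> L"
  shows "\<forall>\<^sub>F s in at_right 0. h + s *\<^sub>R e \<in> K"
proof -
  have hL: "h \<in> L" and hS: "h \<in> strict_dirs"
    using h by (auto simp: K_set_def L_def strict_dirs_def)
  have "((\<lambda>s. h + s *\<^sub>R e) \<longlongrightarrow> h + 0 *\<^sub>R e) (at_right 0)"
    by (intro tendsto_intros)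
  then have "\<forall>\<^sub>F s in at_right 0. h + s *\<^sub>R e \<in> strict_dirs"
    using topological_tendstoD[OF _ open_strict_dirs] hS by simp
  then show ?thesis
  proof eventually_elim
    case (elim s)
    have "h + s *\<^sub>R e \<in> L"
      using hL e subspace_L by (intro subspace_add subspace_scale)
    with elim show ?case
      by (auto simp: K_set_def L_def strict_dirs_def)
  qed
qed

end

locale symmetric_subgradient_pair = subgradient_pair \<theta> p a c m b d x y + symmetric_polyhedral \<theta> p a c m b d
  for \<theta> :: "'n::finite rvec \<Rightarrow> ereal" and p a c m b d x y +
  assumes K_nonempty: "K \<noteq> {}"
begin

text \<open>A permutation fixing \<open>x\<close> and \<open>y\<close> maps points with subgradient
  \<open>y\<close> to such points. A multiple of \<open>e\<close> is a difference of two of them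
  because \<open>K\<close> is nonempty, and so is its permuted image.\<close>

lemma L_permv:
  assumes \<pi>: "\<pi> permutes UNIV" and fix_xy: "permv \<pi> x = x" "permv \<pi> y = y" and e: "e \<in> L"
  shows "permv \<pi> e \<in> L"
proof -
  obtain h where h: "h \<in> K"
    using K_nonempty by blast
  obtain \<epsilon> where \<epsilon>: "y \<in> sub (x + \<epsilon> *\<^sub>R h)" "\<forall>\<^sub>F t in at_right 0. y \<in> sub (x + \<epsilon> *\<^sub>R h + t *\<^sub>R e)"
    using eventually_happens'[OF trivial_limit_at_right_real eventually_y_sub[OF h e]] by blast
  have "\<forall>\<^sub>F t in at_right 0. 0 < t \<and> y \<in> sub (x + \<epsilon> *\<^sub>R h + t *\<^sub>R e)"
    using \<epsilon>(2) eventually_at_right_less[of "0 :: real"] by eventually_elim simp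
  then obtain t where t: "0 < t" "y \<in> sub (x + \<epsilon> *\<^sub>R h + t *\<^sub>R e)"
    using eventually_happens'[OF trivial_limit_at_right_real] by blast
  have "y \<in> sub (permv \<pi> (x + \<epsilon> *\<^sub>R h + t *\<^sub>R e))" "y \<in> sub (permv \<pi> (x + \<epsilon> *\<^sub>R h))"
    using sub_permv[OF \<pi> t(2)] sub_permv[OF \<pi> \<epsilon>(1)] by (simp_all add: fix_xy)
  from diff_in_L[OF this] have "t *\<^sub>R permv \<pi> e \<in> L"
    by (simp add: permv_linear)
  from subspace_scale[OF subspace_L this, of "1 / t"] show ?thesis
    using t(1) by simp
qed

text \<open>The transposition of \<open>i\<close> and \<open>j\<close> fixes \<open>x\<close> and
  \<open>y\<close>, so it keeps \<open>e\<close> in \<open>L\<close> and keeps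
  \<open>e \<bullet> y\<close>. On \<open>L\<close> the pairing with any \<open>a \<nu>\<close> of
  \<open>E1\<close> equals the pairing with \<open>y\<close>, and that with any
  \<open>b \<mu>\<close> of \<open>E2\<close> is 0; the change under the transposition is a product
  of two entry differences.\<close>

lemma L_constant_on_block:
  assumes e: "e \<in> L" and ij: "x $ i = x $ j" "y $ i = y $ j"
    and ne: "(\<exists>\<nu>\<in>E1. a \<nu> $ i \<noteq> a \<nu> $ j) \<or> (\<exists>\<mu>\<in>E2. b \<mu> $ i \<noteq> b \<mu> $ j)"
  shows "e $ i = e $ j"
proof (cases "i = j")
  case False
  let ?\<pi> = "Transposition.transpose i j"
  have \<pi>: "?\<pi> permutes UNIV"
    by (rule permutes_swap_id) auto
  have fix_xy: "permv ?\<pi> x = x" "permv ?\<pi> y = y"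
    using ij by (auto simp: vec_eq_iff Transposition.transpose_def)
  have e': "permv ?\<pi> e \<in> L"
    by (rule L_permv[OF \<pi> fix_xy e])
  have diff: "w \<bullet> permv ?\<pi> e - w \<bullet> e = (w $ i - w $ j) * (e $ j - e $ i)" for w
  proof -
    have "w \<bullet> permv ?\<pi> e - w \<bullet> e = (\<Sum>k\<in>UNIV. w $ k * (e $ ?\<pi> k - e $ k))"
      by (simp add: inner_vec_def sum_subtractf[symmetric] right_diff_distrib)
    also have "\<dots> = w $ i * (e $ j - e $ i) + (w $ j * (e $ i - e $ j) + (\<Sum>k\<in>UNIV - {i, j}. w $ k * (e $ ?\<pi> k - e $ k)))"
      by (simp add: sum_split_pair[OF False])
    also have "(\<Sum>k\<in>UNIV - {i, j}. w $ k * (e $ ?\<pi> k - e $ k)) = 0"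
      by (intro sum.neutral) auto
    finally show ?thesis
      by (simp add: algebra_simps)
  qed
  from ne show ?thesis
  proof (elim disjE bexE)
    fix \<nu> assume \<nu>: "\<nu> \<in> E1" "a \<nu> $ i \<noteq> a \<nu> $ j"
    have "permv ?\<pi> e \<bullet> y = e \<bullet> y"
      using inner_permv[OF \<pi>, of e y] by (simp add: fix_xy)
    then have "a \<nu> \<bullet> permv ?\<pi> e - a \<nu> \<bullet> e = 0"
      using inner_y_L[OF e \<nu>(1)] inner_y_L[OF e' \<nu>(1)] by (simp add: inner_commute)
    then show ?thesis
      using \<nu>(2) diff[of "a \<nu>"] by simp
  next
    fix \<mu> assume \<mu>: "\<mu> \<in> E2" "b \<mu> $ i \<noteq> b \<mu> $ j"
    have "b \<mu> \<bullet> permv ?\<pi> e - b \<mu> \<bullet> e = 0"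
      using LD(2)[OF e \<mu>(1)] LD(2)[OF e' \<mu>(1)] by (simp add: inner_commute)
    then show ?thesis
      using \<mu>(2) diff[of "b \<mu>"] by simp
  qed
qed simp

end

section \<open>Spectral functions\<close>

text \<open>The subgradients of the convex function that is \<open>h\<close> on \<open>C\<close> and \<open>\<infinity>\<close> elsewhere.\<close>

definition csub :: "'a::euclidean_space set \<Rightarrow> ('a \<Rightarrow> real) \<Rightarrow> 'a \<Rightarrow> 'a set"
  where "csub C h x = {w. x \<in> C \<and> (\<forall>z\<in>C. h x + w \<bullet> (z - x) \<le> h z)}"

lemma csubD:
  "w \<in> csub C h x \<Longrightarrow> x \<in> C"
  "w \<in> csub C h x \<Longrightarrow> z \<in> C \<Longrightarrow> h x + w \<bullet> (z - x) \<le> h z"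
  by (auto simp: csub_def)

lemma csubI: "x \<in> C \<Longrightarrow> (\<And>z. z \<in> C \<Longrightarrow> h x + w \<bullet> (z - x) \<le> h z) \<Longrightarrow> w \<in> csub C h x"
  by (simp add: csub_def)

lemma csub_monotone:
  assumes "w1 \<in> csub C h x1" "w2 \<in> csub C h x2"
  shows "0 \<le> (w1 - w2) \<bullet> (x1 - x2)"
  using csubD(2)[OF assms(1) csubD(1)[OF assms(2)]] csubD(2)[OF assms(2) csubD(1)[OF assms(1)]]
  by (simp add: inner_diff_left inner_diff_right)

lemma (in polyhedral_function) sub_eq_csub: "sub = csub dm th"
  by (simp add: fun_eq_iff sub_def csub_def)

locale spectral_polyhedral = symmetric_polyhedral \<theta> p a c m b d
  for \<theta> :: "'n::{finite,linorder} rvec \<Rightarrow> ereal" and p a c m b d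
begin

definition dmS :: "'n symmat set"
  where "dmS = {Z. eigvals Z \<in> dm}"

definition hS :: "'n symmat \<Rightarrow> real"
  where "hS Z = th (eigvals Z)"

abbreviation subS :: "'n symmat \<Rightarrow> 'n symmat set"
  where "subS \<equiv> csub dmS hS"

lemma theta_eigvals: "\<theta> (eigvals Z) = (if Z \<in> dmS then ereal (hS Z) else \<infinity>)"
  by (simp add: theta_eq dmS_def hS_def)

text \<open>\<open>dm\<close> and the sublevel sets of \<open>th\<close> are cut out by linear
  functionals. For each of them the diagonal is dominated by some permutation of the eigenvalues, at
  which \<theta> has the same value by symmetry.\<close>

lemma diag_conj_by_dm:
  assumes R: "orthogonal_matrix R" and Z: "Z \<in> dmS"
  shows "diag (conj_by R Z) \<in> dm" "th (diag (conj_by R Z)) \<le> hS Z"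
proof -
  have *: "\<exists>u\<in>dm. th u = hS Z \<and> w \<bullet> diag (conj_by R Z) \<le> w \<bullet> u" for w
  proof -
    obtain \<sigma> where \<sigma>: "\<sigma> permutes UNIV"
      "\<And>R. orthogonal_matrix R \<Longrightarrow> diag (conj_by R Z) \<bullet> w \<le> (\<chi> i. eigvals Z $ \<sigma> i) \<bullet> w"
      by (rule diag_conj_by_le_permuted[of Z w]) blast
    have "permv \<sigma> (eigvals Z) \<in> dm" "th (permv \<sigma> (eigvals Z)) = hS Z"
      using Z dm_permv[OF \<sigma>(1)] th_permv[OF \<sigma>(1)] by (simp_all add: dmS_def hS_def)
    moreover have "w \<bullet> diag (conj_by R Z) \<le> w \<bullet> permv \<sigma> (eigvals Z)"
      using \<sigma>(2)[OF R] by (simp add: permv_def inner_commute)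
    ultimately show ?thesis
      by blast
  qed
  have "b \<mu> \<bullet> diag (conj_by R Z) \<le> d \<mu>" if "\<mu> \<in> {1..m}" for \<mu>
  proof -
    obtain u where "u \<in> dm" "b \<mu> \<bullet> diag (conj_by R Z) \<le> b \<mu> \<bullet> u"
      using *[of "b \<mu>"] by blast
    then show ?thesis
      using that by (force simp: dm_def)
  qed
  then show "diag (conj_by R Z) \<in> dm"
    by (simp add: dm_def)
  have "a \<nu> \<bullet> diag (conj_by R Z) - c \<nu> \<le> hS Z" if "\<nu> \<in> {1..p}" for \<nu>
  proof -
    obtain u where "th u = hS Z" "a \<nu> \<bullet> diag (conj_by R Z) \<le> a \<nu> \<bullet> u"
      using *[of "a \<nu>"] by blast
    then show ?thesis
      using th_ge[OF that, of u] by simp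
  qed
  then show "th (diag (conj_by R Z)) \<le> hS Z"
    by (simp add: th_le_iff)
qed

lemma spectral_eval:
  assumes "orthogonal_matrix P"
  shows "spectral P v \<in> dmS \<longleftrightarrow> v \<in> dm" "v \<in> dm \<Longrightarrow> hS (spectral P v) = th v"
proof -
  obtain \<sigma> where \<sigma>: "\<sigma> permutes UNIV" "\<And>i. v $ i = eigvals (spectral P v) $ \<sigma> i"
    by (rule eigvals_spectral_permutes[OF assms, of v]) blast
  have v: "v = permv \<sigma> (eigvals (spectral P v))"
    using \<sigma>(2) by (simp add: vec_eq_iff)
  show iff: "spectral P v \<in> dmS \<longleftrightarrow> v \<in> dm"
    using dm_permv[OF \<sigma>(1), of "eigvals (spectral P v)"] unfolding v[symmetric] by (simp add: dmS_def)
  show "hS (spectral P v) = th v" if "v \<in> dm"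
    using th_permv[OF \<sigma>(1), of "eigvals (spectral P v)"] that iff unfolding v[symmetric]
    by (simp add: dmS_def hS_def)
qed

lemma diag_conj_by_combination:
  "diag (conj_by P (s *\<^sub>R Z1 + t *\<^sub>R Z2)) = s *\<^sub>R diag (conj_by P Z1) + t *\<^sub>R diag (conj_by P Z2)"
  by (simp add: linear_add[OF bounded_linear.linear[OF bounded_linear_conj_by]]
      linear_scale[OF bounded_linear.linear[OF bounded_linear_conj_by]] diag_linear)

text \<open>Davis' convexity theorem: in an eigenbasis of the combination its eigenvalues are the
  combination of the two diagonals, to which \<open>diag_conj_by_dm\<close> applies.\<close>

lemma combination_bound:
  assumes Z: "Z1 \<in> dmS" "Z2 \<in> dmS" and st: "0 \<le> s" "0 \<le> t" "s + t = 1"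
  shows "s *\<^sub>R Z1 + t *\<^sub>R Z2 \<in> dmS" "hS (s *\<^sub>R Z1 + t *\<^sub>R Z2) \<le> s * hS Z1 + t * hS Z2"
proof -
  let ?Z = "s *\<^sub>R Z1 + t *\<^sub>R Z2"
  obtain P where P: "P \<in> eig_orth ?Z"
    using eig_orth_nonempty by blast
  then have orth: "orthogonal_matrix P"
    by (simp add: eig_orth_iff)
  have ev: "eigvals ?Z = s *\<^sub>R diag (conj_by P Z1) + t *\<^sub>R diag (conj_by P Z2)"
    using arg_cong[OF eig_orth_conj_by[OF P], of diag] by (simp add: diag_conj_by_combination)
  note D1 = diag_conj_by_dm[OF orth Z(1)] and D2 = diag_conj_by_dm[OF orth Z(2)]
  have "b \<mu> \<bullet> eigvals ?Z \<le> d \<mu>" if "\<mu> \<in> {1..m}" for \<mu>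
  proof -
    have "s * (b \<mu> \<bullet> diag (conj_by P Z1)) + t * (b \<mu> \<bullet> diag (conj_by P Z2)) \<le> s * d \<mu> + t * d \<mu>"
      using D1(1) D2(1) that st by (intro add_mono mult_left_mono) (auto simp: dm_def)
    also have "\<dots> = d \<mu>"
      using st(3) by (simp flip: distrib_right)
    finally show ?thesis
      by (simp add: ev inner_add_right)
  qed
  then show "?Z \<in> dmS"
    by (simp add: dmS_def dm_def)
  have "a \<nu> \<bullet> eigvals ?Z - c \<nu> \<le> s * hS Z1 + t * hS Z2" if "\<nu> \<in> {1..p}" for \<nu>
  proof -
    have "a \<nu> \<bullet> eigvals ?Z - c \<nu> = s * (a \<nu> \<bullet> diag (conj_by P Z1)) + t * (a \<nu> \<bullet> diag (conj_by P Z2)) - (s + t) * c \<nu>"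
      by (simp add: ev inner_add_right st(3))
    also have "\<dots> = s * (a \<nu> \<bullet> diag (conj_by P Z1) - c \<nu>) + t * (a \<nu> \<bullet> diag (conj_by P Z2) - c \<nu>)"
      by (simp add: algebra_simps)
    also have "\<dots> \<le> s * hS Z1 + t * hS Z2"
      using order_trans[OF th_ge[OF that] D1(2)] order_trans[OF th_ge[OF that] D2(2)] st
      by (intro add_mono mult_left_mono) auto
    finally show ?thesis .
  qed
  then show "hS ?Z \<le> s * hS Z1 + t * hS Z2"
    by (simp add: hS_def th_le_iff)
qed

lemma convex_dmS: "convex dmS"
  using combination_bound(1) by (simp add: convex_def)

lemma convex_on_hS: "convex_on dmS hS"
  using combination_bound(2) convex_dmS by (simp add: convex_on_def)

lemma closed_dmS: "closed dmS"
proof -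
  have "closed (eigvals -` dm :: 'n symmat set)"
    by (intro continuous_closed_vimage closed_dm) (simp add: continuous_at tendsto_eigvals)
  then show ?thesis
    by (simp add: dmS_def vimage_def)
qed

lemma continuous_hS: "continuous_on S hS"
  unfolding hS_def by (rule continuous_on_compose2[OF continuous_th[of UNIV]]) (auto intro!: continuous_intros)

text \<open>Pairing with \<open>spectral P w\<close> sees only the diagonal in the basis
  \<open>P\<close>, and passing to that diagonal does not increase the function.\<close>

lemma spectral_subS:
  assumes P: "orthogonal_matrix P" and w: "w \<in> sub z"
  shows "spectral P w \<in> subS (spectral P z)"
proof (rule csubI)
  have z: "z \<in> dm"
    using subD(1)[OF w] .
  then show "spectral P z \<in> dmS"
    using spectral_eval(1)[OF P] by simp
  fix Z' assume Z': "Z' \<in> dmS"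
  have cz: "conj_by P (spectral P z) = Diag z"
    using spectral_iff[OF P] by blast
  have "spectral P w \<bullet> (Z' - spectral P z) = diag (conj_by P Z') \<bullet> w - z \<bullet> w"
    using inner_spectral[OF P, of Z' w] inner_spectral[OF P, of "spectral P z" w]
    by (simp add: inner_diff_right inner_commute[of "spectral P w"] cz)
  then have "spectral P w \<bullet> (Z' - spectral P z) = w \<bullet> (diag (conj_by P Z') - z)"
    by (simp add: inner_diff_right inner_commute)
  then show "hS (spectral P z) + spectral P w \<bullet> (Z' - spectral P z) \<le> hS Z'"
    using subD(2)[OF w diag_conj_by_dm(1)[OF P Z']] diag_conj_by_dm(2)[OF P Z'] spectral_eval(2)[OF P z]
    by simp
qed

text \<open>The competitor with the eigenvalues of \<open>Z\<close> in an eigenbasis of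
  \<open>W\<close> has the same function value, so the subgradient inequality forces equality in von
  Neumann's trace inequality.\<close>

lemma subS_simultaneous:
  assumes W: "W \<in> subS Z"
  shows "eig_orth Z \<inter> eig_orth W \<noteq> {}" "eigvals W \<in> sub (eigvals Z)"
proof -
  obtain R where R: "R \<in> eig_orth W"
    using eig_orth_nonempty by blast
  then have oR: "orthogonal_matrix R"
    by (simp add: eig_orth_iff)
  have Z: "eigvals Z \<in> dm"
    using csubD(1)[OF W] by (simp add: dmS_def)
  have "hS Z + W \<bullet> (spectral R (eigvals Z) - Z) \<le> hS (spectral R (eigvals Z))"
    using csubD(2)[OF W] spectral_eval(1)[OF oR] Z by blast
  then have "W \<bullet> spectral R (eigvals Z) \<le> W \<bullet> Z"
    using spectral_eval(2)[OF oR Z] by (simp add: hS_def inner_diff_right)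
  moreover have "W \<bullet> spectral R (eigvals Z) = eigvals W \<bullet> eigvals Z"
    using inner_spectral[OF oR, of W] eig_orth_conj_by[OF R] by simp
  ultimately show ne: "eig_orth Z \<inter> eig_orth W \<noteq> {}"
    using von_Neumann_trace[of W Z] von_Neumann_equality[of W Z] by force
  then obtain P where P: "P \<in> eig_orth Z" "P \<in> eig_orth W"
    by blast
  have oP: "orthogonal_matrix P" and Zs: "Z = spectral P (eigvals Z)"
    using P(1) unfolding eig_orth_iff by blast+
  have "th (eigvals Z) + eigvals W \<bullet> (z - eigvals Z) \<le> th z" if z: "z \<in> dm" for z
  proof -
    have "spectral P z \<in> dmS"
      using spectral_eval(1)[OF oP] z by simp
    from csubD(2)[OF W this] have "hS Z + W \<bullet> (spectral P z - Z) \<le> hS (spectral P z)" .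
    moreover have "W \<bullet> spectral P z = eigvals W \<bullet> z"
      using inner_spectral[OF oP, of W] eig_orth_conj_by[OF P(2)] by simp
    moreover have "W \<bullet> Z = eigvals W \<bullet> eigvals Z"
      using inner_spectral[OF oP, of W "eigvals Z", folded Zs] eig_orth_conj_by[OF P(2)] by simp
    ultimately show ?thesis
      using spectral_eval(2)[OF oP z] by (simp add: hS_def inner_diff_right)
  qed
  then show "eigvals W \<in> sub (eigvals Z)"
    using Z by (simp add: sub_def)
qed

end

section \<open>Tilt stability and strong monotonicity\<close>

lemma GDERIV_gradient:
  assumes "\<phi> differentiable at x"
  shows "GDERIV \<phi> x :> gradient \<phi> x"
proof -
  obtain D where D: "(\<phi> has_derivative D) (at x)"
    using assms by (auto simp: differentiable_def)
  then have lin: "linear D"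
    by (simp add: has_derivative_linear)
  define v where "v = (\<Sum>i\<in>Basis. D i *\<^sub>R i)"
  have "D h = h \<bullet> v" for h
  proof -
    have "D h = D (\<Sum>i\<in>Basis. (h \<bullet> i) *\<^sub>R i)"
      by (simp add: euclidean_representation)
    also have "\<dots> = (\<Sum>i\<in>Basis. (h \<bullet> i) * D i)"
      by (simp add: linear_sum[OF lin] linear_scale[OF lin])
    also have "\<dots> = h \<bullet> v"
      by (simp add: v_def inner_sum_right mult.commute)
    finally show ?thesis .
  qed
  then have v: "GDERIV \<phi> x :> v"
    using D by (simp add: gderiv_def ext[of D "\<lambda>h. h \<bullet> v"])
  have "w = v" if "GDERIV \<phi> x :> w" for w
  proof -
    have "(\<lambda>h. h \<bullet> w) = (\<lambda>h. h \<bullet> v)"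
      using that v has_derivative_unique unfolding gderiv_def by blast
    then have "(w - v) \<bullet> w = (w - v) \<bullet> v"
      by metis
    then show ?thesis
      by (metis inner_diff_right inner_eq_zero_iff right_minus_eq)
  qed
  with v show ?thesis
    unfolding gradient_def by (metis theI)
qed

locale smooth_function =
  fixes \<phi> :: "'a::euclidean_space \<Rightarrow> real"
  assumes smooth: "C2_smooth \<phi>"
begin

abbreviation G :: "'a \<Rightarrow> 'a"
  where "G \<equiv> gradient \<phi>"

lemma has_derivative_phi: "(\<phi> has_derivative (\<lambda>h. h \<bullet> G x)) (at x)"
  using GDERIV_gradient[of \<phi> x] smooth unfolding C2_smooth_def gderiv_def by blast

lemma has_derivative_G: "(G has_derivative hessian \<phi> x) (at x)"
  using smooth by (simp add: C2_smooth_def hessian_def frechet_derivative_works[symmetric])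

lemma bounded_linear_hessian: "bounded_linear (hessian \<phi> x)"
  using has_derivative_G has_derivative_bounded_linear by blast

lemma hessian_linear:
  "hessian \<phi> x (u + v) = hessian \<phi> x u + hessian \<phi> x v"
  "hessian \<phi> x (r *\<^sub>R u) = r *\<^sub>R hessian \<phi> x u"
  "hessian \<phi> x 0 = 0"
  using bounded_linear.linear[OF bounded_linear_hessian, of x]
  by (simp_all add: linear_add linear_scale linear_0)

lemma continuous_phi: "continuous_on S \<phi>"
  by (rule has_derivative_continuous_on[of _ _ "\<lambda>x h. h \<bullet> G x"])
    (rule has_derivative_at_withinI[OF has_derivative_phi])

lemma continuous_G: "continuous_on S G"
  by (rule has_derivative_continuous_on[of _ _ "\<lambda>x. hessian \<phi> x"])
    (rule has_derivative_at_withinI[OF has_derivative_G])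

lemma tendsto_G [tendsto_intros]: "(Z \<longlongrightarrow> x) F \<Longrightarrow> ((\<lambda>k. G (Z k)) \<longlongrightarrow> G x) F"
  using continuous_G[of UNIV] by (simp add: continuous_on_eq_continuous_at isCont_tendsto_compose)

lemma Blinfun_hessian: "blinfun_apply (Blinfun (hessian \<phi> x)) = hessian \<phi> x"
  by (rule bounded_linear_Blinfun_apply[OF bounded_linear_hessian])

lemma tendsto_hessian:
  assumes "(Z \<longlongrightarrow> x) F"
  shows "((\<lambda>k. hessian \<phi> (Z k) h) \<longlongrightarrow> hessian \<phi> x h) F"
proof -
  have "isCont (\<lambda>x. Blinfun (hessian \<phi> x)) x"
    using smooth by (simp add: C2_smooth_def continuous_on_eq_continuous_at)
  from isCont_tendsto_compose[OF this assms]
  have "((\<lambda>k. blinfun_apply (Blinfun (hessian \<phi> (Z k))) h) \<longlongrightarrow> blinfun_apply (Blinfun (hessian \<phi> x)) h) F"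
    by (intro tendsto_intros)
  then show ?thesis
    by (simp add: Blinfun_hessian)
qed

lemma strictly_differentiable:
  assumes "0 < e"
  obtains \<delta> where "0 < \<delta>"
    "\<And>u v. norm (u - x) < \<delta> \<Longrightarrow> norm (v - x) < \<delta> \<Longrightarrow> norm (G v - G u - hessian \<phi> x (v - u)) \<le> e * norm (v - u)"
proof -
  have "isCont (\<lambda>x. Blinfun (hessian \<phi> x)) x"
    using smooth by (simp add: C2_smooth_def continuous_on_eq_continuous_at)
  then obtain \<delta> where \<delta>: "0 < \<delta>" "\<And>z. dist z x < \<delta> \<Longrightarrow> dist (Blinfun (hessian \<phi> z)) (Blinfun (hessian \<phi> x)) < e"
    using assms unfolding continuous_at_eps_delta by blast
  show ?thesis
  proof (rule that[OF \<delta>(1)])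
    fix u v assume uv: "norm (u - x) < \<delta>" "norm (v - x) < \<delta>"
    have "norm (G v - G u - hessian \<phi> x (v - u)) \<le> norm (v - u) * e"
    proof (rule differentiable_bound_linearization[where S = "ball x \<delta>" and f = G and f' = "hessian \<phi>" and ?x0.0 = x])
      fix t :: real assume t: "t \<in> {0..1}"
      have "u \<in> ball x \<delta>" "v \<in> ball x \<delta>"
        using uv by (simp_all add: dist_norm norm_minus_commute)
      then have "(1 - t) *\<^sub>R u + t *\<^sub>R v \<in> ball x \<delta>"
        using t convexD_alt[OF convex_ball, of u x \<delta> v t] by simp
      then show "u + t *\<^sub>R (v - u) \<in> ball x \<delta>"
        by (simp add: algebra_simps)
    next
      fix z assume "z \<in> ball x \<delta>"
      then have "norm (Blinfun (hessian \<phi> z) - Blinfun (hessian \<phi> x)) < e"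
        using \<delta>(2)[of z] by (simp add: dist_norm norm_minus_commute)
      then show "onorm (hessian \<phi> z - hessian \<phi> x) \<le> e"
        by (simp add: norm_blinfun.rep_eq minus_blinfun.rep_eq Blinfun_hessian fun_diff_def)
    qed (use \<delta>(1) has_derivative_at_withinI[OF has_derivative_G] in auto)
    then show "norm (G v - G u - hessian \<phi> x (v - u)) \<le> e * norm (v - u)"
      by (simp add: mult.commute)
  qed
qed

lemma G_locally_Lipschitz:
  obtains B \<delta> where "0 < \<delta>" "0 < B"
    "\<And>u v. norm (u - x) < \<delta> \<Longrightarrow> norm (v - x) < \<delta> \<Longrightarrow> norm (G v - G u) \<le> B * norm (v - u)"
proof -
  obtain \<delta> where \<delta>: "0 < \<delta>"
    "\<And>u v. norm (u - x) < \<delta> \<Longrightarrow> norm (v - x) < \<delta> \<Longrightarrow> norm (G v - G u - hessian \<phi> x (v - u)) \<le> 1 * norm (v - u)"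
    using strictly_differentiable[of 1 x] by auto
  obtain B where B: "0 < B" "\<And>h. norm (hessian \<phi> x h) \<le> norm h * B"
    using bounded_linear.pos_bounded[OF bounded_linear_hessian] by blast
  show ?thesis
  proof (rule that[OF \<delta>(1)])
    show "0 < B + 1" using B(1) by simp
    fix u v assume "norm (u - x) < \<delta>" "norm (v - x) < \<delta>"
    from \<delta>(2)[OF this] B(2)[of "v - u"] norm_triangle_sub[of "G v - G u" "hessian \<phi> x (v - u)"]
    show "norm (G v - G u) \<le> (B + 1) * norm (v - u)"
      by (simp add: algebra_simps)
  qed
qed

text \<open>Passes from an inequality along a ray with error o(s) to its first-order part; it serves
  both regular subgradients and minimizers.\<close>

lemma first_order_limit:
  assumes "\<And>e. 0 < e \<Longrightarrow> \<forall>\<^sub>F s in at_right 0. - e * s \<le> \<phi> (x + s *\<^sub>R D) - \<phi> x + s * A"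
  shows "0 \<le> D \<bullet> G x + A"
proof (rule field_le_epsilon)
  fix e :: real assume e: "0 < e"
  have "((\<lambda>s. \<phi> (x + s *\<^sub>R D)) has_derivative (\<lambda>s. (s *\<^sub>R D) \<bullet> G x)) (at 0)"
    by (rule has_derivative_compose[of "\<lambda>s. x + s *\<^sub>R D" "\<lambda>s. s *\<^sub>R D" 0 UNIV \<phi> "\<lambda>h. h \<bullet> G x"])
      (auto intro!: derivative_eq_intros simp: has_derivative_phi)
  then have "((\<lambda>s. \<phi> (x + s *\<^sub>R D)) has_real_derivative (D \<bullet> G x)) (at 0)"
    by (simp add: has_field_derivative_def mult_commute_abs)
  then have "((\<lambda>s. (\<phi> (x + s *\<^sub>R D) - \<phi> x) / s) \<longlongrightarrow> D \<bullet> G x) (at 0)"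
    by (simp add: has_field_derivative_iff)
  then have "((\<lambda>s. (\<phi> (x + s *\<^sub>R D) - \<phi> x) / s) \<longlongrightarrow> D \<bullet> G x) (at_right 0)"
    by (rule tendsto_mono[OF at_le, rotated]) simp
  then have lim: "((\<lambda>s. (\<phi> (x + s *\<^sub>R D) - \<phi> x) / s + A + e) \<longlongrightarrow> D \<bullet> G x + A + e) (at_right 0)"
    by (intro tendsto_intros)
  have "\<forall>\<^sub>F s in at_right 0. 0 \<le> (\<phi> (x + s *\<^sub>R D) - \<phi> x) / s + A + e"
    using assms[OF e] eventually_at_right_less[of "0 :: real"]
  proof eventually_elim
    case (elim s)
    then have "0 \<le> (\<phi> (x + s *\<^sub>R D) - \<phi> x + s * A + e * s) / s"
      by simp
    also have "\<dots> = (\<phi> (x + s *\<^sub>R D) - \<phi> x) / s + A + e"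
      using elim(2) by (simp add: add_divide_distrib)
    finally show ?case .
  qed
  from tendsto_lowerbound[OF lim this] show "0 \<le> D \<bullet> G x + A + e"
    by simp
qed

text \<open>The second difference \<open>q\<close> is symmetric in its directions. The mean value
  theorem along \<open>u\<close> and strict differentiability of the gradient along \<open>v\<close>
  identify the limit of \<open>q u v t / t^2\<close>.\<close>

lemma hessian_symmetric: "hessian \<phi> x u \<bullet> v = hessian \<phi> x v \<bullet> u"
proof -
  define q where "q u v t = \<phi> (x + t *\<^sub>R u + t *\<^sub>R v) - \<phi> (x + t *\<^sub>R u) - \<phi> (x + t *\<^sub>R v) + \<phi> x" for u v t
  have lim: "((\<lambda>t. q u v t / t\<^sup>2) \<longlongrightarrow> hessian \<phi> x v \<bullet> u) (at_right 0)" for u v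
  proof (rule tendstoI)
    fix e :: real assume e: "0 < e"
    define N where "N = norm u * norm v + 1"
    have N: "0 < N"
      by (simp add: N_def add_nonneg_pos)
    obtain \<delta> where \<delta>: "0 < \<delta>"
      "\<And>z w. norm (z - x) < \<delta> \<Longrightarrow> norm (w - x) < \<delta> \<Longrightarrow> norm (G w - G z - hessian \<phi> x (w - z)) \<le> (e / (2 * N)) * norm (w - z)"
      using strictly_differentiable[of "e / (2 * N)" x] e N by auto
    define M where "M = norm u + norm v + 1"
    have M: "0 < M"
      by (simp add: M_def add_nonneg_pos)
    have "\<forall>\<^sub>F t in at_right 0. t < \<delta> / M"
      unfolding eventually_at_right_field using \<delta>(1) M by (intro exI[of _ "\<delta> / M"]) auto
    then show "\<forall>\<^sub>F t in at_right 0. dist (q u v t / t\<^sup>2) (hessian \<phi> x v \<bullet> u) < e"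
      using eventually_at_right_less[of "0 :: real"]
    proof eventually_elim
      case (elim t)
      let ?h = "\<lambda>r. \<phi> (x + r *\<^sub>R u + t *\<^sub>R v) - \<phi> (x + r *\<^sub>R u)"
      have der: "(?h has_real_derivative (u \<bullet> G (x + r *\<^sub>R u + t *\<^sub>R v) - u \<bullet> G (x + r *\<^sub>R u))) (at r)" for r
      proof -
        have 1: "((\<lambda>r. \<phi> (w + r *\<^sub>R u)) has_derivative (\<lambda>s. (s *\<^sub>R u) \<bullet> G (w + r *\<^sub>R u))) (at r)" for w
          by (rule has_derivative_compose[of "\<lambda>s. w + s *\<^sub>R u" "\<lambda>s. s *\<^sub>R u" r UNIV \<phi> "\<lambda>h. h \<bullet> G (w + r *\<^sub>R u)"])
            (auto intro!: derivative_eq_intros simp: has_derivative_phi)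
        have 2: "((\<lambda>r. \<phi> (w + r *\<^sub>R u)) has_real_derivative (u \<bullet> G (w + r *\<^sub>R u))) (at r)" for w
          using 1[of w] by (simp add: has_field_derivative_def mult_commute_abs)
        from DERIV_diff[OF 2[of "x + t *\<^sub>R v"] 2[of x]] show ?thesis
          by (simp add: add_ac)
      qed
      obtain r where r: "0 < r" "r < t"
        "?h t - ?h 0 = (t - 0) * (u \<bullet> G (x + r *\<^sub>R u + t *\<^sub>R v) - u \<bullet> G (x + r *\<^sub>R u))"
        using MVT2[OF elim(2) der] by (elim exE conjE)
      have q: "q u v t = t * (u \<bullet> (G (x + r *\<^sub>R u + t *\<^sub>R v) - G (x + r *\<^sub>R u)))"
        using r(3) by (simp add: q_def inner_diff_right)
      have tM: "t * M < \<delta>"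
        using elim(1) M by (simp add: field_simps)
      have "norm (r *\<^sub>R u) \<le> t * norm u"
        using r by (simp add: mult_right_mono)
      moreover have "norm (t *\<^sub>R v) = t * norm v"
        using elim(2) by simp
      moreover have "t * norm u + t * norm v < \<delta>" "t * norm u < \<delta>"
        using tM elim(2) mult_nonneg_nonneg[OF less_imp_le[OF elim(2)] norm_ge_zero[of v]]
        unfolding M_def distrib_left mult_1_right by linarith+
      ultimately have "norm (r *\<^sub>R u + t *\<^sub>R v) < \<delta>" "norm (r *\<^sub>R u) < \<delta>"
        using norm_triangle_ineq[of "r *\<^sub>R u" "t *\<^sub>R v"] by linarith+
      then have "norm (G (x + r *\<^sub>R u + t *\<^sub>R v) - G (x + r *\<^sub>R u) - hessian \<phi> x (t *\<^sub>R v)) \<le> (e / (2 * N)) * norm (t *\<^sub>R v)"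
        using \<delta>(2)[of "x + r *\<^sub>R u" "x + r *\<^sub>R u + t *\<^sub>R v"] by (simp add: add.assoc)
      then have "norm u * norm (G (x + r *\<^sub>R u + t *\<^sub>R v) - G (x + r *\<^sub>R u) - hessian \<phi> x (t *\<^sub>R v)) \<le> norm u * ((e / (2 * N)) * (t * norm v))"
        using elim(2) by (intro mult_left_mono) auto
      with Cauchy_Schwarz_ineq2[of u "G (x + r *\<^sub>R u + t *\<^sub>R v) - G (x + r *\<^sub>R u) - hessian \<phi> x (t *\<^sub>R v)"]
      have "\<bar>u \<bullet> (G (x + r *\<^sub>R u + t *\<^sub>R v) - G (x + r *\<^sub>R u)) - t * (hessian \<phi> x v \<bullet> u)\<bar> \<le> (e / (2 * N)) * (t * (norm u * norm v))"
        by (simp add: inner_diff_right hessian_linear inner_commute[of u "hessian \<phi> x v"] mult_ac)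
      also have "\<dots> \<le> (e / (2 * N)) * (t * N)"
        using e N elim(2) by (intro mult_left_mono) (auto simp: N_def)
      also have "\<dots> < e * t"
        using e N elim(2) by simp
      finally have less: "\<bar>u \<bullet> (G (x + r *\<^sub>R u + t *\<^sub>R v) - G (x + r *\<^sub>R u)) - t * (hessian \<phi> x v \<bullet> u)\<bar> < e * t" .
      have "q u v t / t\<^sup>2 - hessian \<phi> x v \<bullet> u = (u \<bullet> (G (x + r *\<^sub>R u + t *\<^sub>R v) - G (x + r *\<^sub>R u)) - t * (hessian \<phi> x v \<bullet> u)) / t"
        using elim(2) by (simp add: q power2_eq_square diff_divide_distrib)
      then show ?case
        using less elim(2) by (simp add: dist_real_def pos_divide_less_eq)
    qed
  qed
  have "q u v = q v u"
    by (simp add: q_def fun_eq_iff add_ac)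
  then show ?thesis
    using tendsto_unique[OF trivial_limit_at_right_real lim[of u v]] lim[of v u] by simp
qed

end

text \<open>The sum rule for \<open>h\<close> and the indicator of the ball, by separating the open
  ball at negative heights from the region above \<open>h u - h z - w \<bullet> (u - z)\<close>.
  \<open>A\<close> is a normal vector of the ball at \<open>z\<close>; the last inequality makes it
  vanish when \<open>z\<close> is interior.\<close>

lemma convex_subgradient_ball:
  fixes C :: "'a::euclidean_space set"
  assumes C: "convex C" "convex_on C h" and X: "x0 \<in> C" and z: "z \<in> C" "norm (z - x0) \<le> \<gamma>" and \<gamma>: "0 < \<gamma>"
    and le: "\<And>u. u \<in> C \<Longrightarrow> norm (u - x0) \<le> \<gamma> \<Longrightarrow> h z + w \<bullet> (u - z) \<le> h u"
  obtains A where "w - A \<in> csub C h z" "\<gamma> * norm A \<le> A \<bullet> (z - x0)"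
proof -
  let ?g = "\<lambda>u. h u - h z - w \<bullet> (u - z)"
  let ?S = "ball x0 \<gamma> \<times> {..< (0 :: real)}" and ?T = "{(u, r). u \<in> C \<and> ?g u \<le> r}"
  have convS: "convex ?S"
    by (intro convex_Times convex_ball) simp
  have convT: "convex ?T"
    unfolding convex_alt
  proof (intro ballI allI impI)
    fix p q :: "'a \<times> real" and s :: real assume pq: "p \<in> ?T" "q \<in> ?T" and s: "0 \<le> s \<and> s \<le> 1"
    obtain u1 r1 u2 r2 where [simp]: "p = (u1, r1)" "q = (u2, r2)"
      by (cases p, cases q)
    have u: "u1 \<in> C" "?g u1 \<le> r1" "u2 \<in> C" "?g u2 \<le> r2"
      using pq by auto
    let ?u = "(1 - s) *\<^sub>R u1 + s *\<^sub>R u2"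
    have uC: "?u \<in> C"
      using convexD_alt[OF C(1) u(1,3)] s by simp
    have "?u - z = (1 - s) *\<^sub>R (u1 - z) + s *\<^sub>R (u2 - z)"
      by (simp add: algebra_simps)
    then have "w \<bullet> (?u - z) = (1 - s) * (w \<bullet> (u1 - z)) + s * (w \<bullet> (u2 - z))"
      by (simp add: inner_add_right)
    moreover have "h ?u \<le> (1 - s) * h u1 + s * h u2"
      using convex_onD[OF C(2) _ _ u(1,3), of s] s by simp
    moreover have "(1 - s) * h u1 + s * h u2 - h z - ((1 - s) * (w \<bullet> (u1 - z)) + s * (w \<bullet> (u2 - z))) = (1 - s) * ?g u1 + s * ?g u2"
      by (simp add: algebra_simps)
    moreover have "(1 - s) * ?g u1 + s * ?g u2 \<le> (1 - s) * r1 + s * r2"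
      using u s by (intro add_mono mult_left_mono) auto
    ultimately have "?g ?u \<le> (1 - s) * r1 + s * r2"
      by linarith
    with uC show "(1 - s) *\<^sub>R p + s *\<^sub>R q \<in> ?T"
      by simp
  qed
  have memT: "(u, r) \<in> ?T \<longleftrightarrow> u \<in> C \<and> ?g u \<le> r" for u r
    by simp
  have disj: "?S \<inter> ?T = {}"
  proof -
    have "\<not> ?g u \<le> r" if "u \<in> C" "u \<in> ball x0 \<gamma>" "r < 0" for u r
      using le[OF that(1)] that(2,3) by (simp add: dist_norm norm_minus_commute)
    then show ?thesis
      by auto
  qed
  have "(x0, -1) \<in> ?S" "(x0, ?g x0) \<in> ?T"
    using \<gamma> X by auto
  then obtain q k where q: "q \<noteq> 0" "\<And>s. s \<in> ?S \<Longrightarrow> q \<bullet> s \<le> k" "\<And>s. s \<in> ?T \<Longrightarrow> k \<le> q \<bullet> s"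
    using separating_hyperplane_sets[OF convS convT _ _ disj] by blast
  define A \<beta> where "A = fst q" and "\<beta> = snd q"
  have qS: "A \<bullet> u + \<beta> * r \<le> k" if "norm (u - x0) < \<gamma>" "r < 0" for u r
    using q(2)[of "(u, r)"] that by (simp add: A_def \<beta>_def inner_prod_def dist_norm norm_minus_commute)
  have qT: "k \<le> A \<bullet> u + \<beta> * r" if "u \<in> C" "?g u \<le> r" for u r
    using q(3)[of "(u, r)"] that by (simp add: A_def \<beta>_def inner_prod_def)
  have \<beta>0: "0 \<le> \<beta>"
  proof (rule ccontr)
    assume neg: "\<not> 0 \<le> \<beta>"
    define r where "r = max (?g x0) ((k - A \<bullet> x0 - 1) / \<beta>)"
    have "k \<le> A \<bullet> x0 + \<beta> * r"
      using qT[OF X] by (simp add: r_def)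
    moreover have "\<beta> * r \<le> k - A \<bullet> x0 - 1"
    proof -
      have "(k - A \<bullet> x0 - 1) / \<beta> \<le> r"
        by (simp add: r_def)
      then show ?thesis
        using neg by (simp add: divide_le_eq mult.commute)
    qed
    ultimately show False by simp
  qed
  have bound: "A \<bullet> x0 + \<gamma> * norm A \<le> k"
  proof (rule field_le_epsilon)
    fix e :: real assume e: "0 < e"
    \<comment> \<open>Points of the open ball approach its support point in direction
      \<open>A\<close>; the shortfall \<delta> and the height \<open>r\<close> cost at most
      \<open>e / 2\<close> each.\<close>
    define \<delta> where "\<delta> = min (\<gamma> / 2) (e / (2 * (norm A + 1)))"
    have nA: "0 < norm A + 1"
      by (simp add: add_nonneg_pos)
    have \<delta>: "0 < \<delta>" "\<delta> < \<gamma>" "\<delta> * norm A \<le> e / 2"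
    proof -
      show "0 < \<delta>" "\<delta> < \<gamma>"
        using e \<gamma> nA by (simp_all add: \<delta>_def)
      have "\<delta> * norm A \<le> (e / (2 * (norm A + 1))) * (norm A + 1)"
        using e nA by (intro mult_mono) (auto simp: \<delta>_def)
      also have "\<dots> = e / 2"
        using nA by (simp add: field_simps)
      finally show "\<delta> * norm A \<le> e / 2" .
    qed
    define u where "u = x0 + (\<gamma> - \<delta>) *\<^sub>R sgn A"
    have "norm (u - x0) \<le> \<gamma> - \<delta>"
      using \<delta> by (simp add: u_def norm_sgn)
    then have "norm (u - x0) < \<gamma>"
      using \<delta>(1) by simp
    moreover define r where "r = - (e / (2 * (\<beta> + 1)))"
    moreover have "r < 0" "- (\<beta> * r) \<le> e / 2"
      using e \<beta>0 by (simp_all add: r_def field_simps)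
    ultimately have "A \<bullet> u \<le> k + e / 2"
      using qS[of u r] by simp
    moreover have "A \<bullet> sgn A = norm A"
      by (cases "A = 0") (simp_all add: sgn_div_norm power2_norm_eq_inner[symmetric] power2_eq_square)
    then have "A \<bullet> u = A \<bullet> x0 + (\<gamma> - \<delta>) * norm A"
      by (simp add: u_def inner_add_right)
    ultimately show "A \<bullet> x0 + \<gamma> * norm A \<le> k + e"
      using \<delta>(3) by (simp add: algebra_simps)
  qed
  \<comment> \<open>A vertical hyperplane cannot separate, because the centre of the ball belongs to
    \<open>C\<close>.\<close>
  have \<beta>: "0 < \<beta>"
  proof (rule ccontr)
    assume "\<not> 0 < \<beta>"
    with \<beta>0 have b0: "\<beta> = 0" by simp
    then have "k \<le> A \<bullet> x0"
      using qT[OF X order_refl] by simp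
    with bound have "\<gamma> * norm A \<le> 0"
      by simp
    then have "A = 0"
      using \<gamma> by (simp add: mult_le_0_iff)
    with b0 q(1) show False
      by (simp add: A_def \<beta>_def prod_eq_iff)
  qed
  have kz: "k = A \<bullet> z"
  proof (rule antisym)
    show "k \<le> A \<bullet> z"
      using qT[OF z(1), of 0] by simp
    have "A \<bullet> (z - x0) \<le> norm A * norm (z - x0)"
      by (rule norm_cauchy_schwarz)
    also have "\<dots> \<le> norm A * \<gamma>"
      using z(2) by (intro mult_left_mono) auto
    finally show "A \<bullet> z \<le> k"
      using bound by (simp add: inner_diff_right mult.commute)
  qed
  show ?thesis
  proof (rule that[of "(1 / \<beta>) *\<^sub>R A"])
    show "w - (1 / \<beta>) *\<^sub>R A \<in> csub C h z"
    proof (rule csubI[OF z(1)])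
      fix u assume u: "u \<in> C"
      have "A \<bullet> z \<le> A \<bullet> u + \<beta> * ?g u"
        using qT[OF u order_refl] kz by simp
      then have "(A \<bullet> z - A \<bullet> u) / \<beta> \<le> ?g u"
        using \<beta> by (simp add: pos_divide_le_eq mult.commute)
      then show "h z + (w - (1 / \<beta>) *\<^sub>R A) \<bullet> (u - z) \<le> h u"
        by (simp add: inner_diff_left inner_diff_right diff_divide_distrib)
    qed
    have "\<gamma> * norm A \<le> A \<bullet> (z - x0)"
      using bound kz by (simp add: inner_diff_right)
    then have "(\<gamma> * norm A) / \<beta> \<le> (A \<bullet> (z - x0)) / \<beta>"
      using \<beta> by (intro divide_right_mono) auto
    then show "\<gamma> * norm ((1 / \<beta>) *\<^sub>R A) \<le> ((1 / \<beta>) *\<^sub>R A) \<bullet> (z - x0)"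
      using \<beta> by simp
  qed
qed

section \<open>Smooth plus convex functions\<close>

locale composite = smooth_function \<phi>
  for \<phi> :: "'a::euclidean_space \<Rightarrow> real" +
  fixes C :: "'a set" and h :: "'a \<Rightarrow> real" and f :: "'a \<Rightarrow> ereal"
  assumes closed_C: "closed C" and convex_C: "convex C" and convex_h: "convex_on C h"
    and continuous_h: "continuous_on C h"
    and f_def: "\<And>x. f x = ereal (\<phi> x) + (if x \<in> C then ereal (h x) else \<infinity>)"
begin

lemma csub_limit:
  assumes Z: "Z \<longlonglongrightarrow> x" and W: "W \<longlonglongrightarrow> w" and sub: "\<And>k. W k \<in> csub C h (Z k)"
  shows "w \<in> csub C h x"
proof (rule csubI)
  have ZC: "\<And>k. Z k \<in> C"
    using csubD(1)[OF sub] .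
  show x: "x \<in> C"
    using closed_sequentially[OF closed_C ZC Z] .
  fix z assume z: "z \<in> C"
  have "(\<lambda>k. h (Z k)) \<longlonglongrightarrow> h x"
    using continuous_on_tendsto_compose[OF continuous_h Z x] ZC by simp
  then have "(\<lambda>k. h (Z k) + W k \<bullet> (z - Z k)) \<longlonglongrightarrow> h x + w \<bullet> (z - x)"
    by (intro tendsto_intros W Z)
  then show "h x + w \<bullet> (z - x) \<le> h z"
    by (rule LIMSEQ_le_const2) (use csubD(2)[OF sub z] in auto)
qed

lemma finite_f_iff: "\<bar>f x\<bar> \<noteq> \<infinity> \<longleftrightarrow> x \<in> C"
  by (simp add: f_def)

lemma convex_h_segment:
  assumes "x \<in> C" "z \<in> C" "0 \<le> s" "s \<le> 1"
  shows "x + s *\<^sub>R (z - x) \<in> C" "h (x + s *\<^sub>R (z - x)) \<le> h x + s * (h z - h x)"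
proof -
  have eq: "x + s *\<^sub>R (z - x) = (1 - s) *\<^sub>R x + s *\<^sub>R z"
    by (simp add: algebra_simps)
  show "x + s *\<^sub>R (z - x) \<in> C"
    unfolding eq using convexD_alt[OF convex_C] assms by simp
  show "h (x + s *\<^sub>R (z - x)) \<le> h x + s * (h z - h x)"
    unfolding eq using convex_onD[OF convex_h assms(3,4,1,2)] by (simp add: algebra_simps)
qed

text \<open>The liminf is tested along the segment to \<open>z\<close>; convexity bounds the
  increment of \<open>h\<close> there by a multiple of \<open>h z - h x\<close>.\<close>

lemma regular_subdifferential_csub:
  assumes "v \<in> regular_subdifferential f x"
  shows "v - G x \<in> csub C h x"
proof (rule csubI)
  show x: "x \<in> C"
    using assms finite_f_iff by (simp add: regular_subdifferential_def)
  fix z assume z: "z \<in> C"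
  show "h x + (v - G x) \<bullet> (z - x) \<le> h z"
  proof (cases "z = x")
    case False
    let ?D = "z - x"
    have Dpos: "0 < norm ?D"
      using False by simp
    have "0 \<le> ?D \<bullet> G x + (h z - h x - v \<bullet> ?D)"
    proof (rule first_order_limit)
      fix e :: real assume e: "0 < e"
      let ?q = "\<lambda>y. (f y - f x - ereal (v \<bullet> (y - x))) / ereal (norm (y - x))"
      have "ereal (- (e / norm ?D)) < 0"
        using e Dpos by simp
      also have "0 \<le> Liminf (at x) ?q"
        using assms by (simp add: regular_subdifferential_def)
      finally have ev: "\<forall>\<^sub>F y in at x. ereal (- (e / norm ?D)) < ?q y"
        by (rule less_LiminfD)
      have "filterlim (\<lambda>s. x + s *\<^sub>R ?D) (at x) (at_right 0)"
      proof (rule filterlim_atI)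
        have "((\<lambda>s. x + s *\<^sub>R ?D) \<longlongrightarrow> x + 0 *\<^sub>R ?D) (at_right 0)"
          by (intro tendsto_intros)
        then show "((\<lambda>s. x + s *\<^sub>R ?D) \<longlongrightarrow> x) (at_right 0)"
          by simp
        show "\<forall>\<^sub>F s in at_right 0. x + s *\<^sub>R ?D \<noteq> x"
          using eventually_at_right_less[of "0 :: real"] by eventually_elim (use False in simp)
      qed
      from eventually_compose_filterlim[OF ev this]
      have "\<forall>\<^sub>F s in at_right 0. ereal (- (e / norm ?D)) < ?q (x + s *\<^sub>R ?D)" .
      moreover have "\<forall>\<^sub>F s in at_right 0. s < (1 :: real)"
        unfolding eventually_at_right_field by (intro exI[of _ 1]) auto
      ultimately show "\<forall>\<^sub>F s in at_right 0. - e * s \<le> \<phi> (x + s *\<^sub>R ?D) - \<phi> x + s * (h z - h x - v \<bullet> ?D)"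
        using eventually_at_right_less[of "0 :: real"]
      proof eventually_elim
        case (elim s)
        let ?y = "x + s *\<^sub>R ?D"
        have y: "?y \<in> C" "h ?y \<le> h x + s * (h z - h x)"
          using convex_h_segment[OF x z, of s] elim by auto
        have ny: "norm (?y - x) = s * norm ?D"
          using elim(3) by simp
        have "?q ?y = ereal ((\<phi> ?y + h ?y - (\<phi> x + h x) - v \<bullet> (?y - x)) / norm (?y - x))"
          using y(1) x Dpos elim(3) by (simp add: f_def)
        with elim(1) have "- (e / norm ?D) < (\<phi> ?y + h ?y - (\<phi> x + h x) - v \<bullet> (?y - x)) / (s * norm ?D)"
          unfolding ny by simp
        then have "- (e / norm ?D) * (s * norm ?D) < \<phi> ?y + h ?y - (\<phi> x + h x) - v \<bullet> (?y - x)"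
          using Dpos elim(3) by (simp add: pos_less_divide_eq)
        then have "- e * s < \<phi> ?y + h ?y - (\<phi> x + h x) - s * (v \<bullet> ?D)"
          using Dpos by simp
        with y(2) show ?case
          by (simp add: algebra_simps)
      qed
    qed
    then show ?thesis
      by (simp add: inner_diff_left inner_commute[of "G x"])
  qed simp
qed

lemma stationary_csub:
  assumes "0 \<in> limiting_subdifferential f x"
  shows "- G x \<in> csub C h x"
proof -
  obtain xs vs where *: "xs \<longlonglongrightarrow> x" "vs \<longlonglongrightarrow> 0" "\<And>k. vs k \<in> regular_subdifferential f (xs k)"
    using assms by (auto simp: limiting_subdifferential_def)
  have "(\<lambda>k. vs k - G (xs k)) \<longlonglongrightarrow> 0 - G x"
    by (intro tendsto_intros *)
  from csub_limit[OF *(1) this regular_subdifferential_csub[OF *(3)]] show ?thesis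
    by simp
qed

text \<open>Localized in the graph: base points are close to \<open>x\<close> and subgradients are
  close to \<open>- G x\<close>.\<close>

definition strongly_monotone_near :: "'a \<Rightarrow> bool"
  where "strongly_monotone_near x \<longleftrightarrow> (\<exists>\<kappa>>0. \<exists>\<delta>>0. \<forall>z1 w1 z2 w2.
    w1 \<in> csub C h z1 \<and> w2 \<in> csub C h z2 \<and> norm (z1 - x) < \<delta> \<and> norm (z2 - x) < \<delta> \<and>
    norm (w1 + G x) < \<delta> \<and> norm (w2 + G x) < \<delta> \<longrightarrow>
    \<kappa> * (norm (z1 - z2))\<^sup>2 \<le> (G z1 - G z2 + w1 - w2) \<bullet> (z1 - z2))"

lemma tilt_argmin_iff:
  assumes "x \<in> C" "0 < \<gamma>"
  shows "z \<in> tilt_argmin f x \<gamma> v \<longleftrightarrow> z \<in> C \<and> norm (z - x) \<le> \<gamma> \<and>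
    (\<forall>u\<in>C. norm (u - x) \<le> \<gamma> \<longrightarrow> \<phi> z + h z - v \<bullet> z \<le> \<phi> u + h u - v \<bullet> u)"
proof
  assume "z \<in> tilt_argmin f x \<gamma> v"
  then have z: "dist x z \<le> \<gamma>" and min: "\<And>u. dist x u \<le> \<gamma> \<Longrightarrow> f z - ereal (v \<bullet> z) \<le> f u - ereal (v \<bullet> u)"
    by (auto simp: tilt_argmin_def)
  have zC: "z \<in> C"
  proof (rule ccontr)
    assume "z \<notin> C"
    with min[of x] assms show False
      by (simp add: f_def)
  qed
  have "\<phi> z + h z - v \<bullet> z \<le> \<phi> u + h u - v \<bullet> u" if "u \<in> C" "norm (u - x) \<le> \<gamma>" for u
    using min[of u] that zC by (simp add: f_def dist_norm norm_minus_commute)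
  with z zC show "z \<in> C \<and> norm (z - x) \<le> \<gamma> \<and>
    (\<forall>u\<in>C. norm (u - x) \<le> \<gamma> \<longrightarrow> \<phi> z + h z - v \<bullet> z \<le> \<phi> u + h u - v \<bullet> u)"
    by (simp add: dist_norm norm_minus_commute)
next
  assume *: "z \<in> C \<and> norm (z - x) \<le> \<gamma> \<and>
    (\<forall>u\<in>C. norm (u - x) \<le> \<gamma> \<longrightarrow> \<phi> z + h z - v \<bullet> z \<le> \<phi> u + h u - v \<bullet> u)"
  have "f z - ereal (v \<bullet> z) \<le> f u - ereal (v \<bullet> u)" if "dist x u \<le> \<gamma>" for u
    using * that by (cases "u \<in> C") (auto simp: f_def dist_norm norm_minus_commute)
  then show "z \<in> tilt_argmin f x \<gamma> v"
    using * by (simp add: tilt_argmin_def dist_norm norm_minus_commute)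
qed

lemma tilt_argmin_first_order:
  assumes x: "x \<in> C" "0 < \<gamma>" and z: "z \<in> tilt_argmin f x \<gamma> v" and u: "u \<in> C" "norm (u - x) \<le> \<gamma>"
  shows "h z + (v - G z) \<bullet> (u - z) \<le> h u"
proof -
  note * = z[unfolded tilt_argmin_iff[OF x]]
  have "0 \<le> (u - z) \<bullet> G z + (h u - h z - v \<bullet> (u - z))"
  proof (rule first_order_limit)
    fix e :: real assume e: "0 < e"
    have "\<forall>\<^sub>F s in at_right 0. s < (1 :: real)"
      unfolding eventually_at_right_field by (intro exI[of _ 1]) auto
    then show "\<forall>\<^sub>F s in at_right 0. - e * s \<le> \<phi> (z + s *\<^sub>R (u - z)) - \<phi> z + s * (h u - h z - v \<bullet> (u - z))"
      using eventually_at_right_less[of "0 :: real"]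
    proof eventually_elim
      case (elim s)
      let ?y = "z + s *\<^sub>R (u - z)"
      have y: "?y \<in> C" "h ?y \<le> h z + s * (h u - h z)"
        using convex_h_segment[of z u s] elim * u by auto
      have "?y \<in> cball x \<gamma>"
      proof -
        have "(1 - s) *\<^sub>R z + s *\<^sub>R u \<in> cball x \<gamma>"
          using convexD_alt[OF convex_cball, of z x \<gamma> u s] elim * u by (simp add: dist_norm norm_minus_commute)
        then show ?thesis
          by (simp add: algebra_simps)
      qed
      then have "\<phi> z + h z - v \<bullet> z \<le> \<phi> ?y + h ?y - v \<bullet> ?y"
        using * y(1) by (simp add: dist_norm norm_minus_commute)
      then have "0 \<le> \<phi> ?y - \<phi> z + s * (h u - h z - v \<bullet> (u - z))"
        using y(2) by (simp add: inner_add_right right_diff_distrib)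
      moreover have "- e * s \<le> 0"
        using e elim by simp
      ultimately show ?case
        by linarith
    qed
  qed
  then show ?thesis
    by (simp add: inner_diff_left inner_commute[of "G z"])
qed

lemma tilt_argmin_nonempty:
  assumes x: "x \<in> C" "0 < \<gamma>"
  shows "tilt_argmin f x \<gamma> v \<noteq> {}"
proof -
  have K: "compact (C \<inter> cball x \<gamma>)" and ne: "C \<inter> cball x \<gamma> \<noteq> {}"
    using closed_C x by (auto intro: closed_Int_compact)
  have cont: "continuous_on (C \<inter> cball x \<gamma>) (\<lambda>z. \<phi> z + h z - v \<bullet> z)"
    by (intro continuous_intros continuous_phi continuous_on_subset[OF continuous_h]) auto
  obtain z where "z \<in> C \<inter> cball x \<gamma>" "\<forall>u\<in>C \<inter> cball x \<gamma>. \<phi> z + h z - v \<bullet> z \<le> \<phi> u + h u - v \<bullet> u"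
    using continuous_attains_inf[OF K ne cont] by (elim bexE)
  then have "z \<in> tilt_argmin f x \<gamma> v"
    unfolding tilt_argmin_iff[OF x] by (simp add: dist_norm norm_minus_commute)
  then show ?thesis by blast
qed

text \<open>Compactness gives minimizers over the ball, stationary up to a normal vector
  \<open>A\<close>. Strong monotonicity against the pair at \<open>x\<close> pushes them into the
  open ball, which makes \<open>A\<close> vanish; applied to two minimizers it gives uniqueness and
  the modulus \<open>1 / \<kappa>\<close>.\<close>

lemma tilt_stable_of_strongly_monotone:
  assumes sub: "- G x \<in> csub C h x" and sm: "strongly_monotone_near x"
  shows "tilt_stable_local_minimizer f x"
proof -
  have x: "x \<in> C"
    using csubD(1)[OF sub] .
  obtain \<kappa> \<delta> where \<kappa>: "0 < \<kappa>" and \<delta>: "0 < \<delta>" and SM: "\<And>z1 w1 z2 w2.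
    w1 \<in> csub C h z1 \<Longrightarrow> w2 \<in> csub C h z2 \<Longrightarrow> norm (z1 - x) < \<delta> \<Longrightarrow> norm (z2 - x) < \<delta> \<Longrightarrow>
    norm (w1 + G x) < \<delta> \<Longrightarrow> norm (w2 + G x) < \<delta> \<Longrightarrow>
    \<kappa> * (norm (z1 - z2))\<^sup>2 \<le> (G z1 - G z2 + w1 - w2) \<bullet> (z1 - z2)"
    using sm unfolding strongly_monotone_near_def by blast
  obtain B \<delta>' where B: "0 < \<delta>'" "0 < B"
    "\<And>u v. norm (u - x) < \<delta>' \<Longrightarrow> norm (v - x) < \<delta>' \<Longrightarrow> norm (G v - G u) \<le> B * norm (v - u)"
    by (rule G_locally_Lipschitz[of x]) blast
  \<comment> \<open>With \<open>B * \<gamma>\<close> and the bound \<open>r\<close> on the tilt at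
    most \<open>\<delta> / 8\<close>, the terms \<open>v\<close>, \<open>G z - G x\<close> and
    \<open>A\<close> sum to at most \<open>\<delta> / 2\<close>. The bound
    \<open>r \<le> \<kappa> * \<gamma>\<close> keeps minimizers off the sphere.\<close>
  define \<gamma> where "\<gamma> = min (min (\<delta> / 2) (\<delta>' / 2)) (\<delta> / (8 * B))"
  have \<gamma>: "0 < \<gamma>" "\<gamma> < \<delta>" "\<gamma> < \<delta>'" "B * \<gamma> \<le> \<delta> / 8"
  proof -
    show "0 < \<gamma>" "\<gamma> < \<delta>" "\<gamma> < \<delta>'"
      using \<delta> B(1,2) by (auto simp: \<gamma>_def min_def)
    have "B * \<gamma> \<le> B * (\<delta> / (8 * B))"
      using B(2) by (intro mult_left_mono) (auto simp: \<gamma>_def)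
    then show "B * \<gamma> \<le> \<delta> / 8"
      using B(2) by simp
  qed
  define r where "r = min (\<kappa> * \<gamma>) (\<delta> / 8)"
  have r: "0 < r" "r \<le> \<kappa> * \<gamma>" "r \<le> \<delta> / 8"
    using \<kappa> \<gamma> \<delta> by (auto simp: r_def)
  have key: "v - G z \<in> csub C h z \<and> norm (z - x) < \<gamma> \<and> norm (v - G z + G x) < \<delta> \<and> \<kappa> * norm (z - x) \<le> norm v"
    if v: "norm v < r" and z: "z \<in> tilt_argmin f x \<gamma> v" for v z
  proof -
    note zprop = z[unfolded tilt_argmin_iff[OF x \<gamma>(1)]]
    obtain A where A: "v - G z - A \<in> csub C h z" "\<gamma> * norm A \<le> A \<bullet> (z - x)"
      by (rule convex_subgradient_ball[OF convex_C convex_h x _ _ \<gamma>(1) tilt_argmin_first_order[OF x \<gamma>(1) z]])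
        (use zprop in auto)
    have Gz: "norm (G z - G x) \<le> B * \<gamma>"
    proof -
      have "norm (G z - G x) \<le> B * norm (z - x)"
        using B(3)[of x z] zprop \<gamma>(3) B(1) by simp
      also have "\<dots> \<le> B * \<gamma>"
        using zprop B(2) by simp
      finally show ?thesis .
    qed
    have mono: "0 \<le> (v - G z - A + G x) \<bullet> (z - x)"
      using csub_monotone[OF A(1) sub] by simp
    \<comment> \<open>Monotonicity against the pair at \<open>x\<close>: the normal can only balance
      the tilt and the change of the gradient.\<close>
    have nA: "norm A \<le> norm v + B * \<gamma>"
    proof -
      have "A \<bullet> (z - x) \<le> (v - (G z - G x)) \<bullet> (z - x)"
        using mono by (simp add: inner_diff_left inner_add_left)
      also have "\<dots> \<le> norm (v - (G z - G x)) * norm (z - x)"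
        by (rule norm_cauchy_schwarz)
      also have "\<dots> \<le> (norm v + B * \<gamma>) * \<gamma>"
      proof (rule mult_mono)
        show "norm (v - (G z - G x)) \<le> norm v + B * \<gamma>"
          using norm_triangle_ineq4[of v "G z - G x"] Gz by simp
        show "norm (z - x) \<le> \<gamma>"
          using zprop by simp
        show "0 \<le> norm v + B * \<gamma>"
          using B(2) \<gamma>(1) by simp
      qed simp
      finally have "\<gamma> * norm A \<le> \<gamma> * (norm v + B * \<gamma>)"
        using A(2) by (simp add: mult.commute)
      then show ?thesis
        using \<gamma>(1) by simp
    qed
    have near: "norm (v - G z - A + G x) < \<delta>"
    proof -
      have eq: "v - G z - A + G x = v - (G z - G x) - A"
        by simp
      have "norm (v - G z - A + G x) \<le> norm v + norm (G z - G x) + norm A"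
        unfolding eq using norm_triangle_ineq4[of "v - (G z - G x)" A] norm_triangle_ineq4[of v "G z - G x"] by linarith
      then show ?thesis
        using Gz nA v r(3) \<gamma>(4) \<delta> by linarith
    qed
    have "\<kappa> * (norm (z - x))\<^sup>2 \<le> (G z - G x + (v - G z - A) - - G x) \<bullet> (z - x)"
      using zprop \<gamma> \<delta> near by (intro SM[OF A(1) sub]) auto
    also have "\<dots> = v \<bullet> (z - x) - A \<bullet> (z - x)"
      by (simp add: inner_diff_left inner_add_left)
    also have "\<dots> \<le> norm v * norm (z - x)"
      using A(2) norm_cauchy_schwarz[of v "z - x"] mult_nonneg_nonneg[OF less_imp_le[OF \<gamma>(1)] norm_ge_zero[of A]] by linarith
    finally have "norm (z - x) * (\<kappa> * norm (z - x)) \<le> norm (z - x) * norm v"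
      by (simp add: power2_eq_square mult_ac)
    then have grow: "\<kappa> * norm (z - x) \<le> norm v"
      by (cases "norm (z - x) = 0") auto
    then have "\<kappa> * norm (z - x) < \<kappa> * \<gamma>"
      using v r(2) by linarith
    then have zlt: "norm (z - x) < \<gamma>"
      using \<kappa> by simp
    have "\<gamma> * norm A \<le> norm A * norm (z - x)"
      using A(2) norm_cauchy_schwarz[of A "z - x"] by linarith
    then have "A = 0"
      using zlt by (auto simp: mult.commute[of \<gamma>] mult_le_cancel_left)
    then show ?thesis
      using A(1) near zlt grow by simp
  qed
  have lip: "\<kappa> * norm (z1 - z2) \<le> norm (v1 - v2)"
    if "norm v1 < r" "z1 \<in> tilt_argmin f x \<gamma> v1" "norm v2 < r" "z2 \<in> tilt_argmin f x \<gamma> v2" for v1 z1 v2 z2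
  proof -
    have "\<kappa> * (norm (z1 - z2))\<^sup>2 \<le> (G z1 - G z2 + (v1 - G z1) - (v2 - G z2)) \<bullet> (z1 - z2)"
      using key[OF that(1,2)] key[OF that(3,4)] \<gamma> by (intro SM) auto
    also have "\<dots> = (v1 - v2) \<bullet> (z1 - z2)"
      by simp
    also have "\<dots> \<le> norm (v1 - v2) * norm (z1 - z2)"
      by (rule norm_cauchy_schwarz)
    finally have "norm (z1 - z2) * (\<kappa> * norm (z1 - z2)) \<le> norm (z1 - z2) * norm (v1 - v2)"
      by (simp add: power2_eq_square mult_ac)
    then show ?thesis
      by (cases "norm (z1 - z2) = 0") auto
  qed
  define s where "s v = (SOME z. z \<in> tilt_argmin f x \<gamma> v)" for v
  have s: "s v \<in> tilt_argmin f x \<gamma> v" for v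
    unfolding s_def using tilt_argmin_nonempty[OF x \<gamma>(1)] by (simp add: some_in_eq)
  have single: "tilt_argmin f x \<gamma> v = {s v}" if "norm v < r" for v
  proof -
    have "z = s v" if "z \<in> tilt_argmin f x \<gamma> v" for z
      using lip[OF \<open>norm v < r\<close> that \<open>norm v < r\<close> s] \<kappa> by (simp add: mult_le_0_iff)
    then show ?thesis
      using s by blast
  qed
  have "s 0 = x"
    using key[of 0 "s 0"] s r(1) \<kappa> by (simp add: mult_le_0_iff)
  moreover have "(1 / \<kappa>)-lipschitz_on (ball 0 r) s"
  proof (rule lipschitz_onI)
    fix v1 v2 :: 'a assume "v1 \<in> ball 0 r" "v2 \<in> ball 0 r"
    then have "\<kappa> * norm (s v1 - s v2) \<le> norm (v1 - v2)"
      by (intro lip s) auto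
    then show "dist (s v1) (s v2) \<le> 1 / \<kappa> * dist v1 v2"
      using \<kappa> by (simp add: dist_norm field_simps)
  qed (use \<kappa> in simp)
  ultimately show ?thesis
    unfolding tilt_stable_local_minimizer_def finite_f_iff
    using x \<gamma>(1) r(1) single[of 0] single
    by (intro conjI exI[of _ \<gamma>] exI[of _ "ball 0 r"] exI[of _ s] exI[of _ "1 / \<kappa>"]) auto
qed

end

context composite
begin

text \<open>The Lipschitz map \<open>s\<close> speaks only of minimizers, whereas a nearby pair of
  the graph is merely stationary. The facts \<open>solve\<close> and \<open>small\<close> show that
  such a pair is a minimizer. Lipschitz dependence then yields uniform quadratic growth, and two
  growth inequalities add up to strong monotonicity.\<close>

lemma strongly_monotone_of_tilt_stable:
  assumes sub: "- G x \<in> csub C h x" and tilt: "tilt_stable_local_minimizer f x"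
  shows "strongly_monotone_near x"
proof -
  have x: "x \<in> C"
    using csubD(1)[OF sub] .
  obtain \<gamma> U s L0 where \<gamma>: "0 < \<gamma>" and s0: "tilt_argmin f x \<gamma> 0 = {x}" and U: "open U" "0 \<in> U"
    and arg: "\<forall>v\<in>U. tilt_argmin f x \<gamma> v = {s v}" and lip0: "L0-lipschitz_on U s"
    using tilt unfolding tilt_stable_local_minimizer_def by blast
  obtain r0 where r0: "0 < r0" "ball 0 r0 \<subseteq> U"
    using openE[OF U] by blast
  have sarg: "s v \<in> tilt_argmin f x \<gamma> v" if "norm v < r0" for v
    using arg r0(2) that by force
  have sx: "s 0 = x"
    using arg U(2) s0 by simp
  define L where "L = L0 + 1"
  have L: "0 < L"
    using lipschitz_on_nonneg[OF lip0] by (simp add: L_def)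
  have lip: "norm (s v - s w) \<le> L * norm (v - w)" if "norm v < r0" "norm w < r0" for v w
  proof -
    have "v \<in> U" "w \<in> U"
      using r0(2) that by auto
    then have "norm (s v - s w) \<le> L0 * norm (v - w)"
      using lipschitz_onD[OF lip0] by (simp add: dist_norm)
    also have "\<dots> \<le> L * norm (v - w)"
      by (simp add: L_def mult_right_mono)
    finally show ?thesis .
  qed
  obtain B \<delta>' where B: "0 < \<delta>'" "0 < B"
    "\<And>u v. norm (u - x) < \<delta>' \<Longrightarrow> norm (v - x) < \<delta>' \<Longrightarrow> norm (G v - G u) \<le> B * norm (v - u)"
    by (rule G_locally_Lipschitz[of x]) blast
  define r1 where "r1 = min (r0 / 2) (min (\<gamma> / (2 * L)) (\<delta>' / (2 * L)))"
  have r1: "0 < r1" "r1 < r0" "L * r1 < \<gamma>" "L * r1 < \<delta>'"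
  proof -
    show "0 < r1" "r1 < r0"
      using r0 \<gamma> B L by (auto simp: r1_def min_def)
    have "r1 \<le> \<gamma> / (2 * L)" "r1 \<le> \<delta>' / (2 * L)"
      by (auto simp: r1_def)
    then have "L * r1 \<le> L * (\<gamma> / (2 * L))" "L * r1 \<le> L * (\<delta>' / (2 * L))"
      using L by (simp_all only: mult_left_mono less_imp_le)
    then show "L * r1 < \<gamma>" "L * r1 < \<delta>'"
      using L \<gamma> B(1) by auto
  qed
  define F where "F z = \<phi> z + h z" for z
  \<comment> \<open>For small tilts this is the conjugate of \<open>F\<close> restricted to the
    ball; \<open>s v\<close> is a subgradient of it at \<open>v\<close>, see
    \<open>m_lower\<close>.\<close>
  define m where "m v = v \<bullet> s v - F (s v)" for v
  have sC: "s v \<in> C" "norm (s v - x) \<le> \<gamma>" if "norm v < r0" for v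
    using sarg[OF that] by (simp_all add: tilt_argmin_iff[OF x \<gamma>])
  have opt: "F (s v) - v \<bullet> s v \<le> F z - v \<bullet> z" if "norm v < r0" "z \<in> C" "norm (z - x) \<le> \<gamma>" for v z
    using sarg[OF that(1)] that(2,3) by (simp add: tilt_argmin_iff[OF x \<gamma>] F_def)
  have m_lower: "s v \<bullet> (w - v) \<le> m w - m v" if "norm v < r0" "norm w < r0" for v w
    using opt[OF that(2) sC[OF that(1)]] by (simp add: m_def inner_diff_right inner_commute)
  have near_s: "norm (s v - x) \<le> L * norm v" if "norm v < r0" for v
    using lip[OF that, of 0] r0(1) by (simp add: sx)
  \<comment> \<open>Larger than the Lipschitz constant of \<open>G\<close> near \<open>x\<close>, so
    that adding \<rho> times the identity to \<open>G\<close> makes it strongly monotone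
    there.\<close>
  define \<rho> where "\<rho> = B + 1"
  have \<rho>: "0 < \<rho>" "B < \<rho>"
    using B(2) by (simp_all add: \<rho>_def)
  have cont_m: "continuous_on (cball 0 r1) m"
  proof -
    have cs: "continuous_on (cball 0 r1) s"
      using lipschitz_on_continuous_on[OF lip0] by (rule continuous_on_subset) (use r0(2) r1(2) in force)
    have im: "s ` cball 0 r1 \<subseteq> C"
      using sC(1) r1(2) by force
    show ?thesis
      unfolding m_def F_def
      by (intro continuous_intros cs continuous_on_compose2[OF continuous_phi[of UNIV] cs]
          continuous_on_compose2[OF continuous_h cs im]) auto
  qed
  \<comment> \<open>The equation is the stationarity condition of the strongly convex
    \<open>\<Psi>\<close>; minimizing it over a compact ball replaces a surjectivity theorem for
    monotone maps.\<close>
  have solve: "\<exists>v'. norm v' < r1 \<and> v' + \<rho> *\<^sub>R s v' = c" if c: "2 * norm (c - \<rho> *\<^sub>R x) < r1" for c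
  proof -
    define \<Psi> where "\<Psi> v = v \<bullet> v / 2 + \<rho> * m v - c \<bullet> v" for v
    have cont: "continuous_on (cball 0 r1) \<Psi>"
      unfolding \<Psi>_def by (intro continuous_intros cont_m) auto
    have ne: "cball (0 :: 'a) r1 \<noteq> {}"
      using r1(1) by simp
    obtain v where v: "v \<in> cball 0 r1" "\<forall>w\<in>cball 0 r1. \<Psi> v \<le> \<Psi> w"
      using continuous_attains_inf[OF compact_cball ne cont] by blast
    have vr0: "norm v < r0"
      using v(1) r1(2) by simp
    have "\<Psi> v \<le> \<Psi> 0"
      using v(2) r1(1) by simp
    then have "v \<bullet> v / 2 + \<rho> * (m v - m 0) \<le> c \<bullet> v"
      by (simp add: \<Psi>_def right_diff_distrib)
    moreover have "\<rho> * (x \<bullet> v) \<le> \<rho> * (m v - m 0)"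
      using m_lower[of 0 v] vr0 r0(1) \<rho>(1) by (simp add: sx)
    ultimately have "v \<bullet> v / 2 \<le> (c - \<rho> *\<^sub>R x) \<bullet> v"
      by (simp add: inner_diff_left)
    also have "\<dots> \<le> norm (c - \<rho> *\<^sub>R x) * norm v"
      by (rule norm_cauchy_schwarz)
    finally have "norm v * norm v \<le> norm v * (2 * norm (c - \<rho> *\<^sub>R x))"
      by (simp add: power2_norm_eq_inner[symmetric] power2_eq_square mult_ac)
    then have "norm v \<le> 2 * norm (c - \<rho> *\<^sub>R x)"
      by (cases "norm v = 0") auto
    with c have vr1: "norm v < r1"
      by simp
    define D where "D = c - v - \<rho> *\<^sub>R s v"
    have "D = 0"
    proof (rule ccontr)
      assume "D \<noteq> 0"
      then have nD: "0 < norm D" by simp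
      \<comment> \<open>A step along the residual \<open>D\<close> that stays in the ball and whose
        second-order term is at most half of the first-order decrease.\<close>
      define t where "t = min ((r1 - norm v) / norm D) (1 / (1 + 2 * \<rho> * L))"
      have pos: "0 < 1 + 2 * \<rho> * L"
        using \<rho>(1) L by (simp add: add_pos_pos)
      have t: "0 < t" "t * norm D \<le> r1 - norm v" "t * (1 / 2 + \<rho> * L) \<le> 1 / 2"
      proof -
        show "0 < t"
          using vr1 nD pos by (simp add: t_def)
        have "t \<le> (r1 - norm v) / norm D"
          by (simp add: t_def)
        then show "t * norm D \<le> r1 - norm v"
          using nD by (simp add: pos_le_divide_eq)
        have "t \<le> 1 / (1 + 2 * \<rho> * L)"
          by (simp add: t_def)
        then have "t * (1 + 2 * \<rho> * L) \<le> 1"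
          using pos by (simp add: pos_le_divide_eq)
        then show "t * (1 / 2 + \<rho> * L) \<le> 1 / 2"
          by (simp add: algebra_simps)
      qed
      let ?w = "v + t *\<^sub>R D"
      have "norm ?w \<le> norm v + t * norm D"
        using norm_triangle_ineq[of v "t *\<^sub>R D"] t(1) by simp
      then have w: "norm ?w \<le> r1"
        using t(2) by simp
      then have wr0: "norm ?w < r0"
        using r1(2) by simp
      have "m ?w - m v \<le> t * (s ?w \<bullet> D)"
        using m_lower[OF wr0 vr0] by simp
      moreover have "s ?w \<bullet> D \<le> s v \<bullet> D + L * t * (norm D)\<^sup>2"
      proof -
        have "(s ?w - s v) \<bullet> D \<le> norm (s ?w - s v) * norm D"
          by (rule norm_cauchy_schwarz)
        also have "\<dots> \<le> (L * norm (?w - v)) * norm D"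
          by (intro mult_right_mono lip wr0 vr0) auto
        also have "\<dots> = L * t * (norm D)\<^sup>2"
          using t(1) by (simp add: power2_eq_square)
        finally show ?thesis
          by (simp add: inner_diff_left)
      qed
      ultimately have mw: "m ?w - m v \<le> t * (s v \<bullet> D + L * t * (norm D)\<^sup>2)"
        using t(1) by (meson mult_left_mono less_imp_le order_trans)
      have "\<Psi> v \<le> \<Psi> ?w"
        using v(2) w by simp
      moreover have ww: "?w \<bullet> ?w / 2 = v \<bullet> v / 2 + t * (v \<bullet> D) + t\<^sup>2 * (norm D)\<^sup>2 / 2"
        unfolding power2_norm_eq_inner
        by (simp add: inner_add_left inner_add_right inner_commute[of D v] power2_eq_square algebra_simps add_divide_distrib)
      moreover have cw: "c \<bullet> ?w = c \<bullet> v + t * (c \<bullet> D)"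
        by (simp add: inner_add_right)
      ultimately have "0 \<le> t * (v \<bullet> D) + t\<^sup>2 * (norm D)\<^sup>2 / 2 + \<rho> * (m ?w - m v) - t * (c \<bullet> D)"
        unfolding \<Psi>_def ww cw right_diff_distrib by linarith
      moreover have "\<rho> * (m ?w - m v) \<le> \<rho> * (t * (s v \<bullet> D + L * t * (norm D)\<^sup>2))"
        using mw \<rho>(1) by (intro mult_left_mono) auto
      ultimately have "0 \<le> t * (v \<bullet> D) + t\<^sup>2 * (norm D)\<^sup>2 / 2 + \<rho> * (t * (s v \<bullet> D + L * t * (norm D)\<^sup>2)) - t * (c \<bullet> D)"
        by linarith
      also have "\<dots> = t * (t * (1 / 2 + \<rho> * L) * (norm D)\<^sup>2 - (c \<bullet> D - v \<bullet> D - \<rho> * (s v \<bullet> D)))"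
        by (simp add: algebra_simps power2_eq_square)
      finally have "0 \<le> t * (t * (1 / 2 + \<rho> * L) * (norm D)\<^sup>2 - (c \<bullet> D - v \<bullet> D - \<rho> * (s v \<bullet> D)))" .
      moreover have "c \<bullet> D - v \<bullet> D - \<rho> * (s v \<bullet> D) = (norm D)\<^sup>2"
      proof -
        have "c \<bullet> D - v \<bullet> D - \<rho> * (s v \<bullet> D) = (c - v - \<rho> *\<^sub>R s v) \<bullet> D"
          by (simp add: inner_diff_left)
        then show ?thesis
          by (simp add: power2_norm_eq_inner flip: D_def)
      qed
      ultimately have "(norm D)\<^sup>2 \<le> t * (1 / 2 + \<rho> * L) * (norm D)\<^sup>2"
        using t(1) by (simp add: zero_le_mult_iff)
      also have "\<dots> \<le> 1 / 2 * (norm D)\<^sup>2"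
        using t(3) by (intro mult_right_mono) auto
      finally show False
        using nD by simp
    qed
    then have "v + \<rho> *\<^sub>R s v = c"
      by (simp add: D_def algebra_simps)
    with vr1 show ?thesis by blast
  qed
  define \<delta> where "\<delta> = min \<delta>' (min (r1 / (4 * (1 + B + \<rho>))) (min (L * r1) (\<gamma> / 2)))"
  have pos: "0 < 1 + B + \<rho>"
    using B(2) \<rho>(1) by simp
  have \<delta>: "0 < \<delta>" "\<delta> \<le> \<delta>'" "(1 + B + \<rho>) * \<delta> \<le> r1 / 4" "\<delta> \<le> L * r1"
  proof -
    show "0 < \<delta>" "\<delta> \<le> \<delta>'" "\<delta> \<le> L * r1"
      using B(1) r1(1) pos L \<gamma> by (simp_all add: \<delta>_def)
    have "(1 + B + \<rho>) * \<delta> \<le> (1 + B + \<rho>) * (r1 / (4 * (1 + B + \<rho>)))"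
      using pos by (intro mult_left_mono) (auto simp: \<delta>_def)
    moreover have "q * (r1 / (4 * q)) = r1 / 4" if "0 < q" for q
      using that by simp
    ultimately show "(1 + B + \<rho>) * \<delta> \<le> r1 / 4"
      using pos by metis
  qed
  \<comment> \<open>The pair is compared with the minimizer \<open>s v'\<close> for which
    \<open>v' + \<rho> s v'\<close> equals \<open>G z + w + \<rho> z\<close>. Monotonicity of the
    subgradients together with \<open>B < \<rho>\<close> makes the two points coincide.\<close>
  have small: "norm (G z + w) < r1" "z = s (G z + w)"
    if zw: "w \<in> csub C h z" "norm (z - x) < \<delta>" "norm (w + G x) < \<delta>" for z w
  proof -
    have Gz: "norm (G z - G x) \<le> B * norm (z - x)"
      using B(3)[of x z] zw(2) \<delta>(2) B(1) by simp
    have "(1 + B + \<rho>) * \<delta> = \<delta> + B * \<delta> + \<rho> * \<delta>"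
      by (simp add: algebra_simps)
    moreover have "B * norm (z - x) \<le> B * \<delta>" "\<rho> * norm (z - x) \<le> \<rho> * \<delta>"
      using zw(2) B(2) \<rho>(1) by simp_all
    moreover have v_eq: "G z + w = (G z - G x) + (w + G x)"
      by simp
    have "norm (G z + w) \<le> norm (G z - G x) + norm (w + G x)"
      unfolding v_eq by (rule norm_triangle_ineq)
    ultimately have nv: "norm (G z + w) + \<rho> * norm (z - x) < r1 / 4"
      using \<delta>(3) zw(3) Gz by linarith
    moreover have "0 \<le> \<rho> * norm (z - x)"
      using \<rho>(1) by simp
    ultimately show "norm (G z + w) < r1"
      using r1(1) by linarith
    let ?v = "G z + w"
    have eq: "?v + \<rho> *\<^sub>R z - \<rho> *\<^sub>R x = ?v + \<rho> *\<^sub>R (z - x)"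
      by (simp add: algebra_simps)
    have "norm (?v + \<rho> *\<^sub>R z - \<rho> *\<^sub>R x) \<le> norm ?v + \<rho> * norm (z - x)"
      unfolding eq using norm_triangle_ineq[of ?v "\<rho> *\<^sub>R (z - x)"] \<rho>(1) by simp
    then have "2 * norm (?v + \<rho> *\<^sub>R z - \<rho> *\<^sub>R x) < r1"
      using nv r1(1) by linarith
    from solve[OF this] obtain v' where v': "norm v' < r1" "v' + \<rho> *\<^sub>R s v' = ?v + \<rho> *\<^sub>R z"
      by blast
    have v'r0: "norm v' < r0"
      using v'(1) r1(2) by simp
    have "norm (s v' - x) \<le> L * norm v'"
      by (rule near_s[OF v'r0])
    also have "\<dots> \<le> L * r1"
      using v'(1) L by simp
    finally have sv': "norm (s v' - x) \<le> L * r1" .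
    have w': "v' - G (s v') \<in> csub C h (s v')"
    proof -
      obtain A where A: "v' - G (s v') - A \<in> csub C h (s v')" "\<gamma> * norm A \<le> A \<bullet> (s v' - x)"
        by (rule convex_subgradient_ball[OF convex_C convex_h x sC[OF v'r0] \<gamma>
              tilt_argmin_first_order[OF x \<gamma> sarg[OF v'r0]]]) auto
      have "\<gamma> * norm A \<le> norm A * norm (s v' - x)"
        using A(2) norm_cauchy_schwarz[of A "s v' - x"] by linarith
      moreover have "norm (s v' - x) < \<gamma>"
        using sv' r1(3) by simp
      ultimately have "A = 0"
        by (auto simp: mult.commute[of \<gamma>] mult_le_cancel_left)
      with A(1) show ?thesis by simp
    qed
    have vv: "v' - ?v = - (\<rho> *\<^sub>R (s v' - z))"
    proof -
      have "v' - ?v + (\<rho> *\<^sub>R s v' - \<rho> *\<^sub>R z) = (v' + \<rho> *\<^sub>R s v') - (?v + \<rho> *\<^sub>R z)"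
        by simp
      also have "\<dots> = 0"
        using v'(2) by simp
      finally show ?thesis
        by (simp only: eq_neg_iff_add_eq_0 scaleR_diff_right)
    qed
    have w'_eq: "v' - G (s v') - w = - (\<rho> *\<^sub>R (s v' - z)) - (G (s v') - G z)"
      unfolding vv[symmetric] by simp
    have "0 \<le> (v' - G (s v') - w) \<bullet> (s v' - z)"
      by (rule csub_monotone[OF w' zw(1)])
    then have "\<rho> * (norm (s v' - z))\<^sup>2 \<le> - ((G (s v') - G z) \<bullet> (s v' - z))"
      unfolding w'_eq inner_diff_left[of "- (\<rho> *\<^sub>R (s v' - z))"] by (simp add: power2_norm_eq_inner)
    also have "\<dots> \<le> norm (G (s v') - G z) * norm (s v' - z)"
      using Cauchy_Schwarz_ineq2[of "G (s v') - G z" "s v' - z"] by linarith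
    also have "\<dots> \<le> (B * norm (s v' - z)) * norm (s v' - z)"
      using B(3)[of z "s v'"] sv' r1(4) zw(2) \<delta>(2) by (intro mult_right_mono) auto
    finally have "(\<rho> - B) * (norm (s v' - z))\<^sup>2 \<le> 0"
      by (simp add: algebra_simps power2_eq_square)
    then have eq: "s v' = z"
      using \<rho>(2) by (simp add: mult_le_0_iff)
    then have "v' = ?v"
      using vv by simp
    with eq show "z = s ?v"
      by simp
  qed
  \<comment> \<open>Tilting further by \<open>\<eta> (z2 - z1)\<close> moves the minimizer by at
    most half of the distance from \<open>z1\<close> to \<open>z2\<close>.\<close>
  define \<eta> where "\<eta> = 1 / (2 * L)"
  have \<eta>: "0 < \<eta>" "\<eta> * L = 1 / 2"
    using L by (simp_all add: \<eta>_def)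
  define \<delta>2 where "\<delta>2 = min \<delta> (min (\<gamma> / 2) ((r0 - r1) / (2 * \<eta>)))"
  have \<delta>2: "0 < \<delta>2" "\<delta>2 \<le> \<delta>" "\<delta>2 \<le> \<gamma>" "\<eta> * (2 * \<delta>2) \<le> r0 - r1"
  proof -
    show "0 < \<delta>2" "\<delta>2 \<le> \<delta>" "\<delta>2 \<le> \<gamma>"
      using \<delta>(1) \<gamma> r1(2) \<eta>(1) by (auto simp: \<delta>2_def)
    have "\<eta> * (2 * \<delta>2) \<le> \<eta> * (2 * ((r0 - r1) / (2 * \<eta>)))"
      using \<eta>(1) by (intro mult_left_mono) (auto simp: \<delta>2_def)
    then show "\<eta> * (2 * \<delta>2) \<le> r0 - r1"
      using \<eta>(1) by simp
  qed
  have growth: "F z1 + v1 \<bullet> (z2 - z1) + \<eta> / 2 * (norm (z2 - z1))\<^sup>2 \<le> F z2"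
    if v1: "norm v1 < r1" and z1: "z1 = s v1" "norm (z1 - x) < \<delta>2" and z2: "z2 \<in> C" "norm (z2 - x) < \<delta>2" for v1 z1 z2
  proof -
    let ?D = "z2 - z1"
    let ?v = "v1 + \<eta> *\<^sub>R ?D"
    have "norm ?D < 2 * \<delta>2"
      using norm_triangle_ineq4[of "z2 - x" "z1 - x"] z1(2) z2(2) by simp
    then have "\<eta> * norm ?D \<le> r0 - r1"
      using \<eta>(1) \<delta>2(4) by (intro order_trans[OF mult_left_mono \<delta>2(4)]) auto
    then have vr0: "norm ?v < r0"
      using norm_triangle_ineq[of v1 "\<eta> *\<^sub>R ?D"] v1 \<eta>(1) by simp
    have v1r0: "norm v1 < r0"
      using v1 r1(2) by simp
    have "F (s ?v) - ?v \<bullet> s ?v \<le> F z2 - ?v \<bullet> z2"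
      using z2 \<delta>2(3) by (intro opt[OF vr0]) auto
    moreover have "F z1 - v1 \<bullet> z1 \<le> F (s ?v) - v1 \<bullet> s ?v"
      using opt[OF v1r0 sC[OF vr0]] unfolding z1(1)[symmetric] .
    ultimately have 1: "F z1 + v1 \<bullet> ?D + \<eta> * (?D \<bullet> (z2 - s ?v)) \<le> F z2"
      by (simp add: inner_add_left inner_diff_right right_diff_distrib)
    have "?D \<bullet> (z2 - s ?v) = ?D \<bullet> ?D - ?D \<bullet> (s ?v - s v1)"
      by (simp add: z1(1) inner_diff_right)
    moreover have "?D \<bullet> (s ?v - s v1) \<le> (norm ?D)\<^sup>2 / 2"
    proof -
      have "?D \<bullet> (s ?v - s v1) \<le> norm ?D * norm (s ?v - s v1)"
        by (rule norm_cauchy_schwarz)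
      also have "\<dots> \<le> norm ?D * (L * norm (?v - v1))"
        by (intro mult_left_mono lip[OF vr0 v1r0]) auto
      also have "\<dots> = (\<eta> * L) * (norm ?D)\<^sup>2"
        using \<eta>(1) by (simp add: power2_eq_square)
      finally show ?thesis
        by (simp add: \<eta>(2))
    qed
    ultimately have 2: "(norm ?D)\<^sup>2 / 2 \<le> ?D \<bullet> (z2 - s ?v)"
      unfolding power2_norm_eq_inner by linarith
    have "\<eta> * ((norm ?D)\<^sup>2 / 2) \<le> \<eta> * (?D \<bullet> (z2 - s ?v))"
      using 2 \<eta>(1) by (intro mult_left_mono) auto
    with 1 show ?thesis
      by simp
  qed
  show ?thesis
    unfolding strongly_monotone_near_def
  proof (rule exI[of _ \<eta>], rule conjI[OF \<eta>(1)], rule exI[of _ \<delta>2], rule conjI[OF \<delta>2(1)], intro allI impI)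
    fix z1 w1 z2 w2
    assume *: "w1 \<in> csub C h z1 \<and> w2 \<in> csub C h z2 \<and> norm (z1 - x) < \<delta>2 \<and> norm (z2 - x) < \<delta>2 \<and>
      norm (w1 + G x) < \<delta>2 \<and> norm (w2 + G x) < \<delta>2"
    then have s1: "norm (G z1 + w1) < r1" "z1 = s (G z1 + w1)" and s2: "norm (G z2 + w2) < r1" "z2 = s (G z2 + w2)"
      using small \<delta>2(2) by auto
    have C12: "z1 \<in> C" "z2 \<in> C"
      using * csubD(1)[of w1 C h z1] csubD(1)[of w2 C h z2] by simp_all
    have "F z1 + (G z1 + w1) \<bullet> (z2 - z1) + \<eta> / 2 * (norm (z2 - z1))\<^sup>2 \<le> F z2"
      by (rule growth[OF s1]) (use * C12 in auto)
    moreover have "F z2 + (G z2 + w2) \<bullet> (z1 - z2) + \<eta> / 2 * (norm (z1 - z2))\<^sup>2 \<le> F z1"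
      by (rule growth[OF s2]) (use * C12 in auto)
    ultimately show "\<eta> * (norm (z1 - z2))\<^sup>2 \<le> (G z1 - G z2 + w1 - w2) \<bullet> (z1 - z2)"
      by (simp add: norm_minus_commute[of z2] inner_diff_left inner_diff_right inner_add_left)
  qed
qed

theorem tilt_stable_iff_strongly_monotone:
  assumes "- G x \<in> csub C h x"
  shows "tilt_stable_local_minimizer f x \<longleftrightarrow> strongly_monotone_near x"
  using assms strongly_monotone_of_tilt_stable tilt_stable_of_strongly_monotone by blast

end

section \<open>Tangent directions of spectral functions\<close>

lemma conj_by_spectral:
  "conj_by P (spectral R v) $ i $ j = (\<Sum>r\<in>UNIV. (transpose P ** R) $ i $ r * (transpose P ** R) $ j $ r * v $ r)"
proof -
  have "conj_by P (spectral R v) = (transpose P ** R) ** Diag v ** transpose (transpose P ** R)"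
    by (simp add: conj_by_def mat_of_spectral matrix_transpose_mul matrix_mul_assoc)
  then show ?thesis
    by (simp only: conj_Diag_nth)
qed

lemma conj_by_linear:
  "conj_by P (Z - W) = conj_by P Z - conj_by P W" "conj_by P (Z + W) = conj_by P Z + conj_by P W"
  "conj_by P (r *\<^sub>R Z) = r *\<^sub>R conj_by P Z" "conj_by P 0 = 0"
  using bounded_linear.linear[OF bounded_linear_conj_by, of P]
  by (simp_all add: linear_diff linear_add linear_scale linear_0)

lemma tendsto_conj_by [tendsto_intros]:
  "(P \<longlongrightarrow> R) F \<Longrightarrow> (Z \<longlongrightarrow> W) F \<Longrightarrow> ((\<lambda>k. conj_by (P k) (Z k)) \<longlongrightarrow> conj_by R W) F"
  unfolding conj_by_def by (intro tendsto_intros)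

text \<open>Orthonormality of the rows allows the eigenvalues to be recentred at any
  \<open>c\<close>, at the price of \<open>c\<close> on the diagonal.\<close>

lemma orthogonal_row_sum_shift:
  fixes Q :: "real^'n^'n"
  assumes "orthogonal_matrix Q"
  shows "(\<Sum>r\<in>UNIV. Q $ i $ r * Q $ j $ r * z r) = (\<Sum>r\<in>UNIV. Q $ i $ r * Q $ j $ r * (z r - c)) + (if i = j then c else 0)"
proof -
  have "(\<Sum>r\<in>UNIV. Q $ i $ r * Q $ j $ r * (z r - c)) = (\<Sum>r\<in>UNIV. Q $ i $ r * Q $ j $ r * z r) - c * (\<Sum>r\<in>UNIV. Q $ i $ r * Q $ j $ r)"
    unfolding sum_distrib_left sum_subtractf[symmetric] by (intro sum.cong refl) (simp add: algebra_simps)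
  then show ?thesis
    using orthogonal_rows[OF assms, of i j] by simp
qed

text \<open>The right-hand side is the mass that the doubly stochastic matrix \<open>Q\<^sub>i\<^sub>r\<^sup>2\<close> moves across the
  cut \<open>T\<close>; the constant \<open>c\<close> is arbitrary.\<close>

lemma cut_deficit:
  fixes Q :: "real^'n::finite^'n"
  assumes Q: "orthogonal_matrix Q"
  shows "(\<Sum>i\<in>T. z i) - (\<Sum>i\<in>T. \<Sum>r\<in>UNIV. Q $ i $ r * Q $ i $ r * z r)
    = (\<Sum>r\<in>T. \<Sum>i\<in>-T. (Q $ i $ r)\<^sup>2 * (z r - c)) + (\<Sum>r\<in>-T. \<Sum>i\<in>T. (Q $ i $ r)\<^sup>2 * (c - z r))"
proof -
  have UT: "(\<Sum>r\<in>UNIV. f r) = (\<Sum>r\<in>T. f r) + (\<Sum>r\<in>-T. f r)" for f :: "'n \<Rightarrow> real"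
    using sum.union_disjoint[of T "- T" f] by simp
  have "(\<Sum>i\<in>T. \<Sum>r\<in>UNIV. Q $ i $ r * Q $ i $ r * z r) = (\<Sum>i\<in>T. (\<Sum>r\<in>UNIV. Q $ i $ r * Q $ i $ r * (z r - c)) + c)"
    by (intro sum.cong refl) (simp add: orthogonal_row_sum_shift[OF Q, of _ _ z c])
  also have "\<dots> = (\<Sum>i\<in>T. \<Sum>r\<in>UNIV. (Q $ i $ r)\<^sup>2 * (z r - c)) + (\<Sum>i\<in>T. c)"
    by (simp add: sum.distrib power2_eq_square)
  finally have 1: "(\<Sum>i\<in>T. \<Sum>r\<in>UNIV. Q $ i $ r * Q $ i $ r * z r) = (\<Sum>i\<in>T. \<Sum>r\<in>UNIV. (Q $ i $ r)\<^sup>2 * (z r - c)) + (\<Sum>i\<in>T. c)" .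
  have 2: "(\<Sum>i\<in>T. \<Sum>r\<in>UNIV. (Q $ i $ r)\<^sup>2 * (z r - c)) = (\<Sum>r\<in>T. \<Sum>i\<in>T. (Q $ i $ r)\<^sup>2 * (z r - c)) + (\<Sum>r\<in>-T. \<Sum>i\<in>T. (Q $ i $ r)\<^sup>2 * (z r - c))"
    unfolding UT sum.distrib by (intro arg_cong2[of _ _ _ _ "(+)"] sum.swap)
  have col: "z r - c = (\<Sum>i\<in>T. (Q $ i $ r)\<^sup>2 * (z r - c)) + (\<Sum>i\<in>-T. (Q $ i $ r)\<^sup>2 * (z r - c))" for r
  proof -
    have "(\<Sum>i\<in>UNIV. (Q $ i $ r)\<^sup>2 * (z r - c)) = (z r - c)"
      using orthogonal_columns[OF Q, of r r] by (simp add: power2_eq_square flip: sum_distrib_right)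
    then show ?thesis
      unfolding UT by simp
  qed
  have 3: "(\<Sum>r\<in>T. z r - c) = (\<Sum>r\<in>T. \<Sum>i\<in>T. (Q $ i $ r)\<^sup>2 * (z r - c)) + (\<Sum>r\<in>T. \<Sum>i\<in>-T. (Q $ i $ r)\<^sup>2 * (z r - c))"
    unfolding sum.distrib[symmetric] by (rule sum.cong[OF refl col])
  have 4: "(\<Sum>r\<in>-T. \<Sum>i\<in>T. (Q $ i $ r)\<^sup>2 * (c - z r)) = - (\<Sum>r\<in>-T. \<Sum>i\<in>T. (Q $ i $ r)\<^sup>2 * (z r - c))"
    by (simp add: sum_negf[symmetric] algebra_simps)
  have 5: "(\<Sum>r\<in>T. z r - c) = (\<Sum>r\<in>T. z r) - (\<Sum>r\<in>T. c)"
    by (rule sum_subtractf)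
  show ?thesis
    using 1 2 3 4 5 by linarith
qed

text \<open>With \<open>c\<close> between the values on \<open>T\<close> and those off
  \<open>T\<close>, all terms of \<open>cut_deficit\<close> are nonnegative, so each is at most the
  sum.\<close>

lemma cut_entry_bound:
  fixes Q :: "real^'n::finite^'n"
  assumes Q: "orthogonal_matrix Q" and c: "\<And>i. i \<in> T \<Longrightarrow> c \<le> z i" "\<And>i. i \<notin> T \<Longrightarrow> z i \<le> c"
    and ij: "(i \<in> T) \<noteq> (j \<in> T)"
  shows "(Q $ i $ j)\<^sup>2 * \<bar>z j - c\<bar> \<le> (\<Sum>i\<in>T. z i) - (\<Sum>i\<in>T. \<Sum>r\<in>UNIV. Q $ i $ r * Q $ i $ r * z r)"
proof -
  let ?S1 = "\<lambda>r. \<Sum>i\<in>-T. (Q $ i $ r)\<^sup>2 * (z r - c)" and ?S2 = "\<lambda>r. \<Sum>i\<in>T. (Q $ i $ r)\<^sup>2 * (c - z r)"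
  have n1: "0 \<le> (Q $ i $ r)\<^sup>2 * (z r - c)" if "r \<in> T" for i r
    using c(1)[OF that] by simp
  have n2: "0 \<le> (Q $ i $ r)\<^sup>2 * (c - z r)" if "r \<notin> T" for i r
    using c(2)[OF that] by simp
  have s1: "0 \<le> sum ?S1 T" and s2: "0 \<le> sum ?S2 (- T)"
    using n1 n2 by (auto intro!: sum_nonneg)
  have "(Q $ i $ j)\<^sup>2 * \<bar>z j - c\<bar> \<le> sum ?S1 T + sum ?S2 (- T)"
  proof (cases "j \<in> T")
    case True
    then have "i \<in> - T" using ij by simp
    then have "(Q $ i $ j)\<^sup>2 * (z j - c) \<le> ?S1 j"
      using n1[OF True] by (intro member_le_sum[of i "- T" "\<lambda>i. (Q $ i $ j)\<^sup>2 * (z j - c)"]) auto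
    also have "?S1 j \<le> sum ?S1 T"
      using n1 by (intro member_le_sum True sum_nonneg) auto
    finally show ?thesis
      using c(1)[OF True] s2 by simp
  next
    case False
    then have "i \<in> T" using ij by simp
    then have "(Q $ i $ j)\<^sup>2 * (c - z j) \<le> ?S2 j"
      using n2[OF False] by (intro member_le_sum[of i T "\<lambda>i. (Q $ i $ j)\<^sup>2 * (c - z j)"]) auto
    also have "?S2 j \<le> sum ?S2 (- T)"
      using n2 False by (intro member_le_sum sum_nonneg) auto
    finally show ?thesis
      using c(2)[OF False] s1 by simp
  qed
  then show ?thesis
    using cut_deficit[OF Q, of z T c] by simp
qed

text \<open>Lowering the weights on \<open>T\<close> by the gap keeps them nonincreasing, so the
  trace inequality still holds; the lowered part is the deficit on the left.\<close>

lemma cut_deficit_le: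
  fixes Z :: "'n::{finite,linorder} symmat"
  assumes P: "orthogonal_matrix P" and w: "\<And>i j. i \<le> j \<Longrightarrow> w $ j \<le> w $ i"
    and gap: "\<And>i j. i \<in> T \<Longrightarrow> j \<notin> T \<Longrightarrow> w $ j + g \<le> w $ i" and g: "0 < g"
  shows "g * ((\<Sum>i\<in>T. eigvals Z $ i) - (\<Sum>i\<in>T. conj_by P Z $ i $ i)) \<le> eigvals Z \<bullet> w - diag (conj_by P Z) \<bullet> w"
proof -
  let ?w = "\<chi> i. w $ i - (if i \<in> T then g else 0)"
  have "?w $ j \<le> ?w $ i" if "i \<le> j" for i j
    using w[OF that] gap[of i j] g by auto
  from diag_conj_by_le_eigvals[OF this P] have "diag (conj_by P Z) \<bullet> ?w \<le> eigvals Z \<bullet> ?w" .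
  moreover have "v \<bullet> ?w = v \<bullet> w - g * (\<Sum>i\<in>T. v $ i)" for v
  proof -
    have "v \<bullet> ?w = (\<Sum>i\<in>UNIV. v $ i * w $ i - (if i \<in> T then g * v $ i else 0))"
      by (auto simp: inner_vec_def right_diff_distrib intro!: sum.cong)
    then show ?thesis
      by (simp add: sum_subtractf inner_vec_def sum.If_cases sum_distrib_left)
  qed
  ultimately show ?thesis
    by (simp add: right_diff_distrib)
qed

section \<open>Common blocks of X and Y and the tangent space\<close>

locale spectral_pair = spectral_polyhedral \<theta> p a c m b d +
  symmetric_subgradient_pair \<theta> p a c m b d "eigvals X" "eigvals Y"
  for \<theta> :: "'n::{finite,linorder} rvec \<Rightarrow> ereal" and p a c m b d and X Y :: "'n symmat" +
  assumes Y_subS: "Y \<in> subS X"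
begin

abbreviation x :: "'n rvec" where "x \<equiv> eigvals X"
abbreviation y :: "'n rvec" where "y \<equiv> eigvals Y"

text \<open>The index \<open>i\<close> lies in a block \<open>gam X Y l k\<close> with \<open>k \<in> E_set X Y E1 E2 a b l\<close>.\<close>

definition Eblk :: "'n \<Rightarrow> bool"
  where "Eblk i \<longleftrightarrow> (\<exists>j k. x $ j = x $ i \<and> y $ j = y $ i \<and> x $ k = x $ i \<and> y $ k = y $ i \<and>
    ((\<exists>\<nu>\<in>E1. a \<nu> $ j \<noteq> a \<nu> $ k) \<or> (\<exists>\<mu>\<in>E2. b \<mu> $ j \<noteq> b \<mu> $ k)))"

text \<open>The subspace T of the overview. On blocks with \<open>Eblk\<close> only the off-diagonal
  entries are required to vanish; equality of the diagonal entries follows from \<open>L\<close> by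
  \<open>L_constant_on_Eblk\<close>.\<close>

definition tangent :: "'n rmat \<Rightarrow> 'n symmat set"
  where "tangent P = {H. (\<forall>i j. x $ i = x $ j \<and> y $ i \<noteq> y $ j \<longrightarrow> conj_by P H $ i $ j = 0) \<and>
    diag (conj_by P H) \<in> L \<and>
    (\<forall>i j. Eblk i \<and> x $ i = x $ j \<and> y $ i = y $ j \<and> i \<noteq> j \<longrightarrow> conj_by P H $ i $ j = 0)}"

text \<open>A vector that distinguishes \<open>k\<close> from \<open>l\<close> distinguishes any
  third index of the block from one of them, so \<open>L_constant_on_block\<close> reaches the whole
  block.\<close>

lemma L_constant_on_Eblk:
  assumes e: "e \<in> L" and i: "Eblk i" "x $ i = x $ j" "y $ i = y $ j"
  shows "e $ i = e $ j"
proof -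
  obtain k l where kl: "x $ k = x $ i" "y $ k = y $ i" "x $ l = x $ i" "y $ l = y $ i"
    "(\<exists>\<nu>\<in>E1. a \<nu> $ k \<noteq> a \<nu> $ l) \<or> (\<exists>\<mu>\<in>E2. b \<mu> $ k \<noteq> b \<mu> $ l)"
    using i(1) unfolding Eblk_def by blast
  have kl_eq: "e $ k = e $ l"
    by (rule L_constant_on_block[OF e _ _ kl(5)]) (simp_all add: kl)
  have "e $ j = e $ k" if j: "x $ j = x $ i" "y $ j = y $ i" for j
  proof -
    have "((\<exists>\<nu>\<in>E1. a \<nu> $ j \<noteq> a \<nu> $ k) \<or> (\<exists>\<mu>\<in>E2. b \<mu> $ j \<noteq> b \<mu> $ k)) \<or>
      ((\<exists>\<nu>\<in>E1. a \<nu> $ j \<noteq> a \<nu> $ l) \<or> (\<exists>\<mu>\<in>E2. b \<mu> $ j \<noteq> b \<mu> $ l))"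
      using kl(5) by metis
    then show ?thesis
    proof
      assume ne: "(\<exists>\<nu>\<in>E1. a \<nu> $ j \<noteq> a \<nu> $ k) \<or> (\<exists>\<mu>\<in>E2. b \<mu> $ j \<noteq> b \<mu> $ k)"
      show ?thesis
        by (rule L_constant_on_block[OF e _ _ ne]) (simp_all add: kl j)
    next
      assume ne: "(\<exists>\<nu>\<in>E1. a \<nu> $ j \<noteq> a \<nu> $ l) \<or> (\<exists>\<mu>\<in>E2. b \<mu> $ j \<noteq> b \<mu> $ l)"
      have "e $ j = e $ l"
        by (rule L_constant_on_block[OF e _ _ ne]) (simp_all add: kl j)
      then show ?thesis
        by (simp add: kl_eq)
    qed
  qed
  from this[of i] this[of j] show ?thesis
    using i by simp
qed

lemma constant_off_Eblk:
  assumes "\<not> Eblk i" "x $ i = x $ j" "y $ i = y $ j"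
  shows "\<nu> \<in> E1 \<Longrightarrow> a \<nu> $ i = a \<nu> $ j" "\<mu> \<in> E2 \<Longrightarrow> b \<mu> $ i = b \<mu> $ j"
proof -
  have *: "\<not> ((\<exists>\<nu>\<in>E1. a \<nu> $ i \<noteq> a \<nu> $ j) \<or> (\<exists>\<mu>\<in>E2. b \<mu> $ i \<noteq> b \<mu> $ j))"
    using assms unfolding Eblk_def by metis
  then show "a \<nu> $ i = a \<nu> $ j" if "\<nu> \<in> E1"
    using that by blast
  show "b \<mu> $ i = b \<mu> $ j" if "\<mu> \<in> E2"
    using that * by blast
qed

lemma subspace_tangent: "subspace (tangent P)"
  unfolding subspace_def tangent_def
proof (intro conjI ballI allI CollectI impI; (elim CollectE conjE)?)
  show "diag (conj_by P 0) \<in> L"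
  proof -
    have "diag (conj_by P 0) = 0"
      by (simp add: conj_by_linear vec_eq_iff)
    then show ?thesis
      using subspace_0[OF subspace_L] by simp
  qed
  show "diag (conj_by P (H + K)) \<in> L" if "diag (conj_by P H) \<in> L" "diag (conj_by P K) \<in> L" for H K
    using subspace_add[OF subspace_L that] by (simp add: conj_by_linear diag_linear)
  show "diag (conj_by P (r *\<^sub>R H)) \<in> L" if "diag (conj_by P H) \<in> L" for H r
    using subspace_scale[OF subspace_L that] by (simp add: conj_by_linear diag_linear)
qed (simp_all add: conj_by_linear)

text \<open>Both \<open>x\<close> and \<open>y\<close> are nonincreasing, so the level sets of \<open>x + y\<close> are the common level sets of
  \<open>x\<close> and \<open>y\<close>.\<close>

lemma sum_eigvals_eq_iff: "(x + y) $ i = (x + y) $ j \<longleftrightarrow> x $ i = x $ j \<and> y $ i = y $ j"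
proof (cases "i \<le> j")
  case True
  then show ?thesis
    using eigvals_antitone[OF True, of X] eigvals_antitone[OF True, of Y] by auto
next
  case False
  then have ji: "j \<le> i" by simp
  show ?thesis
    using eigvals_antitone[OF ji, of X] eigvals_antitone[OF ji, of Y] by auto
qed

text \<open>A union of leading common blocks of \<open>x\<close> and \<open>y\<close>; by
  \<open>cutD\<close> it is an initial segment of the indices.\<close>

definition cut :: "'n set \<Rightarrow> bool"
  where "cut T \<longleftrightarrow> (\<forall>i\<in>T. \<forall>j\<in>-T. (x + y) $ j < (x + y) $ i)"

lemma cutD: 
  assumes "cut T" "i \<in> T" "j \<notin> T"
  shows "(x + y) $ j < (x + y) $ i" "i < j"
proof -
  show *: "(x + y) $ j < (x + y) $ i"
    using assms by (simp add: cut_def)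
  show "i < j"
  proof (rule ccontr)
    assume "\<not> i < j"
    then have "j \<le> i" by simp
    then show False
      using * eigvals_antitone[of j i X] eigvals_antitone[of j i Y] by simp
  qed
qed

lemma cut_level: "cut {j. r \<le> (x + y) $ j}" "cut {j. r < (x + y) $ j}"
  by (auto simp: cut_def)

lemma cut_level_x: "cut {j. r \<le> x $ j}"
  unfolding cut_def
proof (intro ballI)
  fix i j assume "i \<in> {j. r \<le> x $ j}" "j \<in> - {j. r \<le> x $ j}"
  then have lt: "x $ j < x $ i" by simp
  then have "i \<le> j"
    using eigvals_antitone[of j i X] by force
  then show "(x + y) $ j < (x + y) $ i"
    using lt eigvals_antitone[of i j Y] by simp
qed

end

text \<open>Common setting of two applications. For the critical cone, \<open>Z2\<close> is
  constantly \<open>X\<close>, the deficit is o(t) and \<open>norm (Z1 k - X)\<close> is O(t). For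
  pairs violating strong monotonicity the deficit is O(t^2) while \<open>Z1\<close> merely tends to
  \<open>X\<close>. Both satisfy \<open>D_lim\<close> and \<open>DX_lim\<close>.\<close>

locale tangent_sequence = spectral_pair \<theta> p a c m b d X Y
  for \<theta> :: "'n::{finite,linorder} rvec \<Rightarrow> ereal" and p a c m b d and X Y :: "'n symmat" +
  fixes Z1 Z2 W2 :: "nat \<Rightarrow> 'n symmat" and t :: "nat \<Rightarrow> real" and P P1 :: "nat \<Rightarrow> 'n rmat"
    and Pbar :: "'n rmat" and H :: "'n symmat" and e :: "'n rvec"
  assumes Z1_dmS: "\<And>k. Z1 k \<in> dmS" and W2_subS: "\<And>k. W2 k \<in> subS (Z2 k)"
    and P_eig: "\<And>k. P k \<in> eig_orth (Z2 k) \<inter> eig_orth (W2 k)" and P1_eig: "\<And>k. P1 k \<in> eig_orth (Z1 k)"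
    and t_pos: "\<And>k. 0 < t k" and t_lim: "t \<longlonglongrightarrow> 0"
    and Z1_lim: "Z1 \<longlonglongrightarrow> X" and Z2_lim: "Z2 \<longlonglongrightarrow> X" and W2_lim: "W2 \<longlonglongrightarrow> Y" and P_lim: "P \<longlonglongrightarrow> Pbar"
    and H_lim: "(\<lambda>k. (1 / t k) *\<^sub>R (Z1 k - Z2 k)) \<longlonglongrightarrow> H"
    and e_lim: "(\<lambda>k. (1 / t k) *\<^sub>R (eigvals (Z1 k) - eigvals (Z2 k))) \<longlonglongrightarrow> e"
    and D_lim: "(\<lambda>k. (hS (Z1 k) - hS (Z2 k) - W2 k \<bullet> (Z1 k - Z2 k)) / t k) \<longlonglongrightarrow> 0"
    and DX_lim: "(\<lambda>k. (hS (Z1 k) - hS (Z2 k) - W2 k \<bullet> (Z1 k - Z2 k)) * norm (Z1 k - X) / (t k)\<^sup>2) \<longlonglongrightarrow> 0"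
begin

abbreviation z1 where "z1 k \<equiv> eigvals (Z1 k)"
abbreviation z2 where "z2 k \<equiv> eigvals (Z2 k)"
abbreviation w2 where "w2 k \<equiv> eigvals (W2 k)"
abbreviation D where "D k \<equiv> hS (Z1 k) - hS (Z2 k) - W2 k \<bullet> (Z1 k - Z2 k)"

definition Q where "Q k = transpose (P k) ** P1 k"

text \<open>The deficit in Ky Fan's trace inequality for the leading index set
  \<open>T\<close>.\<close>

definition B where "B T k = (\<Sum>i\<in>T. z1 k $ i) - (\<Sum>i\<in>T. conj_by (P k) (Z1 k) $ i $ i)"

lemma orth_P: "orthogonal_matrix (P k)" and orth_P1: "orthogonal_matrix (P1 k)"
  using P_eig[of k] P1_eig[of k] by (simp_all add: eig_orth_iff)

lemma orth_Q: "orthogonal_matrix (Q k)"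
  unfolding Q_def using orth_P orth_P1 by (simp add: orthogonal_matrix_mul)

lemma conj_Z1: "conj_by (P k) (Z1 k) $ i $ j = (\<Sum>r\<in>UNIV. Q k $ i $ r * Q k $ j $ r * z1 k $ r)"
proof -
  have "Z1 k = spectral (P1 k) (z1 k)"
    using P1_eig[of k] unfolding eig_orth_iff by blast
  then show ?thesis
    using conj_by_spectral[of "P k" "P1 k" "z1 k" i j] by (simp add: Q_def)
qed

lemma conj_Z2: "conj_by (P k) (Z2 k) = Diag (z2 k)" and conj_W2: "conj_by (P k) (W2 k) = Diag (w2 k)"
  using P_eig[of k] by (simp_all add: eig_orth_conj_by)

lemma scaled_conj:
  "conj_by (P k) ((1 / t k) *\<^sub>R (Z1 k - Z2 k)) $ i $ j
    = (conj_by (P k) (Z1 k) $ i $ j - (if i = j then z2 k $ i else 0)) / t k"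
  by (simp add: conj_by_linear conj_Z2)

lemma conj_lim: "(\<lambda>k. (conj_by (P k) (Z1 k) $ i $ j - (if i = j then z2 k $ i else 0)) / t k) \<longlonglongrightarrow> conj_by Pbar H $ i $ j"
  unfolding scaled_conj[symmetric] by (intro tendsto_intros P_lim H_lim)

lemma e_nth_lim: "(\<lambda>k. (z1 k $ i - z2 k $ i) / t k) \<longlonglongrightarrow> e $ i"
  using tendsto_vec_nth[OF e_lim, of i] by simp

lemma B_nonneg: "cut T \<Longrightarrow> 0 \<le> B T k"
proof -
  assume T: "cut T"
  let ?w = "\<chi> i. (if i \<in> T then 1 else 0 :: real)"
  have "?w $ j \<le> ?w $ i" if "i \<le> j" for i j
    using cutD(2)[OF T, of j i] that by (cases "j \<in> T"; cases "i \<in> T") auto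
  from diag_conj_by_le_eigvals[OF this orth_P[of k], of "Z1 k"]
  show ?thesis
    by (simp add: B_def inner_vec_def if_distrib[of "\<lambda>z. c * z" for c] sum.If_cases cong: if_cong)
qed

lemma eigvals_inner_gap: "z2 k \<bullet> z1 k - Z2 k \<bullet> Z1 k \<le> (norm (Z1 k - Z2 k))\<^sup>2"
proof -
  have "(norm (z1 k - z2 k))\<^sup>2 = (norm (z1 k))\<^sup>2 + (norm (z2 k))\<^sup>2 - 2 * (z2 k \<bullet> z1 k)"
    "(norm (Z1 k - Z2 k))\<^sup>2 = (norm (Z1 k))\<^sup>2 + (norm (Z2 k))\<^sup>2 - 2 * (Z2 k \<bullet> Z1 k)"
    by (simp_all add: power2_norm_eq_inner inner_diff_left inner_diff_right inner_commute)
  then show ?thesis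
    using norm_eigvals[of "Z1 k"] norm_eigvals[of "Z2 k"] zero_le_power2[of "norm (z1 k - z2 k)"]
      zero_le_power2[of "norm (Z1 k - Z2 k)"]
    by simp
qed

text \<open>The deficit \<open>D\<close> is a deficit of \<open>th\<close> plus a von Neumann
  deficit; both are nonnegative, so each inherits the smallness of \<open>D\<close>.\<close>

lemma D_split:
  "D k = (th (z1 k) - th (z2 k) - w2 k \<bullet> (z1 k - z2 k)) + (w2 k \<bullet> z1 k - W2 k \<bullet> Z1 k)"
  "0 \<le> th (z1 k) - th (z2 k) - w2 k \<bullet> (z1 k - z2 k)"
  "0 \<le> w2 k \<bullet> z1 k - W2 k \<bullet> Z1 k"
proof -
  have "W2 k \<bullet> Z2 k = w2 k \<bullet> z2 k"
    using inner_conj_by[OF orth_P[of k], of "W2 k" "Z2 k"] by (simp add: conj_Z2 conj_W2 inner_Diag)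
  then show "D k = (th (z1 k) - th (z2 k) - w2 k \<bullet> (z1 k - z2 k)) + (w2 k \<bullet> z1 k - W2 k \<bullet> Z1 k)"
    by (simp add: hS_def inner_diff_right)
  show "0 \<le> th (z1 k) - th (z2 k) - w2 k \<bullet> (z1 k - z2 k)"
    using subD(2)[OF subS_simultaneous(2)[OF W2_subS[of k]], of "z1 k"] Z1_dmS[of k] by (simp add: dmS_def)
  show "0 \<le> w2 k \<bullet> z1 k - W2 k \<bullet> Z1 k"
    using von_Neumann_trace[of "W2 k" "Z1 k"] by simp
qed

text \<open>Neither \<open>w2\<close> nor \<open>z2\<close> alone need separate \<open>T\<close>,
  but their sum eventually does with a fixed gap. The deficit with weight \<open>w2\<close> is at
  most \<open>D\<close>, that with weight \<open>z2\<close> at most the squared distance.\<close>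

lemma B_bound:
  assumes T: "cut T"
  obtains C where "0 \<le> C" "\<forall>\<^sub>F k in sequentially. B T k \<le> C * (D k + (norm (Z1 k - Z2 k))\<^sup>2)"
proof -
  let ?gaps = "(\<lambda>(i, j). (x + y) $ i - (x + y) $ j) ` (T \<times> - T)"
  \<comment> \<open>The inserted 1 covers an empty \<open>T\<close> or complement; half of the
    limiting gap survives for large \<open>k\<close>.\<close>
  define g where "g = Min (insert 1 ?gaps) / 2"
  have fin: "finite ?gaps" by simp
  have "\<forall>r\<in>insert 1 ?gaps. 0 < r"
    using cutD(1)[OF T] by auto
  then have g: "0 < g"
    using fin by (simp add: g_def)
  have gap: "g < (x + y) $ i - (x + y) $ j" if "i \<in> T" "j \<notin> T" for i j
  proof -
    have "2 * g \<le> (x + y) $ i - (x + y) $ j"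
      unfolding g_def using fin that by (auto intro!: Min_le)
    then show ?thesis
      using g by linarith
  qed
  have "\<forall>\<^sub>F k in sequentially. \<forall>i\<in>T. \<forall>j\<in>-T. g < (w2 k + z2 k) $ i - (w2 k + z2 k) $ j"
  proof (intro eventually_ball_finite ballI)
    fix i j assume ij: "i \<in> T" "j \<in> - T"
    have "(\<lambda>k. (w2 k + z2 k) $ i - (w2 k + z2 k) $ j) \<longlonglongrightarrow> (y + x) $ i - (y + x) $ j"
      by (intro tendsto_intros W2_lim Z2_lim)
    then show "\<forall>\<^sub>F k in sequentially. g < (w2 k + z2 k) $ i - (w2 k + z2 k) $ j"
      using gap[of i j] ij by (intro order_tendstoD(1)) (auto simp: add.commute)
  qed auto
  then have "\<forall>\<^sub>F k in sequentially. B T k \<le> (1 / g) * (D k + (norm (Z1 k - Z2 k))\<^sup>2)"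
  proof eventually_elim
    case (elim k)
    have "g * B T k \<le> z1 k \<bullet> (w2 k + z2 k) - diag (conj_by (P k) (Z1 k)) \<bullet> (w2 k + z2 k)"
      unfolding B_def
    proof (rule cut_deficit_le[OF orth_P _ _ g])
      show "(w2 k + z2 k) $ j \<le> (w2 k + z2 k) $ i" if "i \<le> j" for i j
        using eigvals_antitone[OF that, of "W2 k"] eigvals_antitone[OF that, of "Z2 k"] by simp
      show "(w2 k + z2 k) $ j + g \<le> (w2 k + z2 k) $ i" if "i \<in> T" "j \<notin> T" for i j
        using elim that by force
    qed
    also have "\<dots> = (w2 k \<bullet> z1 k - W2 k \<bullet> Z1 k) + (z2 k \<bullet> z1 k - Z2 k \<bullet> Z1 k)"
    proof -
      have "W2 k \<bullet> Z1 k = diag (conj_by (P k) (Z1 k)) \<bullet> w2 k" "Z2 k \<bullet> Z1 k = diag (conj_by (P k) (Z1 k)) \<bullet> z2 k"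
        using inner_conj_by[OF orth_P[of k], of "W2 k" "Z1 k"] inner_conj_by[OF orth_P[of k], of "Z2 k" "Z1 k"]
        by (simp_all add: conj_Z2 conj_W2 inner_Diag inner_commute)
      then show ?thesis
        by (simp add: inner_add_right inner_commute)
    qed
    also have "\<dots> \<le> D k + (norm (Z1 k - Z2 k))\<^sup>2"
      using D_split[of k] eigvals_inner_gap[of k] by linarith
    finally show ?case
      using g by (simp add: field_simps)
  qed
  then show ?thesis
    using g by (intro that[of "1 / g"]) auto
qed

lemma norm_diff_lim: "(\<lambda>k. norm (Z1 k - Z2 k) / t k) \<longlonglongrightarrow> norm H"
proof -
  have eq: "norm ((1 / t k) *\<^sub>R (Z1 k - Z2 k)) = norm (Z1 k - Z2 k) / t k" for k
    using t_pos[of k] by simp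
  from tendsto_norm[OF H_lim] show ?thesis
    unfolding eq .
qed

lemma B_lim:
  assumes T: "cut T"
  shows "(\<lambda>k. B T k / t k) \<longlonglongrightarrow> 0" "(\<lambda>k. B T k * norm (Z1 k - X) / (t k)\<^sup>2) \<longlonglongrightarrow> 0"
proof -
  obtain C where C: "0 \<le> C" "\<forall>\<^sub>F k in sequentially. B T k \<le> C * (D k + (norm (Z1 k - Z2 k))\<^sup>2)"
    by (rule B_bound[OF T]) blast
  have div1: "C * (u + v\<^sup>2) / s = C * (u / s + v / s * v)" for u v s
    by (simp add: add_divide_distrib distrib_left power2_eq_square)
  have div2: "C * (u + v\<^sup>2) * r / s\<^sup>2 = C * (u * r / s\<^sup>2 + (v / s)\<^sup>2 * r)" for u v s r
    by (simp add: add_divide_distrib distrib_left distrib_right power_divide mult.assoc)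
  have nZ: "(\<lambda>k. norm (Z1 k - X)) \<longlonglongrightarrow> 0"
    using Z1_lim by (simp add: tendsto_norm_zero_iff LIM_zero_iff)
  have nZ12: "(\<lambda>k. norm (Z1 k - Z2 k)) \<longlonglongrightarrow> 0"
    using tendsto_norm[OF tendsto_diff[OF Z1_lim Z2_lim]] by simp
  have 1: "(\<lambda>k. C * (D k / t k + (norm (Z1 k - Z2 k) / t k) * norm (Z1 k - Z2 k))) \<longlonglongrightarrow> C * (0 + norm H * 0)"
    by (intro tendsto_intros D_lim norm_diff_lim nZ12)
  show "(\<lambda>k. B T k / t k) \<longlonglongrightarrow> 0"
  proof (rule tendsto_sandwich[OF _ _ tendsto_const])
    show "\<forall>\<^sub>F k in sequentially. 0 \<le> B T k / t k"
      by (intro always_eventually allI divide_nonneg_pos B_nonneg[OF T] t_pos)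
    show "\<forall>\<^sub>F k in sequentially. B T k / t k \<le> C * (D k / t k + (norm (Z1 k - Z2 k) / t k) * norm (Z1 k - Z2 k))"
      using C(2)
    proof eventually_elim
      case (elim k)
      then have "B T k / t k \<le> C * (D k + (norm (Z1 k - Z2 k))\<^sup>2) / t k"
        using t_pos[of k] by (intro divide_right_mono) auto
      also have "\<dots> = C * (D k / t k + (norm (Z1 k - Z2 k) / t k) * norm (Z1 k - Z2 k))"
        by (rule div1)
      finally show ?case .
    qed
    show "(\<lambda>k. C * (D k / t k + (norm (Z1 k - Z2 k) / t k) * norm (Z1 k - Z2 k))) \<longlonglongrightarrow> 0"
      using 1 by simp
  qed
  have 2: "(\<lambda>k. C * (D k * norm (Z1 k - X) / (t k)\<^sup>2 + (norm (Z1 k - Z2 k) / t k)\<^sup>2 * norm (Z1 k - X))) \<longlonglongrightarrow> C * (0 + (norm H)\<^sup>2 * 0)"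
    by (intro tendsto_intros DX_lim norm_diff_lim nZ)
  show "(\<lambda>k. B T k * norm (Z1 k - X) / (t k)\<^sup>2) \<longlonglongrightarrow> 0"
  proof (rule tendsto_sandwich[OF _ _ tendsto_const])
    show "\<forall>\<^sub>F k in sequentially. 0 \<le> B T k * norm (Z1 k - X) / (t k)\<^sup>2"
      using B_nonneg[OF T] by simp
    show "\<forall>\<^sub>F k in sequentially. B T k * norm (Z1 k - X) / (t k)\<^sup>2
        \<le> C * (D k * norm (Z1 k - X) / (t k)\<^sup>2 + (norm (Z1 k - Z2 k) / t k)\<^sup>2 * norm (Z1 k - X))"
      using C(2)
    proof eventually_elim
      case (elim k)
      then have "B T k * norm (Z1 k - X) / (t k)\<^sup>2 \<le> C * (D k + (norm (Z1 k - Z2 k))\<^sup>2) * norm (Z1 k - X) / (t k)\<^sup>2"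
        by (intro divide_right_mono mult_right_mono) auto
      also have "\<dots> = C * (D k * norm (Z1 k - X) / (t k)\<^sup>2 + (norm (Z1 k - Z2 k) / t k)\<^sup>2 * norm (Z1 k - X))"
        by (rule div2)
      finally show ?case .
    qed
    show "(\<lambda>k. C * (D k * norm (Z1 k - X) / (t k)\<^sup>2 + (norm (Z1 k - Z2 k) / t k)\<^sup>2 * norm (Z1 k - X))) \<longlonglongrightarrow> 0"
      using 2 by simp
  qed
qed

lemma entry_bound:
  assumes T: "cut T" and k: "\<And>i. i \<in> T \<Longrightarrow> i \<le> k" "\<And>i. i \<notin> T \<Longrightarrow> k \<le> i" and ij: "(i \<in> T) \<noteq> (j \<in> T)"
  shows "(Q n $ i $ j)\<^sup>2 * \<bar>z1 n $ j - z1 n $ k\<bar> \<le> B T n"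
proof -
  have "z1 n $ k \<le> z1 n $ i" if "i \<in> T" for i
    using k(1)[OF that] eigvals_antitone by blast
  moreover have "z1 n $ i \<le> z1 n $ k" if "i \<notin> T" for i
    using k(2)[OF that] eigvals_antitone by blast
  ultimately show ?thesis
    using cut_entry_bound[OF orth_Q[of n], of T "z1 n $ k" "\<lambda>i. z1 n $ i" i j] ij
    unfolding B_def conj_Z1 by blast
qed

lemma cut_Max: assumes "cut T" "i \<in> T" shows "\<And>j. j \<in> T \<Longrightarrow> j \<le> Max T" "\<And>j. j \<notin> T \<Longrightarrow> Max T \<le> j" "Max T \<in> T"
proof -
  show M: "Max T \<in> T"
    using assms(2) by (intro Max_in) auto
  show "j \<le> Max T" if "j \<in> T" for j
    using that by simp
  show "Max T \<le> j" if "j \<notin> T" for j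
    using cutD(2)[OF assms(1) M that] by simp
qed

lemma cut_Min: assumes "cut T" "i \<notin> T" shows "\<And>j. j \<in> T \<Longrightarrow> j \<le> Min (- T)" "\<And>j. j \<notin> T \<Longrightarrow> Min (- T) \<le> j" "Min (- T) \<notin> T"
proof -
  have "Min (- T) \<in> - T"
    using assms(2) by (intro Min_in) auto
  then show M: "Min (- T) \<notin> T"
    by simp
  show "Min (- T) \<le> j" if "j \<notin> T" for j
    using that by simp
  show "j \<le> Min (- T)" if "j \<in> T" for j
    using cutD(2)[OF assms(1) that M] by simp
qed

text \<open>The deficit \<open>B T\<close> is o(t), so on a leading block the trace and the sum of
  the eigenvalues have the same limiting quotient.\<close>

lemma trace_cut_lim:
  assumes T: "cut T"
  shows "(\<Sum>i\<in>T. conj_by Pbar H $ i $ i) = (\<Sum>i\<in>T. e $ i)"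
proof (rule LIMSEQ_unique)
  show "(\<lambda>k. \<Sum>i\<in>T. (conj_by (P k) (Z1 k) $ i $ i - z2 k $ i) / t k) \<longlonglongrightarrow> (\<Sum>i\<in>T. conj_by Pbar H $ i $ i)"
    using conj_lim[of i i for i] by (intro tendsto_sum) simp
  have "(\<lambda>k. (\<Sum>i\<in>T. (z1 k $ i - z2 k $ i) / t k) - B T k / t k) \<longlonglongrightarrow> (\<Sum>i\<in>T. e $ i) - 0"
    by (intro tendsto_diff tendsto_sum e_nth_lim B_lim(1)[OF T])
  moreover have "(\<Sum>i\<in>T. (z1 k $ i - z2 k $ i) / t k) - B T k / t k = (\<Sum>i\<in>T. (conj_by (P k) (Z1 k) $ i $ i - z2 k $ i) / t k)" for k
    by (simp add: B_def sum_divide_distrib[symmetric] sum_subtractf diff_divide_distrib)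
  ultimately show "(\<lambda>k. \<Sum>i\<in>T. (conj_by (P k) (Z1 k) $ i $ i - z2 k $ i) / t k) \<longlonglongrightarrow> (\<Sum>i\<in>T. e $ i)"
    by simp
qed

lemma trace_block: "(\<Sum>j | (x + y) $ j = (x + y) $ i. conj_by Pbar H $ j $ j) = (\<Sum>j | (x + y) $ j = (x + y) $ i. e $ j)"
proof -
  let ?T1 = "{j. (x + y) $ i \<le> (x + y) $ j}" and ?T2 = "{j. (x + y) $ i < (x + y) $ j}"
  have eq: "{j. (x + y) $ j = (x + y) $ i} = ?T1 - ?T2" and sub: "?T2 \<subseteq> ?T1"
    by auto
  have "(\<Sum>j\<in>?T1 - ?T2. f j) = sum f ?T1 - sum f ?T2" for f :: "'n \<Rightarrow> real"
    using sub by (intro sum_diff) auto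
  then show ?thesis
    unfolding eq using trace_cut_lim[OF cut_level(1)] trace_cut_lim[OF cut_level(2)] by simp
qed

end

lemma abs_mult_le_squares: "\<bar>u * v\<bar> \<le> u\<^sup>2 + v\<^sup>2" for u v :: real
proof -
  have "0 \<le> (\<bar>u\<bar> - \<bar>v\<bar>)\<^sup>2"
    by simp
  then have "2 * \<bar>u * v\<bar> \<le> u\<^sup>2 + v\<^sup>2"
    by (simp add: power2_diff abs_mult)
  then show ?thesis
    by linarith
qed

context tangent_sequence
begin

lemma abs_diff_eigvals_le: "\<bar>z1 k $ i - x $ i\<bar> \<le> norm (Z1 k - X)"
  using component_le_norm_cart[of "z1 k - x" i] Hoffman_Wielandt[of "Z1 k" X] by simp

text \<open>Off the blocks of \<open>X\<close> the entries of \<open>Q\<close> are controlled by a cut separating the two blocks.\<close>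

lemma entry_across_lim:
  assumes ij: "x $ i \<noteq> x $ r"
  shows "(\<lambda>k. (Q k $ i $ r)\<^sup>2 / t k) \<longlonglongrightarrow> 0"
proof -
  obtain T l where T: "cut T" and l: "\<And>j. j \<in> T \<Longrightarrow> j \<le> l" "\<And>j. j \<notin> T \<Longrightarrow> l \<le> j"
    and ir: "(i \<in> T) \<noteq> (r \<in> T)" and xl: "x $ r \<noteq> x $ l"
  proof (cases "x $ r < x $ i")
    case True
    let ?T = "{j. x $ i \<le> x $ j}"
    have T: "cut ?T" by (rule cut_level_x)
    have i: "i \<in> ?T" by simp
    have "x $ r \<noteq> x $ Max ?T"
      using cut_Max(3)[OF T i] True by auto
    then show ?thesis
      using that[OF T cut_Max(1,2)[OF T i]] True by auto
  next
    case False
    let ?T = "{j. x $ r \<le> x $ j}"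
    have T: "cut ?T" by (rule cut_level_x)
    have i: "i \<notin> ?T" using False ij by simp
    have "x $ r \<noteq> x $ Min (- ?T)"
      using cut_Min(3)[OF T i] by auto
    then show ?thesis
      using that[OF T cut_Min(1,2)[OF T i]] i by auto
  qed
  define g where "g = \<bar>x $ r - x $ l\<bar> / 2"
  have g: "0 < g"
    using xl by (simp add: g_def)
  have "(\<lambda>k. \<bar>z1 k $ r - z1 k $ l\<bar>) \<longlonglongrightarrow> \<bar>x $ r - x $ l\<bar>"
    by (intro tendsto_intros Z1_lim)
  then have ev: "\<forall>\<^sub>F k in sequentially. g < \<bar>z1 k $ r - z1 k $ l\<bar>"
    using g by (intro order_tendstoD(1)) (auto simp: g_def)
  have lim: "(\<lambda>k. (1 / g) * (B T k / t k)) \<longlonglongrightarrow> 0"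
    using tendsto_mult_left[OF B_lim(1)[OF T], of "1 / g"] by simp
  show ?thesis
  proof (rule tendsto_sandwich[OF _ _ tendsto_const lim])
    show "\<forall>\<^sub>F k in sequentially. 0 \<le> (Q k $ i $ r)\<^sup>2 / t k"
      by (intro always_eventually allI divide_nonneg_pos zero_le_power2 t_pos)
    show "\<forall>\<^sub>F k in sequentially. (Q k $ i $ r)\<^sup>2 / t k \<le> (1 / g) * (B T k / t k)"
      using ev
    proof eventually_elim
      case (elim k)
      have "(Q k $ i $ r)\<^sup>2 * g \<le> (Q k $ i $ r)\<^sup>2 * \<bar>z1 k $ r - z1 k $ l\<bar>"
        using elim by (intro mult_left_mono) auto
      also have "\<dots> \<le> B T k"
        by (rule entry_bound[OF T l ir])
      finally have "(Q k $ i $ r)\<^sup>2 \<le> (1 / g) * B T k"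
        using g by (simp add: field_simps)
      then have "(Q k $ i $ r)\<^sup>2 / t k \<le> (1 / g) * B T k / t k"
        using t_pos[of k] by (intro divide_right_mono) auto
      then show ?case
        by simp
    qed
  qed
qed

lemma product_lim_of_squares:
  assumes s: "(\<lambda>k. (Q k $ i $ r)\<^sup>2 / t k) \<longlonglongrightarrow> 0" "(\<lambda>k. (Q k $ j $ r)\<^sup>2 / t k) \<longlonglongrightarrow> 0" and f: "f \<longlonglongrightarrow> v"
  shows "(\<lambda>k. Q k $ i $ r * Q k $ j $ r * f k / t k) \<longlonglongrightarrow> 0"
proof -
  have "(\<lambda>k. ((Q k $ i $ r)\<^sup>2 / t k + (Q k $ j $ r)\<^sup>2 / t k) * \<bar>f k\<bar>) \<longlonglongrightarrow> (0 + 0) * \<bar>v\<bar>"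
    by (intro tendsto_intros s f)
  then have lim: "(\<lambda>k. ((Q k $ i $ r)\<^sup>2 / t k + (Q k $ j $ r)\<^sup>2 / t k) * \<bar>f k\<bar>) \<longlonglongrightarrow> 0"
    by simp
  show ?thesis
  proof (rule tendsto_0_le[OF lim, of _ 1], intro always_eventually allI)
    fix k
    have "norm (Q k $ i $ r * Q k $ j $ r * f k / t k) = \<bar>Q k $ i $ r * Q k $ j $ r\<bar> * \<bar>f k\<bar> / t k"
      using t_pos[of k] by (simp add: abs_mult)
    also have "\<dots> \<le> ((Q k $ i $ r)\<^sup>2 + (Q k $ j $ r)\<^sup>2) * \<bar>f k\<bar> / t k"
      using t_pos[of k] by (intro divide_right_mono mult_right_mono abs_mult_le_squares) auto
    also have "\<dots> = ((Q k $ i $ r)\<^sup>2 / t k + (Q k $ j $ r)\<^sup>2 / t k) * \<bar>f k\<bar>"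
      by (simp add: add_divide_distrib distrib_right)
    also have "\<dots> \<le> norm (((Q k $ i $ r)\<^sup>2 / t k + (Q k $ j $ r)\<^sup>2 / t k) * \<bar>f k\<bar>) * 1"
      by simp
    finally show "norm (Q k $ i $ r * Q k $ j $ r * f k / t k) \<le> norm (((Q k $ i $ r)\<^sup>2 / t k + (Q k $ j $ r)\<^sup>2 / t k) * \<bar>f k\<bar>) * 1" .
  qed
qed

lemma conj_Z1_shift:
  "(conj_by (P k) (Z1 k) $ i $ j - (if i = j then z2 k $ i else 0)) / t k =
    (\<Sum>r\<in>UNIV. Q k $ i $ r * Q k $ j $ r * (z1 k $ r - v) / t k) + (if i = j then (v - z2 k $ i) / t k else 0)"
  unfolding conj_Z1 orthogonal_row_sum_shift[OF orth_Q, of _ i j "\<lambda>r. z1 k $ r" v]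
  by (simp add: sum_divide_distrib[symmetric] add_divide_distrib diff_divide_distrib)

text \<open>Between different blocks of \<open>Y\<close> inside a block of \<open>X\<close>: both factors of \<open>Q\<^sub>i\<^sub>r Q\<^sub>j\<^sub>r (z\<^sub>r - z\<^sub>l)\<close> cannot
  lie on the same side of the cut through \<open>l\<close>.\<close>

lemma tangent_off_block_aux:
  assumes ij: "x $ i = x $ j" "y $ j < y $ i"
  shows "conj_by Pbar H $ i $ j = 0"
proof -
  let ?T = "{r. (x + y) $ i \<le> (x + y) $ r}"
  have T: "cut ?T" by (rule cut_level)
  have iT: "i \<in> ?T" and jT: "j \<notin> ?T"
    using ij by simp_all
  define l where "l = Max ?T"
  note l = cut_Max[OF T iT, folded l_def]
  have xl: "x $ l = x $ i"
  proof (rule antisym)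
    show "x $ l \<le> x $ i"
      using l(1)[OF iT] by (rule eigvals_antitone)
    show "x $ i \<le> x $ l"
      using l(2)[OF jT] eigvals_antitone[of l j X] ij(1) by simp
  qed
  have trm: "(\<lambda>k. Q k $ i $ r * Q k $ j $ r * (z1 k $ r - z1 k $ l) / t k) \<longlonglongrightarrow> 0" for r
  proof (cases "x $ r = x $ i")
    case True
    have sq_abs: "(u * v)\<^sup>2 = u\<^sup>2 * \<bar>v\<bar> * \<bar>v\<bar>" for u v :: real
      by (simp add: power_mult_distrib mult.assoc power2_eq_square[of v])
    \<comment> \<open>\<open>B\<close> over \<open>t\<close> alone would not control the squared
      entry. Since \<open>r\<close> and \<open>l\<close> lie in one block of \<open>x\<close>, the
      factor \<open>z1 k $ r - z1 k $ l\<close> supplies \<open>norm (Z1 k - X)\<close>; this is the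
      place of \<open>DX_lim\<close>.\<close>
    have sq: "(Q k $ i $ r * Q k $ j $ r * (z1 k $ r - z1 k $ l) / t k)\<^sup>2 \<le> 2 * (B ?T k * norm (Z1 k - X) / (t k)\<^sup>2)" for k
    proof -
      have B1: "(Q k $ i $ r * Q k $ j $ r)\<^sup>2 * \<bar>z1 k $ r - z1 k $ l\<bar> \<le> B ?T k"
      proof (cases "r \<in> ?T")
        case True
        have "(Q k $ i $ r * Q k $ j $ r)\<^sup>2 \<le> (Q k $ j $ r)\<^sup>2"
          unfolding power_mult_distrib using orthogonal_entry_le_1(1)[OF orth_Q[of k], of i r]
          by (intro mult_left_le_one_le) auto
        then have "(Q k $ i $ r * Q k $ j $ r)\<^sup>2 * \<bar>z1 k $ r - z1 k $ l\<bar> \<le> (Q k $ j $ r)\<^sup>2 * \<bar>z1 k $ r - z1 k $ l\<bar>"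
          by (rule mult_right_mono) simp
        also have "\<dots> \<le> B ?T k"
          by (rule entry_bound[OF T l(1,2)]) (use True jT in auto)
        finally show ?thesis .
      next
        case False
        have "(Q k $ i $ r * Q k $ j $ r)\<^sup>2 \<le> (Q k $ i $ r)\<^sup>2"
          unfolding power_mult_distrib using orthogonal_entry_le_1(1)[OF orth_Q[of k], of j r]
          by (intro mult_right_le_one_le) auto
        then have "(Q k $ i $ r * Q k $ j $ r)\<^sup>2 * \<bar>z1 k $ r - z1 k $ l\<bar> \<le> (Q k $ i $ r)\<^sup>2 * \<bar>z1 k $ r - z1 k $ l\<bar>"
          by (rule mult_right_mono) simp
        also have "\<dots> \<le> B ?T k"
          by (rule entry_bound[OF T l(1,2)]) (use False iT in auto)
        finally show ?thesis .
      qed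
      have zl: "\<bar>z1 k $ r - z1 k $ l\<bar> \<le> 2 * norm (Z1 k - X)"
        using abs_diff_eigvals_le[of k r] abs_diff_eigvals_le[of k l] xl True by linarith
      have "(Q k $ i $ r * Q k $ j $ r * (z1 k $ r - z1 k $ l))\<^sup>2
          = ((Q k $ i $ r * Q k $ j $ r)\<^sup>2 * \<bar>z1 k $ r - z1 k $ l\<bar>) * \<bar>z1 k $ r - z1 k $ l\<bar>"
        by (rule sq_abs)
      also have "\<dots> \<le> B ?T k * (2 * norm (Z1 k - X))"
        using B1 zl B_nonneg[OF T] by (intro mult_mono) auto
      finally have "(Q k $ i $ r * Q k $ j $ r * (z1 k $ r - z1 k $ l))\<^sup>2 / (t k)\<^sup>2 \<le> B ?T k * (2 * norm (Z1 k - X)) / (t k)\<^sup>2"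
        by (rule divide_right_mono) simp
      then show ?thesis
        by (simp add: power_divide mult_ac)
    qed
    have "(\<lambda>k. 2 * (B ?T k * norm (Z1 k - X) / (t k)\<^sup>2)) \<longlonglongrightarrow> 2 * 0"
      by (intro tendsto_intros B_lim(2)[OF T])
    then have lim: "(\<lambda>k. 2 * (B ?T k * norm (Z1 k - X) / (t k)\<^sup>2)) \<longlonglongrightarrow> 0"
      by simp
    have "(\<lambda>k. (Q k $ i $ r * Q k $ j $ r * (z1 k $ r - z1 k $ l) / t k)\<^sup>2) \<longlonglongrightarrow> 0"
      by (rule tendsto_sandwich[OF _ _ tendsto_const lim]) (use sq in auto)
    from tendsto_real_sqrt[OF this]
    have "(\<lambda>k. \<bar>Q k $ i $ r * Q k $ j $ r * (z1 k $ r - z1 k $ l) / t k\<bar>) \<longlonglongrightarrow> 0"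
      by (simp only: real_sqrt_abs real_sqrt_zero)
    then show ?thesis
      by (rule tendsto_rabs_zero_cancel)
  next
    case False
    then have "x $ i \<noteq> x $ r" "x $ j \<noteq> x $ r"
      using ij(1) by auto
    then show ?thesis
      by (intro product_lim_of_squares[where v = "x $ r - x $ l"] entry_across_lim tendsto_intros Z1_lim)
  qed
  have "(\<lambda>k. \<Sum>r\<in>UNIV. Q k $ i $ r * Q k $ j $ r * (z1 k $ r - z1 k $ l) / t k) \<longlonglongrightarrow> (\<Sum>r\<in>(UNIV :: 'n set). 0)"
    by (intro tendsto_sum trm)
  moreover have "i \<noteq> j"
    using ij(2) by auto
  ultimately have "(\<lambda>k. (conj_by (P k) (Z1 k) $ i $ j - (if i = j then z2 k $ i else 0)) / t k) \<longlonglongrightarrow> 0"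
    unfolding conj_Z1_shift[of k i j "z1 k $ l" for k] by simp
  from LIMSEQ_unique[OF conj_lim this] show ?thesis .
qed

lemma tangent_off_block: "x $ i = x $ j \<Longrightarrow> y $ i \<noteq> y $ j \<Longrightarrow> conj_by Pbar H $ i $ j = 0"
  using tangent_off_block_aux[of i j] tangent_off_block_aux[of j i] conj_by_commute[of Pbar H i j]
  by (cases "y $ j < y $ i") auto

lemma y_sub_eventually: "\<forall>\<^sub>F k in sequentially. y \<in> sub (z2 k)"
proof -
  obtain \<delta> where \<delta>: "0 < \<delta>" "\<And>w z. w \<in> sub z \<Longrightarrow> norm (w - y) < \<delta> \<Longrightarrow> y \<in> sub z"
    by (rule sub_nearby[of y]) blast
  have "(\<lambda>k. norm (w2 k - y)) \<longlonglongrightarrow> norm (y - y)"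
    by (intro tendsto_intros W2_lim)
  then have "\<forall>\<^sub>F k in sequentially. norm (w2 k - y) < \<delta>"
    using \<delta>(1) by (intro order_tendstoD(2)) auto
  then show ?thesis
    by eventually_elim (use \<delta>(2) subS_simultaneous(2)[OF W2_subS] in blast)
qed

text \<open>\<open>limit_in_L\<close> wants the fixed \<open>y\<close> as subgradient at
  \<open>z2 k\<close>, which \<open>sub_nearby\<close> supplies for large \<open>k\<close>.
  Replacing \<open>w2 k\<close> by \<open>y\<close> in the deficit costs only o(t).\<close>

lemma e_in_L: "e \<in> L"
proof -
  obtain N where N: "\<And>k. N \<le> k \<Longrightarrow> y \<in> sub (z2 k)"
    using y_sub_eventually by (auto simp: eventually_sequentially)
  let ?s = "\<lambda>k. k + N"
  show ?thesis
  proof (rule limit_in_L[of "\<lambda>k. z1 (?s k)" "\<lambda>k. z2 (?s k)" "\<lambda>k. t (?s k)"])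
    show "z1 (?s k) \<in> dm" for k
      using Z1_dmS by (simp add: dmS_def)
    show "y \<in> sub (z2 (?s k))" for k
      by (rule N) simp
    show "0 < t (?s k)" for k
      by (rule t_pos)
    show "(\<lambda>k. (1 / t (?s k)) *\<^sub>R (z1 (?s k) - z2 (?s k))) \<longlonglongrightarrow> e"
      using LIMSEQ_ignore_initial_segment[OF e_lim, of N] by simp
    have "(\<lambda>k. (th (z1 k) - th (z2 k) - y \<bullet> (z1 k - z2 k)) / t k) \<longlonglongrightarrow> 0"
    proof -
      have 1: "(\<lambda>k. (th (z1 k) - th (z2 k) - w2 k \<bullet> (z1 k - z2 k)) / t k) \<longlonglongrightarrow> 0"
      proof (rule tendsto_sandwich[OF _ _ tendsto_const D_lim])
        show "\<forall>\<^sub>F k in sequentially. 0 \<le> (th (z1 k) - th (z2 k) - w2 k \<bullet> (z1 k - z2 k)) / t k"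
          by (intro always_eventually allI divide_nonneg_pos D_split(2) t_pos)
        show "\<forall>\<^sub>F k in sequentially. (th (z1 k) - th (z2 k) - w2 k \<bullet> (z1 k - z2 k)) / t k \<le> D k / t k"
        proof (intro always_eventually allI divide_right_mono)
          show "th (z1 k) - th (z2 k) - w2 k \<bullet> (z1 k - z2 k) \<le> D k" for k
            using D_split(1,3)[of k] by linarith
        qed (rule less_imp_le[OF t_pos])
      qed
      have "(\<lambda>k. (w2 k - y) \<bullet> ((1 / t k) *\<^sub>R (z1 k - z2 k))) \<longlonglongrightarrow> (y - y) \<bullet> e"
        by (intro tendsto_intros W2_lim e_lim)
      then have 2: "(\<lambda>k. (w2 k - y) \<bullet> (z1 k - z2 k) / t k) \<longlonglongrightarrow> 0"
        by simp
      have "(th (z1 k) - th (z2 k) - w2 k \<bullet> (z1 k - z2 k)) / t k + (w2 k - y) \<bullet> (z1 k - z2 k) / t k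
          = (th (z1 k) - th (z2 k) - y \<bullet> (z1 k - z2 k)) / t k" for k
        by (simp add: inner_diff_left add_divide_distrib[symmetric])
      with tendsto_add[OF 1 2] show ?thesis
        by simp
    qed
    from LIMSEQ_ignore_initial_segment[OF this, of N]
    show "(\<lambda>k. (th (z1 (?s k)) - th (z2 (?s k)) - y \<bullet> (z1 (?s k) - z2 (?s k))) / t (?s k)) \<longlonglongrightarrow> 0" .
  qed
qed

text \<open>\<open>z2 k - x\<close> lies in \<open>L\<close>, so \<open>z2 k\<close> is constant on
  the block; the spread of \<open>z1 k\<close> comes from \<open>e\<close>, which is constant there
  too.\<close>

lemma z1_block_lim:
  assumes i: "Eblk i" "x $ i = x $ j" "y $ i = y $ j"
  shows "(\<lambda>k. (z1 k $ j - z1 k $ i) / t k) \<longlonglongrightarrow> 0"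
proof -
  have lim: "(\<lambda>k. (z1 k $ j - z2 k $ j) / t k - (z1 k $ i - z2 k $ i) / t k) \<longlonglongrightarrow> e $ j - e $ i"
    by (intro tendsto_intros e_nth_lim)
  have ej: "e $ j - e $ i = 0"
    using L_constant_on_Eblk[OF e_in_L i] by simp
  have "\<forall>\<^sub>F k in sequentially. (z1 k $ j - z2 k $ j) / t k - (z1 k $ i - z2 k $ i) / t k = (z1 k $ j - z1 k $ i) / t k"
    using y_sub_eventually
  proof eventually_elim
    case (elim k)
    have "z2 k $ i - x $ i = z2 k $ j - x $ j"
      using L_constant_on_Eblk[OF diff_in_L[OF elim y_sub] i] by simp
    then have "z2 k $ i = z2 k $ j"
      using i(2) by simp
    then show ?case
      by (simp add: diff_divide_distrib)
  qed
  from Lim_transform_eventually[OF lim this] show ?thesis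
    by (simp add: ej)
qed

text \<open>Recentred at \<open>z1 k $ i\<close>, the terms of the block of \<open>i\<close> are
  o(t) by \<open>z1_block_lim\<close>. For \<open>r\<close> outside, a cut with threshold index
  \<open>l\<close> in that block separates \<open>r\<close> from both \<open>i\<close> and
  \<open>j\<close>, and \<open>B\<close> bounds the remaining term.\<close>

lemma tangent_Eblk:
  assumes i: "Eblk i" and j: "x $ i = x $ j" "y $ i = y $ j"
  shows "conj_by Pbar H $ i $ j = (if i = j then e $ i else 0)"
proof -
  have trm: "(\<lambda>k. Q k $ i $ r * Q k $ j $ r * (z1 k $ r - z1 k $ i) / t k) \<longlonglongrightarrow> 0" for r
  proof -
    have ex: "\<exists>T l. cut T \<and> (\<forall>j\<in>T. j \<le> l) \<and> (\<forall>j\<in>-T. l \<le> j) \<and> (i \<in> T) \<noteq> (r \<in> T) \<and> (x + y) $ l = (x + y) $ i"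
      if "(x + y) $ r \<noteq> (x + y) $ i"
    proof (cases "(x + y) $ r < (x + y) $ i")
      case True
      let ?T = "{r. (x + y) $ i \<le> (x + y) $ r}"
      have T: "cut ?T" by (rule cut_level)
      have iT: "i \<in> ?T" by simp
      have "(x + y) $ Max ?T = (x + y) $ i"
      proof (rule antisym)
        show "(x + y) $ Max ?T \<le> (x + y) $ i"
          using eigvals_antitone[OF cut_Max(1)[OF T iT iT], of X] eigvals_antitone[OF cut_Max(1)[OF T iT iT], of Y] by simp
        show "(x + y) $ i \<le> (x + y) $ Max ?T"
          using cut_Max(3)[OF T iT] by simp
      qed
      then show ?thesis
        using T cut_Max(1,2)[OF T iT] True
        by (intro exI[of _ ?T] exI[of _ "Max ?T"]) auto
    next
      case False
      let ?T = "{r. (x + y) $ i < (x + y) $ r}"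
      have T: "cut ?T" by (rule cut_level)
      have iT: "i \<notin> ?T" by simp
      have "(x + y) $ Min (- ?T) = (x + y) $ i"
      proof (rule antisym)
        show "(x + y) $ i \<le> (x + y) $ Min (- ?T)"
          using eigvals_antitone[OF cut_Min(2)[OF T iT iT], of X] eigvals_antitone[OF cut_Min(2)[OF T iT iT], of Y] by simp
        show "(x + y) $ Min (- ?T) \<le> (x + y) $ i"
          using cut_Min(3)[OF T iT] by simp
      qed
      then show ?thesis
        using T cut_Min(1,2)[OF T iT] False that
        by (intro exI[of _ ?T] exI[of _ "Min (- ?T)"]) auto
    qed
    show ?thesis
    proof (cases "(x + y) $ r = (x + y) $ i")
      case True
      then have "(\<lambda>k. (z1 k $ r - z1 k $ i) / t k) \<longlonglongrightarrow> 0"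
        using sum_eigvals_eq_iff[of r i] by (intro z1_block_lim i) auto
      then have "(\<lambda>k. \<bar>(z1 k $ r - z1 k $ i) / t k\<bar>) \<longlonglongrightarrow> 0"
        by (rule tendsto_rabs_zero)
      then show ?thesis
      proof (rule tendsto_0_le[of _ _ _ 1], intro always_eventually allI)
        fix k
        have "\<bar>Q k $ i $ r * Q k $ j $ r\<bar> \<le> 1"
          unfolding abs_mult using orthogonal_entry_le_1(2)[OF orth_Q[of k]] by (intro mult_le_one) auto
        then have "\<bar>Q k $ i $ r * Q k $ j $ r\<bar> * \<bar>(z1 k $ r - z1 k $ i) / t k\<bar> \<le> 1 * \<bar>(z1 k $ r - z1 k $ i) / t k\<bar>"
          by (rule mult_right_mono) simp
        then show "norm (Q k $ i $ r * Q k $ j $ r * (z1 k $ r - z1 k $ i) / t k) \<le> norm \<bar>(z1 k $ r - z1 k $ i) / t k\<bar> * 1"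
          by (simp add: abs_mult mult.assoc)
      qed
    next
      case False
      then obtain T l where T: "cut T" and l: "\<And>j. j \<in> T \<Longrightarrow> j \<le> l" "\<And>j. j \<notin> T \<Longrightarrow> l \<le> j"
        and ir: "(i \<in> T) \<noteq> (r \<in> T)" and xl: "(x + y) $ l = (x + y) $ i"
        using ex by (metis ComplI)
      have jT: "(j \<in> T) \<noteq> (r \<in> T)"
      proof -
        have "(x + y) $ j = (x + y) $ i"
          using j by simp
        then have "j \<in> T \<longleftrightarrow> i \<in> T"
          using cutD(1)[OF T, of i j] cutD(1)[OF T, of j i] by fastforce
        then show ?thesis
          using ir by simp
      qed
      have zl: "(\<lambda>k. (z1 k $ l - z1 k $ i) / t k) \<longlonglongrightarrow> 0"
        using xl sum_eigvals_eq_iff[of l i] by (intro z1_block_lim i) auto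
      have "(\<lambda>k. 2 * (B T k / t k) + \<bar>(z1 k $ l - z1 k $ i) / t k\<bar>) \<longlonglongrightarrow> 2 * 0 + \<bar>0\<bar>"
        by (intro tendsto_intros B_lim(1)[OF T] zl)
      then have lim: "(\<lambda>k. 2 * (B T k / t k) + \<bar>(z1 k $ l - z1 k $ i) / t k\<bar>) \<longlonglongrightarrow> 0"
        by simp
      show ?thesis
      proof (rule tendsto_0_le[OF lim, of _ 1], intro always_eventually allI)
        fix k
        let ?q = "Q k $ i $ r * Q k $ j $ r"
        have q1: "\<bar>?q\<bar> \<le> 1"
          unfolding abs_mult using orthogonal_entry_le_1(2)[OF orth_Q[of k]] by (intro mult_le_one) auto
        have "\<bar>?q\<bar> * \<bar>z1 k $ r - z1 k $ l\<bar> \<le> ((Q k $ i $ r)\<^sup>2 + (Q k $ j $ r)\<^sup>2) * \<bar>z1 k $ r - z1 k $ l\<bar>"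
          by (intro mult_right_mono abs_mult_le_squares) auto
        also have "\<dots> \<le> 2 * B T k"
          using entry_bound[OF T l ir, of k] entry_bound[OF T l jT, of k] by (simp add: distrib_right)
        finally have 1: "\<bar>?q\<bar> * \<bar>z1 k $ r - z1 k $ l\<bar> \<le> 2 * B T k" .
        have 2: "\<bar>?q\<bar> * \<bar>z1 k $ l - z1 k $ i\<bar> \<le> \<bar>z1 k $ l - z1 k $ i\<bar>"
          using mult_right_mono[OF q1, of "\<bar>z1 k $ l - z1 k $ i\<bar>"] by simp
        have "\<bar>?q\<bar> * \<bar>z1 k $ r - z1 k $ i\<bar> \<le> \<bar>?q\<bar> * (\<bar>z1 k $ r - z1 k $ l\<bar> + \<bar>z1 k $ l - z1 k $ i\<bar>)"
          by (intro mult_left_mono) auto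
        then have "\<bar>?q\<bar> * \<bar>z1 k $ r - z1 k $ i\<bar> \<le> 2 * B T k + \<bar>z1 k $ l - z1 k $ i\<bar>"
          using 1 2 by (simp add: distrib_left)
        then have "\<bar>?q\<bar> * \<bar>z1 k $ r - z1 k $ i\<bar> / t k \<le> (2 * B T k + \<bar>z1 k $ l - z1 k $ i\<bar>) / t k"
          using t_pos[of k] by (intro divide_right_mono) auto
        also have "\<dots> = 2 * (B T k / t k) + \<bar>(z1 k $ l - z1 k $ i) / t k\<bar>"
          using t_pos[of k] by (simp add: add_divide_distrib)
        finally have "\<bar>?q * (z1 k $ r - z1 k $ i) / t k\<bar> \<le> 2 * (B T k / t k) + \<bar>(z1 k $ l - z1 k $ i) / t k\<bar>"
          using t_pos[of k] by (simp add: abs_mult)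
        then show "norm (?q * (z1 k $ r - z1 k $ i) / t k) \<le> norm (2 * (B T k / t k) + \<bar>(z1 k $ l - z1 k $ i) / t k\<bar>) * 1"
          by simp
      qed
    qed
  qed
  have "(\<lambda>k. (\<Sum>r\<in>UNIV. Q k $ i $ r * Q k $ j $ r * (z1 k $ r - z1 k $ i) / t k) + (if i = j then (z1 k $ i - z2 k $ i) / t k else 0))
      \<longlonglongrightarrow> (\<Sum>r\<in>(UNIV :: 'n set). 0) + (if i = j then e $ i else 0)"
  proof (intro tendsto_add tendsto_sum trm)
    show "(\<lambda>k. if i = j then (z1 k $ i - z2 k $ i) / t k else 0) \<longlonglongrightarrow> (if i = j then e $ i else 0)"
      by (cases "i = j") (simp_all add: e_nth_lim)
  qed
  then have "(\<lambda>k. (conj_by (P k) (Z1 k) $ i $ j - (if i = j then z2 k $ i else 0)) / t k) \<longlonglongrightarrow> (if i = j then e $ i else 0)"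
    unfolding conj_Z1_shift[of k i j "z1 k $ i" for k] by simp
  from LIMSEQ_unique[OF conj_lim this] show ?thesis .
qed

text \<open>The diagonal of the limit equals \<open>e\<close> entrywise on \<open>Eblk\<close>
  blocks and in block sums elsewhere, which is all that such a \<open>w\<close> sees.\<close>

lemma inner_diag_eq:
  assumes w: "\<And>i j. \<not> Eblk i \<Longrightarrow> x $ i = x $ j \<Longrightarrow> y $ i = y $ j \<Longrightarrow> w $ i = w $ j"
  shows "diag (conj_by Pbar H) \<bullet> w = e \<bullet> w"
proof -
  define s where "s i = (x + y) $ i" for i
  define f where "f i = (conj_by Pbar H $ i $ i - e $ i) * w $ i" for i
  have "(\<Sum>i\<in>UNIV. f i) = (\<Sum>v\<in>range s. \<Sum>i\<in>{i \<in> UNIV. s i = v}. f i)"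
    by (rule sum.image_gen) simp
  also have "\<dots> = 0"
  proof (rule sum.neutral, rule ballI)
    fix v assume "v \<in> range s"
    then obtain i where v: "v = s i" by blast
    have same: "x $ i = x $ j" "y $ i = y $ j" if "s j = s i" for j
      using sum_eigvals_eq_iff[of j i] that by (simp_all add: s_def)
    show "(\<Sum>j\<in>{j \<in> UNIV. s j = v}. f j) = 0"
    proof (cases "Eblk i")
      case True
      have "f j = 0" if "s j = s i" for j
      proof -
        have "Eblk j"
          using True same[OF that] unfolding Eblk_def by simp
        then show ?thesis
          using tangent_Eblk[of j j] by (simp add: f_def)
      qed
      then show ?thesis
        by (simp add: v)
    next
      case False
      have "f j = (conj_by Pbar H $ j $ j - e $ j) * w $ i" if "s j = s i" for j
        using w[OF False same[OF that]] by (simp add: f_def)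
      then have "(\<Sum>j\<in>{j \<in> UNIV. s j = v}. f j) = (\<Sum>j | s j = s i. (conj_by Pbar H $ j $ j - e $ j) * w $ i)"
        unfolding v by (intro sum.cong) simp_all
      also have "\<dots> = ((\<Sum>j | s j = s i. conj_by Pbar H $ j $ j) - (\<Sum>j | s j = s i. e $ j)) * w $ i"
        by (simp add: sum_distrib_right[symmetric] sum_subtractf)
      also have "\<dots> = 0"
        using trace_block[of i] by (simp add: s_def)
      finally show ?thesis .
    qed
  qed
  finally have "(\<Sum>i\<in>UNIV. f i) = 0" .
  then show ?thesis
    by (simp add: f_def inner_vec_def left_diff_distrib sum_subtractf)
qed

text \<open>Strictly active vectors are constant on the blocks without \<open>Eblk\<close>, so
  \<open>inner_diag_eq\<close> transfers membership in \<open>L\<close> from \<open>e\<close> to the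
  diagonal.\<close>

lemma limit_tangent: "H \<in> tangent Pbar"
proof -
  have "diag (conj_by Pbar H) \<in> L"
    unfolding L_def
  proof (intro CollectI conjI ballI)
    fix \<nu> \<nu>' assume \<nu>: "\<nu> \<in> E1" "\<nu>' \<in> E1"
    have "diag (conj_by Pbar H) \<bullet> (a \<nu>' - a \<nu>) = e \<bullet> (a \<nu>' - a \<nu>)"
      using constant_off_Eblk(1)[OF _ _ _ \<nu>(1)] constant_off_Eblk(1)[OF _ _ _ \<nu>(2)]
      by (intro inner_diag_eq) simp
    then show "diag (conj_by Pbar H) \<bullet> (a \<nu>' - a \<nu>) = 0"
      using LD(1)[OF e_in_L \<nu>] by (simp add: inner_diff_right)
  next
    fix \<mu> assume \<mu>: "\<mu> \<in> E2"
    have "diag (conj_by Pbar H) \<bullet> b \<mu> = e \<bullet> b \<mu>"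
      by (rule inner_diag_eq) (rule constant_off_Eblk(2)[OF _ _ _ \<mu>])
    then show "diag (conj_by Pbar H) \<bullet> b \<mu> = 0"
      using LD(2)[OF e_in_L \<mu>] by simp
  qed
  then show ?thesis
    unfolding tangent_def using tangent_off_block tangent_Eblk by simp
qed

end

section \<open>The quadratic form\<close>

lemma kth_largest_bij: "finite S \<Longrightarrow> bij_betw (kth_largest S) {1..card S} S"
  and kth_largest_less: "finite S \<Longrightarrow> k \<in> {1..card S} \<Longrightarrow> l \<in> {1..card S} \<Longrightarrow> k < l \<Longrightarrow> kth_largest S l < kth_largest S k"
proof -
  assume S: "finite S"
  define xs where "xs = rev (sorted_list_of_set S)"
  have xs: "set xs = S" "length xs = card S" "distinct xs"
    using S by (simp_all add: xs_def)
  have kth: "kth_largest S k = xs ! (k - 1)" for k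
    by (simp add: kth_largest_def xs_def)
  have less: "xs ! j < xs ! i" if "i < j" "j < length xs" for i j
  proof -
    have "sorted_wrt (<) (sorted_list_of_set S)"
      by (rule strict_sorted_list_of_set)
    then have "sorted_wrt (>) xs"
      by (simp add: xs_def sorted_wrt_rev)
    then show ?thesis
      using that by (simp add: sorted_wrt_iff_nth_less)
  qed
  show "kth_largest S l < kth_largest S k" if "k \<in> {1..card S}" "l \<in> {1..card S}" "k < l" for k l
    unfolding kth using that xs(2) by (intro less) auto
  then have inj: "inj_on (kth_largest S) {1..card S}"
    by (intro inj_onI) (metis linorder_neq_iff less_irrefl)
  have "kth_largest S ` {1..card S} \<subseteq> S"
    unfolding kth using xs(1,2) by (auto intro!: nth_mem simp flip: xs(1))
  moreover have "card (kth_largest S ` {1..card S}) = card S"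
    using card_image[OF inj] by simp
  ultimately have "kth_largest S ` {1..card S} = S"
    using S by (intro card_subset_eq) auto
  with inj show "bij_betw (kth_largest S) {1..card S} S"
    by (simp add: bij_betw_def)
qed

lemma obtain_kth_largest:
  assumes "finite S" "s \<in> S"
  obtains k where "k \<in> {1..card S}" "s = kth_largest S k"
  using kth_largest_bij[OF assms(1)] assms(2) unfolding bij_betw_def by blast

lemma kth_largest_eq_iff:
  assumes "finite S" "k \<in> {1..card S}" "l \<in> {1..card S}"
  shows "kth_largest S k = kth_largest S l \<longleftrightarrow> k = l"
  using kth_largest_bij[OF assms(1)] assms(2,3) unfolding bij_betw_def by (auto dest: inj_onD)

lemma kth_largest_less_iff:
  assumes "finite S" "k \<in> {1..card S}" "l \<in> {1..card S}"
  shows "kth_largest S l < kth_largest S k \<longleftrightarrow> k < l"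
  using kth_largest_less[OF assms] kth_largest_less[OF assms(1,3,2)] kth_largest_eq_iff[OF assms]
  by (cases k l rule: linorder_cases) auto

lemma sum_alpha:
  fixes F :: "'n::{finite,linorder} \<Rightarrow> real"
  shows "(\<Sum>l\<in>{1..num_eigs X}. \<Sum>i\<in>alpha X l. F i) = (\<Sum>i\<in>UNIV. F i)"
proof -
  let ?S = "range (($) (eigvals X))"
  have fin: "finite ?S" by simp
  define idx where "idx i = (THE l. l \<in> {1..num_eigs X} \<and> eigvals X $ i = kth_largest ?S l)" for i
  have idx: "idx i \<in> {1..num_eigs X}" "eigvals X $ i = kth_largest ?S (idx i)" for i
  proof -
    obtain l where l: "l \<in> {1..card ?S}" "eigvals X $ i = kth_largest ?S l"
      by (rule obtain_kth_largest[OF fin rangeI]) blast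
    have "idx i = l"
      unfolding idx_def num_eigs_def using l kth_largest_eq_iff[OF fin] by (intro the_equality) auto
    then show "idx i \<in> {1..num_eigs X}" "eigvals X $ i = kth_largest ?S (idx i)"
      using l by (simp_all add: num_eigs_def)
  qed
  have "alpha X l = {i \<in> UNIV. idx i = l}" if "l \<in> {1..num_eigs X}" for l
  proof (rule set_eqI)
    fix i
    have "i \<in> alpha X l \<longleftrightarrow> kth_largest ?S (idx i) = kth_largest ?S l"
      by (simp only: alpha_def mem_Collect_eq idx(2)[symmetric])
    also have "\<dots> \<longleftrightarrow> i \<in> {i \<in> UNIV. idx i = l}"
      using kth_largest_eq_iff[OF fin idx(1)[of i, unfolded num_eigs_def] that[unfolded num_eigs_def]] by simp
    finally show "i \<in> alpha X l \<longleftrightarrow> i \<in> {i \<in> UNIV. idx i = l}" .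
  qed
  then have "(\<Sum>l\<in>{1..num_eigs X}. \<Sum>i\<in>alpha X l. F i) = (\<Sum>l\<in>{1..num_eigs X}. \<Sum>i\<in>{i \<in> UNIV. idx i = l}. F i)"
    by (intro sum.cong) auto
  also have "\<dots> = (\<Sum>i\<in>UNIV. F i)"
    by (rule sum.group) (use idx(1) in auto)
  finally show ?thesis .
qed

text \<open>Brings the block sum of \<open>Upsilon\<close> into the form of \<open>qform\<close>: it
  runs over the ordered pairs with decreasing eigenvalues, and the factor 2 symmetrizes.\<close>

lemma sum_alpha_pairs:
  fixes F :: "'n::{finite,linorder} \<Rightarrow> 'n \<Rightarrow> real"
  assumes sym: "\<And>i j. F i j = F j i" and diag: "\<And>i j. eigvals X $ i = eigvals X $ j \<Longrightarrow> F i j = 0"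
  shows "2 * (\<Sum>l\<in>{1..num_eigs X}. \<Sum>l'\<in>{l<..num_eigs X}. \<Sum>i\<in>alpha X l. \<Sum>j\<in>alpha X l'. F i j)
    = (\<Sum>i\<in>UNIV. \<Sum>j\<in>UNIV. F i j)"
proof -
  let ?S = "range (($) (eigvals X))" and ?N = "{1..num_eigs X}"
  let ?F = "\<lambda>i j. if eigvals X $ j < eigvals X $ i then F i j else 0"
  have fin: "finite ?S" by simp
  have "(\<Sum>l'\<in>{l<..num_eigs X}. \<Sum>i\<in>alpha X l. \<Sum>j\<in>alpha X l'. F i j) = (\<Sum>i\<in>alpha X l. \<Sum>l'\<in>?N. \<Sum>j\<in>alpha X l'. ?F i j)"
    if l: "l \<in> ?N" for l
  proof -
    have in_l: "(\<Sum>i\<in>alpha X l. \<Sum>j\<in>alpha X l'. ?F i j) = (if l < l' then \<Sum>i\<in>alpha X l. \<Sum>j\<in>alpha X l'. F i j else 0)"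
      if l': "l' \<in> ?N" for l'
    proof -
      have "eigvals X $ j < eigvals X $ i \<longleftrightarrow> l < l'" if "i \<in> alpha X l" "j \<in> alpha X l'" for i j
        using kth_largest_less_iff[OF fin, of l l'] l l' that by (simp add: alpha_def num_eigs_def)
      then show ?thesis
        by (auto intro!: sum.cong sum.neutral)
    qed
    have "(\<Sum>i\<in>alpha X l. \<Sum>l'\<in>?N. \<Sum>j\<in>alpha X l'. ?F i j) = (\<Sum>l'\<in>?N. \<Sum>i\<in>alpha X l. \<Sum>j\<in>alpha X l'. ?F i j)"
      by (rule sum.swap)
    also have "\<dots> = (\<Sum>l'\<in>?N. if l < l' then \<Sum>i\<in>alpha X l. \<Sum>j\<in>alpha X l'. F i j else 0)"
      by (rule sum.cong[OF refl in_l])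
    also have "\<dots> = (\<Sum>l'\<in>{l<..num_eigs X}. \<Sum>i\<in>alpha X l. \<Sum>j\<in>alpha X l'. F i j)"
      using l by (intro sum.mono_neutral_cong_right) auto
    finally show ?thesis by simp
  qed
  then have "(\<Sum>l\<in>?N. \<Sum>l'\<in>{l<..num_eigs X}. \<Sum>i\<in>alpha X l. \<Sum>j\<in>alpha X l'. F i j)
      = (\<Sum>l\<in>?N. \<Sum>i\<in>alpha X l. \<Sum>l'\<in>?N. \<Sum>j\<in>alpha X l'. ?F i j)"
    by (intro sum.cong) auto
  also have "\<dots> = (\<Sum>i\<in>UNIV. \<Sum>j\<in>UNIV. ?F i j)"
    by (simp only: sum_alpha)
  finally have 1: "(\<Sum>l\<in>?N. \<Sum>l'\<in>{l<..num_eigs X}. \<Sum>i\<in>alpha X l. \<Sum>j\<in>alpha X l'. F i j) = (\<Sum>i\<in>UNIV. \<Sum>j\<in>UNIV. ?F i j)" .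
  have "(\<Sum>i\<in>UNIV. \<Sum>j\<in>UNIV. ?F i j) = (\<Sum>j\<in>UNIV. \<Sum>i\<in>UNIV. ?F i j)"
    by (rule sum.swap)
  then have "2 * (\<Sum>i\<in>UNIV. \<Sum>j\<in>UNIV. ?F i j) = (\<Sum>i\<in>UNIV. \<Sum>j\<in>UNIV. ?F i j + ?F j i)"
    by (simp add: sum.distrib)
  also have "\<dots> = (\<Sum>i\<in>UNIV. \<Sum>j\<in>UNIV. F i j)"
  proof (intro sum.cong refl)
    fix i j
    show "?F i j + ?F j i = F i j"
      using diag[of i j] sym[of i j] by (cases "eigvals X $ i" "eigvals X $ j" rule: linorder_cases) auto
  qed
  finally show ?thesis
    unfolding 1 .
qed

text \<open>Matrices commuting with \<open>Diag x\<close> and \<open>Diag y\<close> only mix indices with equal coefficients.\<close>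

lemma label_form_invariant:
  fixes Q1 Q2 A :: "real^'n::finite^'n"
  assumes Q: "orthogonal_matrix Q1" "orthogonal_matrix Q2"
    and lab: "\<And>i j. Q1 $ i $ j \<noteq> 0 \<Longrightarrow> f i = f j" "\<And>i j. Q2 $ i $ j \<noteq> 0 \<Longrightarrow> f i = f j"
  shows "(\<Sum>i\<in>UNIV. \<Sum>j\<in>UNIV. c (f i) (f j) * ((transpose Q1 ** A ** Q2) $ i $ j)\<^sup>2)
    = (\<Sum>i\<in>UNIV. \<Sum>j\<in>UNIV. c (f i) (f j) * (A $ i $ j)\<^sup>2)"
proof -
  define wt where "wt M = (\<chi> i j. c (f i) (f j) * M $ i $ j)" for M :: "real^'n^'n"
  have form: "(\<Sum>i\<in>UNIV. \<Sum>j\<in>UNIV. c (f i) (f j) * (M $ i $ j)\<^sup>2) = M \<bullet> wt M" for M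
    by (simp add: inner_matrix_sum wt_def power2_eq_square mult_ac)
  have entry: "(transpose Q1 ** M ** Q2) $ i $ j = (\<Sum>l\<in>UNIV. \<Sum>k\<in>UNIV. Q1 $ k $ i * M $ k $ l * Q2 $ l $ j)" for M i j
    by (simp add: matrix_matrix_mult_def sum_distrib_right)
  have "wt (transpose Q1 ** A ** Q2) = transpose Q1 ** wt A ** Q2"
  proof -
    have "wt (transpose Q1 ** A ** Q2) $ i $ j = (transpose Q1 ** wt A ** Q2) $ i $ j" for i j
    proof -
      have scaled: "c (f i) (f j) * (Q1 $ k $ i * A $ k $ l * Q2 $ l $ j) = Q1 $ k $ i * wt A $ k $ l * Q2 $ l $ j" for k l
        using lab(1)[of k i] lab(2)[of l j] by (cases "Q1 $ k $ i = 0 \<or> Q2 $ l $ j = 0") (auto simp: wt_def)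
      have "wt (transpose Q1 ** A ** Q2) $ i $ j = c (f i) (f j) * (\<Sum>l\<in>UNIV. \<Sum>k\<in>UNIV. Q1 $ k $ i * A $ k $ l * Q2 $ l $ j)"
        by (simp only: wt_def vec_lambda_beta entry)
      also have "\<dots> = (\<Sum>l\<in>UNIV. \<Sum>k\<in>UNIV. Q1 $ k $ i * wt A $ k $ l * Q2 $ l $ j)"
        unfolding sum_distrib_left by (intro sum.cong refl scaled)
      also have "\<dots> = (transpose Q1 ** wt A ** Q2) $ i $ j"
        by (simp only: entry)
      finally show ?thesis .
    qed
    then show ?thesis
      by (simp add: vec_eq_iff)
  qed
  then have "(transpose Q1 ** A ** Q2) \<bullet> wt (transpose Q1 ** A ** Q2) = (transpose Q1 ** A ** Q2) \<bullet> (transpose Q1 ** wt A ** Q2)"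
    by simp
  also have "\<dots> = A \<bullet> wt A"
    using Q by (simp add: inner_orthogonal_mult)
  finally show ?thesis
    unfolding form .
qed

text \<open>The transition matrix commutes with \<open>Diag (eigvals X)\<close>, so it links only
  equal eigenvalues.\<close>

lemma eig_orth_change_label:
  assumes P: "P \<in> eig_orth X" "R \<in> eig_orth X" and ne: "(transpose P ** R) $ i $ j \<noteq> 0"
  shows "eigvals X $ i = eigvals X $ j"
proof -
  have oP: "orthogonal_matrix P" and oR: "orthogonal_matrix R"
    using P by (simp_all add: eig_orth_iff)
  have XP: "mat_of X = P ** Diag (eigvals X) ** transpose P" and XR: "mat_of X = R ** Diag (eigvals X) ** transpose R"
    using P by (simp_all add: eig_orth_def)
  have "transpose P ** mat_of X ** R = Diag (eigvals X) ** (transpose P ** R)"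
    unfolding XP using oP by (simp add: matrix_mul_assoc)
  moreover have "transpose P ** mat_of X ** R = (transpose P ** R) ** Diag (eigvals X)"
    unfolding XR using oR by (simp add: matrix_mul_assoc)
  ultimately have "(Diag (eigvals X) ** (transpose P ** R)) $ i $ j = ((transpose P ** R) ** Diag (eigvals X)) $ i $ j"
    by simp
  then show ?thesis
    using ne by (simp only: mult_Diag_nth) simp
qed

lemma closed_eig_orth_limit:
  assumes P: "\<And>k. P k \<in> eig_orth (Z k)" and lim: "P \<longlonglongrightarrow> R" "Z \<longlonglongrightarrow> X"
  shows "R \<in> eig_orth X"
proof -
  have "\<And>k. P k \<in> {P. orthogonal_matrix P}"
    using P by (simp add: eig_orth_iff)
  then have "R \<in> {P. orthogonal_matrix P}"
    by (rule closed_sequentially[OF closed_orthogonal_matrices _ lim(1)])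
  moreover have "mat_of X = R ** Diag (eigvals X) ** transpose R"
  proof (rule LIMSEQ_unique)
    show "(\<lambda>k. mat_of (Z k)) \<longlonglongrightarrow> mat_of X"
      by (intro tendsto_intros lim)
    have "(\<lambda>k. P k ** Diag (eigvals (Z k)) ** transpose (P k)) \<longlonglongrightarrow> R ** Diag (eigvals X) ** transpose R"
      by (intro tendsto_intros lim)
    moreover have "mat_of (Z k) = P k ** Diag (eigvals (Z k)) ** transpose (P k)" for k
      using P[of k] by (simp add: eig_orth_def)
    ultimately show "(\<lambda>k. mat_of (Z k)) \<longlonglongrightarrow> R ** Diag (eigvals X) ** transpose R"
      by simp
  qed
  ultimately show ?thesis
    by (simp add: eig_orth_def)
qed

context spectral_pair
begin

text \<open>\<open>Upsilon\<close> as a sum over all pairs of indices; pairs inside a block of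
  \<open>X\<close> contribute 0 by the convention \<open>u / 0 = 0\<close>.\<close>

definition qform :: "'n rmat \<Rightarrow> 'n symmat \<Rightarrow> real"
  where "qform P H = (\<Sum>i\<in>UNIV. \<Sum>j\<in>UNIV. (y $ i - y $ j) / (x $ i - x $ j) * (conj_by P H $ i $ j)\<^sup>2)"

lemma coefficient_nonneg: "0 \<le> (y $ i - y $ j) / (x $ i - x $ j)"
proof (cases "i \<le> j")
  case True
  then show ?thesis
    using eigvals_antitone[OF True, of X] eigvals_antitone[OF True, of Y] by simp
next
  case False
  then have ji: "j \<le> i" by simp
  show ?thesis
    using eigvals_antitone[OF ji, of X] eigvals_antitone[OF ji, of Y] by (intro divide_nonpos_nonpos) auto
qed

lemma qform_nonneg: "0 \<le> qform P H"
  unfolding qform_def by (intro sum_nonneg mult_nonneg_nonneg coefficient_nonneg zero_le_power2)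

lemma qform_eq_0_iff:
  "qform P H = 0 \<longleftrightarrow> (\<forall>i j. x $ i \<noteq> x $ j \<and> y $ i \<noteq> y $ j \<longrightarrow> conj_by P H $ i $ j = 0)"
proof -
  have nn: "0 \<le> (y $ i - y $ j) / (x $ i - x $ j) * (conj_by P H $ i $ j)\<^sup>2" for i j
    by (intro mult_nonneg_nonneg coefficient_nonneg zero_le_power2)
  have "qform P H = 0 \<longleftrightarrow> (\<forall>i j. (y $ i - y $ j) / (x $ i - x $ j) * (conj_by P H $ i $ j)\<^sup>2 = 0)"
    unfolding qform_def using nn by (simp add: sum_nonneg_eq_0_iff sum_nonneg del: mult_eq_0_iff)
  then show ?thesis
    by auto
qed

text \<open>Limits of the eigenbases of two sequences may differ, so the form must allow different
  bases left and right. Both transition matrices mix only indices with equal entries in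
  \<open>x\<close> and in \<open>y\<close>.\<close>

lemma qform_mixed:
  assumes P: "P \<in> eig_orth X \<inter> eig_orth Y" and R1: "R1 \<in> eig_orth X \<inter> eig_orth Y" and R2: "R2 \<in> eig_orth X \<inter> eig_orth Y"
  shows "(\<Sum>i\<in>UNIV. \<Sum>j\<in>UNIV. (y $ i - y $ j) / (x $ i - x $ j) * ((transpose R1 ** mat_of H ** R2) $ i $ j)\<^sup>2) = qform P H"
proof -
  let ?Q1 = "transpose P ** R1" and ?Q2 = "transpose P ** R2"
  have oP: "orthogonal_matrix P" and o1: "orthogonal_matrix R1" and o2: "orthogonal_matrix R2"
    using P R1 R2 by (simp_all add: eig_orth_iff)
  have oQ: "orthogonal_matrix ?Q1" "orthogonal_matrix ?Q2"
    using oP o1 o2 by (simp_all add: orthogonal_matrix_mul)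
  have "transpose ?Q1 ** conj_by P H ** ?Q2 = transpose R1 ** (P ** transpose P) ** mat_of H ** (P ** transpose P) ** R2"
    by (simp add: conj_by_def matrix_transpose_mul matrix_mul_assoc)
  also have "\<dots> = transpose R1 ** mat_of H ** R2"
    using oP by simp
  finally have eq: "transpose R1 ** mat_of H ** R2 = transpose ?Q1 ** conj_by P H ** ?Q2"
    by simp
  have lab1: "(x $ i, y $ i) = (x $ j, y $ j)" if "?Q1 $ i $ j \<noteq> 0" for i j
    using eig_orth_change_label[of P X R1 i j] eig_orth_change_label[of P Y R1 i j] P R1 that by simp
  have lab2: "(x $ i, y $ i) = (x $ j, y $ j)" if "?Q2 $ i $ j \<noteq> 0" for i j
    using eig_orth_change_label[of P X R2 i j] eig_orth_change_label[of P Y R2 i j] P R2 that by simp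
  have "(\<Sum>i\<in>UNIV. \<Sum>j\<in>UNIV. (\<lambda>(a, b) (a', b'). (b - b') / (a - a')) (x $ i, y $ i) (x $ j, y $ j) * ((transpose ?Q1 ** conj_by P H ** ?Q2) $ i $ j)\<^sup>2)
     = (\<Sum>i\<in>UNIV. \<Sum>j\<in>UNIV. (\<lambda>(a, b) (a', b'). (b - b') / (a - a')) (x $ i, y $ i) (x $ j, y $ j) * (conj_by P H $ i $ j)\<^sup>2)"
    by (rule label_form_invariant[OF oQ lab1 lab2])
  then show ?thesis
    unfolding eq qform_def by simp
qed

lemma Upsilon_eq_qform:
  assumes P: "P \<in> eig_orth X \<inter> eig_orth Y"
  shows "Upsilon X Y H = qform P H"
proof -
  define R where "R = (SOME P. P \<in> eig_orth X \<inter> eig_orth Y)"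
  have R: "R \<in> eig_orth X \<inter> eig_orth Y"
    unfolding R_def by (rule someI[of "\<lambda>P. P \<in> eig_orth X \<inter> eig_orth Y", OF P])
  have "Upsilon X Y H = (\<Sum>i\<in>UNIV. \<Sum>j\<in>UNIV. (y $ i - y $ j) / (x $ i - x $ j) * (conj_by R H $ i $ j)\<^sup>2)"
    unfolding Upsilon_def Let_def R_def[symmetric]
  proof (rule sum_alpha_pairs)
    fix i j
    have "(y $ i - y $ j) / (x $ i - x $ j) = (y $ j - y $ i) / (x $ j - x $ i)"
      by (metis minus_diff_eq minus_divide_divide)
    then show "(y $ i - y $ j) / (x $ i - x $ j) * (conj_by R H $ i $ j)\<^sup>2 = (y $ j - y $ i) / (x $ j - x $ i) * (conj_by R H $ j $ i)\<^sup>2"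
      using conj_by_commute[of R H i j] by simp
  qed simp
  also have "\<dots> = qform P H"
    using qform_mixed[OF P R R, of H] by (simp only: conj_by_def)
  finally show ?thesis .
qed

end

lemma rearrangement_orthogonal:
  fixes P R :: "'n::{finite,linorder} rmat"
  assumes P: "orthogonal_matrix P" and R: "orthogonal_matrix R"
    and u: "\<And>i j. i \<le> j \<Longrightarrow> u $ j \<le> u $ i" and w: "\<And>i j. i \<le> j \<Longrightarrow> w $ j \<le> w $ i"
  shows "(\<Sum>i\<in>UNIV. \<Sum>j\<in>UNIV. ((transpose P ** R) $ i $ j)\<^sup>2 * (w $ i * u $ j)) \<le> w \<bullet> u"
    "(\<Sum>i\<in>UNIV. \<Sum>j\<in>UNIV. ((transpose P ** R) $ i $ j)\<^sup>2 * (u $ j * w $ i)) \<le> w \<bullet> u"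
proof -
  have "(\<Sum>i\<in>UNIV. \<Sum>j\<in>UNIV. ((transpose P ** R) $ i $ j)\<^sup>2 * (w $ i * u $ j)) = diag (conj_by P (spectral R u)) \<bullet> w"
    unfolding inner_vec_def diag_nth conj_by_spectral inner_real_def sum_distrib_right
    by (intro sum.cong refl) (simp add: power2_eq_square mult_ac)
  also have "\<dots> \<le> eigvals (spectral R u) \<bullet> w"
    by (rule diag_conj_by_le_eigvals[OF w P])
  also have "\<dots> = w \<bullet> u"
    using eigvals_spectral[OF R u] by (simp add: inner_commute)
  finally show 1: "(\<Sum>i\<in>UNIV. \<Sum>j\<in>UNIV. ((transpose P ** R) $ i $ j)\<^sup>2 * (w $ i * u $ j)) \<le> w \<bullet> u" .
  then show "(\<Sum>i\<in>UNIV. \<Sum>j\<in>UNIV. ((transpose P ** R) $ i $ j)\<^sup>2 * (u $ j * w $ i)) \<le> w \<bullet> u"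
    by (simp add: mult.commute)
qed

text \<open>The squared entries form a doubly stochastic matrix: the unmixed products keep their
  sum, and the mixed ones are bounded by the rearrangement inequality.\<close>

lemma mixed_monotone:
  fixes P R :: "'n::{finite,linorder} rmat"
  assumes P: "orthogonal_matrix P" and R: "orthogonal_matrix R"
    and u1: "\<And>i j. i \<le> j \<Longrightarrow> u1 $ j \<le> u1 $ i" and w1: "\<And>i j. i \<le> j \<Longrightarrow> w1 $ j \<le> w1 $ i"
    and u2: "\<And>i j. i \<le> j \<Longrightarrow> u2 $ j \<le> u2 $ i" and w2: "\<And>i j. i \<le> j \<Longrightarrow> w2 $ j \<le> w2 $ i"
  shows "(w1 - w2) \<bullet> (u1 - u2) \<le> (\<Sum>i\<in>UNIV. \<Sum>j\<in>UNIV. ((transpose P ** R) $ i $ j)\<^sup>2 * ((w1 $ j - w2 $ i) * (u1 $ j - u2 $ i)))"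
proof -
  let ?Q = "transpose P ** R"
  have oQ: "orthogonal_matrix ?Q"
    using P R by (simp add: orthogonal_matrix_mul)
  have row: "(\<Sum>j\<in>UNIV. (?Q $ i $ j)\<^sup>2) = 1" for i
    using orthogonal_rows[OF oQ, of i i] by (simp add: power2_eq_square)
  have col: "(\<Sum>i\<in>UNIV. (?Q $ i $ j)\<^sup>2) = 1" for j
    using orthogonal_columns[OF oQ, of j j] by (simp add: power2_eq_square)
  have 1: "(\<Sum>i\<in>UNIV. \<Sum>j\<in>UNIV. (?Q $ i $ j)\<^sup>2 * (w2 $ i * u2 $ i)) = w2 \<bullet> u2"
    by (simp add: sum_distrib_right[symmetric] row inner_vec_def)
  have "(\<Sum>i\<in>UNIV. \<Sum>j\<in>UNIV. (?Q $ i $ j)\<^sup>2 * (w1 $ j * u1 $ j)) = (\<Sum>j\<in>UNIV. \<Sum>i\<in>UNIV. (?Q $ i $ j)\<^sup>2 * (w1 $ j * u1 $ j))"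
    by (rule sum.swap)
  then have 2: "(\<Sum>i\<in>UNIV. \<Sum>j\<in>UNIV. (?Q $ i $ j)\<^sup>2 * (w1 $ j * u1 $ j)) = w1 \<bullet> u1"
    by (simp add: sum_distrib_right[symmetric] col inner_vec_def)
  have "(?Q $ i $ j)\<^sup>2 * ((w1 $ j - w2 $ i) * (u1 $ j - u2 $ i))
      = (?Q $ i $ j)\<^sup>2 * (w1 $ j * u1 $ j) + (?Q $ i $ j)\<^sup>2 * (w2 $ i * u2 $ i)
        - (?Q $ i $ j)\<^sup>2 * (w2 $ i * u1 $ j) - (?Q $ i $ j)\<^sup>2 * (w1 $ j * u2 $ i)" for i j
    by (simp add: algebra_simps)
  then have "(\<Sum>i\<in>UNIV. \<Sum>j\<in>UNIV. (?Q $ i $ j)\<^sup>2 * ((w1 $ j - w2 $ i) * (u1 $ j - u2 $ i)))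
      = w1 \<bullet> u1 + w2 \<bullet> u2 - (\<Sum>i\<in>UNIV. \<Sum>j\<in>UNIV. (?Q $ i $ j)\<^sup>2 * (w2 $ i * u1 $ j))
        - (\<Sum>i\<in>UNIV. \<Sum>j\<in>UNIV. (?Q $ i $ j)\<^sup>2 * (w1 $ j * u2 $ i))"
    by (simp add: sum.distrib sum_subtractf 1 2)
  moreover have "(\<Sum>i\<in>UNIV. \<Sum>j\<in>UNIV. (?Q $ i $ j)\<^sup>2 * (w2 $ i * u1 $ j)) \<le> w2 \<bullet> u1"
    by (rule rearrangement_orthogonal(1)[OF P R u1 w2])
  moreover have "(\<Sum>i\<in>UNIV. \<Sum>j\<in>UNIV. (?Q $ i $ j)\<^sup>2 * (w1 $ j * u2 $ i)) \<le> u2 \<bullet> w1"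
    by (rule rearrangement_orthogonal(2)[OF P R w1 u2])
  ultimately show ?thesis
    by (simp add: inner_diff_left inner_diff_right inner_commute)
qed

section \<open>Positivity on tangent directions implies strong monotonicity\<close>

locale monotone_pair_sequence = spectral_pair \<theta> p a c m b d X Y
  for \<theta> :: "'n::{finite,linorder} rvec \<Rightarrow> ereal" and p a c m b d and X Y :: "'n symmat" +
  fixes Z1 Z2 W1 W2 :: "nat \<Rightarrow> 'n symmat" and t :: "nat \<Rightarrow> real" and P1 P2 :: "nat \<Rightarrow> 'n rmat"
    and R1 R2 :: "'n rmat" and H :: "'n symmat"
  assumes W1_subS: "\<And>k. W1 k \<in> subS (Z1 k)" and W2_subS: "\<And>k. W2 k \<in> subS (Z2 k)"
    and P1_eig: "\<And>k. P1 k \<in> eig_orth (Z1 k) \<inter> eig_orth (W1 k)" and P2_eig: "\<And>k. P2 k \<in> eig_orth (Z2 k) \<inter> eig_orth (W2 k)"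
    and t_pos: "\<And>k. 0 < t k" and t_lim: "t \<longlonglongrightarrow> 0"
    and Z1_lim: "Z1 \<longlonglongrightarrow> X" and Z2_lim: "Z2 \<longlonglongrightarrow> X" and W1_lim: "W1 \<longlonglongrightarrow> Y" and W2_lim: "W2 \<longlonglongrightarrow> Y"
    and P1_lim: "P1 \<longlonglongrightarrow> R1" and P2_lim: "P2 \<longlonglongrightarrow> R2"
    and H_lim: "(\<lambda>k. (1 / t k) *\<^sub>R (Z1 k - Z2 k)) \<longlonglongrightarrow> H"
begin

abbreviation z1 where "z1 k \<equiv> eigvals (Z1 k)"
abbreviation z2 where "z2 k \<equiv> eigvals (Z2 k)"
abbreviation w1 where "w1 k \<equiv> eigvals (W1 k)"
abbreviation w2 where "w2 k \<equiv> eigvals (W2 k)"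

definition Q where "Q k = transpose (P2 k) ** P1 k"

lemma orth: "orthogonal_matrix (P1 k)" "orthogonal_matrix (P2 k)"
  using P1_eig[of k] P2_eig[of k] by (simp_all add: eig_orth_iff)

text \<open>With the basis of the second pair on the left and that of the first on the right, the
  differences of base points and of subgradients both become entrywise multiples of
  \<open>Q\<close>; their inner product is then an explicit sum.\<close>

lemma mixed_entry:
  assumes "P1 k \<in> eig_orth V1" "P2 k \<in> eig_orth V2"
  shows "(transpose (P2 k) ** mat_of (V1 - V2) ** P1 k) $ i $ j = Q k $ i $ j * (eigvals V1 $ j - eigvals V2 $ i)"
proof -
  have V: "mat_of V1 = P1 k ** Diag (eigvals V1) ** transpose (P1 k)" "mat_of V2 = P2 k ** Diag (eigvals V2) ** transpose (P2 k)"
    using assms by (simp_all add: eig_orth_def)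
  have "transpose (P2 k) ** mat_of V1 ** P1 k = Q k ** Diag (eigvals V1)"
    unfolding V Q_def using orth[of k] by (simp add: matrix_mul_assoc)
  moreover have "transpose (P2 k) ** mat_of V2 ** P1 k = Diag (eigvals V2) ** Q k"
    unfolding V Q_def using orth[of k] by (simp add: matrix_mul_assoc)
  ultimately have eq: "transpose (P2 k) ** mat_of (V1 - V2) ** P1 k = Q k ** Diag (eigvals V1) - Diag (eigvals V2) ** Q k"
    by (simp add: minus_symmat.rep_eq matrix_mult_diff)
  show ?thesis
    unfolding eq vector_minus_component mult_Diag_nth by (simp add: algebra_simps)
qed

lemma inner_mixed:
  "(W1 k - W2 k) \<bullet> (Z1 k - Z2 k) = (\<Sum>i\<in>UNIV. \<Sum>j\<in>UNIV. (Q k $ i $ j)\<^sup>2 * ((w1 k $ j - w2 k $ i) * (z1 k $ j - z2 k $ i)))"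
proof -
  have "(W1 k - W2 k) \<bullet> (Z1 k - Z2 k)
     = (transpose (P2 k) ** mat_of (W1 k - W2 k) ** P1 k) \<bullet> (transpose (P2 k) ** mat_of (Z1 k - Z2 k) ** P1 k)"
    using orth[of k] by (simp add: inner_orthogonal_mult inner_symmat.rep_eq)
  also have "\<dots> = (\<Sum>i\<in>UNIV. \<Sum>j\<in>UNIV. (Q k $ i $ j * (w1 k $ j - w2 k $ i)) * (Q k $ i $ j * (z1 k $ j - z2 k $ i)))"
    unfolding inner_matrix_sum using P1_eig[of k] P2_eig[of k] by (simp add: mixed_entry)
  finally show ?thesis
    by (simp add: power2_eq_square mult_ac)
qed

definition A where "A = transpose R2 ** mat_of H ** R1"

lemma entry_lim: "(\<lambda>k. Q k $ i $ j * (z1 k $ j - z2 k $ i) / t k) \<longlonglongrightarrow> A $ i $ j"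
proof -
  have "(\<lambda>k. (transpose (P2 k) ** mat_of ((1 / t k) *\<^sub>R (Z1 k - Z2 k)) ** P1 k) $ i $ j) \<longlonglongrightarrow> A $ i $ j"
    unfolding A_def by (intro tendsto_intros P1_lim P2_lim H_lim)
  moreover have "(transpose (P2 k) ** mat_of ((1 / t k) *\<^sub>R (Z1 k - Z2 k)) ** P1 k) $ i $ j = Q k $ i $ j * (z1 k $ j - z2 k $ i) / t k" for k
    using mixed_entry[of k "Z1 k" "Z2 k" i j] P1_eig[of k] P2_eig[of k]
    by (simp add: scaleR_symmat.rep_eq matrix_mult_scaleR_left matrix_mult_scaleR_right)
  ultimately show ?thesis
    by simp
qed

lemma gap_lim: "(\<lambda>k. z1 k $ j - z2 k $ i) \<longlonglongrightarrow> x $ j - x $ i"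
  by (intro tendsto_intros Z1_lim Z2_lim)

lemma w_gap_lim: "(\<lambda>k. w1 k $ j - w2 k $ i) \<longlonglongrightarrow> y $ j - y $ i"
  by (intro tendsto_intros W1_lim W2_lim)

lemma Q_sq_lim:
  assumes "x $ i \<noteq> x $ j"
  shows "(\<lambda>k. (Q k $ i $ j)\<^sup>2 / (t k)\<^sup>2) \<longlonglongrightarrow> (A $ i $ j)\<^sup>2 / (x $ j - x $ i)\<^sup>2"
proof -
  have "(\<lambda>k. (Q k $ i $ j * (z1 k $ j - z2 k $ i) / t k)\<^sup>2 / (z1 k $ j - z2 k $ i)\<^sup>2) \<longlonglongrightarrow> (A $ i $ j)\<^sup>2 / (x $ j - x $ i)\<^sup>2"
    using assms by (intro tendsto_divide tendsto_power entry_lim gap_lim) simp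
  moreover have "\<forall>\<^sub>F k in sequentially. z1 k $ j - z2 k $ i \<noteq> 0"
    using assms by (intro tendsto_imp_eventually_ne[OF gap_lim]) simp
  then have "\<forall>\<^sub>F k in sequentially. (Q k $ i $ j * (z1 k $ j - z2 k $ i) / t k)\<^sup>2 / (z1 k $ j - z2 k $ i)\<^sup>2 = (Q k $ i $ j)\<^sup>2 / (t k)\<^sup>2"
    by eventually_elim (simp add: power_mult_distrib power_divide)
  ultimately show ?thesis
    by (rule Lim_transform_eventually)
qed

lemma cross_lim:
  assumes g: "\<And>i j. x $ i \<noteq> x $ j \<Longrightarrow> (\<lambda>k. g k i j) \<longlonglongrightarrow> g' i j"
  shows "(\<lambda>k. (\<Sum>i\<in>UNIV. \<Sum>j\<in>UNIV. (if x $ i = x $ j then 0 else (Q k $ i $ j)\<^sup>2 * ((w1 k $ j - w2 k $ i) * g k i j))) / (t k)\<^sup>2)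
    \<longlonglongrightarrow> (\<Sum>i\<in>UNIV. \<Sum>j\<in>UNIV. (if x $ i = x $ j then 0 else (A $ i $ j)\<^sup>2 / (x $ j - x $ i)\<^sup>2 * ((y $ j - y $ i) * g' i j)))"
  unfolding sum_divide_distrib
proof (intro tendsto_sum)
  fix i j
  show "(\<lambda>k. (if x $ i = x $ j then 0 else (Q k $ i $ j)\<^sup>2 * ((w1 k $ j - w2 k $ i) * g k i j)) / (t k)\<^sup>2)
    \<longlonglongrightarrow> (if x $ i = x $ j then 0 else (A $ i $ j)\<^sup>2 / (x $ j - x $ i)\<^sup>2 * ((y $ j - y $ i) * g' i j))"
  proof (cases "x $ i = x $ j")
    case False
    have "(\<lambda>k. (Q k $ i $ j)\<^sup>2 / (t k)\<^sup>2 * ((w1 k $ j - w2 k $ i) * g k i j)) \<longlonglongrightarrow> (A $ i $ j)\<^sup>2 / (x $ j - x $ i)\<^sup>2 * ((y $ j - y $ i) * g' i j)"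
      by (intro tendsto_mult Q_sq_lim[OF False] w_gap_lim g[OF False])
    then show ?thesis
      using False by simp
  qed simp
qed

text \<open>On a block of \<open>X\<close> the eigenvalues of \<open>Z1\<close> and \<open>Z2\<close> cluster; recentring them at a vanishing multiple of
  \<open>x\<close> keeps them ordered, so the full rearrangement inequality applies with negligible cross terms.\<close>

lemma inner_lower_bound:
  obtains \<tau> where "\<tau> \<longlonglongrightarrow> qform R2 H" "\<And>k. \<tau> k \<le> (W1 k - W2 k) \<bullet> (Z1 k - Z2 k) / (t k)\<^sup>2"
proof -
  let ?gaps = "(\<lambda>(i, j). x $ i - x $ j) ` {(i, j). x $ j < x $ i}"
  define \<gamma> where "\<gamma> = Min (insert 1 ?gaps)"
  have fin: "finite (insert 1 ?gaps)" by simp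
  have "\<forall>r\<in>insert 1 ?gaps. 0 < r"
    by auto
  then have \<gamma>: "0 < \<gamma>"
    using fin unfolding \<gamma>_def by (subst Min_gr_iff) auto
  have gap: "\<gamma> \<le> x $ i - x $ j" if "x $ j < x $ i" for i j
    unfolding \<gamma>_def using fin that by (intro Min_le) auto
  define \<epsilon> where "\<epsilon> k = norm (z1 k - x) + norm (z2 k - x)" for k
  have \<epsilon>: "\<epsilon> \<longlonglongrightarrow> 0"
  proof -
    have "(\<lambda>k. norm (z1 k - x) + norm (z2 k - x)) \<longlonglongrightarrow> norm (x - x) + norm (x - x)"
      by (intro tendsto_intros Z1_lim Z2_lim)
    then show ?thesis
      by (simp add: \<epsilon>_def[abs_def])
  qed
  \<comment> \<open>Subtracting \<open>x\<close> can disturb the order by at most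
    \<open>2 * \<epsilon> k\<close>, and only across a gap of \<open>x\<close>, which is at least
    \<gamma>; adding \<open>M k\<close> times \<open>x\<close> compensates this.\<close>
  define M where "M k = 2 * \<epsilon> k / \<gamma>" for k
  have M: "M \<longlonglongrightarrow> 0"
    using tendsto_divide[OF tendsto_mult[OF tendsto_const[of 2] \<epsilon>] tendsto_const[of \<gamma>]] \<gamma> by (simp add: M_def[abs_def])
  define u1 where "u1 k = (z1 k - x) + M k *\<^sub>R x" for k
  define u2 where "u2 k = (z2 k - x) + M k *\<^sub>R x" for k
  have anti: "u $ j - x $ j + M k * x $ j \<le> u $ i - x $ i + M k * x $ i"
    if u: "\<And>i. \<bar>u $ i - x $ i\<bar> \<le> \<epsilon> k" "u $ j \<le> u $ i" and ij: "i \<le> j" for u i j k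
  proof (cases "x $ i = x $ j")
    case True
    then show ?thesis
      using u(2) by simp
  next
    case False
    then have "x $ j < x $ i"
      using eigvals_antitone[OF ij, of X] by simp
    from gap[OF this] have "M k * \<gamma> \<le> M k * (x $ i - x $ j)"
      using \<gamma> by (intro mult_left_mono) (auto simp: M_def \<epsilon>_def)
    then have "2 * \<epsilon> k \<le> M k * (x $ i - x $ j)"
      using \<gamma> by (simp add: M_def)
    then have "2 * \<epsilon> k \<le> M k * x $ i - M k * x $ j"
      by (simp add: right_diff_distrib)
    then show ?thesis
      using u(1)[of i] u(1)[of j] by linarith
  qed
  have "\<bar>z1 k $ i - x $ i\<bar> \<le> \<epsilon> k" "\<bar>z2 k $ i - x $ i\<bar> \<le> \<epsilon> k" for i k
    using component_le_norm_cart[of "z1 k - x" i] component_le_norm_cart[of "z2 k - x" i]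
      norm_ge_zero[of "z1 k - x"] norm_ge_zero[of "z2 k - x"] by (simp_all add: \<epsilon>_def)
  then have u_anti: "u1 k $ j \<le> u1 k $ i" "u2 k $ j \<le> u2 k $ i" if "i \<le> j" for i j k
    using anti[OF _ _ that, of "z1 k" k] anti[OF _ _ that, of "z2 k" k] eigvals_antitone[OF that] by (simp_all add: u1_def u2_def)
  let ?same = "\<lambda>k g. \<Sum>i\<in>UNIV. \<Sum>j\<in>UNIV. (if x $ i = x $ j then (Q k $ i $ j)\<^sup>2 * ((w1 k $ j - w2 k $ i) * g i j) else 0)"
  let ?cross = "\<lambda>k g. \<Sum>i\<in>UNIV. \<Sum>j\<in>UNIV. (if x $ i = x $ j then 0 else (Q k $ i $ j)\<^sup>2 * ((w1 k $ j - w2 k $ i) * g i j))"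
  have split: "(\<Sum>i\<in>UNIV. \<Sum>j\<in>UNIV. (Q k $ i $ j)\<^sup>2 * ((w1 k $ j - w2 k $ i) * g i j)) = ?same k g + ?cross k g" for k g
    unfolding sum.distrib[symmetric] by (intro sum.cong refl) simp
  \<comment> \<open>Inside a block of \<open>X\<close> recentring changes nothing. Across blocks the
    squared entries of \<open>Q\<close> are O(t^2) and the recentred differences tend to 0, so those
    terms vanish in the limit.\<close>
  have same_eq: "?same k (\<lambda>i j. z1 k $ j - z2 k $ i) = ?same k (\<lambda>i j. u1 k $ j - u2 k $ i)" for k
    by (intro sum.cong refl) (simp add: u1_def u2_def)
  define \<tau> where "\<tau> k = ?cross k (\<lambda>i j. z1 k $ j - z2 k $ i) / (t k)\<^sup>2 - ?cross k (\<lambda>i j. u1 k $ j - u2 k $ i) / (t k)\<^sup>2" for k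
  have bound: "\<tau> k \<le> (W1 k - W2 k) \<bullet> (Z1 k - Z2 k) / (t k)\<^sup>2" for k
  proof -
    have "0 \<le> (w1 k - w2 k) \<bullet> (z1 k - z2 k)"
      using csub_monotone subS_simultaneous(2)[OF W1_subS[of k]] subS_simultaneous(2)[OF W2_subS[of k]]
      unfolding sub_eq_csub by blast
    also have "z1 k - z2 k = u1 k - u2 k"
      by (simp add: u1_def u2_def)
    also have "(w1 k - w2 k) \<bullet> (u1 k - u2 k) \<le> (\<Sum>i\<in>UNIV. \<Sum>j\<in>UNIV. (Q k $ i $ j)\<^sup>2 * ((w1 k $ j - w2 k $ i) * (u1 k $ j - u2 k $ i)))"
      unfolding Q_def by (rule mixed_monotone[OF orth(2,1) u_anti(1) eigvals_antitone u_anti(2) eigvals_antitone])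
    finally have "0 \<le> ?same k (\<lambda>i j. u1 k $ j - u2 k $ i) + ?cross k (\<lambda>i j. u1 k $ j - u2 k $ i)"
      unfolding split .
    then have "?cross k (\<lambda>i j. z1 k $ j - z2 k $ i) - ?cross k (\<lambda>i j. u1 k $ j - u2 k $ i) \<le> (W1 k - W2 k) \<bullet> (Z1 k - Z2 k)"
      unfolding inner_mixed split same_eq by linarith
    then have "(?cross k (\<lambda>i j. z1 k $ j - z2 k $ i) - ?cross k (\<lambda>i j. u1 k $ j - u2 k $ i)) / (t k)\<^sup>2 \<le> (W1 k - W2 k) \<bullet> (Z1 k - Z2 k) / (t k)\<^sup>2"
      by (rule divide_right_mono) simp
    then show ?thesis
      unfolding \<tau>_def diff_divide_distrib[symmetric] .
  qed
  have u_lim: "(\<lambda>k. u1 k $ j - u2 k $ i) \<longlonglongrightarrow> 0" for i j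
  proof -
    have "(\<lambda>k. u1 k $ j - u2 k $ i) \<longlonglongrightarrow> ((x $ j - x $ j) + 0 * x $ j) - ((x $ i - x $ i) + 0 * x $ i)"
      unfolding u1_def u2_def vector_add_component vector_minus_component vector_scaleR_component real_scaleR_def
      by (intro tendsto_intros Z1_lim Z2_lim M)
    then show ?thesis by simp
  qed
  have lim: "\<tau> \<longlonglongrightarrow> (\<Sum>i\<in>UNIV. \<Sum>j\<in>UNIV. (if x $ i = x $ j then 0 else (A $ i $ j)\<^sup>2 / (x $ j - x $ i)\<^sup>2 * ((y $ j - y $ i) * (x $ j - x $ i))))
      - (\<Sum>i\<in>UNIV. \<Sum>j\<in>UNIV. (if x $ i = x $ j then 0 else (A $ i $ j)\<^sup>2 / (x $ j - x $ i)\<^sup>2 * ((y $ j - y $ i) * 0)))"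
    unfolding \<tau>_def by (intro tendsto_diff cross_lim gap_lim u_lim)
  have form: "(\<Sum>i\<in>UNIV. \<Sum>j\<in>UNIV. (if x $ i = x $ j then 0 else (A $ i $ j)\<^sup>2 / (x $ j - x $ i)\<^sup>2 * ((y $ j - y $ i) * (x $ j - x $ i))))
      - (\<Sum>i\<in>UNIV. \<Sum>j\<in>UNIV. (if x $ i = x $ j then 0 else (A $ i $ j)\<^sup>2 / (x $ j - x $ i)\<^sup>2 * ((y $ j - y $ i) * 0))) = qform R2 H"
  proof -
    have R: "R1 \<in> eig_orth X \<inter> eig_orth Y" "R2 \<in> eig_orth X \<inter> eig_orth Y"
      using closed_eig_orth_limit[OF _ P1_lim Z1_lim] closed_eig_orth_limit[OF _ P1_lim W1_lim]
        closed_eig_orth_limit[OF _ P2_lim Z2_lim] closed_eig_orth_limit[OF _ P2_lim W2_lim] P1_eig P2_eig by simp_all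
    have "(if x $ i = x $ j then 0 else (A $ i $ j)\<^sup>2 / (x $ j - x $ i)\<^sup>2 * ((y $ j - y $ i) * (x $ j - x $ i)))
        = (y $ i - y $ j) / (x $ i - x $ j) * (A $ i $ j)\<^sup>2" for i j
    proof (cases "x $ i = x $ j")
      case False
      have "v\<^sup>2 / s\<^sup>2 * (r * s) = r / s * v\<^sup>2" if "s \<noteq> 0" for v s r :: real
        using that by (simp add: power2_eq_square)
      from this[of "x $ j - x $ i" "A $ i $ j" "y $ j - y $ i"] False
      show ?thesis
        by (metis (no_types) minus_diff_eq minus_divide_divide right_minus_eq)
    qed simp
    then show ?thesis
      using qform_mixed[OF R(2) R(2) R(1), of H] by (simp add: A_def)
  qed
  show ?thesis
    by (rule that[OF lim[unfolded form] bound])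
qed

end

lemma convergent_subsequence_compact:
  fixes s :: "nat \<Rightarrow> 'a::metric_space"
  assumes "compact S" "\<And>k. s k \<in> S"
  obtains l r where "l \<in> S" "strict_mono r" "(s \<circ> r) \<longlonglongrightarrow> l"
  using assms unfolding compact_def by meson

context spectral_pair
begin

text \<open>Failure yields pairs at scale \<open>1 / (k + 1)\<close>. A limit direction
  \<open>H\<close> of their normalized differences lies in \<open>tangent R2\<close> and has
  nonpositive value of the form, which contradicts positivity.\<close>

lemma strongly_monotone_of_positive:
  assumes comp: "composite \<phi> dmS hS f" and grad: "gradient \<phi> X = - Y"
    and pos: "\<And>P H. P \<in> eig_orth X \<inter> eig_orth Y \<Longrightarrow> H \<in> tangent P \<Longrightarrow> H \<noteq> 0 \<Longrightarrow> 0 < hessian \<phi> X H \<bullet> H + qform P H"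
  shows "composite.strongly_monotone_near \<phi> dmS hS X"
proof -
  interpret composite \<phi> dmS hS f
    by (rule comp)
  show ?thesis
  proof (rule ccontr)
    assume notsm: "\<not> strongly_monotone_near X"
    let ?\<rho> = "\<lambda>k. 1 / real (Suc k)"
    have \<rho>_pos: "0 < ?\<rho> k" for k
      by simp
    have \<rho>_lim: "?\<rho> \<longlonglongrightarrow> 0"
      using LIMSEQ_inverse_real_of_nat by (simp add: inverse_eq_divide)
    have "\<forall>k. \<exists>q. case q of (z1, w1, z2, w2) \<Rightarrow> w1 \<in> subS z1 \<and> w2 \<in> subS z2 \<and> norm (z1 - X) < ?\<rho> k \<and> norm (z2 - X) < ?\<rho> k \<and>
      norm (w1 - Y) < ?\<rho> k \<and> norm (w2 - Y) < ?\<rho> k \<and> (G z1 - G z2 + w1 - w2) \<bullet> (z1 - z2) < ?\<rho> k * (norm (z1 - z2))\<^sup>2"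
    proof
      fix k
      from notsm[unfolded strongly_monotone_near_def] \<rho>_pos[of k]
      obtain z1 w1 z2 w2 where "w1 \<in> subS z1" "w2 \<in> subS z2" "norm (z1 - X) < ?\<rho> k" "norm (z2 - X) < ?\<rho> k"
        "norm (w1 + G X) < ?\<rho> k" "norm (w2 + G X) < ?\<rho> k" "\<not> ?\<rho> k * (norm (z1 - z2))\<^sup>2 \<le> (G z1 - G z2 + w1 - w2) \<bullet> (z1 - z2)"
        by meson
      then show "\<exists>q. case q of (z1, w1, z2, w2) \<Rightarrow> w1 \<in> subS z1 \<and> w2 \<in> subS z2 \<and> norm (z1 - X) < ?\<rho> k \<and> norm (z2 - X) < ?\<rho> k \<and>
      norm (w1 - Y) < ?\<rho> k \<and> norm (w2 - Y) < ?\<rho> k \<and> (G z1 - G z2 + w1 - w2) \<bullet> (z1 - z2) < ?\<rho> k * (norm (z1 - z2))\<^sup>2"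
        by (intro exI[of _ "(z1, w1, z2, w2)"]) (simp add: grad)
    qed
    then obtain q where q: "\<And>k. case q k of (z1, w1, z2, w2) \<Rightarrow> w1 \<in> subS z1 \<and> w2 \<in> subS z2 \<and> norm (z1 - X) < ?\<rho> k \<and> norm (z2 - X) < ?\<rho> k \<and>
      norm (w1 - Y) < ?\<rho> k \<and> norm (w2 - Y) < ?\<rho> k \<and> (G z1 - G z2 + w1 - w2) \<bullet> (z1 - z2) < ?\<rho> k * (norm (z1 - z2))\<^sup>2"
      by (elim choice[THEN exE]) blast
    define Z1 W1 Z2 W2 where "Z1 k = fst (q k)" and "W1 k = fst (snd (q k))" and "Z2 k = fst (snd (snd (q k)))" and "W2 k = snd (snd (snd (q k)))" for k
    have sub: "W1 k \<in> subS (Z1 k)" "W2 k \<in> subS (Z2 k)"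
      and near: "norm (Z1 k - X) < ?\<rho> k" "norm (Z2 k - X) < ?\<rho> k" "norm (W1 k - Y) < ?\<rho> k" "norm (W2 k - Y) < ?\<rho> k"
      and less: "(G (Z1 k) - G (Z2 k) + W1 k - W2 k) \<bullet> (Z1 k - Z2 k) < ?\<rho> k * (norm (Z1 k - Z2 k))\<^sup>2" for k
      using q[of k] by (simp_all add: Z1_def W1_def Z2_def W2_def case_prod_beta)
    define t where "t k = norm (Z1 k - Z2 k)" for k
    have t_pos: "0 < t k" for k
    proof (rule ccontr)
      assume "\<not> 0 < t k"
      then have "Z1 k - Z2 k = 0"
        by (simp add: t_def)
      with less[of k] show False
        by simp
    qed
    have to0: "s \<longlonglongrightarrow> v" if "\<And>k. norm (s k - v) < ?\<rho> k" for s and v :: "'n symmat"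
    proof -
      have "(\<lambda>k. s k - v) \<longlonglongrightarrow> 0"
        by (intro Lim_null_comparison[OF always_eventually \<rho>_lim] allI less_imp_le[OF that])
      then show ?thesis
        by (simp add: LIM_zero_iff)
    qed
    have lims: "Z1 \<longlonglongrightarrow> X" "Z2 \<longlonglongrightarrow> X" "W1 \<longlonglongrightarrow> Y" "W2 \<longlonglongrightarrow> Y"
      using to0[of Z1 X, OF near(1)] to0[of Z2 X, OF near(2)] to0[of W1 Y, OF near(3)] to0[of W2 Y, OF near(4)]
      by simp_all
    have t_lim: "t \<longlonglongrightarrow> 0"
      using tendsto_norm[OF tendsto_diff[OF lims(1,2)]] by (simp add: t_def[abs_def])
    define P1 where "P1 k = (SOME P. P \<in> eig_orth (Z1 k) \<inter> eig_orth (W1 k))" for k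
    define P2 where "P2 k = (SOME P. P \<in> eig_orth (Z2 k) \<inter> eig_orth (W2 k))" for k
    have P1: "P1 k \<in> eig_orth (Z1 k) \<inter> eig_orth (W1 k)" and P2: "P2 k \<in> eig_orth (Z2 k) \<inter> eig_orth (W2 k)" for k
      unfolding P1_def P2_def using subS_simultaneous(1)[OF sub(1)] subS_simultaneous(1)[OF sub(2)] by (simp_all only: some_in_eq not_False_eq_True)
    \<comment> \<open>All four limits are extracted from one compact product;
      \<open>Hoffman_Wielandt\<close> bounds the quotients of the eigenvalues.\<close>
    define s where "s k = ((1 / t k) *\<^sub>R (Z1 k - Z2 k), P1 k, P2 k, (1 / t k) *\<^sub>R (eigvals (Z1 k) - eigvals (Z2 k)))" for k
    have s: "s k \<in> sphere 0 1 \<times> {P. orthogonal_matrix P} \<times> {P. orthogonal_matrix P} \<times> cball 0 1" for k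
    proof -
      have n1: "norm ((1 / t k) *\<^sub>R (Z1 k - Z2 k)) = 1"
        using t_pos[of k] by (simp add: t_def)
      have "norm (eigvals (Z1 k) - eigvals (Z2 k)) / t k \<le> 1"
        using t_pos[of k] Hoffman_Wielandt[of "Z1 k" "Z2 k"] by (simp add: t_def)
      then have n2: "norm ((1 / t k) *\<^sub>R (eigvals (Z1 k) - eigvals (Z2 k))) \<le> 1"
        using t_pos[of k] by simp
      have "orthogonal_matrix (P1 k)" "orthogonal_matrix (P2 k)"
        using P1[of k] P2[of k] by (simp_all add: eig_orth_iff)
      then show ?thesis
        unfolding s_def by (intro SigmaI; simp only: mem_sphere_0 mem_cball_0 n1 n2 mem_Collect_eq)
    qed
    have K: "compact (sphere (0 :: 'n symmat) 1 \<times> {P :: 'n rmat. orthogonal_matrix P} \<times> {P :: 'n rmat. orthogonal_matrix P} \<times> cball (0 :: 'n rvec) 1)"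
      by (intro compact_Times compact_orthogonal_matrices) auto
    obtain l r where l: "l \<in> sphere 0 1 \<times> {P. orthogonal_matrix P} \<times> {P. orthogonal_matrix P} \<times> cball 0 1"
      and r: "strict_mono r" and sr: "(s \<circ> r) \<longlonglongrightarrow> l"
      by (rule convergent_subsequence_compact[of _ s, OF K s]) blast
    obtain H R1 R2 e where le: "l = (H, R1, R2, e)"
      by (cases l) auto
    have H1: "norm H = 1"
      using l by (simp add: le)
    have sl: "(\<lambda>k. (1 / t (r k)) *\<^sub>R (Z1 (r k) - Z2 (r k))) \<longlonglongrightarrow> H" "(\<lambda>k. P1 (r k)) \<longlonglongrightarrow> R1" "(\<lambda>k. P2 (r k)) \<longlonglongrightarrow> R2"
      "(\<lambda>k. (1 / t (r k)) *\<^sub>R (eigvals (Z1 (r k)) - eigvals (Z2 (r k)))) \<longlonglongrightarrow> e"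
      using tendsto_fst[OF sr] tendsto_fst[OF tendsto_snd[OF sr]] tendsto_fst[OF tendsto_snd[OF tendsto_snd[OF sr]]]
        tendsto_snd[OF tendsto_snd[OF tendsto_snd[OF sr]]]
      by (simp_all add: le s_def o_def)
    have sub_lim_m: "(\<lambda>k. u (r k)) \<longlonglongrightarrow> v" if "u \<longlonglongrightarrow> v" for u :: "nat \<Rightarrow> 'n symmat" and v
      using LIMSEQ_subseq_LIMSEQ[OF that r] by (simp add: o_def)
    have sub_lim_r: "(\<lambda>k. u (r k)) \<longlonglongrightarrow> v" if "u \<longlonglongrightarrow> v" for u :: "nat \<Rightarrow> real" and v
      using LIMSEQ_subseq_LIMSEQ[OF that r] by (simp add: o_def)
    interpret mono: monotone_pair_sequence \<theta> p a c m b d X Y "\<lambda>k. Z1 (r k)" "\<lambda>k. Z2 (r k)" "\<lambda>k. W1 (r k)" "\<lambda>k. W2 (r k)"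
      "\<lambda>k. t (r k)" "\<lambda>k. P1 (r k)" "\<lambda>k. P2 (r k)" R1 R2 H
      using sub P1 P2 t_pos sub_lim_r[OF t_lim] sub_lim_m[OF lims(1)] sub_lim_m[OF lims(2)] sub_lim_m[OF lims(3)] sub_lim_m[OF lims(4)] sl
      by unfold_locales auto
    obtain \<tau> where \<tau>: "\<tau> \<longlonglongrightarrow> qform R2 H" "\<And>k. \<tau> k \<le> (W1 (r k) - W2 (r k)) \<bullet> (Z1 (r k) - Z2 (r k)) / (t (r k))\<^sup>2"
      by (rule mono.inner_lower_bound) blast
    have G_lim: "(\<lambda>k. (1 / t k) *\<^sub>R (G (Z1 k) - G (Z2 k) - hessian \<phi> X (Z1 k - Z2 k))) \<longlonglongrightarrow> 0"
    proof (rule LIMSEQ_I)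
      fix e :: real assume e: "0 < e"
      obtain \<delta> where \<delta>: "0 < \<delta>" "\<And>u v. norm (u - X) < \<delta> \<Longrightarrow> norm (v - X) < \<delta> \<Longrightarrow> norm (G v - G u - hessian \<phi> X (v - u)) \<le> (e / 2) * norm (v - u)"
        by (rule strictly_differentiable[of "e / 2" X]) (use e in auto)
      obtain N where N: "\<And>k. N \<le> k \<Longrightarrow> ?\<rho> k < \<delta>"
        using order_tendstoD(2)[OF \<rho>_lim \<delta>(1)] by (auto simp: eventually_sequentially)
      show "\<exists>N. \<forall>k\<ge>N. norm ((1 / t k) *\<^sub>R (G (Z1 k) - G (Z2 k) - hessian \<phi> X (Z1 k - Z2 k)) - 0) < e"
      proof (intro exI[of _ N] allI impI)
        fix k assume Nk: "N \<le> k"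
        have "norm (Z2 k - X) < \<delta>" "norm (Z1 k - X) < \<delta>"
          using less_trans[OF near(2) N[OF Nk]] less_trans[OF near(1) N[OF Nk]] by simp_all
        from \<delta>(2)[OF this] have "norm (G (Z1 k) - G (Z2 k) - hessian \<phi> X (Z1 k - Z2 k)) / t k \<le> e / 2"
          using t_pos[of k] by (simp add: t_def divide_le_eq)
        then have "norm (G (Z1 k) - G (Z2 k) - hessian \<phi> X (Z1 k - Z2 k)) / t k < e"
          by (rule le_less_trans) (use e in simp)
        then show "norm ((1 / t k) *\<^sub>R (G (Z1 k) - G (Z2 k) - hessian \<phi> X (Z1 k - Z2 k)) - 0) < e"
          using t_pos[of k] by simp
      qed
    qed
    have G_quot: "(\<lambda>k. (G (Z1 (r k)) - G (Z2 (r k))) \<bullet> (Z1 (r k) - Z2 (r k)) / (t (r k))\<^sup>2) \<longlonglongrightarrow> hessian \<phi> X H \<bullet> H"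
    proof -
      let ?N = "\<lambda>k. (1 / t (r k)) *\<^sub>R (Z1 (r k) - Z2 (r k))"
      have "(\<lambda>k. ((1 / t (r k)) *\<^sub>R (G (Z1 (r k)) - G (Z2 (r k)) - hessian \<phi> X (Z1 (r k) - Z2 (r k))) + hessian \<phi> X (?N k)) \<bullet> ?N k)
          \<longlonglongrightarrow> (0 + hessian \<phi> X H) \<bullet> H"
      proof (intro tendsto_intros sl(1))
        show "(\<lambda>k. (1 / t (r k)) *\<^sub>R (G (Z1 (r k)) - G (Z2 (r k)) - hessian \<phi> X (Z1 (r k) - Z2 (r k)))) \<longlonglongrightarrow> 0"
          by (rule sub_lim_m[OF G_lim])
        show "(\<lambda>k. hessian \<phi> X (?N k)) \<longlonglongrightarrow> hessian \<phi> X H"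
          by (rule bounded_linear.tendsto[OF bounded_linear_hessian sl(1)])
      qed
      moreover have "((1 / t (r k)) *\<^sub>R (G (Z1 (r k)) - G (Z2 (r k)) - hessian \<phi> X (Z1 (r k) - Z2 (r k))) + hessian \<phi> X (?N k)) \<bullet> ?N k
          = (G (Z1 (r k)) - G (Z2 (r k))) \<bullet> (Z1 (r k) - Z2 (r k)) / (t (r k))\<^sup>2" for k
        unfolding hessian_linear(2) scaleR_add_right[symmetric] by (simp add: power2_eq_square)
      ultimately show ?thesis
        by simp
    qed
    have upper: "(G (Z1 (r k)) - G (Z2 (r k))) \<bullet> (Z1 (r k) - Z2 (r k)) / (t (r k))\<^sup>2 + \<tau> k \<le> ?\<rho> (r k)" for k
    proof -
      have "(G (Z1 (r k)) - G (Z2 (r k))) \<bullet> (Z1 (r k) - Z2 (r k)) + (W1 (r k) - W2 (r k)) \<bullet> (Z1 (r k) - Z2 (r k)) \<le> ?\<rho> (r k) * (t (r k))\<^sup>2"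
        using less[of "r k"] by (simp add: t_def inner_add_left inner_diff_left)
      then have "((G (Z1 (r k)) - G (Z2 (r k))) \<bullet> (Z1 (r k) - Z2 (r k)) + (W1 (r k) - W2 (r k)) \<bullet> (Z1 (r k) - Z2 (r k))) / (t (r k))\<^sup>2 \<le> ?\<rho> (r k)"
        using t_pos[of "r k"] by (subst pos_divide_le_eq) auto
      then show ?thesis
        using \<tau>(2)[of k] unfolding add_divide_distrib by linarith
    qed
    have "hessian \<phi> X H \<bullet> H + qform R2 H \<le> 0"
      by (rule LIMSEQ_le[OF tendsto_add[OF G_quot \<tau>(1)] sub_lim_r[OF \<rho>_lim]]) (use upper in auto)
    moreover have "H \<in> tangent R2"
    proof -
      define D where "D k = hS (Z1 k) - hS (Z2 k) - W2 k \<bullet> (Z1 k - Z2 k)" for k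
      \<comment> \<open>The deficit is at most the monotonicity product of the subgradients, which
        the violated inequality bounds by a multiple of \<open>t^2\<close>.\<close>
      obtain C where C: "\<And>k. D (r k) \<le> C * (t (r k))\<^sup>2"
      proof -
        have "Bseq (\<lambda>k. (G (Z1 (r k)) - G (Z2 (r k))) \<bullet> (Z1 (r k) - Z2 (r k)) / (t (r k))\<^sup>2)"
          using G_quot by (rule convergent_imp_Bseq[OF convergentI])
        then obtain K where K: "\<forall>k. norm ((G (Z1 (r k)) - G (Z2 (r k))) \<bullet> (Z1 (r k) - Z2 (r k)) / (t (r k))\<^sup>2) \<le> K"
          unfolding Bseq_def by blast
        have neg_le: "- I \<le> K * s" if "\<bar>I / s\<bar> \<le> K" "0 < s" for I s :: real
        proof -
          have "- (I / s) \<le> K"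
            using that(1) abs_ge_minus_self[of "I / s"] by linarith
          then have "(- I) / s \<le> K"
            by (simp only: minus_divide_left)
          then show ?thesis
            unfolding pos_divide_le_eq[OF that(2)] .
        qed
        have "D (r k) \<le> (1 + K) * (t (r k))\<^sup>2" for k
        proof -
          have "D (r k) \<le> (W1 (r k) - W2 (r k)) \<bullet> (Z1 (r k) - Z2 (r k))"
            using csubD(2)[OF sub(1)[of "r k"] csubD(1)[OF sub(2)[of "r k"]]] by (simp add: D_def inner_diff_left inner_diff_right)
          also have "\<dots> \<le> ?\<rho> (r k) * (t (r k))\<^sup>2 - (G (Z1 (r k)) - G (Z2 (r k))) \<bullet> (Z1 (r k) - Z2 (r k))"
            using less[of "r k"] by (simp add: t_def inner_add_left inner_diff_left)
          also have "\<dots> \<le> 1 * (t (r k))\<^sup>2 + K * (t (r k))\<^sup>2"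
          proof -
            have "?\<rho> (r k) \<le> 1"
              by simp
            then have "?\<rho> (r k) * (t (r k))\<^sup>2 \<le> 1 * (t (r k))\<^sup>2"
              by (rule mult_right_mono) simp
            moreover have "- ((G (Z1 (r k)) - G (Z2 (r k))) \<bullet> (Z1 (r k) - Z2 (r k))) \<le> K * (t (r k))\<^sup>2"
              by (rule neg_le[OF K[rule_format, of k, unfolded real_norm_def]]) (use t_pos[of "r k"] in simp)
            ultimately show ?thesis by linarith
          qed
          finally show ?thesis
            by (simp add: distrib_right)
        qed
        then show ?thesis
          using that by blast
      qed
      have D0: "0 \<le> D k" for k
        using csubD(2)[OF sub(2)[of k] csubD(1)[OF sub(1)[of k]]] by (simp add: D_def)
      have tr: "(\<lambda>k. t (r k)) \<longlonglongrightarrow> 0" and Zr: "(\<lambda>k. norm (Z1 (r k) - X)) \<longlonglongrightarrow> 0"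
        using sub_lim_r[OF t_lim] sub_lim_m[OF lims(1)] by (simp_all add: tendsto_norm_zero_iff LIM_zero_iff)
      have D1: "(\<lambda>k. D (r k) / t (r k)) \<longlonglongrightarrow> 0"
      proof (rule tendsto_sandwich[OF _ _ tendsto_const])
        show "\<forall>\<^sub>F k in sequentially. 0 \<le> D (r k) / t (r k)"
          by (intro always_eventually allI divide_nonneg_pos D0 t_pos)
        show "\<forall>\<^sub>F k in sequentially. D (r k) / t (r k) \<le> C * t (r k)"
        proof (intro always_eventually allI)
          fix k show "D (r k) / t (r k) \<le> C * t (r k)"
            using C[of k] t_pos[of "r k"] by (subst pos_divide_le_eq) (auto simp: power2_eq_square mult.assoc)
        qed
        show "(\<lambda>k. C * t (r k)) \<longlonglongrightarrow> 0"
          using tendsto_mult_left[OF tr, of C] by simp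
      qed
      have D2: "(\<lambda>k. D (r k) * norm (Z1 (r k) - X) / (t (r k))\<^sup>2) \<longlonglongrightarrow> 0"
      proof (rule tendsto_sandwich[OF _ _ tendsto_const])
        show "\<forall>\<^sub>F k in sequentially. 0 \<le> D (r k) * norm (Z1 (r k) - X) / (t (r k))\<^sup>2"
          by (intro always_eventually allI divide_nonneg_nonneg mult_nonneg_nonneg D0) auto
        show "\<forall>\<^sub>F k in sequentially. D (r k) * norm (Z1 (r k) - X) / (t (r k))\<^sup>2 \<le> C * norm (Z1 (r k) - X)"
        proof (intro always_eventually allI)
          fix k
          have "D (r k) * norm (Z1 (r k) - X) \<le> (C * (t (r k))\<^sup>2) * norm (Z1 (r k) - X)"
            using C[of k] by (intro mult_right_mono) auto
          then show "D (r k) * norm (Z1 (r k) - X) / (t (r k))\<^sup>2 \<le> C * norm (Z1 (r k) - X)"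
            using t_pos[of "r k"] by (subst pos_divide_le_eq) (auto simp: mult_ac)
        qed
        show "(\<lambda>k. C * norm (Z1 (r k) - X)) \<longlonglongrightarrow> 0"
          using tendsto_mult_left[OF Zr, of C] by simp
      qed
      interpret tang: tangent_sequence \<theta> p a c m b d X Y "\<lambda>k. Z1 (r k)" "\<lambda>k. Z2 (r k)" "\<lambda>k. W2 (r k)" "\<lambda>k. t (r k)"
        "\<lambda>k. P2 (r k)" "\<lambda>k. P1 (r k)" R2 H e
      proof
        show "Z1 (r k) \<in> dmS" for k
          using csubD(1)[OF sub(1)] .
        show "(\<lambda>k. (hS (Z1 (r k)) - hS (Z2 (r k)) - W2 (r k) \<bullet> (Z1 (r k) - Z2 (r k))) / t (r k)) \<longlonglongrightarrow> 0"
          using D1 by (simp add: D_def)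
        show "(\<lambda>k. (hS (Z1 (r k)) - hS (Z2 (r k)) - W2 (r k) \<bullet> (Z1 (r k) - Z2 (r k))) * norm (Z1 (r k) - X) / (t (r k))\<^sup>2) \<longlonglongrightarrow> 0"
          using D2 by (simp add: D_def)
      qed (use sub P1 P2 t_pos tr sub_lim_m[OF lims(1)] sub_lim_m[OF lims(2)] sub_lim_m[OF lims(4)] sl in auto)
      show ?thesis
        by (rule tang.limit_tangent)
    qed
    moreover have "R2 \<in> eig_orth X \<inter> eig_orth Y"
      using closed_eig_orth_limit[OF _ sl(3) sub_lim_m[OF lims(2)]] closed_eig_orth_limit[OF _ sl(3) sub_lim_m[OF lims(4)]] P2 by simp
    moreover have "H \<noteq> 0"
      using H1 by auto
    ultimately show False
      using pos[of R2 H] by simp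
  qed
qed

end

section \<open>Curves of rotations\<close>

lemma norm_matrix_mult_le:
  fixes A :: "real^'k^'m"
  obtains C where "\<And>B :: real^'n^'k. norm (A ** B) \<le> C * norm B"
proof -
  have "linear (\<lambda>B :: real^'n^'k. A ** B)"
    by (rule linearI) (simp_all add: matrix_mult_add matrix_mult_scaleR_right)
  then have "bounded_linear (\<lambda>B :: real^'n^'k. A ** B)"
    by (simp add: linear_conv_bounded_linear)
  then obtain C where "\<And>B :: real^'n^'k. norm (A ** B) \<le> norm B * C"
    using bounded_linear.bounded by blast
  then show ?thesis
    by (intro that[of C]) (simp add: mult.commute)
qed

lemma skew_inner_zero:
  fixes S :: "real^'n^'n"
  assumes "transpose S = - S"
  shows "v \<bullet> (S *v v) = 0"
proof -
  have "v \<bullet> (S *v v) = (transpose S *v v) \<bullet> v"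
    using dot_lmul_matrix[of v S v] by (simp add: vector_transpose_matrix)
  also have "\<dots> = - (v \<bullet> (S *v v))"
    unfolding assms by (simp add: matrix_vector_mult_def inner_vec_def sum_negf mult.commute)
  finally show ?thesis by simp
qed

text \<open>The Cayley transform of \<open>t S / 2\<close>.\<close>

lemma rotation_curve:
  fixes S :: "real^'n^'n"
  assumes skew: "transpose S = - S"
  obtains R :: "real \<Rightarrow> real^'n^'n" where "\<And>t. orthogonal_matrix (R t)"
    "((\<lambda>t. (1 / t) *\<^sub>R (R t - mat 1)) \<longlongrightarrow> S) (at_right 0)"
    "\<And>t M. M ** S = S ** M \<Longrightarrow> R t ** M = M ** R t"
proof -
  define K where "K = (1 / 2) *\<^sub>R S"
  define N where "N t = mat 1 - t *\<^sub>R K" for t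
  define N' where "N' t = mat 1 + t *\<^sub>R K" for t
  have trN: "transpose (N t) = N' t" "transpose (N' t) = N t" for t
    by (simp_all add: N_def N'_def K_def skew)
  have commN: "N t ** N' t = N' t ** N t" for t
    by (simp add: N_def N'_def matrix_mult_add matrix_mult_diff matrix_mult_scaleR_left matrix_mult_scaleR_right algebra_simps)
  have inv: "\<exists>B. N t ** B = mat 1 \<and> B ** N t = mat 1" for t
  proof -
    have "v = 0" if "N t *v v = 0" for v
    proof -
      have "v \<bullet> (N t *v v) = v \<bullet> v - t / 2 * (v \<bullet> (S *v v))"
        by (simp add: N_def K_def matrix_vector_mult_diff_rdistrib inner_diff_right scaleR_matrix_vector_assoc[symmetric])
      then show ?thesis
        using that skew_inner_zero[OF skew, of v] by simp
    qed
    then obtain B where "B ** N t = mat 1"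
      using matrix_left_invertible_ker[of "N t"] by blast
    then show ?thesis
      using matrix_left_right_inverse by blast
  qed
  define B where "B t = (SOME B. N t ** B = mat 1 \<and> B ** N t = mat 1)" for t
  have B: "N t ** B t = mat 1" "B t ** N t = mat 1" for t
    using someI_ex[OF inv[of t]] by (simp_all add: B_def)
  define R where "R t = N' t ** B t" for t
  have orth: "orthogonal_matrix (R t)" for t
  proof -
    have tB: "transpose (B t) ** N' t = mat 1"
      using arg_cong[OF B(1)[of t], of transpose] by (simp add: matrix_transpose_mul trN)
    have "transpose (R t) ** R t = transpose (B t) ** (N t ** N' t) ** B t"
      by (simp add: R_def matrix_transpose_mul trN matrix_mul_assoc)
    also have "\<dots> = (transpose (B t) ** N' t) ** (N t ** B t)"
      by (simp add: commN matrix_mul_assoc)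
    also have "\<dots> = mat 1"
      by (simp add: tB B)
    finally show ?thesis
      by (simp add: orthogonal_matrix)
  qed
  have RB: "R t - mat 1 = t *\<^sub>R (S ** B t)" for t
  proof -
    have "R t - N t ** B t = (N' t - N t) ** B t"
      by (simp add: R_def matrix_mult_diff)
    moreover have "N' t - N t = t *\<^sub>R S"
      by (simp add: N_def N'_def K_def scaleR_2[symmetric])
    ultimately show ?thesis
      by (simp add: B matrix_mult_scaleR_left)
  qed
  \<comment> \<open>Expressing the inverse through the orthogonal \<open>R t\<close> bounds it
    uniformly in \<open>t\<close>, in place of an appeal to continuity of matrix inversion.\<close>
  have B_half: "B t = (1 / 2) *\<^sub>R (R t + mat 1)" for t
  proof -
    have "R t + N t ** B t = (N' t + N t) ** B t"
      by (simp add: R_def matrix_mult_add)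
    moreover have "N' t + N t = 2 *\<^sub>R mat 1"
      by (simp add: N_def N'_def scaleR_2)
    ultimately have "R t + mat 1 = 2 *\<^sub>R B t"
      by (simp add: B matrix_mult_scaleR_left)
    then show ?thesis
      by simp
  qed
  have normR: "norm (R t) = norm (mat 1 :: real^'n^'n)" for t
    using norm_orthogonal_mult(1)[OF orth[of t], of "mat 1"] by simp
  have normB: "norm (B t) \<le> norm (mat 1 :: real^'n^'n)" for t
    unfolding B_half using norm_triangle_ineq[of "R t" "mat 1"] normR[of t] by simp
  have Blim: "(B \<longlongrightarrow> mat 1) (at_right 0)"
  proof -
    obtain C where C: "\<And>B :: real^'n^'n. norm (K ** B) \<le> C * norm B"
      by (rule norm_matrix_mult_le[of K]) blast
    have C0: "0 \<le> C"
    proof -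
      have "0 \<le> C * norm (mat 1 :: real^'n^'n)"
        using order_trans[OF norm_ge_zero C[of "mat 1"]] .
      moreover have "0 < norm (mat 1 :: real^'n^'n)"
        by (simp add: mat_def vec_eq_iff)
      ultimately show ?thesis
        by (simp add: zero_le_mult_iff)
    qed
    have "B t - mat 1 = t *\<^sub>R (K ** B t)" for t
    proof -
      have "B t - N t ** B t = t *\<^sub>R (K ** B t)"
        by (simp add: N_def matrix_mult_diff matrix_mult_scaleR_left)
      then show ?thesis
        by (simp add: B)
    qed
    then have bound: "norm (B t - mat 1) \<le> \<bar>t\<bar> * (C * norm (mat 1 :: real^'n^'n))" for t
      using order_trans[OF C[of "B t"] mult_left_mono[OF normB[of t] C0]] by (simp add: mult_left_mono)
    have "((\<lambda>t. \<bar>t\<bar> * (C * norm (mat 1 :: real^'n^'n))) \<longlongrightarrow> \<bar>0\<bar> * (C * norm (mat 1 :: real^'n^'n))) (at_right 0)"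
      by (intro tendsto_intros)
    then have lim: "((\<lambda>t. \<bar>t\<bar> * (C * norm (mat 1 :: real^'n^'n))) \<longlongrightarrow> 0) (at_right (0 :: real))"
      by simp
    have "((\<lambda>t. B t - mat 1) \<longlongrightarrow> 0) (at_right 0)"
      by (rule Lim_null_comparison[OF always_eventually lim]) (use bound in blast)
    then show ?thesis
      by (simp add: LIM_zero_iff)
  qed
  have der: "((\<lambda>t. (1 / t) *\<^sub>R (R t - mat 1)) \<longlongrightarrow> S) (at_right 0)"
  proof -
    have "((\<lambda>t. S ** B t) \<longlongrightarrow> S ** mat 1) (at_right 0)"
      by (intro tendsto_intros Blim)
    moreover have "\<forall>\<^sub>F t in at_right 0. S ** B t = (1 / t) *\<^sub>R (R t - mat 1)"
      using eventually_at_right_less[of "0 :: real"] by eventually_elim (simp add: RB)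
    ultimately show ?thesis
      using Lim_transform_eventually by fastforce
  qed
  have comm: "R t ** M = M ** R t" if M: "M ** S = S ** M" for t M
  proof -
    have MN: "M ** N t = N t ** M" and MN': "M ** N' t = N' t ** M"
      using M by (simp_all add: N_def N'_def K_def matrix_mult_add matrix_mult_diff matrix_mult_scaleR_left matrix_mult_scaleR_right)
    have "B t ** M = B t ** (M ** N t) ** B t"
      by (simp add: B matrix_mul_assoc[symmetric])
    also have "\<dots> = (B t ** N t) ** M ** B t"
      unfolding MN by (simp add: matrix_mul_assoc)
    finally have MB: "B t ** M = M ** B t"
      by (simp add: B)
    show ?thesis
      unfolding R_def by (metis MB MN' matrix_mul_assoc)
  qed
  show ?thesis
    by (rule that[OF orth der comm])
qed

text \<open>By the product rule the limit is the commutator of \<open>S\<close> and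
  \<open>Diag v\<close> plus \<open>Diag e\<close>. Hence an off-diagonal entry can be prescribed
  exactly where \<open>v\<close> has different entries.\<close>

lemma conj_curve_derivative:
  fixes R :: "real \<Rightarrow> 'n::finite rmat"
  assumes skew: "transpose S = - S" and der: "((\<lambda>t. (1 / t) *\<^sub>R (R t - mat 1)) \<longlongrightarrow> S) (at_right 0)"
  shows "((\<lambda>t. (1 / t) *\<^sub>R (R t ** Diag (v + t *\<^sub>R e) ** transpose (R t) - Diag v))
    \<longlongrightarrow> (\<chi> i j. S $ i $ j * (v $ j - v $ i) + (if i = j then e $ i else 0))) (at_right 0)"
proof -
  let ?E = "\<lambda>t. (1 / t) *\<^sub>R (R t - mat 1)"
  have ev: "\<forall>\<^sub>F t in at_right 0. 0 < (t :: real)"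
    by (rule eventually_at_right_less)
  have t0: "((\<lambda>t. t) \<longlongrightarrow> 0) (at_right (0 :: real))"
    by (rule tendsto_ident_at)
  have "((\<lambda>t. mat 1 + t *\<^sub>R ?E t) \<longlongrightarrow> mat 1 + 0 *\<^sub>R S) (at_right 0)"
    by (intro tendsto_intros der t0)
  moreover have "\<forall>\<^sub>F t in at_right 0. mat 1 + t *\<^sub>R ?E t = R t"
    using ev by eventually_elim simp
  ultimately have Rlim: "(R \<longlongrightarrow> mat 1) (at_right 0)"
    using Lim_transform_eventually by fastforce
  have "((\<lambda>t. ?E t ** Diag (v + t *\<^sub>R e) ** transpose (R t) + Diag e ** transpose (R t) + Diag v ** transpose (?E t))
     \<longlongrightarrow> S ** Diag (v + 0 *\<^sub>R e) ** transpose (mat 1) + Diag e ** transpose (mat 1) + Diag v ** transpose S) (at_right 0)"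
    by (intro tendsto_intros der Rlim t0)
  moreover have "\<forall>\<^sub>F t in at_right 0. ?E t ** Diag (v + t *\<^sub>R e) ** transpose (R t) + Diag e ** transpose (R t) + Diag v ** transpose (?E t)
      = (1 / t) *\<^sub>R (R t ** Diag (v + t *\<^sub>R e) ** transpose (R t) - Diag v)"
    using ev
  proof eventually_elim
    case (elim t)
    let ?D = "Diag (v + t *\<^sub>R e)"
    have "t *\<^sub>R (?E t ** ?D ** transpose (R t) + Diag e ** transpose (R t) + Diag v ** transpose (?E t))
       = (R t - mat 1) ** ?D ** transpose (R t) + (t *\<^sub>R Diag e) ** transpose (R t) + Diag v ** transpose (R t - mat 1)"
      using elim by (simp add: matrix_mult_scaleR_left matrix_mult_scaleR_right scaleR_add_right)
    also have "\<dots> = R t ** ?D ** transpose (R t) - Diag v"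
      by (simp add: matrix_mult_diff matrix_mult_add Diag_linear transpose_mat)
    finally have "(1 / t) *\<^sub>R (t *\<^sub>R (?E t ** ?D ** transpose (R t) + Diag e ** transpose (R t) + Diag v ** transpose (?E t)))
      = (1 / t) *\<^sub>R (R t ** ?D ** transpose (R t) - Diag v)"
      by simp
    then show ?case
      using elim by simp
  qed
  ultimately have "((\<lambda>t. (1 / t) *\<^sub>R (R t ** Diag (v + t *\<^sub>R e) ** transpose (R t) - Diag v))
     \<longlongrightarrow> S ** Diag (v + 0 *\<^sub>R e) ** transpose (mat 1) + Diag e ** transpose (mat 1) + Diag v ** transpose S) (at_right 0)"
    by (rule Lim_transform_eventually)
  moreover have "S ** Diag (v + 0 *\<^sub>R e) ** transpose (mat 1) + Diag e ** transpose (mat 1) + Diag v ** transpose S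
    = (\<chi> i j. S $ i $ j * (v $ j - v $ i) + (if i = j then e $ i else 0))"
    unfolding skew by (simp add: vec_eq_iff mult_Diag_nth transpose_mat algebra_simps)
  ultimately show ?thesis
    by simp
qed

lemma spectral_curve_derivative:
  fixes R :: "real \<Rightarrow> 'n::{finite,linorder} rmat"
  assumes P: "orthogonal_matrix P" and skew: "transpose S = - S" and der: "((\<lambda>t. (1 / t) *\<^sub>R (R t - mat 1)) \<longlongrightarrow> S) (at_right 0)"
    and H: "\<And>i j. conj_by P H $ i $ j = S $ i $ j * (v $ j - v $ i) + (if i = j then e $ i else 0)"
  shows "((\<lambda>t. (1 / t) *\<^sub>R (spectral (P ** R t) (v + t *\<^sub>R e) - spectral P v)) \<longlongrightarrow> H) (at_right 0)"
proof -
  let ?C = "\<lambda>t. (1 / t) *\<^sub>R (R t ** Diag (v + t *\<^sub>R e) ** transpose (R t) - Diag v)"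
  have "conj_by P H = (\<chi> i j. S $ i $ j * (v $ j - v $ i) + (if i = j then e $ i else 0))"
    by (simp add: vec_eq_iff H)
  then have C: "(?C \<longlongrightarrow> conj_by P H) (at_right 0)"
    using conj_curve_derivative[OF skew der, of v e] by simp
  then have "((\<lambda>t. P ** ?C t ** transpose P) \<longlongrightarrow> P ** conj_by P H ** transpose P) (at_right 0)"
    by (intro tendsto_intros)
  moreover have "P ** conj_by P H ** transpose P = mat_of H"
  proof -
    have "P ** conj_by P H ** transpose P = (P ** transpose P) ** mat_of H ** (P ** transpose P)"
      by (simp add: conj_by_def matrix_mul_assoc)
    then show ?thesis
      using P by simp
  qed
  moreover have "P ** ?C t ** transpose P = mat_of ((1 / t) *\<^sub>R (spectral (P ** R t) (v + t *\<^sub>R e) - spectral P v))" for t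
    by (simp add: scaleR_symmat.rep_eq minus_symmat.rep_eq mat_of_spectral matrix_transpose_mul matrix_mul_assoc
        matrix_mult_diff matrix_mult_scaleR_left matrix_mult_scaleR_right)
  ultimately show ?thesis
    by (simp add: tendsto_mat_of_iff[symmetric])
qed

section \<open>The affine hull of the critical cone\<close>

context spectral_pair
begin

lemma subderivative_ge: "ereal (Y \<bullet> H) \<le> subderivative (\<theta> \<circ> eigvals) X H"
proof -
  have X: "X \<in> dmS"
    using csubD(1)[OF Y_subS] .
  have "ereal (Y \<bullet> H - e) \<le> subderivative (\<theta> \<circ> eigvals) X H" if e: "0 < e" for e
    unfolding subderivative_def
  proof (rule Liminf_bounded)
    have "((\<lambda>h. Y \<bullet> h) \<longlongrightarrow> Y \<bullet> H) (nhds H)"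
      by (intro tendsto_intros filterlim_ident)
    then have ev: "\<forall>\<^sub>F h in nhds H. Y \<bullet> H - e < Y \<bullet> h"
      using e by (intro order_tendstoD(1)) auto
    have "\<forall>\<^sub>F q in at_right (0 :: real) \<times>\<^sub>F nhds H. 0 < fst q \<and> Y \<bullet> H - e < Y \<bullet> snd q"
      using eventually_prodI[OF eventually_at_right_less[of "0 :: real"] ev] .
    then show "\<forall>\<^sub>F q in at_right 0 \<times>\<^sub>F nhds H. ereal (Y \<bullet> H - e)
        \<le> (case q of (t, h) \<Rightarrow> ((\<theta> \<circ> eigvals) (X + t *\<^sub>R h) - (\<theta> \<circ> eigvals) X) / ereal t)"
    proof eventually_elim
      case (elim q)
      obtain t h where q: "q = (t, h)"
        by (meson surj_pair)
      have t: "0 < t" and h: "Y \<bullet> H - e < Y \<bullet> h"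
        using elim by (simp_all add: q)
      show ?case
      proof (cases "X + t *\<^sub>R h \<in> dmS")
        case True
        have "hS X + t * (Y \<bullet> h) \<le> hS (X + t *\<^sub>R h)"
          using csubD(2)[OF Y_subS True] by simp
        then have "Y \<bullet> h \<le> (hS (X + t *\<^sub>R h) - hS X) / t"
          using t by (simp add: pos_le_divide_eq mult.commute)
        then show ?thesis
          using True X t h by (simp add: q theta_eigvals)
      next
        case False
        then show ?thesis
          using X t by (simp add: q theta_eigvals)
      qed
    qed
  qed
  then have "ereal (Y \<bullet> H) \<le> subderivative (\<theta> \<circ> eigvals) X H + ereal e" if "0 < e" for e
    using add_right_mono[of "ereal (Y \<bullet> H - e)" _ "ereal e"] that by fastforce
  then show ?thesis
    by (rule ereal_le_epsilon2)
qed

text \<open>A liminf is bounded above along any single curve, and \<open>subderivative_ge\<close>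
  gives the opposite bound.\<close>

lemma critical_cone_by_curve:
  assumes lim: "(h \<longlongrightarrow> H) (at_right 0)"
    and le: "\<forall>\<^sub>F t in at_right 0. X + t *\<^sub>R h t \<in> dmS \<and> hS (X + t *\<^sub>R h t) - hS X \<le> t * (Y \<bullet> H)"
  shows "H \<in> critical_cone (\<theta> \<circ> eigvals) X Y"
proof -
  have X: "X \<in> dmS"
    using csubD(1)[OF Y_subS] .
  let ?q = "\<lambda>(t, h). ((\<theta> \<circ> eigvals) (X + t *\<^sub>R h) - (\<theta> \<circ> eigvals) X) / ereal t"
  have "subderivative (\<theta> \<circ> eigvals) X H \<le> ereal (Y \<bullet> H)"
  proof (rule ccontr)
    assume "\<not> ?thesis"
    then have "ereal (Y \<bullet> H) < Liminf (at_right 0 \<times>\<^sub>F nhds H) ?q"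
      by (simp add: subderivative_def)
    then have "\<forall>\<^sub>F q in at_right 0 \<times>\<^sub>F nhds H. ereal (Y \<bullet> H) < ?q q"
      by (rule less_LiminfD)
    moreover have "filterlim (\<lambda>t. (t, h t)) (at_right 0 \<times>\<^sub>F nhds H) (at_right 0)"
      by (intro filterlim_Pair lim filterlim_ident)
    ultimately have "\<forall>\<^sub>F t in at_right 0. ereal (Y \<bullet> H) < ?q (t, h t)"
      by (rule eventually_compose_filterlim)
    with le have "\<forall>\<^sub>F t in at_right (0 :: real). False"
      using eventually_at_right_less[of "0 :: real"]
    proof eventually_elim
      case (elim t)
      then have "Y \<bullet> H < (hS (X + t *\<^sub>R h t) - hS X) / t"
        using X by (simp add: theta_eigvals)
      then have "t * (Y \<bullet> H) < hS (X + t *\<^sub>R h t) - hS X"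
        using elim(3) by (simp add: pos_less_divide_eq mult.commute)
      with elim show ?case
        by simp
    qed
    then show False
      using eventually_happens'[OF trivial_limit_at_right_real] by blast
  qed
  with subderivative_ge[of H] show ?thesis
    by (simp add: critical_cone_def antisym)
qed

text \<open>The liminf equal to \<open>Y \<bullet> H\<close> produces points approaching
  \<open>X\<close> along directions tending to \<open>H\<close> with deficit o(t): a
  \<open>tangent_sequence\<close> in which the second pair and its basis are constant.\<close>

lemma critical_cone_subset_tangent:
  assumes P: "P \<in> eig_orth X \<inter> eig_orth Y" and H: "H \<in> critical_cone (\<theta> \<circ> eigvals) X Y"
  shows "H \<in> tangent P"
proof -
  have X: "X \<in> dmS"
    using csubD(1)[OF Y_subS] .
  let ?q = "\<lambda>(t, h). ((\<theta> \<circ> eigvals) (X + t *\<^sub>R h) - (\<theta> \<circ> eigvals) X) / ereal t"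
  let ?\<rho> = "\<lambda>k. 1 / real (Suc k)"
  have \<rho>_lim: "?\<rho> \<longlonglongrightarrow> 0"
    using LIMSEQ_inverse_real_of_nat by (simp add: inverse_eq_divide)
  define near where "near k q \<longleftrightarrow> 0 < fst q \<and> fst q < ?\<rho> k \<and> norm (snd q - H) < ?\<rho> k \<and> ?q q < ereal (Y \<bullet> H + ?\<rho> k)" for k q
  have "\<exists>q. near k q" for k
  proof (rule ccontr)
    assume none: "\<not> ?thesis"
    have e1: "\<forall>\<^sub>F t in at_right 0. 0 < t \<and> t < ?\<rho> k"
      unfolding eventually_at_right_field by (intro exI[of _ "?\<rho> k"]) auto
    have e2: "\<forall>\<^sub>F h in nhds H. norm (h - H) < ?\<rho> k"
      unfolding eventually_nhds_metric by (intro exI[of _ "?\<rho> k"]) (auto simp: dist_norm)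
    have "\<forall>\<^sub>F q in at_right 0 \<times>\<^sub>F nhds H. (0 < fst q \<and> fst q < ?\<rho> k) \<and> norm (snd q - H) < ?\<rho> k"
      unfolding eventually_prod_filter
      by (intro exI[of _ "\<lambda>t. 0 < t \<and> t < ?\<rho> k"] exI[of _ "\<lambda>h. norm (h - H) < ?\<rho> k"] conjI e1 e2) auto
    then have "\<forall>\<^sub>F q in at_right 0 \<times>\<^sub>F nhds H. ereal (Y \<bullet> H + ?\<rho> k) \<le> ?q q"
    proof eventually_elim
      case (elim q)
      then show ?case
        using none not_less unfolding near_def by blast
    qed
    then have "ereal (Y \<bullet> H + ?\<rho> k) \<le> subderivative (\<theta> \<circ> eigvals) X H"
      unfolding subderivative_def by (rule Liminf_bounded)
    also have "\<dots> = ereal (Y \<bullet> H)"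
      using H by (simp add: critical_cone_def)
    finally show False
      by simp
  qed
  then obtain q where q: "\<And>k. near k (q k)"
    by metis
  define t h where "t k = fst (q k)" and "h k = snd (q k)" for k
  have t: "0 < t k" "t k < ?\<rho> k" and hH: "norm (h k - H) < ?\<rho> k"
    and quot: "((\<theta> \<circ> eigvals) (X + t k *\<^sub>R h k) - (\<theta> \<circ> eigvals) X) / ereal (t k) < ereal (Y \<bullet> H + ?\<rho> k)" for k
    using q[of k] by (simp_all add: near_def t_def h_def case_prod_beta)
  define Z where "Z k = X + t k *\<^sub>R h k" for k
  have Z: "Z k \<in> dmS" for k
  proof (rule ccontr)
    assume "Z k \<notin> dmS"
    with quot[of k] X t(1)[of k] show False
      by (simp add: theta_eigvals Z_def)
  qed
  have quot': "(hS (Z k) - hS X) / t k < Y \<bullet> H + ?\<rho> k" for k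
    using quot[of k] X Z[of k] t(1)[of k] by (simp add: theta_eigvals Z_def)
  have t_lim: "t \<longlonglongrightarrow> 0"
    by (rule tendsto_sandwich[OF _ _ tendsto_const \<rho>_lim]) (use t in \<open>auto intro!: always_eventually less_imp_le\<close>)
  have h_lim: "h \<longlonglongrightarrow> H"
  proof -
    have "(\<lambda>k. h k - H) \<longlonglongrightarrow> 0"
      by (intro Lim_null_comparison[OF always_eventually \<rho>_lim] allI less_imp_le[OF hH])
    then show ?thesis
      by (simp add: LIM_zero_iff)
  qed
  have Z_lim: "Z \<longlonglongrightarrow> X"
  proof -
    have "Z \<longlonglongrightarrow> X + 0 *\<^sub>R H"
      unfolding Z_def by (intro tendsto_intros t_lim h_lim)
    then show ?thesis by simp
  qed
  have hZ: "(1 / t k) *\<^sub>R (Z k - X) = h k" for k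
    using t(1)[of k] by (simp add: Z_def)
  define P1 where "P1 k = (SOME P. P \<in> eig_orth (Z k))" for k
  have P1: "P1 k \<in> eig_orth (Z k)" for k
    unfolding P1_def using eig_orth_nonempty[of "Z k"] by (simp only: some_in_eq not_False_eq_True)
  define s where "s k = (1 / t k) *\<^sub>R (eigvals (Z k) - eigvals X)" for k
  have s: "s k \<in> cball 0 (norm H + 1)" for k
  proof -
    have "norm (s k) = norm (eigvals (Z k) - eigvals X) / t k"
      using t(1)[of k] by (simp add: s_def)
    also have "\<dots> \<le> norm (Z k - X) / t k"
      using t(1)[of k] by (intro divide_right_mono Hoffman_Wielandt) auto
    also have "\<dots> = norm (h k)"
      using t(1)[of k] by (simp add: Z_def)
    also have "\<dots> \<le> norm H + norm (h k - H)"
      by (rule norm_triangle_sub)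
    also have "\<dots> \<le> norm H + 1"
    proof -
      have "?\<rho> k \<le> 1" by simp
      then show ?thesis
        using hH[of k] by linarith
    qed
    finally show ?thesis by simp
  qed
  obtain e r where r: "strict_mono r" and sr: "(s \<circ> r) \<longlonglongrightarrow> e"
    by (rule convergent_subsequence_compact[of _ s, OF compact_cball s]) blast
  have sub_m: "(\<lambda>k. u (r k)) \<longlonglongrightarrow> v" if "u \<longlonglongrightarrow> v" for u :: "nat \<Rightarrow> 'n symmat" and v
    using LIMSEQ_subseq_LIMSEQ[OF that r] by (simp add: o_def)
  have sub_r: "(\<lambda>k. u (r k)) \<longlonglongrightarrow> v" if "u \<longlonglongrightarrow> v" for u :: "nat \<Rightarrow> real" and v
    using LIMSEQ_subseq_LIMSEQ[OF that r] by (simp add: o_def)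
  have D_lim: "(\<lambda>k. (hS (Z k) - hS X - Y \<bullet> (Z k - X)) / t k) \<longlonglongrightarrow> 0"
  proof (rule tendsto_sandwich[OF _ _ tendsto_const])
    show "\<forall>\<^sub>F k in sequentially. 0 \<le> (hS (Z k) - hS X - Y \<bullet> (Z k - X)) / t k"
    proof (intro always_eventually allI divide_nonneg_pos t(1))
      show "0 \<le> hS (Z k) - hS X - Y \<bullet> (Z k - X)" for k
        using csubD(2)[OF Y_subS Z[of k]] by simp
    qed
    show "\<forall>\<^sub>F k in sequentially. (hS (Z k) - hS X - Y \<bullet> (Z k - X)) / t k \<le> Y \<bullet> H + ?\<rho> k - Y \<bullet> h k"
    proof (intro always_eventually allI)
      fix k
      have "(hS (Z k) - hS X - Y \<bullet> (Z k - X)) / t k = (hS (Z k) - hS X) / t k - Y \<bullet> h k"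
        using t(1)[of k] by (simp add: diff_divide_distrib Z_def)
      then show "(hS (Z k) - hS X - Y \<bullet> (Z k - X)) / t k \<le> Y \<bullet> H + ?\<rho> k - Y \<bullet> h k"
        using quot'[of k] by linarith
    qed
    have "(\<lambda>k. Y \<bullet> H + ?\<rho> k - Y \<bullet> h k) \<longlonglongrightarrow> Y \<bullet> H + 0 - Y \<bullet> H"
      by (intro tendsto_intros \<rho>_lim h_lim)
    then show "(\<lambda>k. Y \<bullet> H + ?\<rho> k - Y \<bullet> h k) \<longlonglongrightarrow> 0"
      by simp
  qed
  have DX_lim: "(\<lambda>k. (hS (Z k) - hS X - Y \<bullet> (Z k - X)) * norm (Z k - X) / (t k)\<^sup>2) \<longlonglongrightarrow> 0"
  proof -
    have "(\<lambda>k. (hS (Z k) - hS X - Y \<bullet> (Z k - X)) / t k * norm (h k)) \<longlonglongrightarrow> 0 * norm H"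
      by (intro tendsto_intros D_lim h_lim)
    moreover have "(hS (Z k) - hS X - Y \<bullet> (Z k - X)) / t k * norm (h k) = (hS (Z k) - hS X - Y \<bullet> (Z k - X)) * norm (Z k - X) / (t k)\<^sup>2" for k
      using t(1)[of k] by (simp add: hZ[symmetric] power2_eq_square)
    ultimately show ?thesis
      by simp
  qed
  interpret tang: tangent_sequence \<theta> p a c m b d X Y "\<lambda>k. Z (r k)" "\<lambda>_. X" "\<lambda>_. Y" "\<lambda>k. t (r k)" "\<lambda>_. P" "\<lambda>k. P1 (r k)" P H e
  proof
    show "(\<lambda>k. (1 / t (r k)) *\<^sub>R (Z (r k) - X)) \<longlonglongrightarrow> H"
      unfolding hZ by (rule sub_m[OF h_lim])
    show "(\<lambda>k. (1 / t (r k)) *\<^sub>R (eigvals (Z (r k)) - eigvals X)) \<longlonglongrightarrow> e"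
      using sr by (simp add: s_def o_def)
  qed (use Z P1 P t(1) Y_subS sub_r[OF t_lim] sub_m[OF Z_lim] sub_r[OF D_lim] sub_r[OF DX_lim] in auto)
  show ?thesis
    by (rule tang.limit_tangent)
qed

end

lemma Diag_commute:
  fixes S :: "real^'n::finite^'n"
  assumes "\<And>i j. S $ i $ j \<noteq> 0 \<Longrightarrow> v $ i = v $ j"
  shows "Diag v ** S = S ** Diag v"
  using assms by (auto simp: vec_eq_iff mult_Diag_nth mult.commute)

lemma skew_symmetricI:
  fixes S :: "real^'n^'n"
  assumes "\<And>i j. S $ j $ i = - S $ i $ j"
  shows "transpose S = - S"
  unfolding vec_eq_iff by (intro allI) (simp only: transpose_nth vector_uminus_component assms[symmetric])

lemma spectral_rotate:
  assumes "orthogonal_matrix R" "R ** Diag v = Diag v ** R"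
  shows "spectral (P ** R) v = spectral P v"
proof -
  have "(P ** R) ** Diag v ** transpose (P ** R) = P ** (R ** Diag v) ** transpose R ** transpose P"
    by (simp add: matrix_transpose_mul matrix_mul_assoc)
  also have "\<dots> = P ** Diag v ** (R ** transpose R) ** transpose P"
    unfolding assms(2) by (simp add: matrix_mul_assoc)
  finally show ?thesis
    using assms(1) by (simp add: spectral_def)
qed

lemma eig_orth_rotate:
  assumes "P \<in> eig_orth X" "orthogonal_matrix R" "R ** Diag (eigvals X) = Diag (eigvals X) ** R"
  shows "P ** R \<in> eig_orth X"
  using assms spectral_rotate[OF assms(2,3), of P] by (simp add: eig_orth_iff orthogonal_matrix_mul)

lemma obtain_conj_by:
  fixes M :: "'n::finite rmat"
  assumes "orthogonal_matrix P" "transpose M = M"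
  obtains H where "conj_by P H = M"
proof -
  have "mat_of (sym_of (P ** M ** transpose P)) = P ** M ** transpose P"
    using assms(2) by (intro mat_of_sym_of) (simp add: matrix_transpose_mul matrix_mul_assoc)
  then have "conj_by P (sym_of (P ** M ** transpose P)) = (transpose P ** P) ** M ** (transpose P ** P)"
    by (simp add: conj_by_def matrix_mul_assoc)
  then show ?thesis
    using assms(1) by (intro that) simp
qed

lemma spectral_linear:
  "spectral P (v + w) = spectral P v + spectral P w" "spectral P (t *\<^sub>R v) = t *\<^sub>R spectral P v"
  by (simp_all add: mat_of_inject[symmetric] mat_of_spectral plus_symmat.rep_eq scaleR_symmat.rep_eq Diag_linear
      matrix_mult_add matrix_mult_scaleR_left matrix_mult_scaleR_right)

lemma tendsto_of_difference_quotient: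
  fixes Z :: "real \<Rightarrow> 'a::real_normed_vector"
  assumes "((\<lambda>t. (1 / t) *\<^sub>R (Z t - z)) \<longlongrightarrow> H) (at_right 0)"
  shows "(Z \<longlongrightarrow> z) (at_right 0)"
proof -
  have "((\<lambda>t. z + t *\<^sub>R ((1 / t) *\<^sub>R (Z t - z))) \<longlongrightarrow> z + 0 *\<^sub>R H) (at_right 0)"
    by (intro tendsto_intros assms)
  moreover have "\<forall>\<^sub>F t in at_right 0. z + t *\<^sub>R ((1 / t) *\<^sub>R (Z t - z)) = Z t"
    using eventually_at_right_less[of "0 :: real"] by eventually_elim simp
  ultimately show ?thesis
    using Lim_transform_eventually by fastforce
qed

lemma (in smooth_function) G_along_curve:
  fixes Z :: "real \<Rightarrow> 'a"
  assumes lim: "((\<lambda>t. (1 / t) *\<^sub>R (Z t - z)) \<longlongrightarrow> H) (at_right 0)"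
  shows "((\<lambda>t. (1 / t) *\<^sub>R (G (Z t) - G z)) \<longlongrightarrow> hessian \<phi> z H) (at_right 0)"
proof -
  let ?q = "\<lambda>t. (1 / t) *\<^sub>R (Z t - z)"
  have Zz: "(Z \<longlongrightarrow> z) (at_right 0)"
    by (rule tendsto_of_difference_quotient[OF lim])
  have "((\<lambda>t. (1 / t) *\<^sub>R (G (Z t) - G z) - hessian \<phi> z (?q t)) \<longlongrightarrow> 0) (at_right 0)"
  proof (rule tendstoI)
    fix e :: real assume e: "0 < e"
    define r where "r = e / (norm H + 1)"
    have r: "0 < r" "r * (norm H + 1) = e"
      using e add_nonneg_pos[OF norm_ge_zero[of H] zero_less_one] by (simp_all add: r_def)
    obtain \<delta> where \<delta>: "0 < \<delta>"
      "\<And>u v. norm (u - z) < \<delta> \<Longrightarrow> norm (v - z) < \<delta> \<Longrightarrow> norm (G v - G u - hessian \<phi> z (v - u)) \<le> r * norm (v - u)"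
      by (rule strictly_differentiable[OF r(1)]) blast
    have "\<forall>\<^sub>F t in at_right 0. norm (?q t) < norm H + 1"
      using order_tendstoD(2)[OF tendsto_norm[OF lim], of "norm H + 1"] by simp
    moreover have "\<forall>\<^sub>F t in at_right 0. norm (Z t - z) < \<delta>"
      using tendstoD[OF Zz \<delta>(1)] by (simp add: dist_norm)
    ultimately show "\<forall>\<^sub>F t in at_right 0. dist ((1 / t) *\<^sub>R (G (Z t) - G z) - hessian \<phi> z (?q t)) 0 < e"
      using eventually_at_right_less[of "0 :: real"]
    proof eventually_elim
      case (elim t)
      have "norm ((1 / t) *\<^sub>R (G (Z t) - G z) - hessian \<phi> z (?q t)) = norm ((1 / t) *\<^sub>R (G (Z t) - G z - hessian \<phi> z (Z t - z)))"
        by (simp only: hessian_linear(2) scaleR_diff_right[of "1 / t" "G (Z t) - G z" "hessian \<phi> z (Z t - z)"])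
      also have "\<dots> = (1 / t) * norm (G (Z t) - G z - hessian \<phi> z (Z t - z))"
        using elim(3) by simp
      also have "\<dots> \<le> (1 / t) * (r * norm (Z t - z))"
        using elim(2,3) \<delta>(1) by (intro mult_left_mono \<delta>(2)) auto
      also have "\<dots> = r * norm (?q t)"
        using elim(3) by simp
      also have "\<dots> < r * (norm H + 1)"
        using r(1) elim(1) by (intro mult_strict_left_mono)
      finally show ?case
        using r(2) by (simp add: dist_norm)
    qed
  qed
  moreover have "((\<lambda>t. hessian \<phi> z (?q t)) \<longlongrightarrow> hessian \<phi> z H) (at_right 0)"
    by (rule bounded_linear.tendsto[OF bounded_linear_hessian lim])
  ultimately show ?thesis
    using tendsto_add by fastforce
qed

context spectral_pair
begin

lemma Eblk_cong: "x $ i = x $ j \<Longrightarrow> y $ i = y $ j \<Longrightarrow> Eblk i \<longleftrightarrow> Eblk j"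
  by (simp add: Eblk_def)

text \<open>Strictly active vectors are constant on blocks without \<open>Eblk\<close>, so their
  pairing with \<open>r\<close> depends only on block sums.\<close>

lemma centered_on_blocks_in_L:
  assumes r0: "\<And>i. Eblk i \<Longrightarrow> r $ i = 0"
    and sum0: "\<And>i. \<not> Eblk i \<Longrightarrow> (\<Sum>j | x $ j = x $ i \<and> y $ j = y $ i. r $ j) = 0"
  shows "r \<in> L"
proof -
  have zero: "r \<bullet> w = 0" if w: "\<And>i j. \<not> Eblk i \<Longrightarrow> x $ i = x $ j \<Longrightarrow> y $ i = y $ j \<Longrightarrow> w $ i = w $ j" for w
  proof -
    let ?f = "\<lambda>i. (x $ i, y $ i)"
    have "r \<bullet> w = (\<Sum>q\<in>range ?f. \<Sum>i | i \<in> UNIV \<and> ?f i = q. r $ i * w $ i)"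
      unfolding inner_vec_def by (simp add: sum.image_gen[of UNIV _ ?f])
    also have "\<dots> = 0"
    proof (rule sum.neutral, rule ballI)
      fix q assume "q \<in> range ?f"
      then obtain k where q: "q = ?f k" by blast
      have set: "{i \<in> UNIV. ?f i = q} = {i. x $ i = x $ k \<and> y $ i = y $ k}"
        by (auto simp: q)
      show "(\<Sum>i | i \<in> UNIV \<and> ?f i = q. r $ i * w $ i) = 0"
      proof (cases "Eblk k")
        case True
        then have "r $ i = 0" if "x $ i = x $ k" "y $ i = y $ k" for i
          using r0[of i] Eblk_cong[OF that] by simp
        then show ?thesis
          unfolding set by (intro sum.neutral) simp
      next
        case False
        have "(\<Sum>i | x $ i = x $ k \<and> y $ i = y $ k. r $ i * w $ i) = (\<Sum>i | x $ i = x $ k \<and> y $ i = y $ k. r $ i * w $ k)"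
        proof (rule sum.cong[OF refl])
          fix i assume "i \<in> {i. x $ i = x $ k \<and> y $ i = y $ k}"
          then have "w $ k = w $ i"
            by (intro w[OF False]) auto
          then show "r $ i * w $ i = r $ i * w $ k" by simp
        qed
        also have "\<dots> = 0"
          using sum0[OF False] by (simp flip: sum_distrib_right)
        finally show ?thesis
          unfolding set .
      qed
    qed
    finally show ?thesis .
  qed
  show ?thesis
    unfolding L_def
  proof (intro CollectI conjI ballI)
    show "r \<bullet> (a \<nu>' - a \<nu>) = 0" if "\<nu> \<in> E1" "\<nu>' \<in> E1" for \<nu> \<nu>'
    proof (rule zero)
      fix i j assume ij: "\<not> Eblk i" "x $ i = x $ j" "y $ i = y $ j"
      show "(a \<nu>' - a \<nu>) $ i = (a \<nu>' - a \<nu>) $ j"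
        using constant_off_Eblk(1)[OF ij that(1)] constant_off_Eblk(1)[OF ij that(2)] by simp
    qed
    show "r \<bullet> b \<mu> = 0" if "\<mu> \<in> E2" for \<mu>
      by (rule zero) (rule constant_off_Eblk(2)[OF _ _ _ that])
  qed
qed

text \<open>Subtracting block means from \<open>rank_vec\<close> gives a vector of \<open>L\<close>
  with distinct entries on each block without \<open>Eblk\<close>; a small multiple keeps
  \<open>h\<close> in \<open>K\<close>. On the other blocks \<open>L_constant_on_Eblk\<close> rules
  out separation.\<close>

lemma obtain_separating_direction:
  obtains v where "v \<in> K" "\<And>i j. x $ i = x $ j \<Longrightarrow> y $ i = y $ j \<Longrightarrow> i \<noteq> j \<Longrightarrow> \<not> Eblk i \<Longrightarrow> v $ i \<noteq> v $ j"
proof -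
  obtain h where h: "h \<in> K"
    using K_nonempty by blast
  let ?B = "\<lambda>i. {j. x $ j = x $ i \<and> y $ j = y $ i}"
  define mean where "mean i = (\<Sum>j\<in>?B i. (rank_vec :: 'n rvec) $ j) / real (card (?B i))" for i
  define r :: "'n rvec" where "r = (\<chi> i. if Eblk i then 0 else rank_vec $ i - mean i)"
  have mean: "mean i = mean j" if "x $ i = x $ j" "y $ i = y $ j" for i j
    using that by (simp add: mean_def)
  have "r \<in> L"
  proof (rule centered_on_blocks_in_L)
    show "r $ i = 0" if "Eblk i" for i
      using that by (simp add: r_def)
    show "(\<Sum>j\<in>?B i. r $ j) = 0" if i: "\<not> Eblk i" for i
    proof -
      have "(\<Sum>j\<in>?B i. r $ j) = (\<Sum>j\<in>?B i. rank_vec $ j - mean i)"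
      proof (rule sum.cong[OF refl])
        fix j assume "j \<in> ?B i"
        then show "r $ j = rank_vec $ j - mean i"
          using i Eblk_cong[of j i] mean[of j i] by (simp add: r_def)
      qed
      also have "\<dots> = (\<Sum>j\<in>?B i. rank_vec $ j) - real (card (?B i)) * mean i"
        by (simp add: sum_subtractf)
      also have "\<dots> = 0"
      proof -
        have "card (?B i) \<noteq> 0"
          by auto
        then show ?thesis
          by (simp add: mean_def)
      qed
      finally show ?thesis .
    qed
  qed
  from eventually_K[OF h this] have K: "\<forall>\<^sub>F s in at_right 0. h + s *\<^sub>R r \<in> K" .
  have "\<forall>\<^sub>F s in at_right 0. \<forall>i j. x $ i = x $ j \<longrightarrow> y $ i = y $ j \<longrightarrow> i \<noteq> j \<longrightarrow> \<not> Eblk i \<longrightarrow> (h + s *\<^sub>R r) $ i \<noteq> (h + s *\<^sub>R r) $ j"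
  proof (intro eventually_all_finite)
    fix i j
    show "\<forall>\<^sub>F s in at_right 0. x $ i = x $ j \<longrightarrow> y $ i = y $ j \<longrightarrow> i \<noteq> j \<longrightarrow> \<not> Eblk i \<longrightarrow> (h + s *\<^sub>R r) $ i \<noteq> (h + s *\<^sub>R r) $ j"
    proof (cases "x $ i = x $ j \<and> y $ i = y $ j \<and> i \<noteq> j \<and> \<not> Eblk i")
      case True
      then have D: "r $ i - r $ j \<noteq> 0"
        using Eblk_cong[of i j] mean[of i j] rank_vec_less[of i j] rank_vec_less[of j i] by (force simp: r_def neq_iff)
      have "\<forall>\<^sub>F s in at_right 0. h $ i - h $ j + s * (r $ i - r $ j) \<noteq> 0"
      proof (cases "h $ i = h $ j")
        case True
        then show ?thesis
          using eventually_at_right_less[of "0 :: real"] D by (auto elim: eventually_mono)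
      next
        case False
        have "((\<lambda>s. h $ i - h $ j + s * (r $ i - r $ j)) \<longlongrightarrow> h $ i - h $ j + 0 * (r $ i - r $ j)) (at_right 0)"
          by (intro tendsto_intros)
        then show ?thesis
          using False by (intro tendsto_imp_eventually_ne) auto
      qed
      then show ?thesis
        by eventually_elim (simp add: algebra_simps)
    qed auto
  qed
  with K have "\<forall>\<^sub>F s in at_right 0. h + s *\<^sub>R r \<in> K \<and>
      (\<forall>i j. x $ i = x $ j \<longrightarrow> y $ i = y $ j \<longrightarrow> i \<noteq> j \<longrightarrow> \<not> Eblk i \<longrightarrow> (h + s *\<^sub>R r) $ i \<noteq> (h + s *\<^sub>R r) $ j)"
    by (rule eventually_conj)
  then obtain s where "h + s *\<^sub>R r \<in> K"
    "\<forall>i j. x $ i = x $ j \<longrightarrow> y $ i = y $ j \<longrightarrow> i \<noteq> j \<longrightarrow> \<not> Eblk i \<longrightarrow> (h + s *\<^sub>R r) $ i \<noteq> (h + s *\<^sub>R r) $ j"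
    using eventually_happens'[OF trivial_limit_at_right_real] by blast
  then show ?thesis
    by (intro that) auto
qed

lemma spectral_XY: "P \<in> eig_orth X \<inter> eig_orth Y \<Longrightarrow> orthogonal_matrix P \<and> X = spectral P x \<and> Y = spectral P y"
  using eig_orth_iff by blast

lemma inner_Y: "P \<in> eig_orth X \<inter> eig_orth Y \<Longrightarrow> Y \<bullet> H = diag (conj_by P H) \<bullet> y"
  using spectral_XY[of P] inner_spectral[of P H y] by (simp add: inner_commute)

text \<open>\<open>y\<close> stays a subgradient along \<open>x + t v\<close>; its inequality read
  backwards to \<open>x\<close> bounds the growth by \<open>t (v \<bullet> y)\<close>.\<close>

lemma spectral_K_critical:
  assumes P: "P \<in> eig_orth X \<inter> eig_orth Y" and v: "v \<in> K"
  shows "spectral P v \<in> critical_cone (\<theta> \<circ> eigvals) X Y"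
proof (rule critical_cone_by_curve[OF tendsto_const])
  have oP: "orthogonal_matrix P" and X: "X = spectral P x"
    using spectral_XY[OF P] by auto
  have "\<forall>\<^sub>F t in at_right 0. y \<in> sub (x + t *\<^sub>R v)"
    using eventually_y_sub[OF v subspace_0[OF subspace_L]] by (rule eventually_mono) blast
  then show "\<forall>\<^sub>F t in at_right 0. X + t *\<^sub>R spectral P v \<in> dmS \<and> hS (X + t *\<^sub>R spectral P v) - hS X \<le> t * (Y \<bullet> spectral P v)"
  proof eventually_elim
    case (elim t)
    have eq: "X + t *\<^sub>R spectral P v = spectral P (x + t *\<^sub>R v)"
      by (subst X) (simp add: spectral_linear)
    have dm: "x + t *\<^sub>R v \<in> dm"
      using subD(1)[OF elim] .
    have "th (x + t *\<^sub>R v) + y \<bullet> (x - (x + t *\<^sub>R v)) \<le> th x"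
      by (rule subD(2)[OF elim subD(1)[OF y_sub]])
    then have "th (x + t *\<^sub>R v) - th x \<le> t * (v \<bullet> y)"
      by (simp add: inner_commute)
    moreover have "Y \<bullet> spectral P v = v \<bullet> y"
    proof -
      have "conj_by P (spectral P v) = Diag v"
        using spectral_iff[OF oP] by blast
      then show ?thesis
        by (simp add: inner_Y[OF P])
    qed
    ultimately show ?case
      unfolding eq using spectral_eval[OF oP, of "x + t *\<^sub>R v"] dm by (simp add: hS_def)
  qed
qed

text \<open>A pure rotation keeps the eigenvalues and so the function value, and
  \<open>Y \<bullet> H\<close> is 0. The matrix \<open>S\<close> solves the commutator equation with
  \<open>Diag x\<close>, possible because the entries of \<open>H\<close> inside blocks
  vanish.\<close>

lemma off_block_critical:
  assumes P: "P \<in> eig_orth X \<inter> eig_orth Y" and H: "\<And>i j. x $ i = x $ j \<Longrightarrow> conj_by P H $ i $ j = 0"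
  shows "H \<in> critical_cone (\<theta> \<circ> eigvals) X Y"
proof -
  have oP: "orthogonal_matrix P" and X: "X = spectral P x"
    using spectral_XY[OF P] by auto
  let ?A = "conj_by P H"
  define S :: "'n rmat" where "S = (\<chi> i j. if x $ i = x $ j then 0 else ?A $ i $ j / (x $ j - x $ i))"
  have skew: "transpose S = - S"
  proof -
    have "S $ j $ i = - S $ i $ j" for i j
      using conj_by_commute[of P H i j] minus_divide_right[of "?A $ i $ j" "x $ j - x $ i"] by (simp add: S_def)
    then show ?thesis
      by (rule skew_symmetricI)
  qed
  obtain R where R: "\<And>t. orthogonal_matrix (R t)" "((\<lambda>t. (1 / t) *\<^sub>R (R t - mat 1)) \<longlongrightarrow> S) (at_right 0)"
    by (rule rotation_curve[OF skew]) blast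
  have lim: "((\<lambda>t. (1 / t) *\<^sub>R (spectral (P ** R t) (x + t *\<^sub>R 0) - spectral P x)) \<longlongrightarrow> H) (at_right 0)"
  proof (rule spectral_curve_derivative[OF oP skew R(2)])
    show "?A $ i $ j = S $ i $ j * (x $ j - x $ i) + (if i = j then 0 $ i else 0)" for i j
      using H[of i j] by (cases "x $ i = x $ j") (auto simp: S_def)
  qed
  show ?thesis
  proof (rule critical_cone_by_curve[OF lim])
    have "Y \<bullet> H = 0"
      unfolding inner_Y[OF P] using H by (simp add: inner_vec_def)
    moreover have "X + t *\<^sub>R ((1 / t) *\<^sub>R (spectral (P ** R t) (x + t *\<^sub>R 0) - spectral P x)) = spectral (P ** R t) x" if "0 < t" for t
      using that X by simp
    moreover have "spectral (P ** R t) x \<in> dmS \<and> hS (spectral (P ** R t) x) = hS X" for t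
      using spectral_eval[of "P ** R t" x] orthogonal_matrix_mul[OF oP R(1)[of t]] subD(1)[OF y_sub] by (simp add: hS_def)
    ultimately show "\<forall>\<^sub>F t in at_right 0. X + t *\<^sub>R ((1 / t) *\<^sub>R (spectral (P ** R t) (x + t *\<^sub>R 0) - spectral P x)) \<in> dmS \<and>
        hS (X + t *\<^sub>R ((1 / t) *\<^sub>R (spectral (P ** R t) (x + t *\<^sub>R 0) - spectral P x))) - hS X \<le> t * (Y \<bullet> H)"
      using eventually_at_right_less[of "0 :: real"] by (auto elim!: eventually_mono)
  qed
qed

text \<open>\<open>S\<close> links only indices with equal entries in \<open>x\<close> and in
  \<open>y\<close>, so \<open>P ** R t\<close> remains a common eigenbasis and every point of the
  curve is critical. Its difference quotients lie in the span, which is closed, and tend to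
  \<open>H\<close>.\<close>

lemma block_in_span_critical:
  assumes P: "P \<in> eig_orth X \<inter> eig_orth Y" and H: "H \<in> tangent P"
    and off: "\<And>i j. x $ i \<noteq> x $ j \<Longrightarrow> conj_by P H $ i $ j = 0"
  shows "H \<in> span (critical_cone (\<theta> \<circ> eigvals) X Y)"
proof -
  have oP: "orthogonal_matrix P"
    using spectral_XY[OF P] by auto
  let ?A = "conj_by P H"
  obtain v where v: "v \<in> K" "\<And>i j. x $ i = x $ j \<Longrightarrow> y $ i = y $ j \<Longrightarrow> i \<noteq> j \<Longrightarrow> \<not> Eblk i \<Longrightarrow> v $ i \<noteq> v $ j"
    by (rule obtain_separating_direction) blast
  let ?sep = "\<lambda>i j. x $ i = x $ j \<and> y $ i = y $ j \<and> v $ i \<noteq> v $ j"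
  define S :: "'n rmat" where "S = (\<chi> i j. if ?sep i j then ?A $ i $ j / (v $ j - v $ i) else 0)"
  have skew: "transpose S = - S"
  proof -
    have "S $ j $ i = - S $ i $ j" for i j
      using conj_by_commute[of P H i j] minus_divide_right[of "?A $ i $ j" "v $ j - v $ i"] by (simp add: S_def)
    then show ?thesis
      by (rule skew_symmetricI)
  qed
  obtain R where R: "\<And>t. orthogonal_matrix (R t)" "((\<lambda>t. (1 / t) *\<^sub>R (R t - mat 1)) \<longlongrightarrow> S) (at_right 0)"
    "\<And>t M. M ** S = S ** M \<Longrightarrow> R t ** M = M ** R t"
    by (rule rotation_curve[OF skew]) blast
  have PR: "P ** R t \<in> eig_orth X \<inter> eig_orth Y" for t
  proof -
    have "R t ** Diag x = Diag x ** R t"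
      by (intro R(3) Diag_commute) (simp add: S_def split: if_splits)
    moreover have "R t ** Diag y = Diag y ** R t"
      by (intro R(3) Diag_commute) (simp add: S_def split: if_splits)
    ultimately show ?thesis
      using P eig_orth_rotate R(1) by blast
  qed
  let ?e = "diag ?A"
  have lim: "((\<lambda>t. (1 / t) *\<^sub>R (spectral (P ** R t) (v + t *\<^sub>R ?e) - spectral P v)) \<longlongrightarrow> H) (at_right 0)"
  proof (rule spectral_curve_derivative[OF oP skew R(2)])
    fix i j
    have "?A $ i $ j = 0" if "i \<noteq> j" "\<not> ?sep i j"
      using that H off[of i j] v(2)[of i j] unfolding tangent_def by blast
    then show "?A $ i $ j = S $ i $ j * (v $ j - v $ i) + (if i = j then ?e $ i else 0)"
      by (auto simp: S_def)
  qed
  have "?e \<in> L"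
    using H by (simp add: tangent_def)
  from eventually_K[OF v(1) this]
  have "\<forall>\<^sub>F t in at_right 0. (1 / t) *\<^sub>R (spectral (P ** R t) (v + t *\<^sub>R ?e) - spectral P v) \<in> span (critical_cone (\<theta> \<circ> eigvals) X Y)"
  proof eventually_elim
    case (elim t)
    show ?case
      by (intro span_scale span_diff span_base spectral_K_critical P PR v(1) elim)
  qed
  from Lim_in_closed_set[OF closed_span this trivial_limit_at_right_real lim] show ?thesis .
qed

text \<open>Since 0 is critical, the affine hull is the span. A tangent \<open>H\<close> is its part
  inside the blocks of \<open>X\<close>, handled by rotations around a point of \<open>K\<close>,
  plus the rest, handled by rotations around \<open>x\<close>.\<close>

lemma affine_hull_critical_cone:
  assumes P: "P \<in> eig_orth X \<inter> eig_orth Y"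
  shows "affine hull critical_cone (\<theta> \<circ> eigvals) X Y = tangent P"
proof -
  let ?C = "critical_cone (\<theta> \<circ> eigvals) X Y"
  have "0 \<in> ?C"
    by (rule off_block_critical[OF P]) (simp add: conj_by_linear)
  then have span: "affine hull ?C = span ?C"
    by (intro affine_hull_span_0 hull_inc)
  have "span ?C \<subseteq> tangent P"
    using critical_cone_subset_tangent[OF P] subspace_tangent by (intro span_minimal) auto
  moreover have "H \<in> span ?C" if H: "H \<in> tangent P" for H
  proof -
    have oP: "orthogonal_matrix P"
      using spectral_XY[OF P] by auto
    obtain H2 where H2: "conj_by P H2 = (\<chi> i j. if x $ i = x $ j then conj_by P H $ i $ j else 0)"
    proof (rule obtain_conj_by[OF oP])
      show "transpose (\<chi> i j. if x $ i = x $ j then conj_by P H $ i $ j else 0) = (\<chi> i j. if x $ i = x $ j then conj_by P H $ i $ j else 0)"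
        using conj_by_commute[of P H] by (simp add: vec_eq_iff)
    qed blast
    have "H2 \<in> tangent P"
    proof -
      have "diag (conj_by P H2) = diag (conj_by P H)"
        by (simp add: vec_eq_iff H2)
      then show ?thesis
        using H by (simp add: tangent_def H2)
    qed
    then have "H2 \<in> span ?C"
      by (intro block_in_span_critical[OF P]) (simp_all add: H2)
    moreover have "H - H2 \<in> span ?C"
      by (intro span_base off_block_critical[OF P]) (simp add: conj_by_linear H2)
    ultimately show ?thesis
      using span_add by fastforce
  qed
  ultimately show ?thesis
    unfolding span by blast
qed

end

section \<open>Strong monotonicity implies positivity on tangent directions\<close>

context spectral_pair
begin

text \<open>The denominators that tend to 0 belong to pairs with equal entries in \<open>x\<close>;
  there tangency makes either the entry of \<open>H\<close> or the numerator vanish.\<close>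

lemma perturbed_qform_lim:
  assumes H: "H \<in> tangent P"
  shows "((\<lambda>s. \<Sum>i\<in>UNIV. \<Sum>j\<in>UNIV. (y $ i - y $ j) / ((x + s *\<^sub>R v) $ i - (x + s *\<^sub>R v) $ j) * (conj_by P H $ i $ j)\<^sup>2)
    \<longlongrightarrow> qform P H) (at_right 0)"
  unfolding qform_def
proof (intro tendsto_sum)
  fix i j
  let ?f = "\<lambda>s. (y $ i - y $ j) / ((x + s *\<^sub>R v) $ i - (x + s *\<^sub>R v) $ j) * (conj_by P H $ i $ j)\<^sup>2"
  show "(?f \<longlongrightarrow> (y $ i - y $ j) / (x $ i - x $ j) * (conj_by P H $ i $ j)\<^sup>2) (at_right 0)"
  proof (cases "x $ i = x $ j")
    case True
    then have "(y $ i - y $ j) * (conj_by P H $ i $ j)\<^sup>2 = 0"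
      using H by (auto simp: tangent_def)
    then have "?f = (\<lambda>s. 0)" "(y $ i - y $ j) / (x $ i - x $ j) * (conj_by P H $ i $ j)\<^sup>2 = 0"
      by (auto simp: fun_eq_iff)
    then show ?thesis
      by (simp only: tendsto_const)
  next
    case False
    have "((\<lambda>s. (x + s *\<^sub>R v) $ i - (x + s *\<^sub>R v) $ j) \<longlongrightarrow> (x + 0 *\<^sub>R v) $ i - (x + 0 *\<^sub>R v) $ j) (at_right 0)"
      by (intro tendsto_intros)
    then have "((\<lambda>s. (x + s *\<^sub>R v) $ i - (x + s *\<^sub>R v) $ j) \<longlongrightarrow> x $ i - x $ j) (at_right 0)"
      by simp
    from tendsto_mult[OF tendsto_divide[OF tendsto_const this] tendsto_const] show ?thesis
      using False by simp
  qed
qed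

text \<open>At \<open>x\<close> itself a rotation cannot produce entries of \<open>H\<close> inside
  a block of \<open>X\<close>. At \<open>x + s v\<close> with separating \<open>v\<close>, every
  nonzero off-diagonal entry of \<open>H\<close> joins different eigenvalues and can be
  produced.\<close>

lemma positive_of_strongly_monotone:
  assumes comp: "composite \<phi> dmS hS f" and grad: "gradient \<phi> X = - Y"
    and sm: "composite.strongly_monotone_near \<phi> dmS hS X"
    and P: "P \<in> eig_orth X \<inter> eig_orth Y" and H: "H \<in> tangent P" "H \<noteq> 0"
  shows "0 < hessian \<phi> X H \<bullet> H + qform P H"
proof -
  interpret composite \<phi> dmS hS f
    by (rule comp)
  have oP: "orthogonal_matrix P" and X: "X = spectral P x" and Y: "Y = spectral P y"
    using spectral_XY[OF P] by auto
  let ?A = "conj_by P H"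
  let ?e = "diag ?A"
  have e: "?e \<in> L"
    using H by (simp add: tangent_def)
  obtain \<kappa> \<delta> where \<kappa>: "0 < \<kappa>" and \<delta>: "0 < \<delta>" and mono: "\<And>z1 w1 z2 w2. w1 \<in> subS z1 \<Longrightarrow> w2 \<in> subS z2 \<Longrightarrow>
    norm (z1 - X) < \<delta> \<Longrightarrow> norm (z2 - X) < \<delta> \<Longrightarrow> norm (w1 + G X) < \<delta> \<Longrightarrow> norm (w2 + G X) < \<delta> \<Longrightarrow>
    \<kappa> * (norm (z1 - z2))\<^sup>2 \<le> (G z1 - G z2 + w1 - w2) \<bullet> (z1 - z2)"
    using sm unfolding strongly_monotone_near_def by metis
  obtain v where v: "v \<in> K" "\<And>i j. x $ i = x $ j \<Longrightarrow> y $ i = y $ j \<Longrightarrow> i \<noteq> j \<Longrightarrow> \<not> Eblk i \<Longrightarrow> v $ i \<noteq> v $ j"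
    by (rule obtain_separating_direction) blast
  define z where "z s = x + s *\<^sub>R v" for s
  define q where "q s = (\<Sum>i\<in>UNIV. \<Sum>j\<in>UNIV. (y $ i - y $ j) / (z s $ i - z s $ j) * (?A $ i $ j)\<^sup>2)" for s
  define Z where "Z s = spectral P (z s)" for s
  have Z_eq: "Z s = X + s *\<^sub>R spectral P v" for s
    unfolding Z_def z_def spectral_linear X[symmetric] ..
  have Z_lim: "(Z \<longlongrightarrow> X) (at_right 0)"
  proof -
    have "(Z \<longlongrightarrow> X + 0 *\<^sub>R spectral P v) (at_right 0)"
      unfolding Z_eq by (intro tendsto_intros)
    then show ?thesis by simp
  qed
  have bound: "\<kappa> * (norm H)\<^sup>2 \<le> hessian \<phi> (Z s) H \<bullet> H + q s"
    if s: "0 < s" and sub0: "y \<in> sub (z s)" and sub: "\<forall>\<^sub>F t in at_right 0. y \<in> sub (z s + t *\<^sub>R ?e)"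
      and sep: "\<forall>i j. x $ i \<noteq> x $ j \<longrightarrow> z s $ i \<noteq> z s $ j" and near: "norm (Z s - X) < \<delta>" for s
  proof -
    have A0: "?A $ i $ j = 0" if "z s $ i = z s $ j" "i \<noteq> j" for i j
    proof -
      have xij: "x $ i = x $ j"
        using sep that by blast
      then have "v $ i = v $ j"
        using that s by (simp add: z_def)
      then show ?thesis
        using xij that(2) v(2)[of i j] H(1) unfolding tangent_def by blast
    qed
    \<comment> \<open>Solves the commutator equation with \<open>Diag (z s)\<close>; by
      \<open>A0\<close> the undetermined off-diagonal entries of \<open>H\<close> are 0.\<close>
    define S :: "'n rmat" where "S = (\<chi> i j. if z s $ i = z s $ j then 0 else ?A $ i $ j / (z s $ j - z s $ i))"
    have S_anti: "S $ j $ i = - S $ i $ j" for i j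
      using conj_by_commute[of P H i j] minus_divide_right[of "?A $ i $ j" "z s $ j - z s $ i"] by (simp add: S_def)
    have skew: "transpose S = - S"
      by (rule skew_symmetricI[OF S_anti])
    obtain R where R: "\<And>t. orthogonal_matrix (R t)" "((\<lambda>t. (1 / t) *\<^sub>R (R t - mat 1)) \<longlongrightarrow> S) (at_right 0)"
      by (rule rotation_curve[OF skew]) blast
    \<comment> \<open>The commutator of \<open>S\<close> and \<open>Diag y\<close>, that is the
      velocity of the rotated subgradient.\<close>
    define M :: "'n rmat" where "M = (\<chi> i j. S $ i $ j * (y $ j - y $ i))"
    have "transpose M = M"
      unfolding vec_eq_iff
    proof (intro allI)
      fix i j show "transpose M $ i $ j = M $ i $ j"
        using S_anti[of i j] by (simp add: M_def algebra_simps)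
    qed
    then obtain N where N: "conj_by P N = M"
      by (rule obtain_conj_by[OF oP]) blast
    \<comment> \<open>One rotation moves the base point and the subgradient. The eigenvalues of the
      latter stay \<open>y\<close>, a subgradient at the moved eigenvalues; the summand 0 only fits
      the curve lemma.\<close>
    define Z2 W2 where "Z2 t = spectral (P ** R t) (z s + t *\<^sub>R ?e)" and "W2 t = spectral (P ** R t) (y + t *\<^sub>R 0)" for t
    have oPR: "orthogonal_matrix (P ** R t)" for t
      using oP R(1) by (rule orthogonal_matrix_mul)
    have Hl: "((\<lambda>t. (1 / t) *\<^sub>R (Z2 t - Z s)) \<longlongrightarrow> H) (at_right 0)"
      unfolding Z2_def Z_def
    proof (rule spectral_curve_derivative[OF oP skew R(2)])
      show "?A $ i $ j = S $ i $ j * (z s $ j - z s $ i) + (if i = j then ?e $ i else 0)" for i j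
        using A0[of i j] by (cases "z s $ i = z s $ j") (auto simp: S_def)
    qed
    have Nl: "((\<lambda>t. (1 / t) *\<^sub>R (W2 t - Y)) \<longlongrightarrow> N) (at_right 0)"
    proof -
      have "((\<lambda>t. (1 / t) *\<^sub>R (W2 t - spectral P y)) \<longlongrightarrow> N) (at_right 0)"
        unfolding W2_def
      proof (rule spectral_curve_derivative[OF oP skew R(2)])
        show "conj_by P N $ i $ j = S $ i $ j * (y $ j - y $ i) + (if i = j then 0 $ i else 0)" for i j
          by (simp add: N M_def)
      qed
      then show ?thesis
        unfolding Y[symmetric] .
    qed
    have Gl: "((\<lambda>t. (1 / t) *\<^sub>R (G (Z2 t) - G (Z s))) \<longlongrightarrow> hessian \<phi> (Z s) H) (at_right 0)"
      by (rule G_along_curve[OF Hl])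
    have "N \<bullet> H = q s"
    proof -
      have quot: "A / (l - k) * (s - r) * A = (r - s) / (k - l) * A\<^sup>2" for A k l r s :: real
      proof -
        have "(s - r) / (l - k) = (r - s) / (k - l)"
          using minus_divide_divide[of "r - s" "k - l"] by (simp only: minus_diff_eq)
        moreover have "A / (l - k) * (s - r) * A = (s - r) / (l - k) * A\<^sup>2"
          by (simp add: power2_eq_square)
        ultimately show ?thesis by simp
      qed
      have "N \<bullet> H = M \<bullet> ?A"
        using inner_conj_by[OF oP, of N H] by (simp add: N)
      also have "\<dots> = q s"
        unfolding q_def inner_matrix_sum
      proof (intro sum.cong refl)
        fix i j
        show "M $ i $ j * ?A $ i $ j = (y $ i - y $ j) / (z s $ i - z s $ j) * (?A $ i $ j)\<^sup>2"
          using quot[of "?A $ i $ j" "z s $ j" "z s $ i" "y $ j" "y $ i"]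
          by (cases "z s $ i = z s $ j") (simp_all add: M_def S_def)
      qed
      finally show ?thesis .
    qed
    have "((\<lambda>t. \<kappa> * (norm ((1 / t) *\<^sub>R (Z2 t - Z s)))\<^sup>2) \<longlongrightarrow> \<kappa> * (norm H)\<^sup>2) (at_right 0)"
      by (intro tendsto_intros Hl)
    moreover have "((\<lambda>t. ((1 / t) *\<^sub>R (G (Z2 t) - G (Z s)) + (1 / t) *\<^sub>R (W2 t - Y)) \<bullet> ((1 / t) *\<^sub>R (Z2 t - Z s)))
        \<longlongrightarrow> (hessian \<phi> (Z s) H + N) \<bullet> H) (at_right 0)"
      by (intro tendsto_intros Hl Nl Gl)
    moreover have "\<forall>\<^sub>F t in at_right 0. \<kappa> * (norm ((1 / t) *\<^sub>R (Z2 t - Z s)))\<^sup>2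
        \<le> ((1 / t) *\<^sub>R (G (Z2 t) - G (Z s)) + (1 / t) *\<^sub>R (W2 t - Y)) \<bullet> ((1 / t) *\<^sub>R (Z2 t - Z s))"
    proof -
      have scale: "\<kappa> * (norm (k *\<^sub>R u))\<^sup>2 = k\<^sup>2 * (\<kappa> * (norm u)\<^sup>2)"
        "(k *\<^sub>R (g - g') + k *\<^sub>R (w - w')) \<bullet> (k *\<^sub>R u) = k\<^sup>2 * ((g - g' + w - w') \<bullet> u)" for k and g g' w w' u :: "'n symmat"
        by (simp_all add: power_mult_distrib scaleR_add_right[symmetric] power2_eq_square add_diff_eq del: scaleR_add_right)
      have "\<forall>\<^sub>F t in at_right 0. norm (Z2 t - X) < \<delta>"
        using near by (intro order_tendstoD(2)[OF tendsto_norm[OF tendsto_diff[OF tendsto_of_difference_quotient[OF Hl] tendsto_const]]])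
      moreover have "\<forall>\<^sub>F t in at_right 0. norm (W2 t - Y) < \<delta>"
        using \<delta> by (intro order_tendstoD(2)[OF tendsto_norm[OF tendsto_diff[OF tendsto_of_difference_quotient[OF Nl] tendsto_const]]]) simp
      ultimately show ?thesis
        using sub eventually_at_right_less[of "0 :: real"]
      proof eventually_elim
        case (elim t)
        have "W2 t \<in> subS (Z2 t)"
          using spectral_subS[OF oPR elim(3)] by (simp add: W2_def Z2_def)
        moreover have "Y \<in> subS (Z s)"
          using spectral_subS[OF oP sub0] unfolding Y[symmetric] Z_def .
        ultimately have "\<kappa> * (norm (Z2 t - Z s))\<^sup>2 \<le> (G (Z2 t) - G (Z s) + W2 t - Y) \<bullet> (Z2 t - Z s)"
          using elim(1,2) near \<delta> by (intro mono) (simp_all add: grad)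
        then have "(1 / t)\<^sup>2 * (\<kappa> * (norm (Z2 t - Z s))\<^sup>2) \<le> (1 / t)\<^sup>2 * ((G (Z2 t) - G (Z s) + W2 t - Y) \<bullet> (Z2 t - Z s))"
          by (rule mult_left_mono) simp
        then show ?case
          by (simp only: scale)
      qed
    qed
    ultimately have "\<kappa> * (norm H)\<^sup>2 \<le> (hessian \<phi> (Z s) H + N) \<bullet> H"
      using tendsto_le[OF trivial_limit_at_right_real] by blast
    then show ?thesis
      by (simp add: inner_add_left \<open>N \<bullet> H = q s\<close>)
  qed
  have "\<forall>\<^sub>F s in at_right 0. \<kappa> * (norm H)\<^sup>2 \<le> hessian \<phi> (Z s) H \<bullet> H + q s"
  proof -
    have "\<forall>\<^sub>F s in at_right 0. \<forall>i j. x $ i \<noteq> x $ j \<longrightarrow> z s $ i \<noteq> z s $ j"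
    proof (intro eventually_all_finite)
      fix i j
      show "\<forall>\<^sub>F s in at_right 0. x $ i \<noteq> x $ j \<longrightarrow> z s $ i \<noteq> z s $ j"
      proof (cases "x $ i = x $ j")
        case False
        have "((\<lambda>s. z s $ i - z s $ j) \<longlongrightarrow> (x + 0 *\<^sub>R v) $ i - (x + 0 *\<^sub>R v) $ j) (at_right 0)"
          unfolding z_def by (intro tendsto_intros)
        then have "\<forall>\<^sub>F s in at_right 0. z s $ i - z s $ j \<noteq> 0"
          using False by (intro tendsto_imp_eventually_ne) auto
        then show ?thesis
          by eventually_elim auto
      qed auto
    qed
    moreover have "\<forall>\<^sub>F s in at_right 0. norm (Z s - X) < \<delta>"
      using tendstoD[OF Z_lim \<delta>] by (simp add: dist_norm)
    ultimately show ?thesis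
      using eventually_y_sub[OF v(1) e] eventually_at_right_less[of "0 :: real"]
    proof eventually_elim
      case (elim s)
      then show ?case
        unfolding z_def[symmetric] by (intro bound) auto
    qed
  qed
  moreover have "((\<lambda>s. hessian \<phi> (Z s) H \<bullet> H + q s) \<longlongrightarrow> hessian \<phi> X H \<bullet> H + qform P H) (at_right 0)"
    unfolding q_def z_def by (intro tendsto_intros tendsto_hessian[OF Z_lim] perturbed_qform_lim H(1))
  ultimately have "\<kappa> * (norm H)\<^sup>2 \<le> hessian \<phi> X H \<bullet> H + qform P H"
    by (intro tendsto_lowerbound[OF _ _ trivial_limit_at_right_real])
  moreover have "0 < \<kappa> * (norm H)\<^sup>2"
    using \<kappa> H(2) by simp
  ultimately show ?thesis
    by linarith
qed

end

section \<open>Convex smooth part\<close>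

lemma (in smooth_function) hessian_nonneg:
  assumes convex: "convex_on UNIV \<phi>"
  shows "0 \<le> hessian \<phi> x u \<bullet> u"
proof -
  define \<psi> where "\<psi> t = \<phi> (x + t *\<^sub>R u)" for t
  have der: "(\<psi> has_field_derivative u \<bullet> G (x + t *\<^sub>R u)) (at t within UNIV)" for t
  proof -
    have "((\<lambda>t. x + t *\<^sub>R u) has_derivative (\<lambda>s. s *\<^sub>R u)) (at t)"
      by (auto intro!: derivative_eq_intros)
    from has_derivative_compose[OF this has_derivative_phi]
    show ?thesis
      unfolding \<psi>_def[abs_def] by (simp add: has_field_derivative_def mult.commute[of _ "u \<bullet> _"])
  qed
  have "convex_on UNIV \<psi>"
    unfolding convex_on_def
  proof (intro conjI convex_UNIV ballI allI impI)
    fix s t k l :: real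
    assume kl: "0 \<le> k" "0 \<le> l" "k + l = 1"
    have "x + (k *\<^sub>R s + l *\<^sub>R t) *\<^sub>R u = (k + l) *\<^sub>R x + (k *\<^sub>R s + l *\<^sub>R t) *\<^sub>R u"
      by (simp add: kl(3))
    also have "\<dots> = k *\<^sub>R (x + s *\<^sub>R u) + l *\<^sub>R (x + t *\<^sub>R u)"
      by (simp add: algebra_simps)
    finally show "\<psi> (k *\<^sub>R s + l *\<^sub>R t) \<le> k * \<psi> s + l * \<psi> t"
      unfolding \<psi>_def using convex kl unfolding convex_on_def by simp
  qed
  then have tangent_below: "(u \<bullet> G (x + s *\<^sub>R u)) * (t - s) \<le> \<psi> t - \<psi> s" for s t
    by (rule convex_on_imp_above_tangent[OF _ _ _ _ der]) auto
  have ev: "\<forall>\<^sub>F t in at_right 0. 0 \<le> ((1 / t) *\<^sub>R (G (x + t *\<^sub>R u) - G x)) \<bullet> u"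
    using eventually_at_right_less[of "0 :: real"]
  proof eventually_elim
    case (elim t)
    have "t * (u \<bullet> G x) \<le> t * (u \<bullet> G (x + t *\<^sub>R u))"
      using tangent_below[of 0 t] tangent_below[of t 0] by (simp add: mult.commute)
    then show ?case
      using elim by (simp add: inner_commute[of _ u] inner_diff_right)
  qed
  have lim: "((\<lambda>t. (1 / t) *\<^sub>R (G (x + t *\<^sub>R u) - G x)) \<longlongrightarrow> hessian \<phi> x u) (at_right 0)"
  proof (rule G_along_curve)
    show "((\<lambda>t. (1 / t) *\<^sub>R (x + t *\<^sub>R u - x)) \<longlongrightarrow> u) (at_right 0)"
    proof (rule tendsto_eventually)
      show "\<forall>\<^sub>F t in at_right 0. (1 / t) *\<^sub>R (x + t *\<^sub>R u - x) = u"
        using eventually_at_right_less[of "0 :: real"] by eventually_elim simp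
    qed
  qed
  show ?thesis
    by (rule tendsto_lowerbound[OF tendsto_inner[OF lim tendsto_const] ev trivial_limit_at_right_real])
qed

text \<open>A symmetric positive semidefinite form that vanishes at \<open>u\<close> has
  \<open>u\<close> in its kernel; otherwise it would be negative at \<open>u + s k\<close> for a
  suitable \<open>s\<close>.\<close>

lemma (in smooth_function) hessian_kernel:
  assumes convex: "convex_on UNIV \<phi>" and zero: "hessian \<phi> x u \<bullet> u = 0"
  shows "hessian \<phi> x u = 0"
proof -
  define k c where "k = hessian \<phi> x u" and "c = hessian \<phi> x k \<bullet> k"
  have c: "0 \<le> c"
    unfolding c_def by (rule hessian_nonneg[OF convex])
  \<comment> \<open>Nearly the minimizer in \<open>s\<close>; the denominator \<open>c + 1\<close>
    instead of \<open>c\<close> covers \<open>c = 0\<close>.\<close>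
  define s where "s = - (k \<bullet> k) / (c + 1)"
  have "hessian \<phi> x (u + s *\<^sub>R k) \<bullet> (u + s *\<^sub>R k) = 2 * s * (k \<bullet> k) + s\<^sup>2 * c"
  proof -
    have "hessian \<phi> x k \<bullet> u = k \<bullet> k" "k \<bullet> u = 0" "u \<bullet> k = 0"
      using hessian_symmetric[of x k u] zero by (simp_all add: k_def inner_commute)
    then show ?thesis
      by (simp add: hessian_linear inner_add_left inner_add_right k_def[symmetric] c_def[symmetric] power2_eq_square algebra_simps)
  qed
  then have "0 \<le> 2 * s * (k \<bullet> k) + s\<^sup>2 * c"
    using hessian_nonneg[OF convex, of x "u + s *\<^sub>R k"] by simp
  then have "0 \<le> (2 * s * (k \<bullet> k) + s\<^sup>2 * c) * (c + 1)\<^sup>2"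
    by simp
  also have "\<dots> = 2 * (s * (c + 1)) * (k \<bullet> k) * (c + 1) + (s * (c + 1))\<^sup>2 * c"
    by (simp add: power2_eq_square algebra_simps)
  also have "\<dots> = - ((c + 2) * (k \<bullet> k)\<^sup>2)"
  proof -
    have "s * (c + 1) = - (k \<bullet> k)"
      using c by (simp add: s_def)
    then show ?thesis
      by (simp add: power2_eq_square algebra_simps)
  qed
  finally have "(k \<bullet> k)\<^sup>2 \<le> 0"
    using c by (simp add: mult_le_0_iff)
  then show ?thesis
    by (simp add: k_def)
qed

section \<open>Index sets and the description of the kernel\<close>

lemma gam_iff:
  "i \<in> gam X Y l s \<longleftrightarrow> i \<in> alpha X l \<and> eigvals Y $ i = kth_largest (($) (eigvals Y) ` alpha X l) s"
  by (auto simp: gam_def)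

lemma alpha_eq: "i \<in> alpha X l \<Longrightarrow> j \<in> alpha X l \<Longrightarrow> eigvals X $ i = eigvals X $ j"
  by (simp add: alpha_def)

lemma gam_eq: "i \<in> gam X Y l s \<Longrightarrow> j \<in> gam X Y l s \<Longrightarrow> eigvals X $ i = eigvals X $ j \<and> eigvals Y $ i = eigvals Y $ j"
  by (simp add: gam_iff alpha_def)

lemma gam_closed:
  "i \<in> gam X Y l s \<Longrightarrow> eigvals X $ j = eigvals X $ i \<Longrightarrow> eigvals Y $ j = eigvals Y $ i \<Longrightarrow> j \<in> gam X Y l s"
  by (simp add: gam_iff alpha_def)

lemma gam_distinct:
  assumes "i \<in> gam X Y l s" "j \<in> gam X Y l s'" "s \<in> {1..num_blocks X Y l}" "s' \<in> {1..num_blocks X Y l}" "s \<noteq> s'"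
  shows "eigvals X $ i = eigvals X $ j" "eigvals Y $ i \<noteq> eigvals Y $ j"
proof -
  show "eigvals X $ i = eigvals X $ j"
    using assms alpha_eq by (auto simp: gam_iff)
  show "eigvals Y $ i \<noteq> eigvals Y $ j"
    using assms kth_largest_eq_iff[of "($) (eigvals Y) ` alpha X l" s s'] by (simp add: gam_iff num_blocks_def)
qed

lemma obtain_gam:
  obtains l where "l \<in> {1..num_eigs X}"
    "\<And>j. eigvals X $ j = eigvals X $ i \<Longrightarrow> \<exists>s\<in>{1..num_blocks X Y l}. j \<in> gam X Y l s"
proof -
  obtain l where l: "l \<in> {1..num_eigs X}" "eigvals X $ i = kth_largest (range (($) (eigvals X))) l"
    using obtain_kth_largest[of "range (($) (eigvals X))" "eigvals X $ i"] by (auto simp: num_eigs_def)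
  have "\<exists>s\<in>{1..num_blocks X Y l}. j \<in> gam X Y l s" if j: "eigvals X $ j = eigvals X $ i" for j
  proof -
    have ja: "j \<in> alpha X l"
      using j l(2) by (simp add: alpha_def)
    then obtain s where "s \<in> {1..card (($) (eigvals Y) ` alpha X l)}"
      "eigvals Y $ j = kth_largest (($) (eigvals Y) ` alpha X l) s"
      using obtain_kth_largest[of "($) (eigvals Y) ` alpha X l" "eigvals Y $ j"] by auto
    then show ?thesis
      using ja by (auto simp: gam_iff num_blocks_def)
  qed
  then show ?thesis
    using l(1) that by blast
qed

context spectral_pair
begin

lemma E_set_Eblk:
  assumes k: "k \<in> E_set X Y E1 E2 a b l" and i: "i \<in> gam X Y l k"
  shows "Eblk i"
proof -
  obtain j j' where jj: "j \<in> gam X Y l k" "j' \<in> gam X Y l k"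
    and ne: "(\<exists>\<nu>\<in>E1. a \<nu> $ j \<noteq> a \<nu> $ j') \<or> (\<exists>\<mu>\<in>E2. b \<mu> $ j \<noteq> b \<mu> $ j')"
    using k unfolding E_set_def by blast
  show ?thesis
    unfolding Eblk_def
    by (rule exI[of _ j], rule exI[of _ j']) (use ne gam_eq[OF jj(1) i] gam_eq[OF jj(2) i] in blast)
qed

lemma Eblk_E_set:
  assumes i: "Eblk i" "i \<in> gam X Y l s" and s: "s \<in> {1..num_blocks X Y l}"
  shows "s \<in> E_set X Y E1 E2 a b l"
proof -
  obtain j k where jk: "x $ j = x $ i" "y $ j = y $ i" "x $ k = x $ i" "y $ k = y $ i"
    "(\<exists>\<nu>\<in>E1. a \<nu> $ j \<noteq> a \<nu> $ k) \<or> (\<exists>\<mu>\<in>E2. b \<mu> $ j \<noteq> b \<mu> $ k)"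
    using i(1) unfolding Eblk_def by blast
  show ?thesis
    unfolding E_set_def
    using s gam_closed[OF i(2) jk(1,2)] gam_closed[OF i(2) jk(3,4)] jk(5) by blast
qed

text \<open>\<open>qform_eq_0_iff\<close> accounts for pairs in different blocks of
  \<open>X\<close>. The scalar on a block of \<open>E_set\<close> is any of its diagonal entries,
  which agree by \<open>L_constant_on_Eblk\<close>.\<close>

lemma tangent_kernel_iff:
  "H \<in> tangent P \<and> qform P H = 0 \<longleftrightarrow>
    (\<forall>i j. x $ i \<noteq> x $ j \<and> y $ i \<noteq> y $ j \<longrightarrow> conj_by P H $ i $ j = 0) \<and>
    (\<forall>l\<in>{1..num_eigs X}. \<forall>s\<in>{1..num_blocks X Y l}. \<forall>s'\<in>{1..num_blocks X Y l}. s \<noteq> s' \<longrightarrow>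
      (\<forall>i\<in>gam X Y l s. \<forall>j\<in>gam X Y l s'. conj_by P H $ i $ j = 0)) \<and>
    (\<forall>\<nu>\<in>E1. \<forall>\<nu>'\<in>E1. diag (conj_by P H) \<bullet> a \<nu> = diag (conj_by P H) \<bullet> a \<nu>') \<and>
    (\<forall>\<mu>\<in>E2. diag (conj_by P H) \<bullet> b \<mu> = 0) \<and>
    (\<forall>l\<in>{1..num_eigs X}. \<forall>k\<in>E_set X Y E1 E2 a b l. \<exists>\<rho>. \<forall>i\<in>gam X Y l k. \<forall>j\<in>gam X Y l k.
      conj_by P H $ i $ j = (if i = j then \<rho> else 0))"
  (is "_ \<longleftrightarrow> ?i \<and> ?ii \<and> ?iii_a \<and> ?iii_b \<and> ?iv")
proof (rule iffI)
  assume "H \<in> tangent P \<and> qform P H = 0"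
  then have H: "\<And>i j. x $ i = x $ j \<Longrightarrow> y $ i \<noteq> y $ j \<Longrightarrow> conj_by P H $ i $ j = 0"
    "diag (conj_by P H) \<in> L"
    "\<And>i j. Eblk i \<Longrightarrow> x $ i = x $ j \<Longrightarrow> y $ i = y $ j \<Longrightarrow> i \<noteq> j \<Longrightarrow> conj_by P H $ i $ j = 0"
    and q: "qform P H = 0"
    by (auto simp: tangent_def)
  have ?ii
  proof (intro ballI impI)
    fix l s s' i j
    assume "s \<in> {1..num_blocks X Y l}" "s' \<in> {1..num_blocks X Y l}" "s \<noteq> s'" "i \<in> gam X Y l s" "j \<in> gam X Y l s'"
    then show "conj_by P H $ i $ j = 0"
      using gam_distinct[of i X Y l s j s'] by (intro H(1)) auto
  qed
  moreover have ?iv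
  proof (intro ballI)
    fix l k assume k: "k \<in> E_set X Y E1 E2 a b l"
    show "\<exists>\<rho>. \<forall>i\<in>gam X Y l k. \<forall>j\<in>gam X Y l k. conj_by P H $ i $ j = (if i = j then \<rho> else 0)"
    proof (cases "gam X Y l k = {}")
      case False
      then obtain i0 where i0: "i0 \<in> gam X Y l k" by blast
      have "conj_by P H $ i $ j = (if i = j then conj_by P H $ i0 $ i0 else 0)" if ij: "i \<in> gam X Y l k" "j \<in> gam X Y l k" for i j
      proof (cases "i = j")
        case True
        then show ?thesis
          using L_constant_on_Eblk[OF H(2) E_set_Eblk[OF k i0], of i] gam_eq[OF i0 ij(1)] by simp
      next
        case False
        then show ?thesis
          using H(3)[OF E_set_Eblk[OF k ij(1)], of j] gam_eq[OF ij] by simp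
      qed
      then show ?thesis by blast
    qed auto
  qed
  ultimately show "?i \<and> ?ii \<and> ?iii_a \<and> ?iii_b \<and> ?iv"
    using q LD[OF H(2)] unfolding qform_eq_0_iff by blast
next
  assume *: "?i \<and> ?ii \<and> ?iii_a \<and> ?iii_b \<and> ?iv"
  note i = conjunct1[OF *] and rest = conjunct2[OF *]
  note ii = conjunct1[OF rest] and rest = conjunct2[OF rest]
  note iii = conjunct1[OF rest] conjunct1[OF conjunct2[OF rest]] and iv = conjunct2[OF conjunct2[OF rest]]
  have "conj_by P H $ i $ j = 0" if ij: "x $ i = x $ j" "y $ i \<noteq> y $ j" for i j
  proof -
    obtain l where l: "l \<in> {1..num_eigs X}" "\<And>j. x $ j = x $ i \<Longrightarrow> \<exists>s\<in>{1..num_blocks X Y l}. j \<in> gam X Y l s"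
      by (rule obtain_gam[of X i Y]) blast
    obtain s s' where s: "s \<in> {1..num_blocks X Y l}" "i \<in> gam X Y l s" "s' \<in> {1..num_blocks X Y l}" "j \<in> gam X Y l s'"
      using l(2)[of i] l(2)[of j] ij(1) by metis
    have "s \<noteq> s'"
      using gam_eq[of i X Y l s j] s ij(2) by auto
    then show ?thesis
      using ii l(1) s by blast
  qed
  moreover have "diag (conj_by P H) \<in> L"
    unfolding L_def inner_diff_right right_minus_eq
  proof (intro CollectI conjI ballI)
    show "diag (conj_by P H) \<bullet> a \<nu>' = diag (conj_by P H) \<bullet> a \<nu>" if "\<nu> \<in> E1" "\<nu>' \<in> E1" for \<nu> \<nu>'
      by (rule bspec[OF bspec[OF iii(1) that(2)] that(1)])
    show "diag (conj_by P H) \<bullet> b \<mu> = 0" if "\<mu> \<in> E2" for \<mu>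
      by (rule bspec[OF iii(2) that])
  qed
  moreover have "conj_by P H $ i $ j = 0" if ij: "Eblk i" "x $ i = x $ j" "y $ i = y $ j" "i \<noteq> j" for i j
  proof -
    obtain l where l: "l \<in> {1..num_eigs X}" "\<And>j. x $ j = x $ i \<Longrightarrow> \<exists>s\<in>{1..num_blocks X Y l}. j \<in> gam X Y l s"
      by (rule obtain_gam[of X i Y]) blast
    then obtain s where s: "s \<in> {1..num_blocks X Y l}" "i \<in> gam X Y l s"
      by blast
    have j: "j \<in> gam X Y l s"
      using gam_closed[OF s(2), of j] ij by simp
    obtain \<rho> where "\<forall>i\<in>gam X Y l s. \<forall>j\<in>gam X Y l s. conj_by P H $ i $ j = (if i = j then \<rho> else 0)"
      using iv l(1) Eblk_E_set[OF ij(1) s(2,1)] by blast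
    then show ?thesis
      using s(2) j ij(4) by simp
  qed
  ultimately show "H \<in> tangent P \<and> qform P H = 0"
    unfolding tangent_def qform_eq_0_iff using i by blast
qed

end

theorem theorem5p1:
  fixes \<phi> :: "('n::{finite,linorder}) symmat \<Rightarrow> real"
    and \<theta> :: "'n rvec \<Rightarrow> ereal"
    and f g :: "'n symmat \<Rightarrow> ereal"
    and X Y :: "'n symmat"
    and a b :: "nat \<Rightarrow> 'n rvec" and c d :: "nat \<Rightarrow> real" and p m :: nat
    and I1 I2 E1 E2 :: "nat set"
  assumes smooth: "C2_smooth \<phi>"
    and proper: "proper_fun \<theta>"
    and symm: "symmetric_fun \<theta>"
    and polyhedral: "polyhedral_fun \<theta>"
    and rep: "polyhedral_rep \<theta> p a c m b d"
    and g: "g = \<theta> \<circ> eigvals"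
    and f: "f = (\<lambda>Z. ereal (\<phi> Z) + g Z)"
    and stationary: "0 \<in> limiting_subdifferential f X"
    and Y: "Y = - gradient \<phi> X"
    and I1: "I1 = iota1 p a c (eigvals X)"
    and I2: "I2 = iota2 m b d (eigvals X)"
    and E1: "E1 = eta1 I1 I2 a b (eigvals Y)"
    and E2: "E2 = eta2 I1 I2 a b (eigvals Y)"
    and K: "K_set I1 I2 E1 E2 a b \<noteq> {}"
  shows "(tilt_stable_local_minimizer f X \<longleftrightarrow> SSOSC \<phi> g X Y) \<and>
    (tilt_stable_local_minimizer f X \<longrightarrow> kernel_condition \<phi> g X Y) \<and>
    (SSOSC \<phi> g X Y \<longrightarrow> kernel_condition \<phi> g X Y) \<and>
    (convex_on UNIV \<phi> \<longrightarrow>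
       (kernel_condition \<phi> g X Y \<longleftrightarrow> tilt_stable_local_minimizer f X) \<and>
       (kernel_condition \<phi> g X Y \<longleftrightarrow> SSOSC \<phi> g X Y)) \<and>
    (\<forall>P \<in> eig_orth X \<inter> eig_orth Y.
       ker_q g X Y =
         {H.
           (\<forall>i j. eigvals X $ i \<noteq> eigvals X $ j \<and> eigvals Y $ i \<noteq> eigvals Y $ j
              \<longrightarrow> conj_by P H $ i $ j = 0) \<and>
           (\<forall>l\<in>{1..num_eigs X}. \<forall>s\<in>{1..num_blocks X Y l}. \<forall>s'\<in>{1..num_blocks X Y l}.
              s \<noteq> s' \<longrightarrow>
              (\<forall>i\<in>gam X Y l s. \<forall>j\<in>gam X Y l s'. conj_by P H $ i $ j = 0)) \<and>
           (\<forall>\<nu>\<in>E1. \<forall>\<nu>'\<in>E1. diag (conj_by P H) \<bullet> a \<nu> = diag (conj_by P H) \<bullet> a \<nu>') \<and>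
           (\<forall>\<mu>\<in>E2. diag (conj_by P H) \<bullet> b \<mu> = 0) \<and>
           (\<forall>l\<in>{1..num_eigs X}. \<forall>k\<in>E_set X Y E1 E2 a b l. \<exists>\<rho>.
              \<forall>i\<in>gam X Y l k. \<forall>j\<in>gam X Y l k.
                conj_by P H $ i $ j = (if i = j then \<rho> else 0))})"
proof -
  interpret spectral_polyhedral \<theta> p a c m b d
    using rep symm by unfold_locales
  have comp: "composite \<phi> dmS hS f"
  proof
    show "f Z = ereal (\<phi> Z) + (if Z \<in> dmS then ereal (hS Z) else \<infinity>)" for Z
      by (simp add: f g theta_eigvals)
  qed (use smooth closed_dmS convex_dmS convex_on_hS continuous_hS in auto)
  interpret comp: composite \<phi> dmS hS f
    by (rule comp)
  have Y_subS: "Y \<in> subS X"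
    unfolding Y by (rule comp.stationary_csub[OF stationary])
  interpret pair: spectral_pair \<theta> p a c m b d X Y
    using Y_subS subS_simultaneous(2)[OF Y_subS] K unfolding E1 E2 I1 I2 by unfold_locales
  obtain P where P: "P \<in> eig_orth X \<inter> eig_orth Y"
    using subS_simultaneous(1)[OF Y_subS] by blast
  have grad: "gradient \<phi> X = - Y"
    by (simp add: Y)
  \<comment> \<open>The basis \<open>R\<close> stays arbitrary because the kernel is to be described
    in every common eigenbasis.\<close>
  have hull: "affine hull critical_cone g X Y = pair.tangent R" if "R \<in> eig_orth X \<inter> eig_orth Y" for R
    using pair.affine_hull_critical_cone[OF that] by (simp add: g)
  have ssosc: "SSOSC \<phi> g X Y \<longleftrightarrow> (\<forall>H\<in>pair.tangent R - {0}. 0 < hessian \<phi> X H \<bullet> H + pair.qform R H)"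
    if "R \<in> eig_orth X \<inter> eig_orth Y" for R
    unfolding SSOSC_def hull[OF that] pair.Upsilon_eq_qform[OF that] ..
  have ker: "ker_q g X Y = {H. H \<in> pair.tangent R \<and> pair.qform R H = 0}" if "R \<in> eig_orth X \<inter> eig_orth Y" for R
    unfolding ker_q_def hull[OF that] pair.Upsilon_eq_qform[OF that] ..
  have "tilt_stable_local_minimizer f X \<longleftrightarrow> comp.strongly_monotone_near X"
    by (rule comp.tilt_stable_iff_strongly_monotone) (use Y_subS Y in simp)
  also have "\<dots> \<longleftrightarrow> SSOSC \<phi> g X Y"
    using pair.strongly_monotone_of_positive[OF comp grad] pair.positive_of_strongly_monotone[OF comp grad _ P] ssosc P
    by blast
  finally have tilt: "tilt_stable_local_minimizer f X \<longleftrightarrow> SSOSC \<phi> g X Y" .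
  have kernel: "kernel_condition \<phi> g X Y" if "SSOSC \<phi> g X Y"
  proof -
    have "0 \<in> pair.tangent P"
      using pair.subspace_tangent by (rule subspace_0)
    moreover have "pair.qform P 0 = 0"
      by (simp add: pair.qform_def conj_by_linear)
    moreover have "H = 0" if "hessian \<phi> X H = 0" "H \<in> pair.tangent P" "pair.qform P H = 0" for H
      using \<open>SSOSC \<phi> g X Y\<close> that unfolding ssosc[OF P] by force
    ultimately show ?thesis
      unfolding kernel_condition_def ker[OF P] using comp.hessian_linear(3) by blast
  qed
  have ssosc_of_kernel: "SSOSC \<phi> g X Y" if kc: "kernel_condition \<phi> g X Y" and convex: "convex_on UNIV \<phi>"
    unfolding ssosc[OF P]
  proof (rule ballI, rule ccontr)
    fix H assume H: "H \<in> pair.tangent P - {0}" and le: "\<not> 0 < hessian \<phi> X H \<bullet> H + pair.qform P H"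
    \<comment> \<open>Both summands are nonnegative, so each vanishes, and
      \<open>hessian_kernel\<close> places \<open>H\<close> in the kernel of the Hessian.\<close>
    have "hessian \<phi> X H \<bullet> H = 0"
      using le comp.hessian_nonneg[OF convex, of X H] pair.qform_nonneg[of P H] by linarith
    moreover have "pair.qform P H = 0"
      using le comp.hessian_nonneg[OF convex, of X H] pair.qform_nonneg[of P H] by linarith
    ultimately have "H \<in> {H. hessian \<phi> X H = 0} \<inter> ker_q g X Y"
      using H comp.hessian_kernel[OF convex] unfolding ker[OF P] by blast
    then show False
      using kc H unfolding kernel_condition_def by blast
  qed
  have description: "ker_q g X Y = {H. (\<forall>i j. eigvals X $ i \<noteq> eigvals X $ j \<and> eigvals Y $ i \<noteq> eigvals Y $ j
              \<longrightarrow> conj_by R H $ i $ j = 0) \<and>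
           (\<forall>l\<in>{1..num_eigs X}. \<forall>s\<in>{1..num_blocks X Y l}. \<forall>s'\<in>{1..num_blocks X Y l}.
              s \<noteq> s' \<longrightarrow>
              (\<forall>i\<in>gam X Y l s. \<forall>j\<in>gam X Y l s'. conj_by R H $ i $ j = 0)) \<and>
           (\<forall>\<nu>\<in>E1. \<forall>\<nu>'\<in>E1. diag (conj_by R H) \<bullet> a \<nu> = diag (conj_by R H) \<bullet> a \<nu>') \<and>
           (\<forall>\<mu>\<in>E2. diag (conj_by R H) \<bullet> b \<mu> = 0) \<and>
           (\<forall>l\<in>{1..num_eigs X}. \<forall>k\<in>E_set X Y E1 E2 a b l. \<exists>\<rho>.
              \<forall>i\<in>gam X Y l k. \<forall>j\<in>gam X Y l k.
                conj_by R H $ i $ j = (if i = j then \<rho> else 0))}" if "R \<in> eig_orth X \<inter> eig_orth Y" for R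
    unfolding ker[OF that] pair.tangent_kernel_iff E1 E2 I1 I2 ..
  show ?thesis
    by (intro conjI impI ballI description; use tilt kernel ssosc_of_kernel in blast)
qed

end
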